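(* Let $F\in\mathcal{DM}^{\mathrm{ext}}(\Omega)$, let $U\Subset\Omega$ be open, and let $d(x)=\operatorname{dist}(x,\partial U)$. Then $$\int_0^\infty\langle F\cdot\nu,\phi\rangle_{\partial U^t}\,\mathrm dt=\int_U\phi\,\mathrm d\overline{\nabla d\cdot F}\qquad\text{for any }\phi\in W^{1,\infty}(\Omega).$$ Moreover, this identity extends to any bounded Borel function $\phi$ on $\Omega$, with the understanding that $t\mapsto\langle F\cdot\nu,\phi\rangle_{\partial U^t}$ is then only defined for $\mathcal L^1$-a.e. $t>0$ (as $\int_{\partial U^t}\phi\,\mathrm d(F\cdot\nu)_{\partial U^t}$).
   Context: Let $n\ge2$ and let $\Omega\subset\mathbb R^n$ be open. $A\Subset\Omega$ means that $\overline A$ is compact and $\overline A\subset\Omega$. $\mathcal{DM}^{\mathrm{ext}}(\Omega)$ is the space of finite $\mathbb R^n$-valued Radon measures $F$ on $\Omega$ whose distributional divergence, $\langle\operatorname{div}F,\varphi\rangle=-\int_\Omega\nabla\varphi\cdot \mathrm dF$ for $\varphi\in C_c^\infty(\Omega)$, is a finite signed Radon measure $\operatorname{div}F$ on $\Omega$. Pairing: for $\phi\in W^{1,\infty}(\Omega)$ (continuous representative), $\overline{\nabla\phi\cdot F}$ is the finite signed Radon measure on $\Omega$ characterized by $\int_\Omega\psi\,\mathrm d\overline{\nabla\phi\cdot F}=\lim_{\delta\to0}\int_\Omega\psi\,\nabla\phi_\delta\cdot \mathrm dF$ for all $\psi\in C_c(\Omega)$, where $\phi_\delta=\phi*\rho_\delta$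 and $\rho_\delta$ is a standard mollifier; it is known that the limit exists and $|\overline{\nabla\phi\cdot F}|\le\|\nabla\phi\|_{L^\infty(\Omega)}|F|$. The same definition is used for the $1$-Lipschitz (possibly unbounded) function $d$. Normal trace: for a Borel set $E\Subset\Omega$ and $\phi\in W^{1,\infty}(\Omega)$, $\langle F\cdot\nu,\phi\rangle_{\partial E}:=-\int_E\phi\,\mathrm d(\operatorname{div}F)-\int_E\mathrm d\overline{\nabla\phi\cdot F}$. For $t>0$, $U^t=\{x\in U:\operatorname{dist}(x,\partial U)>t\}$. It is known that for $\mathcal L^1$-a.e. $t>0$ the functional $\langle F\cdot\nu,\cdot\rangle_{\partial U^t}$ is represented by a measure $(F\cdot\nu)_{\partial U^t}$ supported on $\partial U^t$, i.e. $\langle F\cdot\nu,\phi\rangle_{\partial U^t}=\int_{\partial U^t}\phi\,\mathrm d(F\cdot\nu)_{\partial U^t}$ for all $\phi\in W^{1,\infty}(\Omega)$. *)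

theory Defs
  imports "HOL-Analysis.Analysis"
begin

subsection \<open>Finite signed and vector-valued Borel measures\<close>

text \<open>
  A finite signed (for \<^typ>\<open>real\<close>) or vector-valued Borel measure on \<open>S\<close> is a countably additive
  set function on the Borel subsets of \<open>S\<close>. Such measures are automatically Radon on open and on
  compact subsets of a Euclidean space. The value is fixed to be \<open>0\<close> on all other sets, so that two
  measures that agree on the Borel subsets of \<open>S\<close> are equal.
\<close>

definition finite_vmeasure ::
    "'a::euclidean_space set \<Rightarrow> ('a set \<Rightarrow> 'b::real_normed_vector) \<Rightarrow> bool" where
  "finite_vmeasure S \<mu> \<longleftrightarrow>
     (\<forall>A. A \<notin> sets (restrict_space borel S) \<longrightarrow> \<mu> A = 0) \<and>
     (\<forall>A::nat \<Rightarrow> 'a set. range A \<subseteq> sets (restrict_space borel S) \<longrightarrow> disjoint_family A \<longrightarrow>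
        (\<lambda>i. \<mu> (A i)) sums \<mu> (\<Union>i. A i))"

text \<open>Positive and negative variation (the Jordan decomposition \<open>\<mu> = \<mu>\<^sup>+ - \<mu>\<^sup>-\<close>).\<close>

definition pos_variation :: "'a::euclidean_space set \<Rightarrow> ('a set \<Rightarrow> real) \<Rightarrow> 'a measure" where
  "pos_variation S \<mu> = measure_of S (sets (restrict_space borel S))
     (\<lambda>A. SUP B\<in>{B \<in> sets (restrict_space borel S). B \<subseteq> A}. ennreal (\<mu> B))"

definition neg_variation :: "'a::euclidean_space set \<Rightarrow> ('a set \<Rightarrow> real) \<Rightarrow> 'a measure" where
  "neg_variation S \<mu> = pos_variation S (\<lambda>A. - \<mu> A)"

text \<open>\<open>signed_integral S \<mu> E f\<close> is the integral over \<open>E \<subseteq> S\<close> of \<open>f\<close> with respect to the signed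
  measure \<open>\<mu>\<close> on \<open>S\<close>.\<close>

definition signed_integral ::
    "'a::euclidean_space set \<Rightarrow> ('a set \<Rightarrow> real) \<Rightarrow> 'a set \<Rightarrow> ('a \<Rightarrow> real) \<Rightarrow> real" where
  "signed_integral S \<mu> E f =
     (LINT x:E|pos_variation S \<mu>. f x) - (LINT x:E|neg_variation S \<mu>. f x)"

text \<open>\<open>vector_integral S F g\<close> is the integral of \<open>g \<bullet> dF\<close> over \<open>S\<close>.\<close>

definition vector_integral ::
    "'a::euclidean_space set \<Rightarrow> ('a set \<Rightarrow> 'a) \<Rightarrow> ('a \<Rightarrow> 'a) \<Rightarrow> real" where
  "vector_integral S F g =
     (\<Sum>i\<in>Basis. signed_integral S (\<lambda>A. F A \<bullet> i) S (\<lambda>x. g x \<bullet> i))"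


subsection \<open>Function spaces\<close>

definition grad :: "('a::euclidean_space \<Rightarrow> real) \<Rightarrow> 'a \<Rightarrow> 'a" where
  "grad f x = (THE D. GDERIV f x :> D)"

primrec C_k :: "nat \<Rightarrow> ('a::euclidean_space \<Rightarrow> real) \<Rightarrow> bool" where
  "C_k 0 f \<longleftrightarrow> continuous_on UNIV f"
| "C_k (Suc k) f \<longleftrightarrow>
     (\<forall>x. f differentiable (at x)) \<and> (\<forall>i\<in>Basis. C_k k (\<lambda>x. grad f x \<bullet> i))"

definition Cc :: "'a::euclidean_space set \<Rightarrow> ('a \<Rightarrow> real) set" where
  "Cc \<Omega> = {\<psi>. continuous_on UNIV \<psi> \<and>
                compact (closure {x. \<psi> x \<noteq> 0}) \<and> closure {x. \<psi> x \<noteq> 0} \<subseteq> \<Omega>}"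

definition Cc_inf :: "'a::euclidean_space set \<Rightarrow> ('a \<Rightarrow> real) set" where
  "Cc_inf \<Omega> = {\<eta> \<in> Cc \<Omega>. \<forall>k. C_k k \<eta>}"

text \<open>The Sobolev space \<open>W\<^sup>1\<^sup>,\<^sup>\<infinity>(\<Omega>)\<close>, each class being given by its continuous representative \<open>\<phi>\<close>;
  \<open>g\<close> is the weak gradient. Only the values of \<open>\<phi>\<close> on \<open>\<Omega>\<close> matter.\<close>

definition W1inf :: "'a::euclidean_space set \<Rightarrow> ('a \<Rightarrow> real) set" where
  "W1inf \<Omega> = {\<phi>. continuous_on \<Omega> \<phi> \<and> bounded (\<phi> ` \<Omega>) \<and>
     (\<exists>g::'a \<Rightarrow> 'a. set_borel_measurable lborel \<Omega> g \<and>
        (\<exists>C. AE x in lborel. x \<in> \<Omega> \<longrightarrow> norm (g x) \<le> C) \<and>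
        (\<forall>\<eta>\<in>Cc_inf \<Omega>. (LINT x:\<Omega>|lborel. \<phi> x *\<^sub>R grad \<eta> x) = - (LINT x:\<Omega>|lborel. \<eta> x *\<^sub>R g x)))}"


subsection \<open>Divergence-measure fields\<close>

definition is_divergence ::
    "'a::euclidean_space set \<Rightarrow> ('a set \<Rightarrow> 'a) \<Rightarrow> ('a set \<Rightarrow> real) \<Rightarrow> bool" where
  "is_divergence \<Omega> F \<mu> \<longleftrightarrow> finite_vmeasure \<Omega> \<mu> \<and>
     (\<forall>\<eta>\<in>Cc_inf \<Omega>. signed_integral \<Omega> \<mu> \<Omega> \<eta> = - vector_integral \<Omega> F (grad \<eta>))"

definition DM_ext :: "'a::euclidean_space set \<Rightarrow> ('a set \<Rightarrow> 'a) set" where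
  "DM_ext \<Omega> = {F. finite_vmeasure \<Omega> F \<and> (\<exists>\<mu>. is_divergence \<Omega> F \<mu>)}"

definition divergence ::
    "'a::euclidean_space set \<Rightarrow> ('a set \<Rightarrow> 'a) \<Rightarrow> 'a set \<Rightarrow> real" where
  "divergence \<Omega> F = (THE \<mu>. is_divergence \<Omega> F \<mu>)"


subsection \<open>Pairing measure and normal trace\<close>

definition standard_mollifier :: "('a::euclidean_space \<Rightarrow> real) \<Rightarrow> bool" where
  "standard_mollifier \<rho> \<longleftrightarrow> (\<forall>k. C_k k \<rho>) \<and> (\<forall>x. 0 \<le> \<rho> x) \<and> closure {x. \<rho> x \<noteq> 0} \<subseteq> cball 0 1 \<and>
     (\<forall>x y. norm x = norm y \<longrightarrow> \<rho> x = \<rho> y) \<and> (LINT x|lborel. \<rho> x) = 1"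

text \<open>
  \<open>mollify \<rho> \<Omega> \<delta> \<phi> = \<phi> * \<rho>\<^sub>\<delta>\<close>, where \<open>\<rho>\<^sub>\<delta> x = \<delta>\<^sup>-\<^sup>n \<rho> (x / \<delta>)\<close> and \<open>\<phi>\<close> is extended by \<open>0\<close> outside
  \<open>\<Omega>\<close>. The extension is immaterial in the pairing below: on the compact support of \<open>\<psi>\<close>, the
  convolution only sees values of \<open>\<phi>\<close> in \<open>\<Omega>\<close> once \<open>\<delta>\<close> is small.
\<close>

definition mollify ::
    "('a::euclidean_space \<Rightarrow> real) \<Rightarrow> 'a set \<Rightarrow> real \<Rightarrow> ('a \<Rightarrow> real) \<Rightarrow> 'a \<Rightarrow> real" where
  "mollify \<rho> \<Omega> \<delta> \<phi> x = (LINT y:\<Omega>|lborel. \<phi> y * (\<rho> ((x - y) /\<^sub>R \<delta>) / \<delta> ^ DIM('a)))"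

definition is_pairing ::
    "('a::euclidean_space \<Rightarrow> real) \<Rightarrow> 'a set \<Rightarrow> ('a set \<Rightarrow> 'a) \<Rightarrow> ('a \<Rightarrow> real) \<Rightarrow> ('a set \<Rightarrow> real) \<Rightarrow> bool"
  where
  "is_pairing \<rho> \<Omega> F \<phi> \<mu> \<longleftrightarrow> finite_vmeasure \<Omega> \<mu> \<and>
     (\<forall>\<psi>\<in>Cc \<Omega>. ((\<lambda>\<delta>. vector_integral \<Omega> F (\<lambda>x. \<psi> x *\<^sub>R grad (mollify \<rho> \<Omega> \<delta> \<phi>) x))
        \<longlongrightarrow> signed_integral \<Omega> \<mu> \<Omega> \<psi>) (at_right 0))"

definition pairing ::
    "('a::euclidean_space \<Rightarrow> real) \<Rightarrow> 'a set \<Rightarrow> ('a set \<Rightarrow> 'a) \<Rightarrow> ('a \<Rightarrow> real) \<Rightarrow> 'a set \<Rightarrow> real" where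
  "pairing \<rho> \<Omega> F \<phi> = (THE \<mu>. is_pairing \<rho> \<Omega> F \<phi> \<mu>)"

definition normal_trace ::
    "('a::euclidean_space \<Rightarrow> real) \<Rightarrow> 'a set \<Rightarrow> ('a set \<Rightarrow> 'a) \<Rightarrow> 'a set \<Rightarrow> ('a \<Rightarrow> real) \<Rightarrow> real" where
  "normal_trace \<rho> \<Omega> F E \<phi> =
     - signed_integral \<Omega> (divergence \<Omega> F) E \<phi> - pairing \<rho> \<Omega> F \<phi> E"

text \<open>Representation of the normal trace by a finite signed measure living on \<open>\<partial>E\<close>.\<close>

definition is_trace_measure ::
    "('a::euclidean_space \<Rightarrow> real) \<Rightarrow> 'a set \<Rightarrow> ('a set \<Rightarrow> 'a) \<Rightarrow> 'a set \<Rightarrow> ('a set \<Rightarrow> real) \<Rightarrow> bool"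
  where
  "is_trace_measure \<rho> \<Omega> F E \<mu> \<longleftrightarrow> finite_vmeasure (frontier E) \<mu> \<and>
     (\<forall>\<phi>\<in>W1inf \<Omega>. normal_trace \<rho> \<Omega> F E \<phi> = signed_integral (frontier E) \<mu> (frontier E) \<phi>)"

definition trace_measure ::
    "('a::euclidean_space \<Rightarrow> real) \<Rightarrow> 'a set \<Rightarrow> ('a set \<Rightarrow> 'a) \<Rightarrow> 'a set \<Rightarrow> 'a set \<Rightarrow> real" where
  "trace_measure \<rho> \<Omega> F E = (THE \<mu>. is_trace_measure \<rho> \<Omega> F E \<mu>)"

definition inner_set :: "'a::euclidean_space set \<Rightarrow> real \<Rightarrow> 'a set" where
  "inner_set U t = {x \<in> U. infdist x (frontier U) > t}"

end

theory Submission
  imports Defs "HOL-Probability.Helly_Selection"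
begin

text \<open>
  Integrating the normal traces over \<open>t\<close> and applying Fubini turns the left-hand side into
  \<open>- \<integral>\<^sub>U d \<phi> \<partial>(div F) - \<integral>\<^sub>U d \<partial>(\<nabla>\<phi> \<cdot> F)\<close>, and the Leibniz rule for the compactly supported function
  \<open>d \<phi>\<close> identifies this with \<open>\<integral>\<^sub>U \<phi> \<partial>\<nu>\<close>, where \<open>\<nu>\<close> is the pairing measure of \<open>d\<close>. The kink of \<open>d\<close> at the
  boundary is avoided by first replacing \<open>d\<close> by \<open>H \<circ> d\<close>, where \<open>H\<close> vanishes near \<open>0\<close>, and then letting the
  weight \<open>\<zeta> = H'\<close> run through a monotone class. With weights \<open>\<zeta>\<close> concentrated on \<open>(t, t + 1/k)\<close> the same
  identity shows that the trace on the boundary of \<open>U\<^sup>t\<close> is the limit of the measures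
  \<open>k \<nu>\<close> restricted to \<open>{x \<in> U. t < d x < t + 1/k}\<close>. By Fatou's lemma the lower limit of their total masses
  is integrable in \<open>t\<close>, hence finite for almost every \<open>t\<close>, and for such \<open>t\<close> a subsequence converges weakly
  to a trace measure. Its mass is bounded by an integrable function of \<open>t\<close>, which
  extends the identity from smooth to bounded Borel functions by dominated convergence.
\<close>

subsection \<open>The Jordan decomposition\<close>

text \<open>\<open>divergence\<close>, \<open>pairing\<close> and \<open>trace_measure\<close> are
  definite descriptions, so nothing can be computed with them until existence and uniqueness are
  settled; facts that are usually quoted as known are therefore part of the proof. The obstacle in
  the Leibniz rule is that \<open>\<phi>\<close> and the distance are not C1 while \<open>F\<close>
  is only a measure, so their gradients cannot be integrated against \<open>F\<close> directly. Both
  functions are mollified at the same scale \<open>\<delta>\<close>: the product rule is then exact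
  for each \<open>\<delta>\<close>, and the price is a limit in which the test functions move with
  \<open>\<delta>\<close>. This is affordable because the mollified gradients are bounded uniformly
  on compact sets. A second obstacle is measurability in t. The trace measures are determined for
  almost every t only, so for Borel \<open>\<phi>\<close> the integrand is identified up to a null
  set; hence the outer integral is taken with respect to the completed Lebesgue measure.\<close>

definition sigma_additive :: "'a measure \<Rightarrow> ('a set \<Rightarrow> real) \<Rightarrow> bool" where
  "sigma_additive N \<mu> \<longleftrightarrow> (\<forall>A::nat \<Rightarrow> 'a set. range A \<subseteq> sets N \<longrightarrow> disjoint_family A \<longrightarrow>
     (\<lambda>i. \<mu> (A i)) sums \<mu> (\<Union>i. A i))"

lemma sigma_additiveD:
  "sigma_additive N \<mu> \<Longrightarrow> (\<And>i::nat. A i \<in> sets N) \<Longrightarrow> disjoint_family A \<Longrightarrow>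
    (\<lambda>i. \<mu> (A i)) sums \<mu> (\<Union>i. A i)"
  unfolding sigma_additive_def by blast

lemma sigma_additive_empty:
  assumes "sigma_additive N \<mu>" shows "\<mu> {} = 0"
proof -
  have "(\<lambda>i::nat. \<mu> {}) sums \<mu> (\<Union>i::nat. {})"
    by (rule sigma_additiveD[OF assms, of "\<lambda>_. {}"]) (auto simp: disjoint_family_on_def)
  then have "(\<lambda>i::nat. \<mu> {}) \<longlonglongrightarrow> 0" by (intro summable_LIMSEQ_zero) (auto simp: sums_iff)
  then show ?thesis by (simp add: LIMSEQ_const_iff)
qed

lemma sigma_additive_Un:
  assumes "sigma_additive N \<mu>" "A \<in> sets N" "B \<in> sets N" "A \<inter> B = {}"
  shows "\<mu> (A \<union> B) = \<mu> A + \<mu> B"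
proof -
  have "(\<lambda>i. \<mu> (binaryset A B i)) sums \<mu> (\<Union>i. binaryset A B i)"
    using assms
    by (intro sigma_additiveD[OF assms(1)]) (auto simp: binaryset_def disjoint_family_on_def)
  moreover have "(\<lambda>i. \<mu> (binaryset A B i)) sums (\<mu> A + \<mu> B)"
    using sigma_additive_empty[OF assms(1)] by (rule binaryset_sums)
  ultimately show ?thesis by (simp add: sums_iff UN_binaryset_eq)
qed

lemma sigma_additive_Diff:
  assumes "sigma_additive N \<mu>" "A \<in> sets N" "B \<in> sets N" "B \<subseteq> A"
  shows "\<mu> (A - B) = \<mu> A - \<mu> B"
proof -
  have "\<mu> (B \<union> (A - B)) = \<mu> B + \<mu> (A - B)"
    using assms by (intro sigma_additive_Un[OF assms(1)]) auto
  moreover have "B \<union> (A - B) = A" using assms by auto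
  ultimately show ?thesis by simp
qed

lemma sigma_additive_uminus: "sigma_additive N \<mu> \<Longrightarrow> sigma_additive N (\<lambda>A. - \<mu> A)"
  unfolding sigma_additive_def by (auto intro: sums_minus)

definition positive_set :: "'a measure \<Rightarrow> ('a set \<Rightarrow> real) \<Rightarrow> 'a set \<Rightarrow> bool" where
  "positive_set N \<mu> P \<longleftrightarrow> P \<in> sets N \<and> (\<forall>B\<in>sets N. B \<subseteq> P \<longrightarrow> 0 \<le> \<mu> B)"

text \<open>The truncation at \<open>-1\<close> keeps the infimum finite: that \<open>\<mu>\<close> is bounded below is not known yet.\<close>

lemma half_minimal_subset:
  assumes \<mu>: "sigma_additive N \<mu>" and E: "E \<in> sets N"
  shows "\<exists>G\<in>sets N. G \<subseteq> E \<and> \<mu> G \<le> 0 \<and> (\<forall>B\<in>sets N. B \<subseteq> E \<longrightarrow> 2 * \<mu> G \<le> max (\<mu> B) (-1))"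
proof -
  define X where "X = {max (\<mu> B) (-1) |B. B \<in> sets N \<and> B \<subseteq> E}"
  have bdd: "bdd_below X" unfolding X_def by (rule bdd_belowI[of _ "-1"]) auto
  have "max (\<mu> {}) (-1) \<in> X" unfolding X_def by (intro CollectI exI[of _ "{}"]) auto
  then have X0: "0 \<in> X" using sigma_additive_empty[OF \<mu>] by simp
  then have le: "Inf X \<le> 0" using bdd by (rule cInf_lower)
  have lower: "Inf X \<le> max (\<mu> B) (-1)" if "B \<in> sets N" "B \<subseteq> E" for B
    using that bdd by (intro cInf_lower) (auto simp: X_def)
  show ?thesis
  proof (cases "Inf X = 0")
    case True
    then show ?thesis using lower sigma_additive_empty[OF \<mu>] by (intro bexI[of _ "{}"]) auto
  next
    case False
    with le have "Inf X < Inf X / 2" by simp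
    then obtain x where "x \<in> X" "x < Inf X / 2"
      using X0 cInf_lessD[of X "Inf X / 2"] by blast
    then obtain B where B: "B \<in> sets N" "B \<subseteq> E" "max (\<mu> B) (-1) < Inf X / 2"
      unfolding X_def by auto
    have *: "2 * \<mu> B \<le> max (\<mu> B') (-1)" if "B' \<in> sets N" "B' \<subseteq> E" for B'
    proof -
      have "2 * \<mu> B \<le> Inf X" using B(3) by auto
      then show ?thesis using lower[OF that] by linarith
    qed
    have "\<mu> B \<le> 0" using B(3) le by auto
    with * B show ?thesis by blast
  qed
qed

text \<open>Greedy exhaustion: from what is left of \<open>A\<close>, remove a subset that is within
  a factor 2 of the most negative truncated value. The removed sets are disjoint, so their measures
  are summable and tend to 0; a subset \<open>B\<close> of the remainder competed at every stage,
  which forces \<open>0 \<le> \<mu> B\<close> in the limit. Only sets of measure at most 0 are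
  removed, so the value does not drop.\<close>

lemma ex_positive_subset:
  assumes \<mu>: "sigma_additive N \<mu>" and A: "A \<in> sets N"
  shows "\<exists>P\<subseteq>A. positive_set N \<mu> P \<and> \<mu> A \<le> \<mu> P"
proof -
  obtain g where g: "\<And>E. E \<in> sets N \<Longrightarrow> g E \<in> sets N \<and> g E \<subseteq> E \<and> \<mu> (g E) \<le> 0 \<and>
      (\<forall>B\<in>sets N. B \<subseteq> E \<longrightarrow> 2 * \<mu> (g E) \<le> max (\<mu> B) (-1))"
    using half_minimal_subset[OF \<mu>] by metis
  define E where "E = rec_nat A (\<lambda>_ X. X - g X)"
  have E_Suc: "E (Suc n) = E n - g (E n)" and E_0: "E 0 = A" for n
    by (simp_all add: E_def)
  have E: "E n \<in> sets N" for n
  proof (induction n)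
    case 0 then show ?case using A by (simp add: E_0)
  next
    case (Suc n) then show ?case using g[OF Suc] by (auto simp: E_Suc)
  qed
  define G where "G n = g (E n)" for n
  have G: "G n \<in> sets N" "G n \<subseteq> E n" "\<mu> (G n) \<le> 0"
    "\<And>B. B \<in> sets N \<Longrightarrow> B \<subseteq> E n \<Longrightarrow> 2 * \<mu> (G n) \<le> max (\<mu> B) (-1)" for n
    using g[OF E[of n]] by (auto simp: G_def)
  have dec: "decseq E" by (rule decseq_SucI) (auto simp: E_Suc)
  have EA: "E n \<subseteq> A" for n using dec E_0 by (metis decseqD le0)
  have out: "G m \<inter> E n = {}" if "m < n" for m n
  proof -
    have "E n \<subseteq> E (Suc m)" using dec that by (simp add: decseqD)
    then show ?thesis by (auto simp: E_Suc G_def)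
  qed
  have disj: "disjoint_family G"
    unfolding disjoint_family_on_def
  proof (intro ballI impI)
    fix m n :: nat assume "m \<noteq> n"
    then consider "m < n" | "n < m" by linarith
    then show "G m \<inter> G n = {}"
      by cases (use out G(2) in blast)+
  qed
  define P where "P = A - (\<Union>n. G n)"
  have PE: "P \<subseteq> E n" for n
    by (induction n) (auto simp: P_def E_0 E_Suc G_def)
  have sums: "(\<lambda>i. \<mu> (G i)) sums \<mu> (\<Union>i. G i)"
    using G(1) disj by (rule sigma_additiveD[OF \<mu>])
  then have lim: "(\<lambda>i. \<mu> (G i)) \<longlonglongrightarrow> 0" by (intro summable_LIMSEQ_zero) (auto simp: sums_iff)
  have P: "P \<in> sets N" using A G(1) by (auto simp: P_def)
  have "positive_set N \<mu> P"
    unfolding positive_set_def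
  proof (intro conjI ballI impI)
    fix B assume B: "B \<in> sets N" "B \<subseteq> P"
    have "(\<lambda>i. 2 * \<mu> (G i)) \<longlonglongrightarrow> 2 * 0" by (intro tendsto_intros lim)
    then have "2 * 0 \<le> max (\<mu> B) (-1)"
      by (rule LIMSEQ_le_const2) (use G(4) B PE in blast)
    then show "0 \<le> \<mu> B" by auto
  qed fact
  moreover have "\<mu> P = \<mu> A - \<mu> (\<Union>n. G n)"
    unfolding P_def using A G(1,2) EA by (intro sigma_additive_Diff[OF \<mu>]) blast+
  moreover have "\<mu> (\<Union>n. G n) \<le> 0"
    using sums by (rule sums_le[OF G(3) _ sums_zero])
  ultimately show ?thesis by (intro exI[of _ P]) (auto simp: P_def)
qed

lemma positive_set_UN:
  fixes P :: "nat \<Rightarrow> 'a set"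
  assumes \<mu>: "sigma_additive N \<mu>" and P: "\<And>n. positive_set N \<mu> (P n)"
  shows "positive_set N \<mu> (\<Union>n. P n)"
  unfolding positive_set_def
proof (intro conjI ballI impI)
  have sP: "P n \<in> sets N" for n using P unfolding positive_set_def by auto
  then show "(\<Union>n. P n) \<in> sets N" by auto
  fix B assume B: "B \<in> sets N" "B \<subseteq> (\<Union>n. P n)"
  define D where "D n = B \<inter> disjointed P n" for n
  have dP: "disjointed P n \<in> sets N" for n using sP by (meson image_subsetI sets.range_disjointed_sets rangeI subsetD)
  have "(\<lambda>n. \<mu> (D n)) sums \<mu> (\<Union>n. D n)"
    using dP B disjoint_family_disjointed[of P]
    by (intro sigma_additiveD[OF \<mu>]) (fastforce simp: D_def disjoint_family_on_def)+
  moreover have "(\<Union>n. D n) = B" using B UN_disjointed_eq[of P] by (auto simp: D_def)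
  moreover have "0 \<le> \<mu> (D n)" for n
  proof -
    have "D n \<in> sets N" unfolding D_def by (rule sets.Int[OF B(1) dP])
    moreover have "D n \<subseteq> P n" unfolding D_def by (rule le_infI2[OF disjointed_subset])
    ultimately show ?thesis using P[of n] by (simp add: positive_set_def)
  qed
  ultimately show "0 \<le> \<mu> B" using sums_le[OF _ sums_zero, of "\<lambda>n. \<mu> (D n)"] by simp
qed

text \<open>A positive set of maximal measure exists because positive sets are closed under
  countable unions and \<open>\<mu>\<close> is monotone on them. A subset of its complement with
  positive measure would contain a positive set that could be adjoined, contradicting
  maximality.\<close>

lemma Hahn_decomposition:
  assumes \<mu>: "sigma_additive N \<mu>"
  obtains P where "positive_set N \<mu> P" "positive_set N (\<lambda>A. - \<mu> A) (space N - P)"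
proof -
  have mono: "\<mu> A \<le> \<mu> B" if "A \<subseteq> B" "A \<in> sets N" "positive_set N \<mu> B" for A B
  proof -
    have "B - A \<in> sets N" using that by (auto simp: positive_set_def)
    then have "0 \<le> \<mu> (B - A)" using that unfolding positive_set_def by blast
    then show ?thesis
      using that sigma_additive_Diff[OF \<mu>, of B A] by (simp add: positive_set_def)
  qed
  \<comment> \<open>Extended reals, since the supremum is known to be finite only once the union of
    a maximising sequence is seen to attain it.\<close>
  define X where "X = ereal ` \<mu> ` {P. positive_set N \<mu> P}"
  have pe: "positive_set N \<mu> {}" using sigma_additive_empty[OF \<mu>] by (auto simp: positive_set_def)
  then have "X \<noteq> {}" unfolding X_def by auto
  then obtain f where f: "range f \<subseteq> X" "f \<longlonglongrightarrow> Sup X" "incseq f"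
    using Sup_countable_SUP[of X] by (metis LIMSEQ_SUP)
  then have "\<forall>n. \<exists>P. positive_set N \<mu> P \<and> f n = ereal (\<mu> P)" unfolding X_def by auto
  then obtain P where P: "\<And>n. positive_set N \<mu> (P n)" "\<And>n. f n = ereal (\<mu> (P n))" by metis
  define Q where "Q = (\<Union>n. P n)"
  have Q: "positive_set N \<mu> Q" unfolding Q_def by (rule positive_set_UN[OF \<mu> P(1)])
  have "f n \<le> ereal (\<mu> Q)" for n
    using mono[OF _ _ Q, of "P n"] P[of n] by (auto simp: Q_def positive_set_def)
  then have SQ: "Sup X \<le> ereal (\<mu> Q)" using f(2) by (intro LIMSEQ_le_const2) auto
  have max: "\<mu> P' \<le> \<mu> Q" if "positive_set N \<mu> P'" for P'
  proof -
    have "ereal (\<mu> P') \<le> Sup X" using that by (intro Sup_upper) (auto simp: X_def)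
    then show ?thesis using SQ by (metis ereal_less_eq(3) order_trans)
  qed
  have "positive_set N (\<lambda>A. - \<mu> A) (space N - Q)"
    unfolding positive_set_def
  proof (intro conjI ballI impI)
    show "space N - Q \<in> sets N" using Q by (auto simp: positive_set_def)
    fix B assume B: "B \<in> sets N" "B \<subseteq> space N - Q"
    obtain P' where P': "P' \<subseteq> B" "positive_set N \<mu> P'" "\<mu> B \<le> \<mu> P'"
      using ex_positive_subset[OF \<mu> B(1)] by auto
    \<comment> \<open>A binary union written as a countable one, to reuse
      \<open>positive_set_UN\<close>; maximality of \<open>Q\<close> then forces
      \<open>\<mu> P' \<le> 0\<close>.\<close>
    define R where "R = (\<lambda>n::nat. if n = 0 then Q else P')"
    have "positive_set N \<mu> (\<Union>n. R n)"
      by (rule positive_set_UN[OF \<mu>]) (auto simp: R_def Q P')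
    moreover have "(\<Union>n. R n) = Q \<union> P'" unfolding R_def by (auto split: if_splits)
    ultimately have "\<mu> (Q \<union> P') \<le> \<mu> Q" using max by simp
    moreover have "\<mu> (Q \<union> P') = \<mu> Q + \<mu> P'"
      using P' Q B by (intro sigma_additive_Un[OF \<mu>]) (auto simp: positive_set_def)
    ultimately show "0 \<le> - \<mu> B" using P'(3) by simp
  qed
  with Q show ?thesis by (rule that)
qed

lemma finite_vmeasure_sigma_additive:
  "finite_vmeasure S \<mu> \<Longrightarrow> sigma_additive (restrict_space borel S) \<mu>"
  unfolding finite_vmeasure_def sigma_additive_def by blast

lemma sets_pos_variation [simp, measurable_cong]:
  "sets (pos_variation S \<mu>) = sets (restrict_space borel S)"
  and space_pos_variation [simp]: "space (pos_variation S \<mu>) = S"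
proof -
  have "sets (restrict_space borel S) \<subseteq> Pow S"
    using sets.space_closed[of "restrict_space borel S"] by (simp add: space_restrict_space)
  moreover have "sigma_sets S (sets (restrict_space borel S)) = sets (restrict_space borel S)"
    using sets.sigma_sets_eq[of "restrict_space borel S"] by (simp add: space_restrict_space)
  ultimately show "sets (pos_variation S \<mu>) = sets (restrict_space borel S)"
    "space (pos_variation S \<mu>) = S"
    unfolding pos_variation_def by (simp_all add: sets_measure_of space_measure_of)
qed

text \<open>The supremum in \<open>pos_variation\<close> is attained at \<open>A \<inter> P\<close>:
  passing from \<open>B\<close> to \<open>B \<inter> P\<close> drops a nonpositive part, and
  enlarging to \<open>A \<inter> P\<close> adds a nonnegative one. The set function is then
  countably additive, which must be checked before \<open>measure_of\<close> returns it, as the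
  default there is the zero measure.\<close>

lemma emeasure_pos_variation:
  assumes \<mu>: "sigma_additive (restrict_space borel S) \<mu>"
    and P: "positive_set (restrict_space borel S) \<mu> P"
    and NP: "positive_set (restrict_space borel S) (\<lambda>A. - \<mu> A) (S - P)"
    and A: "A \<in> sets (restrict_space borel S)"
  shows "emeasure (pos_variation S \<mu>) A = ennreal (\<mu> (A \<inter> P))"
proof -
  let ?N = "restrict_space borel S"
  have sP: "P \<in> sets ?N" using P by (simp add: positive_set_def)
  have sub: "B \<subseteq> S" if "B \<in> sets ?N" for B
    using sets.sets_into_space[OF that] by (simp add: space_restrict_space)
  have eq: "(SUP B\<in>{B \<in> sets ?N. B \<subseteq> A}. ennreal (\<mu> B)) = ennreal (\<mu> (A \<inter> P))" if A: "A \<in> sets ?N" for A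
  proof (rule antisym)
    show "(SUP B\<in>{B \<in> sets ?N. B \<subseteq> A}. ennreal (\<mu> B)) \<le> ennreal (\<mu> (A \<inter> P))"
    proof (rule SUP_least)
      fix B assume B: "B \<in> {B \<in> sets ?N. B \<subseteq> A}"
      have 1: "\<mu> (B \<inter> P \<union> (B - P)) = \<mu> (B \<inter> P) + \<mu> (B - P)"
        using B sP by (intro sigma_additive_Un[OF \<mu>]) auto
      have 2: "B \<inter> P \<union> (B - P) = B" by auto
      have 3: "0 \<le> - \<mu> (B - P)" using NP B sP sub[of B] unfolding positive_set_def by blast
      have 4: "\<mu> (A \<inter> P - B \<inter> P) = \<mu> (A \<inter> P) - \<mu> (B \<inter> P)"
        using B sP A by (intro sigma_additive_Diff[OF \<mu>]) auto
      have 5: "A \<inter> P - B \<inter> P \<in> sets ?N" using B by (intro sets.Diff sets.Int A sP) simp_all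
      have 6: "0 \<le> \<mu> (A \<inter> P - B \<inter> P)" using P 5 by (simp add: positive_set_def le_infI2 Diff_subset_conv)
      show "ennreal (\<mu> B) \<le> ennreal (\<mu> (A \<inter> P))"
        using 1 2 3 4 6 by (intro ennreal_leI) simp
    qed
    show "ennreal (\<mu> (A \<inter> P)) \<le> (SUP B\<in>{B \<in> sets ?N. B \<subseteq> A}. ennreal (\<mu> B))"
      using A sP by (intro SUP_upper) auto
  qed
  have "emeasure (pos_variation S \<mu>) A = (SUP B\<in>{B \<in> sets ?N. B \<subseteq> A}. ennreal (\<mu> B))"
    unfolding pos_variation_def
  proof (rule emeasure_measure_of_sigma)
    show "sigma_algebra S (sets ?N)"
      using sets.sigma_algebra_axioms[of ?N] by (simp add: space_restrict_space)
    show "positive (sets ?N) (\<lambda>A. SUP B\<in>{B \<in> sets ?N. B \<subseteq> A}. ennreal (\<mu> B))"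
      unfolding positive_def by (subst eq) (simp_all add: sigma_additive_empty[OF \<mu>])
    show "countably_additive (sets ?N) (\<lambda>A. SUP B\<in>{B \<in> sets ?N. B \<subseteq> A}. ennreal (\<mu> B))"
      unfolding countably_additive_def
    proof (intro allI impI)
      fix D :: "nat \<Rightarrow> 'a set"
      assume D: "range D \<subseteq> sets ?N" "disjoint_family D" "\<Union> (range D) \<in> sets ?N"
      have "(\<lambda>i. \<mu> (D i \<inter> P)) sums \<mu> (\<Union>i. D i \<inter> P)"
        using D sP by (intro sigma_additiveD[OF \<mu>]) (auto simp: disjoint_family_on_def)
      moreover have "0 \<le> \<mu> (D i \<inter> P)" for i
      proof -
        have "D i \<inter> P \<in> sets ?N" using D sP by auto
        then show ?thesis using P unfolding positive_set_def by blast
      qed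
      ultimately have "(\<Sum>i. ennreal (\<mu> (D i \<inter> P))) = ennreal (\<mu> (\<Union>i. D i \<inter> P))"
        by (metis sums_unique suminf_ennreal2 sums_summable)
      moreover have "(\<Union>i. D i \<inter> P) = \<Union> (range D) \<inter> P" by auto
      moreover have "D i \<in> sets ?N" for i using D by auto
      ultimately show "(\<Sum>i. SUP B\<in>{B \<in> sets ?N. B \<subseteq> D i}. ennreal (\<mu> B)) =
          (SUP B\<in>{B \<in> sets ?N. B \<subseteq> \<Union> (range D)}. ennreal (\<mu> B))"
        using eq D(3) by simp
    qed
    show "A \<in> sets ?N" by fact
  qed
  with eq A show ?thesis by simp
qed

lemma sets_neg_variation [simp, measurable_cong]:
  "sets (neg_variation S \<mu>) = sets (restrict_space borel S)"
  and space_neg_variation [simp]: "space (neg_variation S \<mu>) = S"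
  by (simp_all add: neg_variation_def)

lemma Jordan_decomposition:
  assumes "finite_vmeasure S \<mu>"
  shows "finite_measure (pos_variation S \<mu>)" "finite_measure (neg_variation S \<mu>)"
    "A \<in> sets (restrict_space borel S) \<Longrightarrow>
      \<mu> A = measure (pos_variation S \<mu>) A - measure (neg_variation S \<mu>) A"
proof -
  let ?N = "restrict_space borel S"
  have \<mu>: "sigma_additive ?N \<mu>" using assms by (rule finite_vmeasure_sigma_additive)
  obtain P where P: "positive_set ?N \<mu> P" "positive_set ?N (\<lambda>A. - \<mu> A) (S - P)"
    using Hahn_decomposition[OF \<mu>] by (auto simp: space_restrict_space)
  have sP: "P \<in> sets ?N" "P \<subseteq> S"
    using P(1) sets.sets_into_space[of P ?N] by (auto simp: positive_set_def space_restrict_space)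
  \<comment> \<open>The roles of \<open>P\<close> and \<open>S - P\<close> are exchanged for
    \<open>- \<mu>\<close>, whose positive variation is the negative variation of
    \<open>\<mu>\<close>.\<close>
  have SSP: "S - (S - P) = P" using sP by auto
  have pos: "emeasure (pos_variation S \<mu>) A = ennreal (\<mu> (A \<inter> P))" if "A \<in> sets ?N" for A
    using emeasure_pos_variation[OF \<mu> P that] .
  have neg: "emeasure (neg_variation S \<mu>) A = ennreal (- \<mu> (A \<inter> (S - P)))" if "A \<in> sets ?N" for A
    unfolding neg_variation_def
    by (rule emeasure_pos_variation[OF sigma_additive_uminus[OF \<mu>] P(2) _ that])
      (use P(1) in \<open>simp add: SSP\<close>)
  have S: "S \<in> sets ?N" using sets.top[of ?N] by (simp add: space_restrict_space)
  show "finite_measure (pos_variation S \<mu>)" "finite_measure (neg_variation S \<mu>)"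
    by (rule finite_measureI; simp add: pos neg S)+
  assume A: "A \<in> sets ?N"
  have AS: "A \<subseteq> S" using sets.sets_into_space[OF A] by (simp add: space_restrict_space)
  have "0 \<le> \<mu> (A \<inter> P)" "0 \<le> - \<mu> (A \<inter> (S - P))"
  proof -
    have "A \<inter> P \<in> sets ?N" "A \<inter> (S - P) \<in> sets ?N"
      by (intro sets.Int sets.Diff A sP S)+
    then show "0 \<le> \<mu> (A \<inter> P)" "0 \<le> - \<mu> (A \<inter> (S - P))"
      using P by (simp_all add: positive_set_def)
  qed
  then have "measure (pos_variation S \<mu>) A - measure (neg_variation S \<mu>) A = \<mu> (A \<inter> P) + \<mu> (A \<inter> (S - P))"
    using pos[OF A] neg[OF A] by (simp add: measure_def)
  also have "\<dots> = \<mu> (A \<inter> P \<union> A \<inter> (S - P))"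
    using A sP S by (intro sigma_additive_Un[OF \<mu>, symmetric]) auto
  also have "A \<inter> P \<union> A \<inter> (S - P) = A" using AS by auto
  finally show "\<mu> A = measure (pos_variation S \<mu>) A - measure (neg_variation S \<mu>) A" ..
qed

subsection \<open>Integrals of bounded Borel functions\<close>

text \<open>The class of integrands: such functions are integrable for every finite measure on
  \<open>S\<close>, so linearity and limit rules for \<open>signed_integral\<close> carry no
  integrability conditions.\<close>

definition bounded_borel :: "'a::euclidean_space set \<Rightarrow> ('a \<Rightarrow> real) set" where
  "bounded_borel S = {f \<in> borel_measurable (restrict_space borel S). bounded (f ` S)}"

lemma bounded_borelI:
  "f \<in> borel_measurable (restrict_space borel S) \<Longrightarrow> (\<And>x. x \<in> S \<Longrightarrow> \<bar>f x\<bar> \<le> B) \<Longrightarrow> f \<in> bounded_borel S"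
  unfolding bounded_borel_def bounded_iff by auto

lemma bounded_borel_measurable: "f \<in> bounded_borel S \<Longrightarrow> f \<in> borel_measurable (restrict_space borel S)"
  unfolding bounded_borel_def by auto

lemma bounded_borel_bound:
  assumes "f \<in> bounded_borel S"
  obtains B where "0 \<le> B" "\<And>x. x \<in> S \<Longrightarrow> \<bar>f x\<bar> \<le> B"
  using assms unfolding bounded_borel_def bounded_pos by (auto intro: that[OF less_imp_le])

lemma bounded_borel_add [intro]:
  assumes "f \<in> bounded_borel S" "g \<in> bounded_borel S"
  shows "(\<lambda>x. f x + g x) \<in> bounded_borel S"
proof -
  obtain B where B: "\<And>x. x \<in> S \<Longrightarrow> \<bar>f x\<bar> \<le> B" using bounded_borel_bound[OF assms(1)] by blast
  obtain C where C: "\<And>x. x \<in> S \<Longrightarrow> \<bar>g x\<bar> \<le> C" using bounded_borel_bound[OF assms(2)] by blast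
  show ?thesis
  proof (rule bounded_borelI)
    show "(\<lambda>x. f x + g x) \<in> borel_measurable (restrict_space borel S)"
      using assms[THEN bounded_borel_measurable] by measurable
    show "\<bar>f x + g x\<bar> \<le> B + C" if "x \<in> S" for x using B[OF that] C[OF that] by linarith
  qed
qed

lemma bounded_borel_mult [intro]:
  assumes "f \<in> bounded_borel S" "g \<in> bounded_borel S"
  shows "(\<lambda>x. f x * g x) \<in> bounded_borel S"
proof -
  obtain B where B: "0 \<le> B" "\<And>x. x \<in> S \<Longrightarrow> \<bar>f x\<bar> \<le> B" using bounded_borel_bound[OF assms(1)] by blast
  obtain C where C: "\<And>x. x \<in> S \<Longrightarrow> \<bar>g x\<bar> \<le> C" using bounded_borel_bound[OF assms(2)] by blast
  show ?thesis
  proof (rule bounded_borelI)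
    show "(\<lambda>x. f x * g x) \<in> borel_measurable (restrict_space borel S)"
      using assms[THEN bounded_borel_measurable] by measurable
    show "\<bar>f x * g x\<bar> \<le> B * C" if "x \<in> S" for x
      unfolding abs_mult using B(2)[OF that] C[OF that] B(1) by (intro mult_mono) auto
  qed
qed

lemma bounded_borel_const [intro, simp]: "(\<lambda>x. c) \<in> bounded_borel S"
  by (rule bounded_borelI[of _ _ "\<bar>c\<bar>"]) auto

lemma bounded_borel_cmult [intro]: "f \<in> bounded_borel S \<Longrightarrow> (\<lambda>x. c * f x) \<in> bounded_borel S"
  by (rule bounded_borel_mult) auto

lemma bounded_borel_minus [intro]: "f \<in> bounded_borel S \<Longrightarrow> (\<lambda>x. - f x) \<in> bounded_borel S"
  using bounded_borel_cmult[of f S "-1"] by simp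

lemma bounded_borel_diff [intro]:
  "f \<in> bounded_borel S \<Longrightarrow> g \<in> bounded_borel S \<Longrightarrow> (\<lambda>x. f x - g x) \<in> bounded_borel S"
  using bounded_borel_add[OF _ bounded_borel_minus, of f S g] by simp

lemma bounded_borel_abs [intro]: "f \<in> bounded_borel S \<Longrightarrow> (\<lambda>x. \<bar>f x\<bar>) \<in> bounded_borel S"
  unfolding bounded_borel_def bounded_iff by (auto intro: borel_measurable_abs)

lemma bounded_borel_indicator [intro]:
  "A \<in> sets (restrict_space borel S) \<Longrightarrow> indicator A \<in> bounded_borel S"
  by (rule bounded_borelI[of _ _ 1]) (auto simp: indicator_def)

lemma bounded_borel_LIMSEQ:
  assumes "\<And>k. F k \<in> bounded_borel S" "\<And>k x. x \<in> S \<Longrightarrow> \<bar>F k x\<bar> \<le> B"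
    and "\<And>x. x \<in> S \<Longrightarrow> (\<lambda>k. F k x) \<longlonglongrightarrow> f x"
  shows "f \<in> bounded_borel S"
proof (rule bounded_borelI[of _ _ B])
  show "f \<in> borel_measurable (restrict_space borel S)"
    using assms(1)[THEN bounded_borel_measurable] assms(3)
    by (intro borel_measurable_LIMSEQ_real[where u = F and u' = f]) (auto simp: space_restrict_space)
  show "\<bar>f x\<bar> \<le> B" if "x \<in> S" for x
    using tendsto_rabs[OF assms(3)[OF that]] assms(2)[OF that] by (intro LIMSEQ_le_const2) auto
qed

lemma bounded_borel_subset:
  assumes "f \<in> bounded_borel S" "T \<subseteq> S"
  shows "f \<in> bounded_borel T"
proof -
  obtain B where B: "\<And>x. x \<in> S \<Longrightarrow> \<bar>f x\<bar> \<le> B" using bounded_borel_bound[OF assms(1)] by blast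
  show ?thesis
  proof (rule bounded_borelI)
    show "f \<in> borel_measurable (restrict_space borel T)"
      using measurable_restrict_mono[OF bounded_borel_measurable[OF assms(1)] assms(2)] .
    show "\<bar>f x\<bar> \<le> B" if "x \<in> T" for x using B that assms(2) by auto
  qed
qed

lemma bounded_borel_continuous:
  "continuous_on S f \<Longrightarrow> bounded (f ` S) \<Longrightarrow> f \<in> bounded_borel S"
  unfolding bounded_borel_def by (auto intro: borel_measurable_continuous_on_restrict)

text \<open>Monotone class induction whose limit step asks for bounded pointwise convergence instead
  of monotone convergence. This suits signed measures, for which dominated convergence is the
  available limit theorem.\<close>

lemma bounded_borel_induct_indicator [consumes 1, case_names indicator add scale lim]:
  assumes f: "f \<in> bounded_borel S"
    and ind: "\<And>A. A \<in> sets (restrict_space borel S) \<Longrightarrow> P (indicator A)"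
    and add: "\<And>f g. f \<in> bounded_borel S \<Longrightarrow> g \<in> bounded_borel S \<Longrightarrow> P f \<Longrightarrow> P g \<Longrightarrow> P (\<lambda>x. f x + g x)"
    and scale: "\<And>f c. f \<in> bounded_borel S \<Longrightarrow> P f \<Longrightarrow> P (\<lambda>x. c * f x)"
    and lim: "\<And>F f B. (\<And>k::nat. F k \<in> bounded_borel S) \<Longrightarrow> (\<And>k. P (F k)) \<Longrightarrow>
       (\<And>k x. x \<in> S \<Longrightarrow> \<bar>F k x\<bar> \<le> B) \<Longrightarrow> (\<And>x. x \<in> S \<Longrightarrow> (\<lambda>k. F k x) \<longlonglongrightarrow> f x) \<Longrightarrow> P f"
  shows "P f"
proof -
  let ?N = "restrict_space borel S"
  have S: "space ?N = S" by (simp add: space_restrict_space)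
  have nonneg: "P u" if u: "u \<in> borel_measurable ?N" "\<And>x. 0 \<le> u x" "bounded (u ` S)" for u
    using u
  proof (induction u rule: borel_measurable_induct_real)
    case (set A) then show ?case by (intro ind)
  next
    case (mult u c)
    show ?case
    proof (cases "c = 0")
      case True
      \<comment> \<open>For \<open>c = 0\<close> a bound on \<open>c * u\<close> says nothing about
        \<open>u\<close>, so the zero function is obtained from the empty set.\<close>
      then show ?thesis using scale[of "indicator {}" 0] ind[of "{}"] by auto
    next
      case False
      obtain B where B: "\<And>x. x \<in> S \<Longrightarrow> \<bar>c * u x\<bar> \<le> B" using mult.prems by (auto simp: bounded_iff)
      have "\<bar>u x\<bar> \<le> B / \<bar>c\<bar>" if "x \<in> S" for x
        using B[OF that] False by (simp add: abs_mult field_simps)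
      then have "bounded (u ` S)" by (auto simp: bounded_iff)
      with mult show ?thesis by (intro scale) (auto simp: bounded_borel_def)
    qed
  next
    case (add u v)
    obtain B where B: "\<And>x. x \<in> S \<Longrightarrow> \<bar>v x + u x\<bar> \<le> B" using add.prems by (auto simp: bounded_iff)
    have "\<bar>u x\<bar> \<le> B" "\<bar>v x\<bar> \<le> B" if "x \<in> S" for x
      using add.hyps(2)[of x] add.hyps(4)[of x] B[OF that] by linarith+
    then have "bounded (u ` S)" "bounded (v ` S)" by (auto simp: bounded_iff)
    with add show ?case by (intro assms(3)) (auto simp: bounded_borel_def)
  next
    case (seq U)
    obtain B where B: "\<And>x. x \<in> S \<Longrightarrow> \<bar>u x\<bar> \<le> B" using seq.prems by (auto simp: bounded_iff)
    have le: "\<bar>U i x\<bar> \<le> B" if "x \<in> S" for i x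
    proof -
      \<comment> \<open>An increasing sequence of nonnegative functions inherits the bound of its
        limit.\<close>
      have "U i x \<le> u x"
        using seq.hyps(3,4) that
        by (intro incseq_le) (auto simp: incseq_def le_fun_def space_restrict_space)
      then show ?thesis using B[OF that] seq.hyps(2)[of i x] by linarith
    qed
    then have bd: "bounded (U i ` S)" for i by (auto simp: bounded_iff)
    show ?case
    proof (rule lim[of U])
      show "U k \<in> bounded_borel S" for k using seq.hyps(1) bd by (auto simp: bounded_borel_def)
      show "P (U k)" for k using seq.IH bd by auto
    qed (use le seq.hyps(4) S in auto)
  qed
  have "P (\<lambda>x. max 0 (f x) + (- 1) * max 0 (- f x))"
  proof (intro add scale nonneg)
    obtain B where B: "\<And>x. x \<in> S \<Longrightarrow> \<bar>f x\<bar> \<le> B" using bounded_borel_bound[OF f] by blast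
    have m: "f \<in> borel_measurable ?N" using f by (rule bounded_borel_measurable)
    from m show m1: "(\<lambda>x. max 0 (f x)) \<in> borel_measurable ?N" by measurable
    from m show m2: "(\<lambda>x. max 0 (- f x)) \<in> borel_measurable ?N" by measurable
    show b1: "bounded ((\<lambda>x. max 0 (f x)) ` S)"
      unfolding bounded_iff by (rule exI[of _ B]) (use B in fastforce)
    show b2: "bounded ((\<lambda>x. max 0 (- f x)) ` S)"
      unfolding bounded_iff by (rule exI[of _ B]) (use B in fastforce)
    show "(\<lambda>x. max 0 (f x)) \<in> bounded_borel S" "(\<lambda>x. max 0 (- f x)) \<in> bounded_borel S"
      "(\<lambda>x. - 1 * max 0 (- f x)) \<in> bounded_borel S"
      using m1 m2 b1 b2 by (auto simp: bounded_borel_def bounded_borel_cmult[unfolded bounded_borel_def])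
  qed auto
  moreover have "(\<lambda>x. max 0 (f x) + (- 1) * max 0 (- f x)) = f" by (auto simp: max_def)
  ultimately show ?thesis by simp
qed

lemma integrable_bounded_borel:
  assumes "f \<in> bounded_borel S" "finite_measure m" "sets m = sets (restrict_space borel S)"
  shows "integrable m f"
proof -
  interpret finite_measure m by fact
  obtain B where B: "\<And>x. x \<in> S \<Longrightarrow> \<bar>f x\<bar> \<le> B" using bounded_borel_bound[OF assms(1)] by blast
  have "space m = S" using sets_eq_imp_space_eq[OF assms(3)] by (simp add: space_restrict_space)
  then show ?thesis
    using B bounded_borel_measurable[OF assms(1)] measurable_cong_sets[OF assms(3) refl, of borel]
    by (intro integrable_const_bound[of _ B]) auto
qed

lemma integral_bounded_borel_LIMSEQ:
  assumes "finite_measure m" "sets m = sets (restrict_space borel S)"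
    and "\<And>k. F k \<in> bounded_borel S" "\<And>k x. x \<in> S \<Longrightarrow> \<bar>F k x\<bar> \<le> B"
    and "\<And>x. x \<in> S \<Longrightarrow> (\<lambda>k. F k x) \<longlonglongrightarrow> f x"
  shows "(\<lambda>k. integral\<^sup>L m (F k)) \<longlonglongrightarrow> integral\<^sup>L m f"
proof (rule integral_dominated_convergence[of _ _ _ "\<lambda>_. B"])
  interpret finite_measure m by fact
  have sp: "space m = S" using sets_eq_imp_space_eq[OF assms(2)] by (simp add: space_restrict_space)
  have f: "f \<in> bounded_borel S" using bounded_borel_LIMSEQ[OF assms(3-5)] .
  show "f \<in> borel_measurable m" "F k \<in> borel_measurable m" for k
    using f assms(3) integrable_bounded_borel[OF _ assms(1,2)] by auto
  show "AE x in m. norm (F k x) \<le> B" "AE x in m. (\<lambda>k. F k x) \<longlonglongrightarrow> f x" for k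
    using assms(4,5) sp by auto
  show "integrable m (\<lambda>_. B)" by simp
qed

lemma bounded_borel_mult_indicator [intro]:
  "f \<in> bounded_borel S \<Longrightarrow> E \<in> sets (restrict_space borel S) \<Longrightarrow> (\<lambda>x. indicator E x * f x) \<in> bounded_borel S"
  by (intro bounded_borel_mult bounded_borel_indicator)

lemma signed_integral_eq:
  "signed_integral S \<mu> E f =
    (LINT x|pos_variation S \<mu>. indicator E x * f x) - (LINT x|neg_variation S \<mu>. indicator E x * f x)"
  by (simp add: signed_integral_def set_lebesgue_integral_def)

lemma signed_integral_top:
  "signed_integral S \<mu> S f = (LINT x|pos_variation S \<mu>. f x) - (LINT x|neg_variation S \<mu>. f x)"
  unfolding signed_integral_eq
  by (intro arg_cong2[of _ _ _ _ "(-)"] Bochner_Integration.integral_cong) auto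

lemma signed_integral_restrict:
  "signed_integral S \<mu> E f = signed_integral S \<mu> S (\<lambda>x. indicator E x * f x)"
  by (simp add: signed_integral_top signed_integral_eq)

context
  fixes S :: "'a::euclidean_space set" and \<mu> :: "'a set \<Rightarrow> real"
  assumes \<mu>: "finite_vmeasure S \<mu>"
begin

lemmas variation_finite = Jordan_decomposition(1,2)[OF \<mu>]

lemma signed_integral_add:
  "f \<in> bounded_borel S \<Longrightarrow> g \<in> bounded_borel S \<Longrightarrow>
    signed_integral S \<mu> S (\<lambda>x. f x + g x) = signed_integral S \<mu> S f + signed_integral S \<mu> S g"
  by (simp add: signed_integral_top integrable_bounded_borel[OF _ variation_finite(1)]
      integrable_bounded_borel[OF _ variation_finite(2)])

lemma signed_integral_cmult:
  "signed_integral S \<mu> S (\<lambda>x. c * f x) = c * signed_integral S \<mu> S f"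
  by (simp add: signed_integral_top right_diff_distrib)

lemma signed_integral_diff:
  "f \<in> bounded_borel S \<Longrightarrow> g \<in> bounded_borel S \<Longrightarrow>
    signed_integral S \<mu> S (\<lambda>x. f x - g x) = signed_integral S \<mu> S f - signed_integral S \<mu> S g"
  by (simp add: signed_integral_top integrable_bounded_borel[OF _ variation_finite(1)]
      integrable_bounded_borel[OF _ variation_finite(2)])

lemma signed_integral_LIMSEQ:
  assumes "\<And>k. F k \<in> bounded_borel S" "\<And>k x. x \<in> S \<Longrightarrow> \<bar>F k x\<bar> \<le> B"
    and "\<And>x. x \<in> S \<Longrightarrow> (\<lambda>k. F k x) \<longlonglongrightarrow> f x"
  shows "(\<lambda>k. signed_integral S \<mu> S (F k)) \<longlonglongrightarrow> signed_integral S \<mu> S f"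
  unfolding signed_integral_top
  by (intro tendsto_diff integral_bounded_borel_LIMSEQ[OF variation_finite(1) _ assms]
      integral_bounded_borel_LIMSEQ[OF variation_finite(2) _ assms]) auto

lemma signed_integral_indicator:
  assumes "A \<in> sets (restrict_space borel S)"
  shows "signed_integral S \<mu> S (indicator A) = \<mu> A"
proof -
  have "A \<inter> S = A" using sets.sets_into_space[OF assms] by (auto simp: space_restrict_space)
  then show ?thesis
    using assms Jordan_decomposition(3)[OF \<mu>] by (simp add: signed_integral_top)
qed

lemma abs_signed_integral_le:
  "\<bar>signed_integral S \<mu> S f\<bar> \<le> (LINT x|pos_variation S \<mu>. \<bar>f x\<bar>) + (LINT x|neg_variation S \<mu>. \<bar>f x\<bar>)"
  unfolding signed_integral_top
  using integral_abs_bound[of "pos_variation S \<mu>" f] integral_abs_bound[of "neg_variation S \<mu>" f]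
  by linarith

lemma abs_signed_integral_le_sup:
  assumes "\<And>x. x \<in> S \<Longrightarrow> \<bar>f x\<bar> \<le> B" "f \<in> bounded_borel S"
  shows "\<bar>signed_integral S \<mu> S f\<bar> \<le>
    B * (measure (pos_variation S \<mu>) S + measure (neg_variation S \<mu>) S)"
proof -
  interpret p: finite_measure "pos_variation S \<mu>" by (rule variation_finite)
  interpret n: finite_measure "neg_variation S \<mu>" by (rule variation_finite)
  have "(LINT x|pos_variation S \<mu>. \<bar>f x\<bar>) \<le> (LINT x|pos_variation S \<mu>. B)"
    using assms by (intro integral_mono integrable_bounded_borel[OF _ variation_finite(1)]) auto
  moreover have "(LINT x|neg_variation S \<mu>. \<bar>f x\<bar>) \<le> (LINT x|neg_variation S \<mu>. B)"
    using assms by (intro integral_mono integrable_bounded_borel[OF _ variation_finite(2)]) auto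
  ultimately show ?thesis
    using abs_signed_integral_le[of f] by (simp add: algebra_simps)
qed

lemma signed_integral_uniform_limit:
  assumes lim: "uniform_limit S F f G"
    and F: "\<forall>\<^sub>F d in G. F d \<in> bounded_borel S" and f: "f \<in> bounded_borel S"
  shows "((\<lambda>d. signed_integral S \<mu> S (F d)) \<longlongrightarrow> signed_integral S \<mu> S f) G"
proof (rule tendstoI)
  fix e :: real assume "0 < e"
  define M where "M = measure (pos_variation S \<mu>) S + measure (neg_variation S \<mu>) S"
  have M: "0 \<le> M" by (simp add: M_def)
  \<comment> \<open>The summand 1 keeps the quotient defined when the total variation is
    zero.\<close>
  define e' where "e' = e / (M + 1)"
  have e': "0 < e'" "e' * M < e" using M \<open>0 < e\<close> by (auto simp: e'_def field_simps)
  have "\<forall>\<^sub>F d in G. \<forall>x\<in>S. dist (F d x) (f x) < e'"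
    using lim e'(1) by (simp add: uniform_limit_iff)
  with F show "\<forall>\<^sub>F d in G. dist (signed_integral S \<mu> S (F d)) (signed_integral S \<mu> S f) < e"
  proof eventually_elim
    case (elim d)
    have "\<bar>signed_integral S \<mu> S (\<lambda>x. F d x - f x)\<bar> \<le> e' * M"
      unfolding M_def using elim f
      by (intro abs_signed_integral_le_sup) (auto simp: dist_real_def less_imp_le)
    then show ?case using e'(2) elim f by (simp add: dist_real_def signed_integral_diff)
  qed
qed

end

text \<open>Any representation of \<open>\<mu>\<close> as a difference of finite measures computes
  its integrals, not only the Jordan one. The trace measure arises as such a difference, of two weak
  limits that may fail to be mutually singular.\<close>

lemma signed_integral_eq_diff:
  assumes \<mu>: "finite_vmeasure S \<mu>" and f: "f \<in> bounded_borel S"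
    and M: "finite_measure M" "sets M = sets (restrict_space borel S)"
    and N: "finite_measure N" "sets N = sets (restrict_space borel S)"
    and eq: "\<And>A. A \<in> sets (restrict_space borel S) \<Longrightarrow> \<mu> A = measure M A - measure N A"
  shows "signed_integral S \<mu> S f = (LINT x|M. f x) - (LINT x|N. f x)"
  using f
proof (induction f rule: bounded_borel_induct_indicator)
  case (indicator A)
  have "space M = S" "space N = S"
    using sets_eq_imp_space_eq[OF M(2)] sets_eq_imp_space_eq[OF N(2)]
    by (simp_all add: space_restrict_space)
  moreover have "A \<inter> S = A" using sets.sets_into_space[OF indicator] by (auto simp: space_restrict_space)
  ultimately show ?case
    using indicator eq M N by (simp add: signed_integral_indicator[OF \<mu>])
next
  case (add f g)
  then show ?case
    by (simp add: signed_integral_add[OF \<mu>] integrable_bounded_borel[OF _ M]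
        integrable_bounded_borel[OF _ N])
next
  case (scale f c)
  then show ?case by (simp add: signed_integral_cmult[OF \<mu>] right_diff_distrib)
next
  case (lim F f B)
  have "(\<lambda>k. signed_integral S \<mu> S (F k)) \<longlonglongrightarrow> (LINT x|M. f x) - (LINT x|N. f x)"
    unfolding lim.IH
    by (intro tendsto_diff integral_bounded_borel_LIMSEQ[OF M lim.hyps]
        integral_bounded_borel_LIMSEQ[OF N lim.hyps])
  moreover have "(\<lambda>k. signed_integral S \<mu> S (F k)) \<longlonglongrightarrow> signed_integral S \<mu> S f"
    by (rule signed_integral_LIMSEQ[OF \<mu> lim.hyps])
  ultimately show ?case by (rule LIMSEQ_unique[rotated])
qed

lemma finite_vmeasure_inner:
  "finite_vmeasure S F \<Longrightarrow> finite_vmeasure S (\<lambda>A. F A \<bullet> i)"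
  unfolding finite_vmeasure_def
  using bounded_linear.sums[OF bounded_linear_inner_left[of i]] by fastforce

lemma finite_vmeasure_eqI:
  assumes "finite_vmeasure S \<mu>" "finite_vmeasure S \<nu>"
    and "\<And>A. A \<in> sets (restrict_space borel S) \<Longrightarrow> \<mu> A = \<nu> A"
  shows "\<mu> = \<nu>"
  using assms unfolding finite_vmeasure_def by (intro ext) metis

lemma finite_vmeasure_diff:
  assumes M: "finite_measure M" "sets M = sets (restrict_space borel S)"
    and N: "finite_measure N" "sets N = sets (restrict_space borel S)"
  shows "finite_vmeasure S (\<lambda>A. if A \<in> sets (restrict_space borel S) then measure M A - measure N A else 0)"
  unfolding finite_vmeasure_def
proof (intro conjI allI impI)
  fix A :: "nat \<Rightarrow> 'a set"
  assume A: "range A \<subseteq> sets (restrict_space borel S)" "disjoint_family A"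
  interpret M: finite_measure M by fact
  interpret N: finite_measure N by fact
  have "(\<lambda>i. measure M (A i) - measure N (A i)) sums (measure M (\<Union>i. A i) - measure N (\<Union>i. A i))"
    using A M N by (intro sums_diff M.finite_measure_UNION N.finite_measure_UNION) auto
  moreover have "A i \<in> sets (restrict_space borel S)" for i using A by auto
  moreover have "(\<Union>i. A i) \<in> sets (restrict_space borel S)" using A by blast
  ultimately show "(\<lambda>i. if A i \<in> sets (restrict_space borel S) then measure M (A i) - measure N (A i) else 0) sums
     (if (\<Union>i. A i) \<in> sets (restrict_space borel S) then measure M (\<Union>i. A i) - measure N (\<Union>i. A i) else 0)"
    by simp
qed auto

subsection \<open>Convolution and mollification\<close>

definition C1 :: "('a::euclidean_space \<Rightarrow> real) \<Rightarrow> bool" where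
  "C1 f \<longleftrightarrow> (\<forall>x. f differentiable (at x)) \<and> continuous_on UNIV (grad f)"

lemma grad_eqI:
  assumes "(f has_derivative (\<lambda>h. h \<bullet> D)) (at x)"
  shows "grad f x = D"
  unfolding grad_def
proof (rule the_equality)
  show "GDERIV f x :> D" using assms by (simp add: gderiv_def)
  fix E assume "GDERIV f x :> E"
  then have "(\<lambda>h. h \<bullet> E) = (\<lambda>h. h \<bullet> D)"
    using assms has_derivative_unique by (simp add: gderiv_def) blast
  then have "(E - D) \<bullet> E = (E - D) \<bullet> D" by meson
  then have "(E - D) \<bullet> (E - D) = 0" by (simp add: inner_diff_right)
  then show "E = D" by simp
qed

lemma differentiable_grad:
  assumes "f differentiable (at x)"
  shows "(f has_derivative (\<lambda>h. h \<bullet> grad f x)) (at x)"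
proof -
  obtain f' where f': "(f has_derivative f') (at x)" using assms by (auto simp: differentiable_def)
  then have lin: "linear f'" by (simp add: has_derivative_linear)
  \<comment> \<open>The linear map \<open>f'\<close> is represented by the vector of its values on
    the basis.\<close>
  define D where "D = (\<Sum>b\<in>Basis. f' b *\<^sub>R b)"
  have *: "f' h = h \<bullet> D" for h
  proof -
    have "f' h = f' (\<Sum>b\<in>Basis. (h \<bullet> b) *\<^sub>R b)" by (simp add: euclidean_representation)
    also have "\<dots> = (\<Sum>b\<in>Basis. (h \<bullet> b) * f' b)"
      by (simp add: linear_sum[OF lin] linear_scale[OF lin])
    also have "\<dots> = h \<bullet> D" by (simp add: D_def inner_sum_right mult.commute)
    finally show ?thesis .
  qed
  have "f' = (\<lambda>h. h \<bullet> D)" by (rule ext) (rule *)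
  with f' have "(f has_derivative (\<lambda>h. h \<bullet> D)) (at x)" by simp
  with grad_eqI[OF this] show ?thesis by simp
qed

lemma C_k_continuous: "C_k k f \<Longrightarrow> continuous_on UNIV f"
  by (cases k) (auto intro!: continuous_at_imp_continuous_on differentiable_imp_continuous_within)

lemma C_k_C1:
  assumes "C_k (Suc k) f" shows "C1 f"
proof -
  have "continuous_on UNIV (\<lambda>x. grad f x \<bullet> i)" if "i \<in> Basis" for i
    using assms that by (auto intro: C_k_continuous)
  then have "continuous_on UNIV (\<lambda>x. grad f x)" by (subst continuous_on_componentwise) auto
  with assms show ?thesis by (simp add: C1_def)
qed

lemma C1_has_derivative: "C1 f \<Longrightarrow> (f has_derivative (\<lambda>h. h \<bullet> grad f x)) (at x)"
  by (intro differentiable_grad) (simp add: C1_def)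

lemma C1_continuous: "C1 f \<Longrightarrow> continuous_on UNIV f"
  by (auto simp: C1_def intro!: continuous_at_imp_continuous_on differentiable_imp_continuous_within)

lemma C1_continuous_grad: "C1 f \<Longrightarrow> continuous_on UNIV (grad f)"
  by (simp add: C1_def)

lemma C1_continuous_grad_inner: "C1 f \<Longrightarrow> continuous_on UNIV (\<lambda>x. grad f x \<bullet> i)"
  by (intro continuous_intros C1_continuous_grad)

lemma C1I:
  assumes "\<And>x. (f has_derivative (\<lambda>h. h \<bullet> D x)) (at x)" "continuous_on UNIV D"
  shows "C1 f" "grad f = D"
proof -
  show *: "grad f = D" using assms(1) by (auto intro: grad_eqI)
  show "C1 f" using assms * by (auto simp: C1_def differentiable_def)
qed

lemma C1_mult:
  assumes "C1 f" "C1 g"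
  shows "C1 (\<lambda>x. f x * g x)" "grad (\<lambda>x. f x * g x) = (\<lambda>x. f x *\<^sub>R grad g x + g x *\<^sub>R grad f x)"
proof -
  have 1: "((\<lambda>x. f x * g x) has_derivative (\<lambda>h. h \<bullet> (f x *\<^sub>R grad g x + g x *\<^sub>R grad f x))) (at x)" for x
    using has_derivative_mult[OF C1_has_derivative[OF assms(1)] C1_has_derivative[OF assms(2)], of x]
    by (simp add: inner_add_right algebra_simps)
  have 2: "continuous_on UNIV (\<lambda>x. f x *\<^sub>R grad g x + g x *\<^sub>R grad f x)"
    using assms by (intro continuous_intros C1_continuous C1_continuous_grad)
  show "C1 (\<lambda>x. f x * g x)" "grad (\<lambda>x. f x * g x) = (\<lambda>x. f x *\<^sub>R grad g x + g x *\<^sub>R grad f x)"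
    using C1I[OF 1 2] by auto
qed

lemma has_derivative_zero_on_open:
  assumes "open V" "x \<in> V" "\<And>y. y \<in> V \<Longrightarrow> f y = 0"
  shows "(f has_derivative (\<lambda>h. 0)) (at x)"
  by (rule has_derivative_transform_within_open[OF has_derivative_const[of 0] assms(1,2)])
    (simp add: assms(3))

lemma grad_zero_on_open:
  assumes "open V" "x \<in> V" "\<And>y. y \<in> V \<Longrightarrow> f y = 0"
  shows "grad f x = 0"
  by (rule grad_eqI) (simp add: has_derivative_zero_on_open[OF assms])

section \<open>Functions of bounded support\<close>

definition vanishes_outside :: "real \<Rightarrow> ('a::euclidean_space \<Rightarrow> real) \<Rightarrow> bool" where
  "vanishes_outside r \<kappa> \<longleftrightarrow> (\<forall>x. r < norm x \<longrightarrow> \<kappa> x = 0)"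

lemma vanishes_outside_grad:
  assumes "vanishes_outside r \<kappa>" shows "vanishes_outside r (\<lambda>x. grad \<kappa> x \<bullet> i)"
  unfolding vanishes_outside_def
proof (intro allI impI)
  fix x :: 'a assume "r < norm x"
  then have "grad \<kappa> x = 0"
    using assms by (intro grad_zero_on_open[of "- cball 0 r"]) (auto simp: vanishes_outside_def)
  then show "grad \<kappa> x \<bullet> i = 0" by simp
qed

lemma bounded_vanishing:
  assumes "continuous_on UNIV \<kappa>" "vanishes_outside r \<kappa>"
  obtains B where "0 \<le> B" "\<And>x. \<bar>\<kappa> x\<bar> \<le> B"
proof -
  have "bounded (\<kappa> ` cball 0 r)"
    using assms(1) by (intro compact_imp_bounded compact_continuous_image)
      (auto intro: continuous_on_subset)
  then obtain B where "0 < B" "\<And>x. x \<in> cball 0 r \<Longrightarrow> \<bar>\<kappa> x\<bar> \<le> B" by (auto simp: bounded_pos)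
  with assms(2) show ?thesis by (intro that[of B]) (auto simp: vanishes_outside_def, metis abs_zero less_imp_le not_le)
qed

lemma uniformly_continuous_vanishing:
  assumes "continuous_on UNIV \<kappa>" "vanishes_outside r \<kappa>"
  shows "uniformly_continuous_on UNIV \<kappa>"
  unfolding uniformly_continuous_on_def
proof (intro allI impI)
  fix e :: real assume "0 < e"
  have "uniformly_continuous_on (cball 0 (r + 1)) \<kappa>"
    using assms(1) by (intro compact_uniformly_continuous) (auto intro: continuous_on_subset)
  then obtain d where d: "0 < d" "\<And>x y. x \<in> cball 0 (r+1) \<Longrightarrow> y \<in> cball 0 (r+1) \<Longrightarrow> dist y x < d \<Longrightarrow> dist (\<kappa> y) (\<kappa> x) < e"
    using \<open>0 < e\<close> unfolding uniformly_continuous_on_def by metis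
  show "\<exists>d>0. \<forall>x\<in>UNIV. \<forall>y\<in>UNIV. dist y x < d \<longrightarrow> dist (\<kappa> y) (\<kappa> x) < e"
  proof (intro exI[of _ "min d 1"] conjI ballI impI)
    fix x y :: 'a assume xy: "dist y x < min d 1"
    show "dist (\<kappa> y) (\<kappa> x) < e"
    proof (cases "norm x \<le> r + 1 \<and> norm y \<le> r + 1")
      case True then show ?thesis using d(2)[of x y] xy by simp
    next
      case False
      have "\<bar>norm y - norm x\<bar> < 1" using xy norm_triangle_ineq3[of y x] by (simp add: dist_norm)
      with False have "r < norm x" "r < norm y" by auto
      then have "\<kappa> x = 0" "\<kappa> y = 0" using assms(2) by (auto simp: vanishes_outside_def)
      then show ?thesis using \<open>0 < e\<close> by simp
    qed
  qed (use d in auto)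
qed

definition locally_bounded :: "('a::euclidean_space \<Rightarrow> real) \<Rightarrow> bool" where
  "locally_bounded f \<longleftrightarrow> f \<in> borel_measurable borel \<and> (\<forall>R. \<exists>B. \<forall>x. norm x \<le> R \<longrightarrow> \<bar>f x\<bar> \<le> B)"

lemma locally_bounded_continuous:
  assumes "continuous_on UNIV f" shows "locally_bounded f"
  unfolding locally_bounded_def
proof (intro conjI allI)
  show "f \<in> borel_measurable borel" using assms by (rule borel_measurable_continuous_onI)
  fix R
  have "bounded (f ` cball 0 R)"
    using assms by (intro compact_imp_bounded compact_continuous_image) (auto intro: continuous_on_subset)
  then obtain B where "\<forall>x\<in>cball 0 R. \<bar>f x\<bar> \<le> B" by (auto simp: bounded_iff)
  then show "\<exists>B. \<forall>x. norm x \<le> R \<longrightarrow> \<bar>f x\<bar> \<le> B" by (intro exI[of _ B]) simp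
qed

section \<open>Convolution with a locally bounded function\<close>

definition convol :: "('a::euclidean_space \<Rightarrow> real) \<Rightarrow> ('a \<Rightarrow> real) \<Rightarrow> 'a \<Rightarrow> real" where
  "convol f \<kappa> x = (LINT y|lborel. f y * \<kappa> (x - y))"

text \<open>With \<open>x\<close> in the ball of radius \<open>R\<close> and a kernel supported in
  the ball of radius \<open>r\<close>, the integrand lives in the ball of radius
  \<open>R + r\<close>, where \<open>f\<close> is bounded. The constant serves all kernels at once,
  so it can be applied to difference and remainder kernels.\<close>

lemma convol_estimate:
  fixes f :: "'a::euclidean_space \<Rightarrow> real"
  assumes f: "locally_bounded f"
  shows "\<exists>C\<ge>0. \<forall>\<kappa> e x. \<kappa> \<in> borel_measurable borel \<longrightarrow> vanishes_outside r \<kappa> \<longrightarrow> (\<forall>z. \<bar>\<kappa> z\<bar> \<le> e) \<longrightarrow>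
    norm x \<le> R \<longrightarrow> integrable lborel (\<lambda>y. f y * \<kappa> (x - y)) \<and> \<bar>convol f \<kappa> x\<bar> \<le> C * e"
proof -
  have fm: "f \<in> borel_measurable borel" using f by (simp add: locally_bounded_def)
  obtain B where B: "\<And>y. norm y \<le> R + r \<Longrightarrow> \<bar>f y\<bar> \<le> B"
    using f unfolding locally_bounded_def by blast
  define V where "V = measure lborel (cball (0::'a) (R + r))"
  have fin: "emeasure lborel (cball (0::'a) (R + r)) < \<infinity>"
    by (rule emeasure_bounded_finite) simp
  have int: "integrable lborel (\<lambda>y. c * indicator (cball (0::'a) (R + r)) y)" for c :: real
    using fin by (intro integrable_mult_right integrable_real_indicator) auto
  show ?thesis
  proof (intro exI[of _ "\<bar>B\<bar> * V"] conjI allI impI)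
    show "0 \<le> \<bar>B\<bar> * V" by (simp add: V_def)
    fix \<kappa> :: "'a \<Rightarrow> real" and e :: real and x :: 'a
    assume k: "\<kappa> \<in> borel_measurable borel" "vanishes_outside r \<kappa>" "\<forall>z. \<bar>\<kappa> z\<bar> \<le> e" and x: "norm x \<le> R"
    have "0 \<le> e" using k(3) by (meson abs_ge_zero order_trans)
    have bound: "\<bar>f y * \<kappa> (x - y)\<bar> \<le> \<bar>B\<bar> * e * indicator (cball (0::'a) (R + r)) y" for y
    proof (cases "norm y \<le> R + r")
      case True
      have "\<bar>f y\<bar> * \<bar>\<kappa> (x - y)\<bar> \<le> \<bar>B\<bar> * e"
        using B[OF True] k(3) by (intro mult_mono) auto
      with True show ?thesis by (simp add: abs_mult)
    next
      case False
      then have "r < norm (x - y)" using x norm_triangle_ineq2[of y x] by (simp add: norm_minus_commute)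
      then show ?thesis using k(2) False by (simp add: vanishes_outside_def)
    qed
    have m: "(\<lambda>y. f y * \<kappa> (x - y)) \<in> borel_measurable lborel" using fm k(1) by measurable
    show I: "integrable lborel (\<lambda>y. f y * \<kappa> (x - y))"
    proof (rule Bochner_Integration.integrable_bound[OF int[of "\<bar>B\<bar> * e"] m], rule AE_I2)
      show "norm (f y * \<kappa> (x - y)) \<le> norm (\<bar>B\<bar> * e * indicator (cball (0::'a) (R + r)) y :: real)" for y
        using order_trans[OF bound[of y] abs_ge_self] by simp
    qed
    have "\<bar>convol f \<kappa> x\<bar> \<le> (LINT y|lborel. \<bar>f y * \<kappa> (x - y)\<bar>)"
      unfolding convol_def by (rule integral_abs_bound)
    also have "\<dots> \<le> (LINT y|lborel. \<bar>B\<bar> * e * indicator (cball (0::'a) (R + r)) y)"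
      using I int bound by (intro integral_mono integrable_abs) auto
    also have "\<dots> = \<bar>B\<bar> * V * e" by (simp add: V_def)
    finally show "\<bar>convol f \<kappa> x\<bar> \<le> \<bar>B\<bar> * V * e" .
  qed
qed

lemma integrable_convol:
  assumes "locally_bounded f" "continuous_on UNIV \<kappa>" "vanishes_outside r \<kappa>"
  shows "integrable lborel (\<lambda>y. f y * \<kappa> (x - y))"
proof -
  obtain B where "\<And>x. \<bar>\<kappa> x\<bar> \<le> B" using bounded_vanishing[OF assms(2,3)] by blast
  then show ?thesis
    using convol_estimate[OF assms(1), of r "norm x"] assms(2,3)
    by (auto intro: borel_measurable_continuous_onI)
qed

text \<open>The gradient of \<open>\<kappa>\<close> is uniformly continuous because it is continuous
  with bounded support, so one radius \<open>d\<close> works for every \<open>z\<close>. The mean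
  value inequality is applied to \<open>\<kappa>\<close> minus its linear part at
  \<open>z\<close>.\<close>

lemma uniform_first_order_Taylor:
  assumes \<kappa>: "C1 \<kappa>" "vanishes_outside r \<kappa>" and "0 < e"
  shows "\<exists>d>0. \<forall>z h. norm h < d \<longrightarrow> \<bar>\<kappa> (z + h) - \<kappa> z - h \<bullet> grad \<kappa> z\<bar> \<le> e * norm h"
proof -
  have "\<exists>d>0. \<forall>z w. dist w z < d \<longrightarrow> \<bar>grad \<kappa> w \<bullet> i - grad \<kappa> z \<bullet> i\<bar> < e / DIM('a)" if "i \<in> Basis" for i
  proof -
    have "uniformly_continuous_on UNIV (\<lambda>x. grad \<kappa> x \<bullet> i)"
      using \<kappa> by (intro uniformly_continuous_vanishing C1_continuous_grad_inner vanishes_outside_grad)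
    moreover have "0 < e / DIM('a)" using \<open>0 < e\<close> by simp
    ultimately show ?thesis
      unfolding uniformly_continuous_on_def dist_real_def by (meson UNIV_I)
  qed
  then obtain D where D: "\<And>i. i \<in> Basis \<Longrightarrow> D i > 0"
    "\<And>i z w. i \<in> Basis \<Longrightarrow> dist w z < D i \<Longrightarrow> \<bar>grad \<kappa> w \<bullet> i - grad \<kappa> z \<bullet> i\<bar> < e / DIM('a)" by metis
  define d where "d = Min (D ` Basis)"
  have d: "0 < d" "\<And>i. i \<in> Basis \<Longrightarrow> d \<le> D i" using D(1) by (auto simp: d_def)
  have close: "norm (grad \<kappa> w - grad \<kappa> z) \<le> e" if "dist w z < d" for w z
  proof -
    have "norm (grad \<kappa> w - grad \<kappa> z) \<le> (\<Sum>i\<in>Basis. \<bar>(grad \<kappa> w - grad \<kappa> z) \<bullet> i\<bar>)" by (rule norm_le_l1)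
    also have "\<dots> \<le> (\<Sum>i\<in>(Basis::'a set). e / DIM('a))"
    proof (rule sum_mono)
      fix i :: 'a assume i: "i \<in> Basis"
      show "\<bar>(grad \<kappa> w - grad \<kappa> z) \<bullet> i\<bar> \<le> e / DIM('a)"
        using D(2)[OF i, of w z] d(2)[OF i] that by (simp add: inner_diff_left)
    qed
    finally show ?thesis by simp
  qed
  show ?thesis
  proof (intro exI[of _ d] conjI allI impI d(1))
    fix z h :: 'a assume h: "norm h < d"
    let ?g = "\<lambda>w. \<kappa> w - w \<bullet> grad \<kappa> z"
    have "norm (?g (z + h) - ?g z) \<le> e * norm (z + h - z)"
    proof (rule differentiable_bound[of "ball z d" _ "\<lambda>w h. h \<bullet> (grad \<kappa> w - grad \<kappa> z)"])
      fix w assume w: "w \<in> ball z d"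
      show "(?g has_derivative (\<lambda>h. h \<bullet> (grad \<kappa> w - grad \<kappa> z))) (at w within ball z d)"
        unfolding inner_diff_right
        by (intro has_derivative_diff has_derivative_at_withinI[OF C1_has_derivative[OF \<kappa>(1)]]
            has_derivative_inner_left has_derivative_ident)
      show "onorm (\<lambda>h. h \<bullet> (grad \<kappa> w - grad \<kappa> z)) \<le> e"
      proof (rule onorm_le)
        fix h
        have "\<bar>h \<bullet> (grad \<kappa> w - grad \<kappa> z)\<bar> \<le> norm h * norm (grad \<kappa> w - grad \<kappa> z)"
          by (rule Cauchy_Schwarz_ineq2)
        also have "\<dots> \<le> norm h * e"
          using w by (intro mult_left_mono close) (auto simp: dist_commute)
        finally show "norm (h \<bullet> (grad \<kappa> w - grad \<kappa> z)) \<le> e * norm h" by (simp add: mult.commute)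
      qed
    qed (use h d in \<open>auto simp: dist_norm\<close>)
    then show "\<bar>\<kappa> (z + h) - \<kappa> z - h \<bullet> grad \<kappa> z\<bar> \<le> e * norm h"
      by (simp add: inner_add_left algebra_simps)
  qed
qed

text \<open>The increment of the convolution from \<open>x\<close> to \<open>y\<close> is the
  convolution at \<open>x\<close> with the increment of the kernel, which is uniformly
  small.\<close>

lemma convol_continuous:
  assumes f: "locally_bounded f" and \<kappa>: "continuous_on UNIV \<kappa>" "vanishes_outside r \<kappa>"
  shows "continuous_on UNIV (convol f \<kappa>)"
  unfolding continuous_on_iff
proof (intro ballI allI impI)
  fix x :: 'a and e :: real assume "0 < e"
  \<comment> \<open>The radius is \<open>r + 1\<close> because kernels are compared only under
    shifts of length below 1.\<close>
  obtain C where C: "0 \<le> C" "\<And>\<kappa>1 e. \<kappa>1 \<in> borel_measurable borel \<Longrightarrow> vanishes_outside (r+1) \<kappa>1 \<Longrightarrow>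
     (\<And>z. \<bar>\<kappa>1 z\<bar> \<le> e) \<Longrightarrow> \<bar>convol f \<kappa>1 x\<bar> \<le> C * e"
    using convol_estimate[OF f, of "r+1" "norm x"] by blast
  define e' where "e' = e / (C + 1)"
  have e': "0 < e'" "C * e' < e" using C(1) \<open>0 < e\<close> by (auto simp: e'_def field_simps)
  obtain d where d: "0 < d" "\<And>z w. dist w z < d \<Longrightarrow> \<bar>\<kappa> w - \<kappa> z\<bar> < e'"
    using uniformly_continuous_vanishing[OF \<kappa>] e'(1)
    unfolding uniformly_continuous_on_def dist_real_def by (meson UNIV_I)
  show "\<exists>d>0. \<forall>y\<in>UNIV. dist y x < d \<longrightarrow> dist (convol f \<kappa> y) (convol f \<kappa> x) < e"
  proof (intro exI[of _ "min d 1"] conjI ballI impI)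
    fix y assume y: "dist y x < min d 1"
    define h where "h = y - x"
    have h: "norm h < d" "norm h < 1" using y by (auto simp: h_def dist_norm)
    define \<kappa>1 where "\<kappa>1 z = \<kappa> (z + h) - \<kappa> z" for z
    have *: "convol f \<kappa>1 x = convol f \<kappa> y - convol f \<kappa> x"
      using integrable_convol[OF f \<kappa>, of y] integrable_convol[OF f \<kappa>, of x]
      unfolding convol_def by (subst Bochner_Integration.integral_diff[symmetric])
        (auto simp: \<kappa>1_def h_def algebra_simps)
    have "\<bar>convol f \<kappa>1 x\<bar> \<le> C * e'"
    proof (rule C(2))
      have "\<kappa> \<in> borel_measurable borel" using \<kappa>(1) by (rule borel_measurable_continuous_onI)
      then show "\<kappa>1 \<in> borel_measurable borel" unfolding \<kappa>1_def by measurable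
      show "vanishes_outside (r + 1) \<kappa>1"
        unfolding vanishes_outside_def
      proof (intro allI impI)
        fix z :: 'a assume z: "r + 1 < norm z"
        have "r < norm (z + h)" using z h(2) norm_triangle_ineq2[of z "-h"] by simp
        with z show "\<kappa>1 z = 0" using \<kappa>(2) by (auto simp: \<kappa>1_def vanishes_outside_def)
      qed
      show "\<bar>\<kappa>1 z\<bar> \<le> e'" for z using d(2)[of "z + h" z] h by (simp add: \<kappa>1_def dist_norm)
    qed
    with e'(2) * show "dist (convol f \<kappa> y) (convol f \<kappa> x) < e" by (simp add: dist_real_def)
  qed (use d in auto)
qed

text \<open>The derivative falls on the kernel, so \<open>f\<close> may be merely Borel and bounded
  on balls: the remainder of the expansion at \<open>x\<close> is the convolution with the Taylor
  remainder of \<open>\<kappa>\<close>, which is small relative to \<open>norm h\<close>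
  uniformly.\<close>

lemma convol_has_derivative:
  fixes f :: "'a::euclidean_space \<Rightarrow> real"
  assumes f: "locally_bounded f" and \<kappa>: "C1 \<kappa>" "vanishes_outside r \<kappa>"
  shows "(convol f \<kappa> has_derivative (\<lambda>h. h \<bullet> (LINT y|lborel. f y *\<^sub>R grad \<kappa> (x - y)))) (at x)"
    and "integrable lborel (\<lambda>y. f y *\<^sub>R grad \<kappa> (x - y))"
proof -
  have c: "continuous_on UNIV \<kappa>" using \<kappa>(1) by (rule C1_continuous)
  have int1: "integrable lborel (\<lambda>y. f y * \<kappa> (x - y))" for x by (rule integrable_convol[OF f c \<kappa>(2)])
  have "integrable lborel (\<lambda>y. f y * (grad \<kappa> (x - y) \<bullet> i))" for i
    using integrable_convol[OF f C1_continuous_grad_inner[OF \<kappa>(1)] vanishes_outside_grad[OF \<kappa>(2)]] .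
  then have "integrable lborel (\<lambda>y. \<Sum>i\<in>Basis. (f y * (grad \<kappa> (x - y) \<bullet> i)) *\<^sub>R i)"
    by (intro Bochner_Integration.integrable_sum integrable_scaleR_left) auto
  moreover have "(\<Sum>i\<in>Basis. (f y * (grad \<kappa> (x - y) \<bullet> i)) *\<^sub>R i) = f y *\<^sub>R grad \<kappa> (x - y)" for y
    by (simp add: scaleR_scaleR[symmetric] scaleR_sum_right[symmetric] euclidean_representation del: scaleR_scaleR)
  ultimately show int2: "integrable lborel (\<lambda>y. f y *\<^sub>R grad \<kappa> (x - y))" by simp
  show "(convol f \<kappa> has_derivative (\<lambda>h. h \<bullet> (LINT y|lborel. f y *\<^sub>R grad \<kappa> (x - y)))) (at x)"
    unfolding has_derivative_at_alt
  proof (intro conjI allI impI)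
    show "bounded_linear (\<lambda>h. h \<bullet> (LINT y|lborel. f y *\<^sub>R grad \<kappa> (x - y)))"
      by (rule bounded_linear_inner_left)
    fix e :: real assume "0 < e"
    obtain C where C: "0 \<le> C" "\<And>\<kappa>1 e. \<kappa>1 \<in> borel_measurable borel \<Longrightarrow> vanishes_outside (r+1) \<kappa>1 \<Longrightarrow>
       (\<And>z. \<bar>\<kappa>1 z\<bar> \<le> e) \<Longrightarrow> \<bar>convol f \<kappa>1 x\<bar> \<le> C * e"
      using convol_estimate[OF f, of "r+1" "norm x"] by blast
    define e' where "e' = e / (C + 1)"
    have e': "0 < e'" "C * e' \<le> e" using C(1) \<open>0 < e\<close> by (auto simp: e'_def field_simps)
    obtain d where d: "0 < d" "\<And>z h. norm h < d \<Longrightarrow> \<bar>\<kappa> (z + h) - \<kappa> z - h \<bullet> grad \<kappa> z\<bar> \<le> e' * norm h"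
      using uniform_first_order_Taylor[OF \<kappa> e'(1)] by blast
    show "\<exists>d>0. \<forall>y. norm (y - x) < d \<longrightarrow> norm (convol f \<kappa> y - convol f \<kappa> x -
        (y - x) \<bullet> (LINT y|lborel. f y *\<^sub>R grad \<kappa> (x - y))) \<le> e * norm (y - x)"
    proof (intro exI[of _ "min d 1"] conjI allI impI)
      fix y assume y: "norm (y - x) < min d 1"
      define h where "h = y - x"
      have h: "norm h < d" "norm h < 1" using y by (auto simp: h_def)
      define \<kappa>1 where "\<kappa>1 z = \<kappa> (z + h) - \<kappa> z - h \<bullet> grad \<kappa> z" for z
      have "convol f \<kappa>1 x = (LINT w|lborel. f w * \<kappa> (y - w) - f w * \<kappa> (x - w) - h \<bullet> (f w *\<^sub>R grad \<kappa> (x - w)))"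
        unfolding convol_def \<kappa>1_def h_def by (intro Bochner_Integration.integral_cong) (auto simp: algebra_simps)
      also have "\<dots> = convol f \<kappa> y - convol f \<kappa> x - h \<bullet> (LINT y|lborel. f y *\<^sub>R grad \<kappa> (x - y))"
        using int1 int2 integral_inner_right[of h lborel "\<lambda>w. f w *\<^sub>R grad \<kappa> (x - w)"]
        unfolding convol_def by (simp del: inner_scaleR_right integral_inner_right)
      finally have *: "convol f \<kappa>1 x = \<dots>" .
      have "\<bar>convol f \<kappa>1 x\<bar> \<le> C * (e' * norm h)"
      proof (rule C(2))
        have "\<kappa> \<in> borel_measurable borel" "grad \<kappa> \<in> borel_measurable borel"
          using \<kappa>(1) by (auto intro: borel_measurable_continuous_onI C1_continuous C1_continuous_grad)
        then show "\<kappa>1 \<in> borel_measurable borel" unfolding \<kappa>1_def by measurable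
        show "vanishes_outside (r + 1) \<kappa>1"
          unfolding vanishes_outside_def
        proof (intro allI impI)
          fix z :: 'a assume z: "r + 1 < norm z"
          have "r < norm (z + h)" using z h(2) norm_triangle_ineq2[of z "-h"] by simp
          moreover have "grad \<kappa> z \<bullet> h = 0"
            using z vanishes_outside_grad[OF \<kappa>(2), of h] by (auto simp: vanishes_outside_def)
          ultimately show "\<kappa>1 z = 0"
            using \<kappa>(2) z by (auto simp: \<kappa>1_def vanishes_outside_def inner_commute)
        qed
        show "\<bar>\<kappa>1 z\<bar> \<le> e' * norm h" for z using d(2)[OF h(1)] by (simp add: \<kappa>1_def)
      qed
      also have "\<dots> \<le> e * norm h" using e'(2) by (simp add: mult_right_mono mult.assoc[symmetric])
      finally show "norm (convol f \<kappa> y - convol f \<kappa> x - (y - x) \<bullet> (LINT y|lborel. f y *\<^sub>R grad \<kappa> (x - y))) \<le> e * norm (y - x)"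
        using * by (simp add: h_def)
    qed (use d in auto)
  qed
qed

lemma grad_convol:
  assumes "locally_bounded f" "C1 \<kappa>" "vanishes_outside r \<kappa>"
  shows "grad (convol f \<kappa>) x = (LINT y|lborel. f y *\<^sub>R grad \<kappa> (x - y))"
  using convol_has_derivative(1)[OF assms] by (rule grad_eqI)

lemma grad_convol_inner:
  assumes "locally_bounded f" "C1 \<kappa>" "vanishes_outside r \<kappa>"
  shows "grad (convol f \<kappa>) x \<bullet> i = convol f (\<lambda>z. grad \<kappa> z \<bullet> i) x"
  unfolding grad_convol[OF assms] convol_def
  using integral_inner_left[where c = i, OF convol_has_derivative(2)[OF assms, of x]] by simp

lemma convol_C_k:
  assumes "locally_bounded f"
  shows "C_k k \<kappa> \<Longrightarrow> vanishes_outside r \<kappa> \<Longrightarrow> C_k k (convol f \<kappa>)"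
proof (induction k arbitrary: \<kappa>)
  case 0
  then show ?case using convol_continuous[OF assms] by simp
next
  case (Suc k)
  have C1: "C1 \<kappa>" using Suc.prems(1) by (rule C_k_C1)
  have "C_k k (\<lambda>x. grad (convol f \<kappa>) x \<bullet> i)" if "i \<in> Basis" for i
  proof -
    have "C_k k (convol f (\<lambda>z. grad \<kappa> z \<bullet> i))"
      using Suc that by (intro Suc.IH vanishes_outside_grad) auto
    then show ?thesis by (simp add: grad_convol_inner[OF assms C1 Suc.prems(2)])
  qed
  then show ?case
    using convol_has_derivative(1)[OF assms C1 Suc.prems(2)] by (auto simp: differentiable_def)
qed

lemma lborel_integral_affine:
  fixes g :: "'a::euclidean_space \<Rightarrow> real"
  assumes "g \<in> borel_measurable borel" "c \<noteq> 0"
  shows "(LINT x|lborel. g x) = \<bar>c\<bar> ^ DIM('a) * (LINT x|lborel. g (t + c *\<^sub>R x))"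
proof -
  have "(LINT x|lborel. g x) = (LINT x|density (distr lborel borel (\<lambda>x. t + c *\<^sub>R x)) (\<lambda>_. ennreal (\<bar>c\<bar> ^ DIM('a))). g x)"
    using lborel_affine[OF assms(2), of t] by (simp add: ennreal_power)
  also have "\<dots> = (LINT x|distr lborel borel (\<lambda>x. t + c *\<^sub>R x). \<bar>c\<bar> ^ DIM('a) * g x)"
    using assms(1) by (subst integral_density) auto
  also have "\<dots> = (LINT x|lborel. \<bar>c\<bar> ^ DIM('a) * g (t + c *\<^sub>R x))"
    using assms(1) by (intro integral_distr) auto
  finally show ?thesis by simp
qed

text \<open>The substitution of \<open>x - y\<close> for \<open>y\<close> preserves Lebesgue
  measure. It lets the derivative of a mollification fall on the function instead of the
  mollifier.\<close>

lemma convol_commute: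
  assumes "f \<in> borel_measurable borel" "\<kappa> \<in> borel_measurable borel"
  shows "convol f \<kappa> x = convol \<kappa> f x"
  using lborel_integral_affine[of "\<lambda>y. f y * \<kappa> (x - y)" "-1" x] assms
  by (simp add: convol_def mult.commute)

lemma C_k_affine:
  "C_k k f \<Longrightarrow> C_k k (\<lambda>y. c * f (a *\<^sub>R y + b))"
proof (induction k arbitrary: f c)
  case 0
  then have "continuous_on UNIV f" by simp
  then show ?case
    by (auto intro!: continuous_intros continuous_on_compose2[of UNIV f])
next
  case (Suc k)
  have C1: "C1 f" using Suc.prems by (rule C_k_C1)
  have d: "((\<lambda>y. c * f (a *\<^sub>R y + b)) has_derivative (\<lambda>h. h \<bullet> ((c * a) *\<^sub>R grad f (a *\<^sub>R x + b)))) (at x)" for x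
  proof -
    have "((\<lambda>y. a *\<^sub>R y + b) has_derivative (\<lambda>h. a *\<^sub>R h)) (at x)"
      by (auto intro!: derivative_eq_intros)
    from has_derivative_mult_right[OF has_derivative_compose[OF this C1_has_derivative[OF C1]], of c]
    show ?thesis by (simp add: mult_ac)
  qed
  have "C_k k (\<lambda>x. grad (\<lambda>y. c * f (a *\<^sub>R y + b)) x \<bullet> i)" if i: "i \<in> Basis" for i
  proof -
    have "C_k k (\<lambda>y. (c * a) * (grad f (a *\<^sub>R y + b) \<bullet> i))"
      using Suc.prems i by (intro Suc.IH) auto
    then show ?thesis by (simp add: grad_eqI[OF d])
  qed
  then show ?case using d by (auto simp: differentiable_def)
qed

lemma compact_neighbourhood:
  fixes K :: "'a::euclidean_space set"
  assumes "compact K" "open \<Omega>" "K \<subseteq> \<Omega>"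
  obtains e K' where "0 < e" "compact K'" "K' \<subseteq> \<Omega>" "\<And>x. x \<in> K \<Longrightarrow> cball x e \<subseteq> K'"
proof -
  obtain e where e: "0 < e" "(\<Union>x\<in>K. ball x e) \<subseteq> \<Omega>"
    using compact_subset_open_imp_ball_epsilon_subset[OF assms] .
  define K' where "K' = {x + y |x y. x \<in> K \<and> y \<in> cball 0 (e/2)}"
  show ?thesis
  proof
    show "0 < e / 2" using e by simp
    show "compact K'" unfolding K'_def using assms(1) by (intro compact_sums) auto
    show "K' \<subseteq> \<Omega>"
    proof
      fix z assume "z \<in> K'"
      then obtain x y where "z = x + y" "x \<in> K" "norm y \<le> e/2" by (auto simp: K'_def)
      with e have "z \<in> ball x e" "x \<in> K" by (auto simp: dist_norm)
      with e(2) show "z \<in> \<Omega>" by blast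
    qed
    show "cball x (e/2) \<subseteq> K'" if "x \<in> K" for x
    proof
      fix z assume "z \<in> cball x (e/2)"
      with that show "z \<in> K'"
        unfolding K'_def
        by (intro CollectI exI[of _ x] exI[of _ "z - x"]) (auto simp: dist_norm norm_minus_commute)
    qed
  qed
qed

section \<open>Mollifiers and compactly supported test functions\<close>

definition mollifier :: "('a::euclidean_space \<Rightarrow> real) \<Rightarrow> real \<Rightarrow> 'a \<Rightarrow> real" where
  "mollifier \<rho> \<delta> z = \<rho> (z /\<^sub>R \<delta>) / \<delta> ^ DIM('a)"

definition zero_ext :: "'a set \<Rightarrow> ('a \<Rightarrow> real) \<Rightarrow> 'a \<Rightarrow> real" where
  "zero_ext \<Omega> \<phi> x = indicator \<Omega> x * \<phi> x"

lemma zero_ext_UNIV [simp]: "zero_ext UNIV \<phi> = \<phi>"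
  by (simp add: zero_ext_def fun_eq_iff)

lemma mollify_eq_convol: "mollify \<rho> \<Omega> \<delta> \<phi> = convol (zero_ext \<Omega> \<phi>) (mollifier \<rho> \<delta>)"
  by (simp add: fun_eq_iff mollify_def convol_def mollifier_def zero_ext_def set_lebesgue_integral_def mult.assoc)

lemma eventually_at_right_less: "0 < e \<Longrightarrow> \<forall>\<^sub>F d in at_right (0::real). 0 < d \<and> d < e"
  unfolding eventually_at_right_field by (intro exI[of _ e]) auto

lemma Cc_continuous: "\<psi> \<in> Cc \<Omega> \<Longrightarrow> continuous_on UNIV \<psi>"
  by (simp add: Cc_def)

lemma CcI:
  assumes "continuous_on UNIV \<psi>" "compact K" "K \<subseteq> \<Omega>" "\<And>x. x \<notin> K \<Longrightarrow> \<psi> x = 0"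
  shows "\<psi> \<in> Cc \<Omega>"
proof -
  have "closure {x. \<psi> x \<noteq> 0} \<subseteq> K"
    using assms by (intro closure_minimal compact_imp_closed) auto
  then show ?thesis
    using assms compact_Int_closed[OF assms(2), of "closure {x. \<psi> x \<noteq> 0}"]
    by (auto simp: Cc_def Int_absorb1)
qed

lemma CcE:
  assumes "\<psi> \<in> Cc \<Omega>"
  obtains K where "compact K" "K \<subseteq> \<Omega>" "\<And>x. x \<notin> K \<Longrightarrow> \<psi> x = 0"
  using assms closure_subset[of "{x. \<psi> x \<noteq> 0}"] by (intro that[of "closure {x. \<psi> x \<noteq> 0}"]) (auto simp: Cc_def)

lemma Cc_bounded:
  assumes "\<psi> \<in> Cc \<Omega>"
  obtains B where "0 \<le> B" "\<And>x. \<bar>\<psi> x\<bar> \<le> B"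
proof -
  obtain K where K: "compact K" "\<And>x. x \<notin> K \<Longrightarrow> \<psi> x = 0" using CcE[OF assms] by metis
  have "bounded (\<psi> ` K)"
    using K(1) Cc_continuous[OF assms]
    by (intro compact_imp_bounded compact_continuous_image) (auto intro: continuous_on_subset)
  then obtain B where "0 < B" "\<And>x. x \<in> K \<Longrightarrow> \<bar>\<psi> x\<bar> \<le> B" by (auto simp: bounded_pos)
  with K(2) have "\<bar>\<psi> x\<bar> \<le> B" for x by (cases "x \<in> K") auto
  with \<open>0 < B\<close> show ?thesis by (intro that[of B]) auto
qed

lemma Cc_bounded_borel:
  assumes "\<psi> \<in> Cc \<Omega>" shows "\<psi> \<in> bounded_borel S"
proof -
  obtain B where "\<And>x. \<bar>\<psi> x\<bar> \<le> B" using Cc_bounded[OF assms] by blast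
  moreover have "\<psi> \<in> borel_measurable (restrict_space borel S)"
    using Cc_continuous[OF assms]
    by (intro borel_measurable_continuous_on_restrict) (auto intro: continuous_on_subset)
  ultimately show ?thesis by (intro bounded_borelI[of _ _ B])
qed

lemma Cc_add: "f \<in> Cc \<Omega> \<Longrightarrow> g \<in> Cc \<Omega> \<Longrightarrow> (\<lambda>x. f x + g x) \<in> Cc \<Omega>"
proof -
  assume f: "f \<in> Cc \<Omega>" and g: "g \<in> Cc \<Omega>"
  obtain K where K: "compact K" "K \<subseteq> \<Omega>" "\<And>x. x \<notin> K \<Longrightarrow> f x = 0" using CcE[OF f] by metis
  obtain L where L: "compact L" "L \<subseteq> \<Omega>" "\<And>x. x \<notin> L \<Longrightarrow> g x = 0" using CcE[OF g] by metis
  show ?thesis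
    using K L by (intro CcI[of _ "K \<union> L"] continuous_intros Cc_continuous[OF f] Cc_continuous[OF g]) auto
qed

lemma Cc_mult: "f \<in> Cc \<Omega> \<Longrightarrow> continuous_on UNIV g \<Longrightarrow> (\<lambda>x. g x * f x) \<in> Cc \<Omega>"
proof -
  assume f: "f \<in> Cc \<Omega>" and g: "continuous_on UNIV g"
  obtain K where K: "compact K" "K \<subseteq> \<Omega>" "\<And>x. x \<notin> K \<Longrightarrow> f x = 0" using CcE[OF f] by metis
  show ?thesis
    using K by (intro CcI[of _ K] continuous_intros Cc_continuous[OF f] g) auto
qed

lemma Cc_cmult: "f \<in> Cc \<Omega> \<Longrightarrow> (\<lambda>x. c * f x) \<in> Cc \<Omega>"
  by (rule Cc_mult) auto

lemma Cc_diff: "f \<in> Cc \<Omega> \<Longrightarrow> g \<in> Cc \<Omega> \<Longrightarrow> (\<lambda>x. f x - g x) \<in> Cc \<Omega>"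
  using Cc_add[OF _ Cc_cmult[of g \<Omega> "-1"], of f] by simp

lemma Cc_zero: "(\<lambda>x. 0) \<in> Cc \<Omega>"
  by (rule CcI[of _ "{}"]) auto

lemma Cc_vanishes:
  assumes "\<psi> \<in> Cc \<Omega>"
  obtains r where "vanishes_outside r \<psi>"
proof -
  obtain K where K: "compact K" "\<And>x. x \<notin> K \<Longrightarrow> \<psi> x = 0" using CcE[OF assms] by metis
  obtain r where "\<And>x. x \<in> K \<Longrightarrow> norm x \<le> r" using compact_imp_bounded[OF K(1)] by (auto simp: bounded_iff)
  then have "vanishes_outside r \<psi>" unfolding vanishes_outside_def using K(2) by (meson not_le)
  then show ?thesis by (rule that)
qed

lemma Cc_mono: "\<Omega> \<subseteq> \<Omega>' \<Longrightarrow> Cc \<Omega> \<subseteq> Cc \<Omega>'"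
  by (auto simp: Cc_def)

text \<open>Moving a small distance in the direction of the gradient realises its norm as a
  difference quotient, up to the first-order error \<open>e'\<close>.\<close>

lemma grad_bound_of_local_Lipschitz:
  assumes f: "f differentiable (at x)" and e: "0 < e"
    and L: "\<And>y. dist y x < e \<Longrightarrow> \<bar>f y - f x\<bar> \<le> L * norm (y - x)"
  shows "norm (grad f x) \<le> L"
proof (rule field_le_epsilon)
  fix e' :: real assume "0 < e'"
  let ?D = "grad f x"
  obtain d where d: "0 < d" "\<And>y. norm (y - x) < d \<Longrightarrow> \<bar>f y - f x - (y - x) \<bullet> ?D\<bar> \<le> e' * norm (y - x)"
    using differentiable_grad[OF f] \<open>0 < e'\<close> unfolding has_derivative_at_alt by fastforce
  \<comment> \<open>Covers a vanishing gradient, where no direction is singled out: any nearby point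
    shows that \<open>L\<close> is nonnegative.\<close>
  have e'L: "0 \<le> L"
  proof -
    obtain u :: 'a where u: "norm u = e / 2" using vector_choose_size[of "e/2"] e by auto
    have "dist (x + u) x < e" using u e by (simp add: dist_norm)
    then have "0 \<le> L * norm (x + u - x)" by (rule order_trans[OF abs_ge_zero L])
    then show ?thesis using u e by (simp add: zero_le_mult_iff)
  qed
  show "norm ?D \<le> L + e'"
  proof (cases "?D = 0")
    case False
    \<comment> \<open>The increment has length \<open>min d e / 2\<close>, so both the
      differentiability estimate and the Lipschitz bound apply to it.\<close>
    define t where "t = min d e / (2 * norm ?D)"
    have t: "0 < t" "t * norm ?D = min d e / 2" using False d(1) e by (auto simp: t_def)
    define y where "y = x + t *\<^sub>R ?D"
    have y: "norm (y - x) = t * norm ?D" using t by (simp add: y_def)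
    have "norm (y - x) < d" "dist y x < e" using y t d(1) e by (auto simp: dist_norm)
    from d(2)[OF this(1)] L[OF this(2)]
    have "\<bar>(y - x) \<bullet> ?D\<bar> \<le> L * norm (y - x) + e' * norm (y - x)" by linarith
    moreover have "(y - x) \<bullet> ?D = t * norm ?D * norm ?D"
      by (simp add: y_def power2_norm_eq_inner[symmetric] power2_eq_square)
    ultimately have "(t * norm ?D) * norm ?D \<le> (t * norm ?D) * (L + e')"
      using y by (simp add: algebra_simps)
    moreover have "0 < t * norm ?D" using t d(1) e by simp
    ultimately show ?thesis by (rule mult_left_le_imp_le)
  qed (use e'L \<open>0 < e'\<close> in auto)
qed

locale mollification =
  fixes \<rho> :: "'a::euclidean_space \<Rightarrow> real"
  assumes \<rho>: "standard_mollifier \<rho>"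
begin

lemma standard: "C_k k \<rho>" "0 \<le> \<rho> x" "closure {x. \<rho> x \<noteq> 0} \<subseteq> cball 0 1" "(LINT x|lborel. \<rho> x) = 1"
  using \<rho> unfolding standard_mollifier_def by blast+

lemma C_k_mollifier: "C_k k (mollifier \<rho> \<delta>)"
  using C_k_affine[of k \<rho> "1 / \<delta> ^ DIM('a)" "inverse \<delta>" 0] standard(1)
  by (simp add: mollifier_def[abs_def])

lemma C1_mollifier: "C1 (mollifier \<rho> \<delta>)"
  using C_k_mollifier[of "Suc 0"] by (rule C_k_C1)

lemma continuous_mollifier: "continuous_on UNIV (mollifier \<rho> \<delta>)"
  by (rule C1_continuous[OF C1_mollifier])

lemma mollifier_measurable [measurable]: "mollifier \<rho> \<delta> \<in> borel_measurable borel"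
  by (rule borel_measurable_continuous_onI[OF continuous_mollifier])

lemma vanishes_outside_mollifier:
  assumes "0 < \<delta>" shows "vanishes_outside \<delta> (mollifier \<rho> \<delta>)"
  unfolding vanishes_outside_def
proof (intro allI impI)
  fix x :: 'a assume "\<delta> < norm x"
  then have "x /\<^sub>R \<delta> \<notin> cball 0 1" using assms by (simp add: field_simps)
  then have "x /\<^sub>R \<delta> \<notin> closure {x. \<rho> x \<noteq> 0}" using standard(3) by blast
  then have "\<rho> (x /\<^sub>R \<delta>) = 0" using closure_subset[of "{x. \<rho> x \<noteq> 0}"] by auto
  then show "mollifier \<rho> \<delta> x = 0" by (simp add: mollifier_def)
qed

lemma mollifier_nonneg: "0 < \<delta> \<Longrightarrow> 0 \<le> mollifier \<rho> \<delta> x"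
  using standard(2) by (simp add: mollifier_def)

lemma integral_mollifier:
  assumes "0 < \<delta>" shows "(LINT y|lborel. mollifier \<rho> \<delta> (x - y)) = 1"
proof -
  have c: "continuous_on UNIV \<rho>" using standard(1) by (rule C_k_continuous)
  then have m: "\<rho> \<in> borel_measurable borel" by (rule borel_measurable_continuous_onI)
  have "(LINT y|lborel. mollifier \<rho> \<delta> (x - y)) = (LINT y|lborel. mollifier \<rho> \<delta> y)"
    using lborel_integral_affine[of "mollifier \<rho> \<delta>" "-1" x] by simp
  also have "\<dots> = \<delta> ^ DIM('a) * (LINT y|lborel. \<rho> y / \<delta> ^ DIM('a))"
    using lborel_integral_affine[of "mollifier \<rho> \<delta>" \<delta> 0] assms by (simp add: mollifier_def)
  also have "\<dots> = (LINT y|lborel. \<rho> y)" using assms by simp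
  finally show ?thesis using standard(4) by simp
qed

lemma integrable_mollifier: "0 < \<delta> \<Longrightarrow> integrable lborel (\<lambda>y. mollifier \<rho> \<delta> (x - y))"
  using integrable_convol[OF locally_bounded_continuous[of "\<lambda>_. 1"] continuous_mollifier vanishes_outside_mollifier]
  by simp

lemma integrable_mollify:
  "locally_bounded f \<Longrightarrow> 0 < \<delta> \<Longrightarrow> integrable lborel (\<lambda>y. f y * mollifier \<rho> \<delta> (x - y))"
  by (rule integrable_convol[OF _ continuous_mollifier vanishes_outside_mollifier])

lemma C_k_mollify: "locally_bounded (zero_ext \<Omega> \<phi>) \<Longrightarrow> 0 < \<delta> \<Longrightarrow> C_k k (mollify \<rho> \<Omega> \<delta> \<phi>)"
  unfolding mollify_eq_convol by (rule convol_C_k[OF _ C_k_mollifier vanishes_outside_mollifier])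

lemma C1_mollify: "locally_bounded (zero_ext \<Omega> \<phi>) \<Longrightarrow> 0 < \<delta> \<Longrightarrow> C1 (mollify \<rho> \<Omega> \<delta> \<phi>)"
  by (rule C_k_C1[of 0]) (rule C_k_mollify)

text \<open>The mollification is an average of \<open>f\<close> over the ball of radius
  \<open>\<delta>\<close>, so it is as close to a constant as \<open>f\<close> is on that ball. With
  \<open>c\<close> the value at \<open>x\<close> this gives uniform approximation, with
  \<open>c = 0\<close> the sup bound.\<close>

lemma abs_convol_mollifier_le:
  assumes "locally_bounded f" "0 < \<delta>" and "\<And>y. dist x y \<le> \<delta> \<Longrightarrow> \<bar>f y - c\<bar> \<le> e"
  shows "\<bar>convol f (mollifier \<rho> \<delta>) x - c\<bar> \<le> e"
proof -
  let ?\<kappa> = "mollifier \<rho> \<delta>"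
  have int: "integrable lborel (\<lambda>y. f y * ?\<kappa> (x - y))" "integrable lborel (\<lambda>y. c * ?\<kappa> (x - y))"
    using integrable_mollify[OF assms(1,2)] integrable_mollifier[OF assms(2)] by auto
  have "convol f ?\<kappa> x - c = (LINT y|lborel. f y * ?\<kappa> (x - y)) - (LINT y|lborel. c * ?\<kappa> (x - y))"
    using integral_mollifier[OF assms(2), of x] by (simp add: convol_def)
  also have "\<dots> = (LINT y|lborel. f y * ?\<kappa> (x - y) - c * ?\<kappa> (x - y))"
    using int by simp
  finally have "\<bar>convol f ?\<kappa> x - c\<bar> \<le> (LINT y|lborel. \<bar>f y * ?\<kappa> (x - y) - c * ?\<kappa> (x - y)\<bar>)"
    using integral_abs_bound by metis
  also have "\<dots> \<le> (LINT y|lborel. e * ?\<kappa> (x - y))"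
  proof (rule integral_mono)
    show "integrable lborel (\<lambda>y. \<bar>f y * ?\<kappa> (x - y) - c * ?\<kappa> (x - y)\<bar>)"
      using int by (intro integrable_abs Bochner_Integration.integrable_diff)
    show "integrable lborel (\<lambda>y. e * ?\<kappa> (x - y))"
      using integrable_mollifier[OF assms(2)] by auto
    fix y
    have "\<bar>f y * ?\<kappa> (x - y) - c * ?\<kappa> (x - y)\<bar> = \<bar>f y - c\<bar> * ?\<kappa> (x - y)"
      using mollifier_nonneg[OF assms(2)] by (simp add: left_diff_distrib[symmetric] abs_mult)
    also have "\<dots> \<le> e * ?\<kappa> (x - y)"
    proof (cases "dist x y \<le> \<delta>")
      case True
      then show ?thesis using assms(3) mollifier_nonneg[OF assms(2)] by (intro mult_right_mono) auto
    next
      case False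
      then have "?\<kappa> (x - y) = 0"
        using vanishes_outside_mollifier[OF assms(2)] by (auto simp: vanishes_outside_def dist_norm)
      then show ?thesis by simp
    qed
    finally show "\<bar>f y * ?\<kappa> (x - y) - c * ?\<kappa> (x - y)\<bar> \<le> e * ?\<kappa> (x - y)" .
  qed
  also have "\<dots> = e" using integral_mollifier[OF assms(2)] by simp
  finally show ?thesis .
qed

text \<open>Once \<open>\<delta>\<close> is below the margin that \<open>K\<close> keeps inside
  \<open>\<Omega>\<close>, the averages see only genuine values of \<open>\<phi>\<close>, which is
  uniformly continuous on the compact neighbourhood \<open>K'\<close>.\<close>

lemma mollify_uniform_limit:
  assumes \<Omega>: "open \<Omega>" and \<phi>: "continuous_on \<Omega> \<phi>" "locally_bounded (zero_ext \<Omega> \<phi>)"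
    and K: "compact K" "K \<subseteq> \<Omega>"
  shows "uniform_limit K (\<lambda>\<delta>. mollify \<rho> \<Omega> \<delta> \<phi>) \<phi> (at_right 0)"
proof (rule uniform_limitI)
  fix e :: real assume "0 < e"
  obtain r K' where r: "0 < r" "compact K'" "K' \<subseteq> \<Omega>" "\<And>x. x \<in> K \<Longrightarrow> cball x r \<subseteq> K'"
    using compact_neighbourhood[OF K(1) \<Omega> K(2)] by metis
  have "uniformly_continuous_on K' \<phi>"
    using r \<phi> by (intro compact_uniformly_continuous) (auto intro: continuous_on_subset)
  then obtain d where d: "0 < d" "\<And>x y. x \<in> K' \<Longrightarrow> y \<in> K' \<Longrightarrow> dist y x < d \<Longrightarrow> dist (\<phi> y) (\<phi> x) < e/2"
    using \<open>0 < e\<close> unfolding uniformly_continuous_on_def by (metis half_gt_zero)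
  have "0 < min r d" using r d by simp
  from eventually_at_right_less[OF this]
  show "\<forall>\<^sub>F \<delta> in at_right 0. \<forall>x\<in>K. dist (mollify \<rho> \<Omega> \<delta> \<phi> x) (\<phi> x) < e"
  proof eventually_elim
    case (elim \<delta>)
    show ?case
    proof
      fix x assume x: "x \<in> K"
      have xK': "x \<in> K'" using r(1) r(4)[OF x] by auto
      have "\<bar>convol (zero_ext \<Omega> \<phi>) (mollifier \<rho> \<delta>) x - \<phi> x\<bar> \<le> e/2"
      proof (rule abs_convol_mollifier_le[OF \<phi>(2)])
        fix y assume y: "dist x y \<le> \<delta>"
        have "y \<in> K'" using r(4)[OF x] y elim by auto
        moreover from this have "y \<in> \<Omega>" using r(3) by auto
        ultimately show "\<bar>zero_ext \<Omega> \<phi> y - \<phi> x\<bar> \<le> e/2"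
          using d(2)[OF xK', of y] y elim by (simp add: zero_ext_def dist_real_def dist_commute less_imp_le)
      qed (use elim in auto)
      then show "dist (mollify \<rho> \<Omega> \<delta> \<phi> x) (\<phi> x) < e"
        using \<open>0 < e\<close> by (simp add: mollify_eq_convol dist_real_def)
    qed
  qed
qed

text \<open>One compact set contains the supports for all small \<open>\<delta>\<close>; this common
  support lets gradient bounds on compact sets act on the approximations.\<close>

lemma mollify_Cc:
  assumes \<Omega>: "open \<Omega>" and \<psi>: "\<psi> \<in> Cc \<Omega>"
  obtains K where "compact K" "K \<subseteq> \<Omega>" "\<And>x. x \<notin> K \<Longrightarrow> \<psi> x = 0"
    "\<forall>\<^sub>F \<delta> in at_right 0. mollify \<rho> UNIV \<delta> \<psi> \<in> Cc_inf \<Omega> \<and> (\<forall>x. x \<notin> K \<longrightarrow> mollify \<rho> UNIV \<delta> \<psi> x = 0)"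
proof -
  obtain S where S: "compact S" "S \<subseteq> \<Omega>" "\<And>x. x \<notin> S \<Longrightarrow> \<psi> x = 0" using CcE[OF \<psi>] by metis
  obtain r K where r: "0 < r" "compact K" "K \<subseteq> \<Omega>" "\<And>x. x \<in> S \<Longrightarrow> cball x r \<subseteq> K"
    using compact_neighbourhood[OF S(1) \<Omega> S(2)] by metis
  have lb: "locally_bounded (zero_ext UNIV \<psi>)" using Cc_continuous[OF \<psi>] by (simp add: locally_bounded_continuous)
  have z: "\<psi> x = 0" if "x \<notin> K" for x using that S(3) r(1) r(4)[of x] by force
  from eventually_at_right_less[OF r(1)]
  have ev: "\<forall>\<^sub>F \<delta> in at_right 0. mollify \<rho> UNIV \<delta> \<psi> \<in> Cc_inf \<Omega> \<and> (\<forall>x. x \<notin> K \<longrightarrow> mollify \<rho> UNIV \<delta> \<psi> x = 0)"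
  proof eventually_elim
    case (elim \<delta>)
    have 0: "mollify \<rho> UNIV \<delta> \<psi> x = 0" if x: "x \<notin> K" for x
    proof -
      have "\<psi> y * mollifier \<rho> \<delta> (x - y) = 0" for y
      proof (cases "y \<in> S")
        case True
        then have "\<not> dist y x \<le> r" using r(4)[OF True] x by (auto simp: subset_eq)
        then have "\<delta> < norm (x - y)" using elim by (simp add: dist_norm norm_minus_commute)
        then show ?thesis
          using vanishes_outside_mollifier[of \<delta>] elim by (auto simp: vanishes_outside_def)
      qed (use S in auto)
      then have "(\<lambda>y. \<psi> y * mollifier \<rho> \<delta> (x - y)) = (\<lambda>y. 0)" by (rule ext)
      then show ?thesis unfolding mollify_eq_convol convol_def zero_ext_UNIV by simp
    qed
    have "mollify \<rho> UNIV \<delta> \<psi> \<in> Cc \<Omega>"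
      using 0 r elim by (intro CcI[of _ K] C1_continuous C1_mollify lb) auto
    with 0 show ?case using C_k_mollify[OF lb] elim by (auto simp: Cc_inf_def)
  qed
  show ?thesis by (rule that[OF r(2,3) z ev])
qed

lemma mollify_Cc_uniform_limit:
  assumes \<psi>: "\<psi> \<in> Cc UNIV"
  shows "uniform_limit UNIV (\<lambda>\<delta>. mollify \<rho> UNIV \<delta> \<psi>) \<psi> (at_right 0)"
proof (rule uniform_limitI)
  fix e :: real assume "0 < e"
  obtain K where K: "compact K" "K \<subseteq> UNIV" "\<And>x. x \<notin> K \<Longrightarrow> \<psi> x = 0"
    "\<forall>\<^sub>F \<delta> in at_right 0. mollify \<rho> UNIV \<delta> \<psi> \<in> Cc_inf UNIV \<and> (\<forall>x. x \<notin> K \<longrightarrow> mollify \<rho> UNIV \<delta> \<psi> x = 0)"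
    by (rule mollify_Cc[OF open_UNIV \<psi>]) blast
  have "uniform_limit K (\<lambda>\<delta>. mollify \<rho> UNIV \<delta> \<psi>) \<psi> (at_right 0)"
    using Cc_continuous[OF \<psi>] K(1) by (intro mollify_uniform_limit) (auto simp: locally_bounded_continuous)
  then have "\<forall>\<^sub>F \<delta> in at_right 0. \<forall>x\<in>K. dist (mollify \<rho> UNIV \<delta> \<psi> x) (\<psi> x) < e"
    using \<open>0 < e\<close> by (rule uniform_limitD)
  with K(4) show "\<forall>\<^sub>F \<delta> in at_right 0. \<forall>x\<in>UNIV. dist (mollify \<rho> UNIV \<delta> \<psi> x) (\<psi> x) < e"
  proof eventually_elim
    case (elim \<delta>)
    show ?case
    proof
      fix x show "dist (mollify \<rho> UNIV \<delta> \<psi> x) (\<psi> x) < e"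
        using elim K(3)[of x] \<open>0 < e\<close> by (cases "x \<in> K") auto
    qed
  qed
qed

text \<open>Since the convolution commutes, the gradient may be taken on \<open>\<psi>\<close>. The
  partial derivatives of the mollifications are then mollifications themselves and converge
  uniformly.\<close>

lemma grad_mollify_inner_C1:
  assumes \<psi>: "C1 \<psi>" "\<psi> \<in> Cc UNIV" and "0 < \<delta>"
  shows "grad (mollify \<rho> UNIV \<delta> \<psi>) x \<bullet> i = mollify \<rho> UNIV \<delta> (\<lambda>x. grad \<psi> x \<bullet> i) x"
proof -
  obtain r where r: "vanishes_outside r \<psi>" using Cc_vanishes[OF \<psi>(2)] .
  have m: "\<psi> \<in> borel_measurable borel" "(\<lambda>x. grad \<psi> x \<bullet> i) \<in> borel_measurable borel"
    using \<psi>(1) by (auto intro!: borel_measurable_continuous_onI C1_continuous C1_continuous_grad_inner)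
  have "mollify \<rho> UNIV \<delta> \<psi> = convol (mollifier \<rho> \<delta>) \<psi>"
    using convol_commute[OF m(1) mollifier_measurable] by (simp add: mollify_eq_convol fun_eq_iff)
  then have "grad (mollify \<rho> UNIV \<delta> \<psi>) x \<bullet> i = convol (mollifier \<rho> \<delta>) (\<lambda>z. grad \<psi> z \<bullet> i) x"
    using grad_convol_inner[OF locally_bounded_continuous[OF continuous_mollifier] \<psi>(1) r] by simp
  also have "\<dots> = mollify \<rho> UNIV \<delta> (\<lambda>x. grad \<psi> x \<bullet> i) x"
    using convol_commute[OF m(2) mollifier_measurable] by (simp add: mollify_eq_convol)
  finally show ?thesis .
qed

lemma Cc_grad_inner:
  assumes "C1 \<psi>" "\<psi> \<in> Cc \<Omega>"
  shows "(\<lambda>x. grad \<psi> x \<bullet> i) \<in> Cc \<Omega>"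
proof -
  obtain K where K: "compact K" "K \<subseteq> \<Omega>" "\<And>x. x \<notin> K \<Longrightarrow> \<psi> x = 0" using CcE[OF assms(2)] by metis
  have "grad \<psi> x \<bullet> i = 0" if "x \<notin> K" for x
    using grad_zero_on_open[of "- K" x \<psi>] that K(3) compact_imp_closed[OF K(1)]
    by (simp add: open_Compl)
  then show ?thesis using K by (intro CcI[of _ K] C1_continuous_grad_inner[OF assms(1)]) auto
qed

end

subsection \<open>Functional monotone class arguments\<close>

lemma indicator_open_limit_Cc:
  fixes V :: "'a::euclidean_space set"
  assumes "open V"
  obtains f where "\<And>k::nat. f k \<in> Cc V" "\<And>k x. 0 \<le> f k x \<and> f k x \<le> 1"
    "\<And>x. (\<lambda>k. f k x) \<longlonglongrightarrow> indicator V x"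
proof
  define W where "W k = - (V \<inter> ball 0 (real k))" for k
  \<comment> \<open>Subtracting 1 before clamping puts the support into the points at distance at
    least \<open>1 / k\<close> from \<open>W k\<close>, a closed subset of \<open>V\<close> that the
    ball makes bounded; the value 1 is reached at distance \<open>2 / k\<close>.\<close>
  define f where "f k x = max 0 (min 1 (real k * infdist x (W k) - 1))" for k x
  have W: "closed (W k)" "W k \<noteq> {}" for k
  proof -
    show "closed (W k)" using assms by (auto simp: W_def)
    obtain u :: 'a where "norm u = real k" using vector_choose_size[of "real k"] by auto
    then have "u \<in> W k" by (simp add: W_def)
    then show "W k \<noteq> {}" by auto
  qed
  show "0 \<le> f k x \<and> f k x \<le> 1" for k x by (simp add: f_def)
  have V0: "f k x = 0" if "x \<in> W k" for k x using that by (simp add: f_def)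
  show "f k \<in> Cc V" for k
  proof (rule CcI)
    show "continuous_on UNIV (f k)" unfolding f_def by (intro continuous_intros)
    let ?K = "{x. 1 \<le> real k * infdist x (W k)}"
    have cl: "closed ?K" by (intro closed_Collect_le continuous_intros)
    have sub: "?K \<subseteq> V \<inter> ball 0 (real k)"
    proof
      fix x assume "x \<in> ?K"
      then have "x \<notin> W k" by auto
      then show "x \<in> V \<inter> ball 0 (real k)" by (simp add: W_def)
    qed
    then have "bounded ?K" using bounded_ball bounded_subset by blast
    with cl show "compact ?K" by (simp add: compact_eq_bounded_closed)
    show "?K \<subseteq> V" using sub by auto
    show "f k x = 0" if "x \<notin> ?K" for x using that by (simp add: f_def)
  qed
  show "(\<lambda>k. f k x) \<longlonglongrightarrow> indicator V x" for x
  proof (cases "x \<in> V")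
    case False
    then have "f k x = 0" for k by (intro V0) (simp add: W_def)
    with False show ?thesis by simp
  next
    case True
    then obtain r where r: "0 < r" "ball x r \<subseteq> V" using assms open_contains_ball by blast
    have "\<forall>\<^sub>F k in sequentially. f k x = 1"
      using eventually_ge_at_top[of "nat \<lceil>norm x + r\<rceil>"] eventually_ge_at_top[of "nat \<lceil>2 / r\<rceil>"]
    proof eventually_elim
      case (elim k)
      have k: "norm x + r \<le> real k" "2 / r \<le> real k" using elim by linarith+
      have "r \<le> infdist x (W k)"
        unfolding infdist_notempty[OF W(2)]
      proof (rule cINF_greatest[OF W(2)])
        fix y assume "y \<in> W k"
        then have "y \<notin> ball x r"
        proof (rule contrapos_pn)
          assume y: "y \<in> ball x r"
          have "norm y < norm x + r" using y norm_triangle_ineq2[of y x] by (simp add: dist_norm norm_minus_commute)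
          with y k r show "y \<notin> W k" by (auto simp: W_def)
        qed
        then show "r \<le> dist x y" by simp
      qed
      then have "real k * r \<le> real k * infdist x (W k)" by (intro mult_left_mono) auto
      moreover have "2 \<le> real k * r" using k(2) r(1) by (simp add: field_simps)
      ultimately show "f k x = 1" by (simp add: f_def)
    qed
    then show ?thesis using True by (simp add: tendsto_eventually)
  qed
qed

text \<open>Open sets generate the Borel sets and are stable under intersection, so Dynkin's
  argument reduces indicators of Borel sets to those of open sets, and these are bounded limits of
  functions in \<open>Cc\<close>.\<close>

lemma bounded_borel_induct_Cc [consumes 2, case_names Cc add scale lim]:
  fixes \<Omega> :: "'a::euclidean_space set"
  assumes \<Omega>: "open \<Omega>" and f: "f \<in> bounded_borel \<Omega>"
    and base: "\<And>\<psi>. \<psi> \<in> Cc \<Omega> \<Longrightarrow> P \<psi>"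
    and add: "\<And>f g. f \<in> bounded_borel \<Omega> \<Longrightarrow> g \<in> bounded_borel \<Omega> \<Longrightarrow> P f \<Longrightarrow> P g \<Longrightarrow> P (\<lambda>x. f x + g x)"
    and scale: "\<And>f c. f \<in> bounded_borel \<Omega> \<Longrightarrow> P f \<Longrightarrow> P (\<lambda>x. c * f x)"
    and lim: "\<And>F f B. (\<And>k::nat. F k \<in> bounded_borel \<Omega>) \<Longrightarrow> (\<And>k. P (F k)) \<Longrightarrow>
       (\<And>k x. x \<in> \<Omega> \<Longrightarrow> \<bar>F k x\<bar> \<le> B) \<Longrightarrow> (\<And>x. x \<in> \<Omega> \<Longrightarrow> (\<lambda>k. F k x) \<longlonglongrightarrow> f x) \<Longrightarrow> P f"
  shows "P f"
  using f
proof (induction f rule: bounded_borel_induct_indicator)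
  case (indicator A)
  have \<Omega>b: "\<Omega> \<in> sets borel" using \<Omega> by simp
  have bb: "indicator (B \<inter> \<Omega>) \<in> bounded_borel \<Omega>" if "B \<in> sets borel" for B
    using that \<Omega>b by (intro bounded_borel_indicator) (auto simp: sets_restrict_space_iff)
  have op: "P (indicator (B \<inter> \<Omega>))" if B: "open B" for B
  proof -
    have o: "open (B \<inter> \<Omega>)" using B \<Omega> by auto
    obtain g where g: "\<And>k::nat. g k \<in> Cc (B \<inter> \<Omega>)" "\<And>k x. 0 \<le> g k x \<and> g k x \<le> 1"
      "\<And>x. (\<lambda>k. g k x) \<longlonglongrightarrow> indicator (B \<inter> \<Omega>) x"
      using indicator_open_limit_Cc[OF o] by blast
    have gC: "g k \<in> Cc \<Omega>" for k using g(1) Cc_mono[of "B \<inter> \<Omega>" \<Omega>] by auto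
    show ?thesis
      by (rule lim[where F=g and B=1]) (use gC g base Cc_bounded_borel[OF gC] in auto)
  qed
  have "P (indicator (B \<inter> \<Omega>))" if "B \<in> sets borel" for B
  proof -
    have "Int_stable {S :: 'a set. open S}" by (auto simp: Int_stable_def)
    moreover have "{S :: 'a set. open S} \<subseteq> Pow UNIV" by auto
    moreover have "B \<in> sigma_sets UNIV {S. open S}" using that by (simp add: borel_def)
    ultimately show ?thesis
    proof (induction B rule: sigma_sets_induct_disjoint)
      case (basic A) then show ?case using op by auto
    next
      case empty then show ?case by (rule op[OF open_empty])
    next
      case (compl A)
      then have A: "A \<in> sets borel" by (simp add: borel_def)
      have "P (\<lambda>x. indicator (UNIV \<inter> \<Omega>) x + (-1) * indicator (A \<inter> \<Omega>) x)"
        using A compl op[of UNIV] by (intro add scale bb bounded_borel_cmult) auto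
      moreover have "(\<lambda>x. indicator (UNIV \<inter> \<Omega>) x + (-1) * indicator (A \<inter> \<Omega>) x) = (indicator ((UNIV - A) \<inter> \<Omega>) :: 'a \<Rightarrow> real)"
        by (auto simp: indicator_def)
      ultimately show ?case by simp
    next
      case (union A)
      have A: "A i \<in> sets borel" for i using union by (auto simp: borel_def)
      define F where "F k x = (\<Sum>i<k. indicator (A i \<inter> \<Omega>) x :: real)" for k and x :: 'a
      have F_eq: "F k = indicator ((\<Union>i<k. A i) \<inter> \<Omega>)" for k
      proof (rule ext)
        fix x
        have "disjoint_family_on (\<lambda>i. A i \<inter> \<Omega>) {..<k}"
          using union by (auto simp: disjoint_family_on_def)
        then have "(indicator (\<Union>i<k. A i \<inter> \<Omega>) x :: real) = (\<Sum>i<k. indicator (A i \<inter> \<Omega>) x)"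
          by (intro indicator_UN_disjoint) auto
        moreover have "(\<Union>i<k. A i) \<inter> \<Omega> = (\<Union>i<k. A i \<inter> \<Omega>)" by auto
        ultimately show "F k x = indicator ((\<Union>i<k. A i) \<inter> \<Omega>) x" by (simp only: F_def)
      qed
      have PF: "P (F k) \<and> F k \<in> bounded_borel \<Omega>" for k
      proof (induction k)
        case 0
        have "F 0 = indicator ({} \<inter> \<Omega>)" by (simp add: F_eq)
        then show ?case using op[OF open_empty] bb[of "{}"] by (simp only: sets.empty_sets simp_thms)
      next
        case (Suc k)
        have "F (Suc k) = (\<lambda>x. F k x + indicator (A k \<inter> \<Omega>) x)" by (simp add: F_def fun_eq_iff)
        then show ?case using Suc union bb[OF A[of k]] by (auto intro!: add)
      qed
      show ?case
      proof (rule lim[where F=F and B=1])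
        show "(\<lambda>k. F k x) \<longlonglongrightarrow> indicator (\<Union> (range A) \<inter> \<Omega>) x" for x
        proof (cases "\<exists>i. x \<in> A i \<and> x \<in> \<Omega>")
          case True
          then obtain i where i: "x \<in> A i" "x \<in> \<Omega>" by auto
          have "\<forall>\<^sub>F k in sequentially. F k x = 1"
            using eventually_gt_at_top[of i] by eventually_elim (use i in \<open>auto simp: F_eq indicator_def\<close>)
          then have "(\<lambda>k. F k x) \<longlonglongrightarrow> 1" by (rule tendsto_eventually)
          moreover have "indicator (\<Union> (range A) \<inter> \<Omega>) x = (1::real)" using i by (auto simp: indicator_def)
          ultimately show ?thesis by simp
        next
          case False
          then have "F k x = 0" for k by (auto simp: F_eq indicator_def)
          with False show ?thesis by (auto simp: indicator_def)
        qed
      qed (use PF in \<open>auto simp: F_eq indicator_def\<close>)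
    qed
  qed
  moreover have "A \<in> sets borel" "A \<inter> \<Omega> = A"
    using indicator \<Omega>b by (auto simp: sets_restrict_space_iff)
  ultimately show ?case by metis
next
  case (add f g) then show ?case by (intro assms(4))
next
  case (scale f c) then show ?case by (intro assms(5))
next
  case (lim F f B)
  show ?case by (rule assms(6)[OF lim.hyps(1) lim.IH lim.hyps(2,3)])
qed

text \<open>Mollification adds one limit step, which reduces continuous test functions to smooth
  ones with the same bound. The uniqueness of all measures below and the final passage to Borel
  functions rest on this form.\<close>

lemma (in mollification) bounded_borel_induct_Cc_inf [consumes 2, case_names Cc_inf add scale lim]:
  fixes \<Omega> :: "'a set"
  assumes \<Omega>: "open \<Omega>" and f: "f \<in> bounded_borel \<Omega>"
    and base: "\<And>\<psi>. \<psi> \<in> Cc_inf \<Omega> \<Longrightarrow> P \<psi>"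
    and add: "\<And>f g. f \<in> bounded_borel \<Omega> \<Longrightarrow> g \<in> bounded_borel \<Omega> \<Longrightarrow> P f \<Longrightarrow> P g \<Longrightarrow> P (\<lambda>x. f x + g x)"
    and scale: "\<And>f c. f \<in> bounded_borel \<Omega> \<Longrightarrow> P f \<Longrightarrow> P (\<lambda>x. c * f x)"
    and lim: "\<And>F f B. (\<And>k::nat. F k \<in> bounded_borel \<Omega>) \<Longrightarrow> (\<And>k. P (F k)) \<Longrightarrow>
       (\<And>k x. x \<in> \<Omega> \<Longrightarrow> \<bar>F k x\<bar> \<le> B) \<Longrightarrow> (\<And>x. x \<in> \<Omega> \<Longrightarrow> (\<lambda>k. F k x) \<longlonglongrightarrow> f x) \<Longrightarrow> P f"
  shows "P f"
  using \<Omega> f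
proof (induction f rule: bounded_borel_induct_Cc)
  case (Cc \<psi>)
  obtain K where K: "compact K" "K \<subseteq> \<Omega>" "\<And>x. x \<notin> K \<Longrightarrow> \<psi> x = 0"
    "\<forall>\<^sub>F \<delta> in at_right 0. mollify \<rho> UNIV \<delta> \<psi> \<in> Cc_inf \<Omega> \<and> (\<forall>x. x \<notin> K \<longrightarrow> mollify \<rho> UNIV \<delta> \<psi> x = 0)"
    by (rule mollify_Cc[OF \<Omega> Cc]) blast
  then obtain b where b: "0 < b" "\<And>\<delta>. 0 < \<delta> \<Longrightarrow> \<delta> < b \<Longrightarrow> mollify \<rho> UNIV \<delta> \<psi> \<in> Cc_inf \<Omega>"
    unfolding eventually_at_right_field by auto
  \<comment> \<open>The shift by 2 makes every term strictly smaller than \<open>b\<close>,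
    including the one for \<open>k = 0\<close>.\<close>
  define dl where "dl k = b / real (k + 2)" for k
  have dl: "0 < dl k" "dl k < b" for k using b(1) by (auto simp: dl_def field_simps intro: add_pos_nonneg)
  have "dl \<longlonglongrightarrow> 0" unfolding dl_def
    by (rule real_tendsto_divide_at_top[OF tendsto_const])
      (intro filterlim_compose[OF filterlim_real_sequentially] filterlim_add_const_nat_at_top)
  then have fl: "filterlim dl (at_right 0) sequentially"
    using dl by (intro tendsto_imp_filterlim_at_right) auto
  obtain B where B: "\<And>x. \<bar>\<psi> x\<bar> \<le> B" using Cc_bounded[OF Cc] by blast
  have lb: "locally_bounded \<psi>" using Cc_continuous[OF Cc] by (rule locally_bounded_continuous)
  show ?case
  proof (rule lim[where F="\<lambda>k. mollify \<rho> UNIV (dl k) \<psi>" and B=B])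
    fix k
    have m: "mollify \<rho> UNIV (dl k) \<psi> \<in> Cc_inf \<Omega>" using b(2) dl by blast
    then show "P (mollify \<rho> UNIV (dl k) \<psi>)" by (rule base)
    show "mollify \<rho> UNIV (dl k) \<psi> \<in> bounded_borel \<Omega>"
      using m by (intro Cc_bounded_borel[of _ \<Omega>]) (simp add: Cc_inf_def)
    show "\<bar>mollify \<rho> UNIV (dl k) \<psi> x\<bar> \<le> B" for x
      using abs_convol_mollifier_le[OF lb dl(1)[of k], where x=x and c=0 and e=B] B by (simp add: mollify_eq_convol)
  next
    have "\<psi> \<in> Cc UNIV" using Cc Cc_mono[of \<Omega> UNIV] by auto
    from tendsto_uniform_limitI[OF mollify_Cc_uniform_limit[OF this]]
    have "((\<lambda>\<delta>. mollify \<rho> UNIV \<delta> \<psi> x) \<longlongrightarrow> \<psi> x) (at_right 0)" for x by simp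
    from filterlim_compose[OF this fl]
    show "(\<lambda>k. mollify \<rho> UNIV (dl k) \<psi> x) \<longlonglongrightarrow> \<psi> x" for x .
  qed
next
  case (add f g) then show ?case by (intro assms(4))
next
  case (scale f c) then show ?case by (intro assms(5))
next
  case (lim F f B)
  show ?case by (rule assms(6)[OF lim.hyps(1) lim.IH lim.hyps(2,3)])
qed

lemma finite_vmeasure_eqI_integral:
  assumes S: "S \<in> sets borel" and \<mu>: "finite_vmeasure S \<mu>" and \<nu>: "finite_vmeasure S \<nu>"
    and eq: "\<And>f. f \<in> bounded_borel S \<Longrightarrow> signed_integral S \<mu> S f = signed_integral S \<nu> S f"
  shows "\<mu> = \<nu>"
proof (rule finite_vmeasure_eqI[OF \<mu> \<nu>])
  fix A assume "A \<in> sets (restrict_space borel S)"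
  then show "\<mu> A = \<nu> A"
    using eq[of "indicator A"] by (auto simp: signed_integral_indicator[OF \<mu>] signed_integral_indicator[OF \<nu>])
qed

text \<open>The set carrying the measures may be smaller than the open set of the test functions:
  \<open>S = \<Omega>\<close> serves the divergence and the pairing, and the boundary of an inner
  set serves the trace measure.\<close>

lemma (in mollification) signed_integral_eqI_Cc_inf:
  fixes \<Omega> S :: "'a set"
  assumes \<Omega>: "open \<Omega>" and \<mu>: "finite_vmeasure S \<mu>" and \<nu>: "finite_vmeasure S \<nu>" and S: "S \<subseteq> \<Omega>"
    and eq: "\<And>\<psi>. \<psi> \<in> Cc_inf \<Omega> \<Longrightarrow> signed_integral S \<mu> S \<psi> = signed_integral S \<nu> S \<psi>"
    and f: "f \<in> bounded_borel \<Omega>"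
  shows "signed_integral S \<mu> S f = signed_integral S \<nu> S f"
  using \<Omega> f
proof (induction f rule: bounded_borel_induct_Cc_inf)
  case (Cc_inf \<psi>) then show ?case by (rule eq)
next
  case (add f g)
  then show ?case using S by (simp add: signed_integral_add[OF \<mu>] signed_integral_add[OF \<nu>] bounded_borel_subset)
next
  case (scale f c)
  then show ?case by (simp add: signed_integral_cmult[OF \<mu>] signed_integral_cmult[OF \<nu>])
next
  case (lim F f B)
  have *: "\<And>k. F k \<in> bounded_borel S" "\<And>k x. x \<in> S \<Longrightarrow> \<bar>F k x\<bar> \<le> B"
    "\<And>x. x \<in> S \<Longrightarrow> (\<lambda>k. F k x) \<longlonglongrightarrow> f x"
    using lim.hyps S bounded_borel_subset by blast+
  show ?case
    using signed_integral_LIMSEQ[OF \<mu> *] signed_integral_LIMSEQ[OF \<nu> *] lim.IH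
    by (simp add: LIMSEQ_unique)
qed

subsection \<open>Sobolev and Lipschitz functions\<close>

context mollification
begin

text \<open>A common framework for the functions in \<open>W\<^sup>1\<^sup>,\<^sup>\<infinity>(\<Omega>)\<close> and the distance function, which may be unbounded.\<close>

definition pairable :: "'a set \<Rightarrow> ('a \<Rightarrow> real) \<Rightarrow> bool" where
  "pairable \<Omega> \<phi> \<longleftrightarrow> continuous_on \<Omega> \<phi> \<and> locally_bounded (zero_ext \<Omega> \<phi>) \<and>
    (\<exists>C. \<forall>K. compact K \<longrightarrow> K \<subseteq> \<Omega> \<longrightarrow>
      (\<forall>\<^sub>F \<delta> in at_right 0. \<forall>x\<in>K. norm (grad (mollify \<rho> \<Omega> \<delta> \<phi>) x) \<le> C))"

lemma zero_ext_measurable: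
  assumes "open \<Omega>" "continuous_on \<Omega> \<phi>"
  shows "zero_ext \<Omega> \<phi> \<in> borel_measurable borel"
  using borel_measurable_continuous_on_indicator[of \<Omega> \<phi>] assms
  by (simp add: zero_ext_def[abs_def])

text \<open>As a function of \<open>y\<close>, the kernel
  \<open>mollifier \<rho> \<delta> (x - y)\<close> is an admissible test function once the ball
  around \<open>x\<close> lies in \<open>\<Omega>\<close>. The weak formulation then writes the
  mollified gradient as an average of the weak gradient, which inherits its essential bound.\<close>

lemma W1inf_pairable:
  assumes \<Omega>: "open \<Omega>" and \<phi>: "\<phi> \<in> W1inf \<Omega>"
  shows "pairable \<Omega> \<phi>"
proof -
  have c: "continuous_on \<Omega> \<phi>" "bounded (\<phi> ` \<Omega>)" using \<phi> by (auto simp: W1inf_def)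
  obtain g C where g: "set_borel_measurable lborel \<Omega> g" "AE x in lborel. x \<in> \<Omega> \<longrightarrow> norm (g x) \<le> C"
    "\<And>\<eta>. \<eta> \<in> Cc_inf \<Omega> \<Longrightarrow> (LINT x:\<Omega>|lborel. \<phi> x *\<^sub>R grad \<eta> x) = - (LINT x:\<Omega>|lborel. \<eta> x *\<^sub>R g x)"
    using \<phi> unfolding W1inf_def by blast
  obtain B where B: "\<And>x. x \<in> \<Omega> \<Longrightarrow> \<bar>\<phi> x\<bar> \<le> B" using c(2) by (auto simp: bounded_iff)
  have lb: "locally_bounded (zero_ext \<Omega> \<phi>)"
    unfolding locally_bounded_def
  proof (intro conjI allI exI impI)
    show "\<bar>zero_ext \<Omega> \<phi> x\<bar> \<le> \<bar>B\<bar>" for x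
      using B[of x] by (auto simp: zero_ext_def indicator_def)
  qed (rule zero_ext_measurable[OF \<Omega> c(1)])
  have "\<forall>\<^sub>F \<delta> in at_right 0. \<forall>x\<in>K. norm (grad (mollify \<rho> \<Omega> \<delta> \<phi>) x) \<le> \<bar>C\<bar>"
    if K: "compact K" "K \<subseteq> \<Omega>" for K
  proof -
    obtain r K' where r: "0 < r" "compact K'" "K' \<subseteq> \<Omega>" "\<And>x. x \<in> K \<Longrightarrow> cball x r \<subseteq> K'"
      using compact_neighbourhood[OF K(1) \<Omega> K(2)] by metis
    from eventually_at_right_less[OF r(1)]
    show ?thesis
    proof eventually_elim
      case (elim \<delta>)
      show ?case
      proof
        fix x assume x: "x \<in> K"
        let ?\<kappa> = "mollifier \<rho> \<delta>"
        have d0: "0 < \<delta>" using elim by simp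
        define \<eta> where "\<eta> y = ?\<kappa> (x - y)" for y
        have \<eta>C: "C_k k \<eta>" for k
          using C_k_affine[OF C_k_mollifier, of k 1 \<delta> "-1" x] by (simp add: \<eta>_def[abs_def])
        have \<eta>z: "\<eta> y = 0" if "y \<notin> cball x r" for y
          using that vanishes_outside_mollifier[OF d0] elim
          by (auto simp: \<eta>_def vanishes_outside_def dist_norm)
        have "\<eta> \<in> Cc_inf \<Omega>"
          unfolding Cc_inf_def using \<eta>C[of 0] r(3) r(4)[OF x] \<eta>z
          by (auto intro!: CcI[of _ "cball x r"] \<eta>C)
        note weak = g(3)[OF this]
        have grad\<eta>: "grad \<eta> y = - grad ?\<kappa> (x - y)" for y
        proof (rule grad_eqI)
          have "((\<lambda>y. x - y) has_derivative (\<lambda>h. - h)) (at y)" by (auto intro!: derivative_eq_intros)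
          from has_derivative_compose[OF this C1_has_derivative[OF C1_mollifier[of \<delta>]]]
          show "(\<eta> has_derivative (\<lambda>h. h \<bullet> - grad ?\<kappa> (x - y))) (at y)" by (simp add: \<eta>_def[abs_def])
        qed
        have "grad (mollify \<rho> \<Omega> \<delta> \<phi>) x = (LINT y|lborel. zero_ext \<Omega> \<phi> y *\<^sub>R grad ?\<kappa> (x - y))"
          unfolding mollify_eq_convol
          by (rule grad_convol[OF lb C1_mollifier vanishes_outside_mollifier[OF d0]])
        also have "\<dots> = - (LINT x:\<Omega>|lborel. \<phi> x *\<^sub>R grad \<eta> x)"
          by (simp add: set_lebesgue_integral_def grad\<eta> zero_ext_def)
        also have "\<dots> = (LINT y|lborel. indicator \<Omega> y *\<^sub>R \<eta> y *\<^sub>R g y)"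
          using weak by (simp add: set_lebesgue_integral_def)
        finally have "norm (grad (mollify \<rho> \<Omega> \<delta> \<phi>) x) \<le> (LINT y|lborel. norm (indicator \<Omega> y *\<^sub>R \<eta> y *\<^sub>R g y))"
          using integral_norm_bound by metis
        also have "\<dots> \<le> (LINT y|lborel. \<bar>C\<bar> * \<eta> y)"
        proof (rule integral_mono_AE')
          show "integrable lborel (\<lambda>y. \<bar>C\<bar> * \<eta> y)" unfolding \<eta>_def using integrable_mollifier[OF d0] by auto
          show "AE y in lborel. norm (indicator \<Omega> y *\<^sub>R \<eta> y *\<^sub>R g y) \<le> \<bar>C\<bar> * \<eta> y"
            using g(2)
          proof eventually_elim
            case (elim y)
            have \<eta>0: "0 \<le> \<eta> y" unfolding \<eta>_def by (rule mollifier_nonneg[OF d0])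
            show ?case
            proof (cases "y \<in> \<Omega>")
              case True
              with elim have "norm (g y) \<le> \<bar>C\<bar>" by simp
              then show ?thesis using True \<eta>0 mult_left_mono[of "norm (g y)" "\<bar>C\<bar>" "\<eta> y"] by (simp add: mult.commute)
            qed (use \<eta>0 in simp)
          qed
          show "AE y in lborel. 0 \<le> \<bar>C\<bar> * \<eta> y"
            using mollifier_nonneg[OF d0] by (simp add: \<eta>_def)
        qed
        also have "\<dots> = \<bar>C\<bar>" using integral_mollifier[OF d0, of x] by (simp add: \<eta>_def)
        finally show "norm (grad (mollify \<rho> \<Omega> \<delta> \<phi>) x) \<le> \<bar>C\<bar>" .
      qed
    qed
  qed
  with c lb show ?thesis unfolding pairable_def by blast
qed

text \<open>The zero extension can jump at the boundary of \<open>\<Omega>\<close>, so the Lipschitz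
  estimate is proved for the convolution of \<open>f\<close> itself and transferred to the
  mollification near \<open>K\<close>, where both agree for small \<open>\<delta>\<close>.\<close>

lemma Lipschitz_pairable:
  assumes \<Omega>: "open \<Omega>" and f: "\<And>x y. \<bar>f x - f y\<bar> \<le> norm (x - y)"
  shows "pairable \<Omega> f"
proof -
  have cont: "continuous_on UNIV f"
    unfolding continuous_on_iff dist_real_def
    using f by (metis dist_norm le_less_trans)
  then have lbf: "locally_bounded f" by (rule locally_bounded_continuous)
  have c\<Omega>: "continuous_on \<Omega> f" using cont by (rule continuous_on_subset) simp
  have lb: "locally_bounded (zero_ext \<Omega> f)"
    unfolding locally_bounded_def
  proof (intro conjI allI)
    show "zero_ext \<Omega> f \<in> borel_measurable borel" by (rule zero_ext_measurable[OF \<Omega> c\<Omega>])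
    fix R
    obtain B where "\<And>x. norm x \<le> R \<Longrightarrow> \<bar>f x\<bar> \<le> B" using lbf unfolding locally_bounded_def by blast
    then have "\<forall>x. norm x \<le> R \<longrightarrow> \<bar>zero_ext \<Omega> f x\<bar> \<le> \<bar>B\<bar>"
      by (fastforce simp: zero_ext_def indicator_def)
    then show "\<exists>B. \<forall>x. norm x \<le> R \<longrightarrow> \<bar>zero_ext \<Omega> f x\<bar> \<le> B" ..
  qed
  have Lip: "\<bar>convol f (mollifier \<rho> \<delta>) x - convol f (mollifier \<rho> \<delta>) y\<bar> \<le> norm (x - y)" if d0: "0 < \<delta>" for \<delta> x y
  proof -
    let ?\<kappa> = "mollifier \<rho> \<delta>"
    have fm: "f \<in> borel_measurable borel" using cont by (rule borel_measurable_continuous_onI)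
    have comm: "convol f ?\<kappa> z = convol ?\<kappa> f z" for z by (rule convol_commute[OF fm mollifier_measurable])
    \<comment> \<open>The kernel is reflected so that the convolution with 1 at the point 0 has
      \<open>?\<kappa>\<close> itself as integrand.\<close>
    have int\<kappa>: "integrable lborel ?\<kappa>"
      using integrable_convol[OF locally_bounded_continuous[of "\<lambda>_. 1"], of "\<lambda>z. ?\<kappa> (- z)" \<delta> 0]
        continuous_mollifier[of \<delta>] vanishes_outside_mollifier[OF d0]
      by (simp add: vanishes_outside_def continuous_on_compose2[of UNIV ?\<kappa> UNIV uminus] continuous_on_minus)
    have int\<kappa>1: "(LINT w|lborel. ?\<kappa> w) = 1"
      using integral_mollifier[OF d0, of 0] lborel_integral_affine[of ?\<kappa> "-1" 0] by simp
    have int: "integrable lborel (\<lambda>w. ?\<kappa> w * f (z - w))" for z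
    proof -
      obtain B where B: "\<And>x. norm x \<le> norm z + \<delta> \<Longrightarrow> \<bar>f x\<bar> \<le> B" using lbf unfolding locally_bounded_def by blast
      have i1: "integrable lborel (\<lambda>w. \<bar>B\<bar> * ?\<kappa> w)"
        using int\<kappa> by auto
      show ?thesis
      proof (rule Bochner_Integration.integrable_bound[OF i1])
        show "(\<lambda>w. ?\<kappa> w * f (z - w)) \<in> borel_measurable lborel" using fm by measurable
        show "AE w in lborel. norm (?\<kappa> w * f (z - w)) \<le> norm (\<bar>B\<bar> * ?\<kappa> w)"
        proof (rule AE_I2)
          fix w
          show "norm (?\<kappa> w * f (z - w)) \<le> norm (\<bar>B\<bar> * ?\<kappa> w)"
          proof (cases "norm w \<le> \<delta>")
            case True
            have "norm (z - w) \<le> norm z + \<delta>" using True norm_triangle_ineq4[of z w] by linarith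
            then have "\<bar>f (z - w)\<bar> \<le> \<bar>B\<bar>" using B[of "z - w"] by linarith
            then have "\<bar>?\<kappa> w\<bar> * \<bar>f (z - w)\<bar> \<le> \<bar>?\<kappa> w\<bar> * \<bar>B\<bar>" by (intro mult_left_mono) auto
            then show ?thesis by (simp add: abs_mult mult.commute)
          next
            case False
            then have "?\<kappa> w = 0" using vanishes_outside_mollifier[OF d0] by (auto simp: vanishes_outside_def)
            then show ?thesis by simp
          qed
        qed
      qed
    qed
    have "convol f ?\<kappa> x - convol f ?\<kappa> y = (LINT w|lborel. ?\<kappa> w * f (x - w) - ?\<kappa> w * f (y - w))"
      unfolding comm unfolding convol_def using int by simp
    then have "\<bar>convol f ?\<kappa> x - convol f ?\<kappa> y\<bar> \<le> (LINT w|lborel. \<bar>?\<kappa> w * f (x - w) - ?\<kappa> w * f (y - w)\<bar>)"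
      using integral_abs_bound by metis
    also have "\<dots> \<le> (LINT w|lborel. norm (x - y) * ?\<kappa> w)"
    proof (rule integral_mono)
      show "integrable lborel (\<lambda>w. \<bar>?\<kappa> w * f (x - w) - ?\<kappa> w * f (y - w)\<bar>)"
        using int by (intro integrable_abs Bochner_Integration.integrable_diff)
      show "integrable lborel (\<lambda>w. norm (x - y) * ?\<kappa> w)" using int\<kappa> by auto
      fix w
      have "\<bar>?\<kappa> w * f (x - w) - ?\<kappa> w * f (y - w)\<bar> = ?\<kappa> w * \<bar>f (x - w) - f (y - w)\<bar>"
        using mollifier_nonneg[OF d0, of w] by (simp add: right_diff_distrib[symmetric] abs_mult)
      also have "\<dots> \<le> ?\<kappa> w * norm (x - y)"
        using f[of "x - w" "y - w"] mollifier_nonneg[OF d0, of w] by (intro mult_left_mono) auto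
      finally show "\<bar>?\<kappa> w * f (x - w) - ?\<kappa> w * f (y - w)\<bar> \<le> norm (x - y) * ?\<kappa> w"
        by (simp add: mult.commute)
    qed
    also have "\<dots> = norm (x - y)" using int\<kappa>1 by simp
    finally show ?thesis .
  qed
  have "\<forall>\<^sub>F \<delta> in at_right 0. \<forall>x\<in>K. norm (grad (mollify \<rho> \<Omega> \<delta> f) x) \<le> 1"
    if K: "compact K" "K \<subseteq> \<Omega>" for K
  proof -
    obtain r K' where r: "0 < r" "compact K'" "K' \<subseteq> \<Omega>" "\<And>x. x \<in> K \<Longrightarrow> cball x r \<subseteq> K'"
      using compact_neighbourhood[OF K(1) \<Omega> K(2)] by metis
    \<comment> \<open>The margin \<open>r\<close> is shared equally between the mollification radius
      and the displacement from \<open>x\<close> to \<open>y\<close>.\<close>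
    have "0 < r / 2" using r by simp
    from eventually_at_right_less[OF this]
    show ?thesis
    proof eventually_elim
      case (elim \<delta>)
      then have d0: "0 < \<delta>" by simp
      show ?case
      proof
        fix x assume x: "x \<in> K"
        have eq: "mollify \<rho> \<Omega> \<delta> f y = convol f (mollifier \<rho> \<delta>) y" if y: "dist y x < r / 2" for y
          unfolding mollify_eq_convol convol_def
        proof (rule Bochner_Integration.integral_cong[OF refl])
          fix w
          show "zero_ext \<Omega> f w * mollifier \<rho> \<delta> (y - w) = f w * mollifier \<rho> \<delta> (y - w)"
          proof (cases "norm (y - w) \<le> \<delta>")
            case True
            have "dist x w \<le> dist y x + dist y w" by (metis dist_commute dist_triangle)
            then have "w \<in> cball x r" using True y elim by (simp add: dist_norm)
            then have "w \<in> \<Omega>" using r(3) r(4)[OF x] by auto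
            then show ?thesis by (simp add: zero_ext_def)
          next
            case False
            then show ?thesis using vanishes_outside_mollifier[OF d0] by (auto simp: vanishes_outside_def)
          qed
        qed
        show "norm (grad (mollify \<rho> \<Omega> \<delta> f) x) \<le> 1"
        proof (rule grad_bound_of_local_Lipschitz[of _ _ "r/2"])
          show "mollify \<rho> \<Omega> \<delta> f differentiable at x" using C1_mollify[OF lb d0] by (simp add: C1_def)
          show "0 < r / 2" using r by simp
          fix y assume y: "dist y x < r / 2"
          show "\<bar>mollify \<rho> \<Omega> \<delta> f y - mollify \<rho> \<Omega> \<delta> f x\<bar> \<le> 1 * norm (y - x)"
            using Lip[OF d0, of y x] eq[OF y] eq[of x] r by simp
        qed
      qed
    qed
  qed
  with c\<Omega> lb show ?thesis unfolding pairable_def by blast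
qed

end

subsection \<open>Functionals dominated by a measure\<close>

text \<open>
  The domination allows \<open>L\<close> to be extended by continuity to all bounded Borel functions, and the measure is
  \<open>A \<mapsto> L 1\<^sub>A\<close>. This avoids the Riesz representation and Radon-Nikodym theorems.
\<close>

lemma dominated_functional_measure:
  fixes \<Omega> :: "'a::euclidean_space set" and m :: "'i \<Rightarrow> 'a measure" and L :: "('a \<Rightarrow> real) \<Rightarrow> real"
  assumes \<Omega>: "open \<Omega>" and I: "finite I"
    and m: "\<And>i. i \<in> I \<Longrightarrow> finite_measure (m i)" "\<And>i. i \<in> I \<Longrightarrow> sets (m i) = sets (restrict_space borel \<Omega>)"
    and L_add: "\<And>\<psi> \<theta>. \<psi> \<in> Cc \<Omega> \<Longrightarrow> \<theta> \<in> Cc \<Omega> \<Longrightarrow> L (\<lambda>x. \<psi> x + \<theta> x) = L \<psi> + L \<theta>"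
    and L_cmult: "\<And>\<psi> c. \<psi> \<in> Cc \<Omega> \<Longrightarrow> L (\<lambda>x. c * \<psi> x) = c * L \<psi>"
    and C: "0 \<le> C" and L_bound: "\<And>\<psi>. \<psi> \<in> Cc \<Omega> \<Longrightarrow> \<bar>L \<psi>\<bar> \<le> C * (\<Sum>i\<in>I. LINT x|m i. \<bar>\<psi> x\<bar>)"
  shows "\<exists>\<mu>. finite_vmeasure \<Omega> \<mu> \<and> (\<forall>\<psi>\<in>Cc \<Omega>. signed_integral \<Omega> \<mu> \<Omega> \<psi> = L \<psi>)"
proof -
  let ?S = "restrict_space borel \<Omega>"
  \<comment> \<open>The L1 seminorm of the dominating measures; \<open>L\<close> is Lipschitz for it
    with constant \<open>C\<close>.\<close>
  define N where "N f = (\<Sum>i\<in>I. LINT x|m i. \<bar>f x\<bar>)" for f :: "'a \<Rightarrow> real"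
  have int: "integrable (m i) f" if "f \<in> bounded_borel \<Omega>" "i \<in> I" for f i
    using integrable_bounded_borel[OF that(1) m(1)[OF that(2)] m(2)[OF that(2)]] .
  have N0: "0 \<le> N f" for f unfolding N_def by (intro sum_nonneg integral_nonneg_AE) auto
  have N_tri: "N f \<le> N g + N h"
    if "f \<in> bounded_borel \<Omega>" "g \<in> bounded_borel \<Omega>" "h \<in> bounded_borel \<Omega>"
      "\<And>x. \<bar>f x\<bar> \<le> \<bar>g x\<bar> + \<bar>h x\<bar>" for f g h
    unfolding N_def sum.distrib[symmetric]
  proof (rule sum_mono)
    fix i assume i: "i \<in> I"
    have "(LINT x|m i. \<bar>f x\<bar>) \<le> (LINT x|m i. \<bar>g x\<bar> + \<bar>h x\<bar>)"
      using that i by (intro integral_mono Bochner_Integration.integrable_add int bounded_borel_abs) auto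
    also have "\<dots> = (LINT x|m i. \<bar>g x\<bar>) + (LINT x|m i. \<bar>h x\<bar>)"
      using that i by (intro Bochner_Integration.integral_add int bounded_borel_abs) auto
    finally show "(LINT x|m i. \<bar>f x\<bar>) \<le> (LINT x|m i. \<bar>g x\<bar>) + (LINT x|m i. \<bar>h x\<bar>)" .
  qed
  have N_cmult: "N (\<lambda>x. c * f x) = \<bar>c\<bar> * N f" for c f
    unfolding N_def by (simp add: abs_mult sum_distrib_left)
  have N_lim: "(\<lambda>k. N (\<lambda>x. F k x - f x)) \<longlonglongrightarrow> 0"
    if F: "\<And>k. F k \<in> bounded_borel \<Omega>" "\<And>k x. x \<in> \<Omega> \<Longrightarrow> \<bar>F k x\<bar> \<le> B" "\<And>x. x \<in> \<Omega> \<Longrightarrow> (\<lambda>k. F k x) \<longlonglongrightarrow> f x"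
    for F f B
  proof -
    have f: "f \<in> bounded_borel \<Omega>" by (rule bounded_borel_LIMSEQ[OF F])
    obtain B' where B': "\<And>x. x \<in> \<Omega> \<Longrightarrow> \<bar>f x\<bar> \<le> B'" using bounded_borel_bound[OF f] by blast
    have "(\<lambda>k. LINT x|m i. \<bar>F k x - f x\<bar>) \<longlonglongrightarrow> (LINT x|m i. 0)" if i: "i \<in> I" for i
    proof (rule integral_bounded_borel_LIMSEQ[OF m(1)[OF i] m(2)[OF i]])
      show "(\<lambda>x. \<bar>F k x - f x\<bar>) \<in> bounded_borel \<Omega>" for k
        by (intro bounded_borel_abs bounded_borel_diff F(1) f)
      show "\<bar>\<bar>F k x - f x\<bar>\<bar> \<le> B + B'" if "x \<in> \<Omega>" for k x using F(2)[OF that, of k] B'[OF that] by linarith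
      show "(\<lambda>k. \<bar>F k x - f x\<bar>) \<longlonglongrightarrow> 0" if "x \<in> \<Omega>" for x
        using tendsto_rabs_zero[OF LIM_zero[OF F(3)[OF that]]] .
    qed
    then have "(\<lambda>k. \<Sum>i\<in>I. LINT x|m i. \<bar>F k x - f x\<bar>) \<longlonglongrightarrow> (\<Sum>i\<in>I. 0)"
      by (intro tendsto_sum) simp
    then show ?thesis by (simp add: N_def)
  qed
  note Cb = Cc_bounded_borel[of _ \<Omega> \<Omega>]
  \<comment> \<open>Density of \<open>Cc\<close> for the seminorm \<open>N\<close>: the approximable
    functions are closed under sums, multiples and bounded limits, so the monotone class induction
    applies.\<close>
  have dense: "\<exists>\<psi>\<in>Cc \<Omega>. N (\<lambda>x. f x - \<psi> x) < e" if "f \<in> bounded_borel \<Omega>" "0 < e" for f e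
    using \<Omega> that
  proof (induction f arbitrary: e rule: bounded_borel_induct_Cc)
    case (Cc \<psi>)
    then show ?case by (intro bexI[of _ \<psi>]) (auto simp: N_def)
  next
    case (add f g)
    obtain \<psi> \<theta> where h: "\<psi> \<in> Cc \<Omega>" "N (\<lambda>x. f x - \<psi> x) < e/2" "\<theta> \<in> Cc \<Omega>" "N (\<lambda>x. g x - \<theta> x) < e/2"
      using add.IH(1)[of "e/2"] add.IH(2)[of "e/2"] add.prems by auto
    have "N (\<lambda>x. f x + g x - (\<psi> x + \<theta> x)) \<le> N (\<lambda>x. f x - \<psi> x) + N (\<lambda>x. g x - \<theta> x)"
      by (intro N_tri bounded_borel_diff bounded_borel_add add.hyps Cb[OF h(1)] Cb[OF h(3)]) auto
    then show ?case using h by (intro bexI[of _ "\<lambda>x. \<psi> x + \<theta> x"] Cc_add) auto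
  next
    case (scale f c)
    have "0 < e / (\<bar>c\<bar> + 1)" using scale.prems by (intro divide_pos_pos) auto
    then obtain \<psi> where h: "\<psi> \<in> Cc \<Omega>" "N (\<lambda>x. f x - \<psi> x) < e / (\<bar>c\<bar> + 1)" using scale.IH by blast
    have "N (\<lambda>x. c * f x - c * \<psi> x) = \<bar>c\<bar> * N (\<lambda>x. f x - \<psi> x)"
      using N_cmult[of c "\<lambda>x. f x - \<psi> x"] by (simp add: right_diff_distrib)
    also have "\<dots> \<le> (\<bar>c\<bar> + 1) * N (\<lambda>x. f x - \<psi> x)" using N0 by (intro mult_right_mono) auto
    also have "\<dots> < e" using h(2) by (simp add: field_simps)
    finally show ?case using h(1) by (intro bexI[of _ "\<lambda>x. c * \<psi> x"] Cc_cmult) auto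
  next
    case (lim F f B)
    have f: "f \<in> bounded_borel \<Omega>" by (rule bounded_borel_LIMSEQ[OF lim.hyps])
    have "\<forall>\<^sub>F k in sequentially. N (\<lambda>x. F k x - f x) < e / 2"
      by (rule order_tendstoD(2)[OF N_lim[OF lim.hyps] half_gt_zero[OF \<open>0 < e\<close>]])
    then obtain k where k: "N (\<lambda>x. F k x - f x) < e / 2" by (auto dest: eventually_happens)
    obtain \<psi> where h: "\<psi> \<in> Cc \<Omega>" "N (\<lambda>x. F k x - \<psi> x) < e / 2" using lim.IH[of "e/2" k] lim.prems by auto
    have "N (\<lambda>x. f x - \<psi> x) \<le> N (\<lambda>x. F k x - f x) + N (\<lambda>x. F k x - \<psi> x)"
      by (intro N_tri bounded_borel_diff lim.hyps(1) f Cb[OF h(1)]) auto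
    then show ?case using h k by (intro bexI[of _ \<psi>]) auto
  qed
  have L_bound': "\<bar>L \<psi>\<bar> \<le> C * N \<psi>" if "\<psi> \<in> Cc \<Omega>" for \<psi> using L_bound[OF that] by (simp add: N_def)
  have L_diff: "L \<psi> - L \<theta> = L (\<lambda>x. \<psi> x - \<theta> x)" if "\<psi> \<in> Cc \<Omega>" "\<theta> \<in> Cc \<Omega>" for \<psi> \<theta>
    using L_add[OF that(1) Cc_cmult[OF that(2), of "-1"]] L_cmult[OF that(2), of "-1"] by simp
  \<comment> \<open>\<open>Lh f\<close> is the only number within \<open>C * N (f - \<psi>)\<close> of \<open>L \<psi>\<close> for every \<open>\<psi>\<close>.\<close>
  define Lh where "Lh f = (SUP \<psi>\<in>Cc \<Omega>. L \<psi> - C * N (\<lambda>x. f x - \<psi> x))" for f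
  have Lh: "\<bar>Lh f - L \<psi>\<bar> \<le> C * N (\<lambda>x. f x - \<psi> x)" if f: "f \<in> bounded_borel \<Omega>" and \<psi>: "\<psi> \<in> Cc \<Omega>" for f \<psi>
  proof -
    have key: "L \<theta> - C * N (\<lambda>x. f x - \<theta> x) \<le> L \<psi> + C * N (\<lambda>x. f x - \<psi> x)"
      if "\<theta> \<in> Cc \<Omega>" "\<psi> \<in> Cc \<Omega>" for \<psi> \<theta>
    proof -
      have "L \<theta> - L \<psi> \<le> C * N (\<lambda>x. \<theta> x - \<psi> x)"
        using L_diff[OF that] L_bound'[OF Cc_diff[OF that]] by linarith
      also have "\<dots> \<le> C * (N (\<lambda>x. f x - \<theta> x) + N (\<lambda>x. f x - \<psi> x))"
        by (intro mult_left_mono N_tri bounded_borel_diff f C Cb[OF that(1)] Cb[OF that(2)]) auto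
      finally show ?thesis by (simp add: algebra_simps)
    qed
    have "bdd_above ((\<lambda>\<psi>. L \<psi> - C * N (\<lambda>x. f x - \<psi> x)) ` Cc \<Omega>)"
      using key[OF _ \<psi>] by (intro bdd_aboveI2[where M="L \<psi> + C * N (\<lambda>x. f x - \<psi> x)"])
    then have "L \<psi> - C * N (\<lambda>x. f x - \<psi> x) \<le> Lh f" unfolding Lh_def using \<psi> by (intro cSUP_upper)
    moreover have "Lh f \<le> L \<psi> + C * N (\<lambda>x. f x - \<psi> x)"
      unfolding Lh_def using \<psi> key by (intro cSUP_least) auto
    ultimately show ?thesis by linarith
  qed
  have dense': "\<exists>\<psi>\<in>Cc \<Omega>. C * N (\<lambda>x. f x - \<psi> x) < e" if f: "f \<in> bounded_borel \<Omega>" and e: "0 < e" for f e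
  proof -
    obtain \<psi> where h: "\<psi> \<in> Cc \<Omega>" "N (\<lambda>x. f x - \<psi> x) < e / (C + 1)"
      using dense[OF f, of "e / (C + 1)"] e C by (auto simp: divide_pos_pos)
    have "C * N (\<lambda>x. f x - \<psi> x) \<le> (C + 1) * N (\<lambda>x. f x - \<psi> x)" using N0 by (intro mult_right_mono) auto
    also have "\<dots> < e" using h(2) C by (simp add: field_simps)
    finally show ?thesis using h(1) by auto
  qed
  have Lh_add: "Lh (\<lambda>x. f x + g x) = Lh f + Lh g" if f: "f \<in> bounded_borel \<Omega>" and g: "g \<in> bounded_borel \<Omega>" for f g
  proof -
    have "\<bar>Lh (\<lambda>x. f x + g x) - (Lh f + Lh g)\<bar> \<le> 0 + e" if e: "0 < e" for e
    proof -
      \<comment> \<open>Each approximation error enters twice, once through the sum and once through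
        its own summand, whence four errors of \<open>e / 4\<close>.\<close>
      obtain \<psi> \<theta> where h: "\<psi> \<in> Cc \<Omega>" "C * N (\<lambda>x. f x - \<psi> x) < e/4" "\<theta> \<in> Cc \<Omega>" "C * N (\<lambda>x. g x - \<theta> x) < e/4"
        using dense'[OF f, of "e/4"] dense'[OF g, of "e/4"] e by auto
      have "N (\<lambda>x. f x + g x - (\<psi> x + \<theta> x)) \<le> N (\<lambda>x. f x - \<psi> x) + N (\<lambda>x. g x - \<theta> x)"
        by (intro N_tri bounded_borel_diff bounded_borel_add f g Cb[OF h(1)] Cb[OF h(3)]) auto
      from mult_left_mono[OF this C]
      have "C * N (\<lambda>x. f x + g x - (\<psi> x + \<theta> x)) \<le> e/4 + e/4" using h by (simp add: algebra_simps)
      moreover have "\<bar>Lh (\<lambda>x. f x + g x) - (L \<psi> + L \<theta>)\<bar> \<le> C * N (\<lambda>x. f x + g x - (\<psi> x + \<theta> x))"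
        using Lh[OF bounded_borel_add[OF f g] Cc_add[OF h(1,3)]] L_add[OF h(1,3)] by simp
      ultimately show ?thesis using Lh[OF f h(1)] Lh[OF g h(3)] h(2,4) by linarith
    qed
    then have "\<bar>Lh (\<lambda>x. f x + g x) - (Lh f + Lh g)\<bar> \<le> 0" by (rule field_le_epsilon)
    then show ?thesis by simp
  qed
  have Lh_cmult: "Lh (\<lambda>x. c * f x) = c * Lh f" if f: "f \<in> bounded_borel \<Omega>" for c f
  proof -
    have "\<bar>Lh (\<lambda>x. c * f x) - c * Lh f\<bar> \<le> 0 + e" if e: "0 < e" for e
    proof -
      have "0 < e / (2 * (\<bar>c\<bar> + 1))" using e by (intro divide_pos_pos) auto
      then obtain \<psi> where h: "\<psi> \<in> Cc \<Omega>" "C * N (\<lambda>x. f x - \<psi> x) < e / (2 * (\<bar>c\<bar> + 1))"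
        using dense'[OF f] by blast
      have "\<bar>c\<bar> * (C * N (\<lambda>x. f x - \<psi> x)) \<le> (\<bar>c\<bar> + 1) * (C * N (\<lambda>x. f x - \<psi> x))"
        using C N0 by (intro mult_right_mono mult_nonneg_nonneg) auto
      also have "\<dots> \<le> e / 2" using h(2) by (simp add: field_simps)
      finally have 1: "\<bar>c\<bar> * (C * N (\<lambda>x. f x - \<psi> x)) \<le> e / 2" .
      have "\<bar>Lh (\<lambda>x. c * f x) - c * L \<psi>\<bar> \<le> C * N (\<lambda>x. c * (f x - \<psi> x))"
        using Lh[OF bounded_borel_cmult[OF f, of c] Cc_cmult[OF h(1), of c]] L_cmult[OF h(1), of c]
        by (simp add: right_diff_distrib)
      then have 2: "\<bar>Lh (\<lambda>x. c * f x) - c * L \<psi>\<bar> \<le> e / 2" 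
      proof -
        have "C * N (\<lambda>x. c * (f x - \<psi> x)) = \<bar>c\<bar> * (C * N (\<lambda>x. f x - \<psi> x))"
          unfolding N_cmult by (simp add: mult_ac)
        then show ?thesis using 1 \<open>\<bar>Lh (\<lambda>x. c * f x) - c * L \<psi>\<bar> \<le> C * N (\<lambda>x. c * (f x - \<psi> x))\<close> by linarith
      qed
      have "\<bar>c * L \<psi> - c * Lh f\<bar> = \<bar>c\<bar> * \<bar>Lh f - L \<psi>\<bar>"
        by (simp add: right_diff_distrib[symmetric] abs_mult abs_minus_commute)
      also have "\<dots> \<le> \<bar>c\<bar> * (C * N (\<lambda>x. f x - \<psi> x))" by (intro mult_left_mono Lh f h) auto
      finally show ?thesis using 1 2 by linarith
    qed
    then have "\<bar>Lh (\<lambda>x. c * f x) - c * Lh f\<bar> \<le> 0" by (rule field_le_epsilon)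
    then show ?thesis by simp
  qed
  have Lh_bound: "\<bar>Lh f\<bar> \<le> C * N f" if "f \<in> bounded_borel \<Omega>" for f
    using Lh[OF that Cc_zero] L_cmult[OF Cc_zero, of 0] by simp
  have Lh_lim: "(\<lambda>k. Lh (F k)) \<longlonglongrightarrow> Lh f"
    if F: "\<And>k. F k \<in> bounded_borel \<Omega>" "\<And>k x. x \<in> \<Omega> \<Longrightarrow> \<bar>F k x\<bar> \<le> B" "\<And>x. x \<in> \<Omega> \<Longrightarrow> (\<lambda>k. F k x) \<longlonglongrightarrow> f x"
    for F f B
  proof -
    have f: "f \<in> bounded_borel \<Omega>" by (rule bounded_borel_LIMSEQ[OF F])
    have "(\<lambda>k. Lh (F k) - Lh f) \<longlonglongrightarrow> 0"
    proof (rule Lim_null_comparison[OF always_eventually])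
      show "\<forall>k. norm (Lh (F k) - Lh f) \<le> C * N (\<lambda>x. F k x - f x)"
      proof
        fix k
        have "Lh (\<lambda>x. F k x + (-1) * f x) = Lh (F k) + (-1) * Lh f"
          using Lh_add[OF F(1)[of k] bounded_borel_cmult[OF f, of "-1"]] Lh_cmult[OF f, of "-1"] by simp
        then show "norm (Lh (F k) - Lh f) \<le> C * N (\<lambda>x. F k x - f x)"
          using Lh_bound[OF bounded_borel_diff[OF F(1)[of k] f]] by simp
      qed
      show "(\<lambda>k. C * N (\<lambda>x. F k x - f x)) \<longlonglongrightarrow> 0" using tendsto_mult_right_zero[OF N_lim[OF F]] .
    qed
    then show ?thesis by (rule LIM_zero_cancel)
  qed
  define \<mu> where "\<mu> A = (if A \<in> sets ?S then Lh (indicator A) else 0)" for A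
  have \<mu>: "finite_vmeasure \<Omega> \<mu>"
    unfolding finite_vmeasure_def
  proof (intro conjI allI impI)
    fix A :: "nat \<Rightarrow> 'a set" assume A: "range A \<subseteq> sets ?S" "disjoint_family A"
    have Ai: "A i \<in> sets ?S" for i using A by auto
    define F where "F k x = (\<Sum>i<k. indicator (A i) x :: real)" for k x
    have F_eq: "F k = indicator (\<Union>i<k. A i)" for k
      unfolding F_def using A by (intro ext indicator_UN_disjoint[symmetric]) (auto simp: disjoint_family_on_def)
    have UA: "(\<Union>i<k. A i) \<in> sets ?S" for k :: nat using Ai by auto
    have Fb: "F k \<in> bounded_borel \<Omega>" for k unfolding F_eq by (intro bounded_borel_indicator UA)
    have part: "Lh (F k) = (\<Sum>i<k. \<mu> (A i))" for k
    proof (induction k)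
      case 0
      have "F 0 = (\<lambda>x. 0 * 0)" by (simp add: F_def fun_eq_iff)
      then show ?case using Lh_cmult[of "\<lambda>x. 0" 0] by simp
    next
      case (Suc k)
      have "F (Suc k) = (\<lambda>x. F k x + indicator (A k) x)" by (simp add: F_def fun_eq_iff)
      then show ?case using Suc Lh_add[OF Fb[of k] bounded_borel_indicator[OF Ai[of k]]] Ai
        by (simp add: \<mu>_def)
    qed
    have "(\<lambda>k. Lh (F k)) \<longlonglongrightarrow> Lh (indicator (\<Union>i. A i))"
    proof (rule Lh_lim[of _ 1])
      show "(\<lambda>k. F k x) \<longlonglongrightarrow> indicator (\<Union>i. A i) x" for x
      proof (cases "\<exists>i. x \<in> A i")
        case True
        then obtain i where i: "x \<in> A i" by auto
        have "\<forall>\<^sub>F k in sequentially. F k x = 1"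
          using eventually_gt_at_top[of i] by eventually_elim (use i in \<open>auto simp: F_eq indicator_def\<close>)
        then have "(\<lambda>k. F k x) \<longlonglongrightarrow> 1" by (rule tendsto_eventually)
        moreover have "indicator (\<Union>i. A i) x = (1::real)" using i by (auto simp: indicator_def)
        ultimately show ?thesis by simp
      next
        case False
        then have "F k x = 0" for k by (auto simp: F_eq indicator_def)
        with False show ?thesis by (auto simp: indicator_def)
      qed
    qed (auto simp: Fb, auto simp: F_eq indicator_def)
    moreover have "(\<Union>i. A i) \<in> sets ?S" using Ai by auto
    ultimately show "(\<lambda>i. \<mu> (A i)) sums \<mu> (\<Union>i. A i)"
      unfolding sums_def part[symmetric] by (simp add: \<mu>_def)
  qed (simp add: \<mu>_def)
  \<comment> \<open>The measure was defined from the values of \<open>Lh\<close> on indicators;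
    linearity and bounded continuity of both sides carry the equality to all bounded Borel
    functions.\<close>
  have "signed_integral \<Omega> \<mu> \<Omega> f = Lh f" if "f \<in> bounded_borel \<Omega>" for f
    using that
  proof (induction f rule: bounded_borel_induct_indicator)
    case (indicator A) then have "\<mu> A = Lh (indicator A)" by (simp add: \<mu>_def)
    with indicator show ?case by (simp add: signed_integral_indicator[OF \<mu>])
  next
    case (add f g) then show ?case by (simp add: signed_integral_add[OF \<mu>] Lh_add)
  next
    case (scale f c) then show ?case by (simp add: signed_integral_cmult[OF \<mu>] Lh_cmult)
  next
    case (lim F f B)
    have "(\<lambda>k. signed_integral \<Omega> \<mu> \<Omega> (F k)) \<longlonglongrightarrow> signed_integral \<Omega> \<mu> \<Omega> f"
      by (rule signed_integral_LIMSEQ[OF \<mu> lim.hyps])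
    then have "(\<lambda>k. Lh (F k)) \<longlonglongrightarrow> signed_integral \<Omega> \<mu> \<Omega> f" using lim.IH by simp
    then show ?case using Lh_lim[OF lim.hyps] by (rule LIMSEQ_unique)
  qed
  moreover have "Lh \<psi> = L \<psi>" if "\<psi> \<in> Cc \<Omega>" for \<psi>
    using Lh[OF Cb[OF that] that] by (simp add: N_def)
  ultimately show ?thesis using \<mu> Cb by (intro exI[of _ \<mu>]) auto
qed

text \<open>The limits of the approximations form a Cauchy sequence, and a three-part estimate shows
  that its limit is attained by \<open>u\<close>. It provides a limit for the pairing with test
  functions that are only continuous, where integration by parts gives no formula.\<close>

lemma tendsto_of_approximations:
  fixes u :: "'x \<Rightarrow> real"
  assumes F: "F \<noteq> bot"
    and approx: "\<And>e. 0 < e \<Longrightarrow> \<exists>v l. (v \<longlongrightarrow> l) F \<and> (\<forall>\<^sub>F x in F. \<bar>u x - v x\<bar> \<le> e)"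
  shows "\<exists>l. (u \<longlongrightarrow> l) F"
proof -
  have "\<exists>v l. (v \<longlongrightarrow> l) F \<and> (\<forall>\<^sub>F x in F. \<bar>u x - v x\<bar> \<le> inverse (real (Suc n)))" for n
    by (rule approx) simp
  then obtain v l where vl: "\<And>n. (v n \<longlongrightarrow> l n) F" "\<And>n. \<forall>\<^sub>F x in F. \<bar>u x - v n x\<bar> \<le> inverse (real (Suc n))"
    by metis
  have near: "\<bar>l m - l n\<bar> \<le> inverse (real (Suc m)) + inverse (real (Suc n))" for m n
  proof (rule tendsto_upperbound[OF _ _ F])
    show "((\<lambda>x. \<bar>v m x - v n x\<bar>) \<longlongrightarrow> \<bar>l m - l n\<bar>) F" by (intro tendsto_intros vl)
    show "\<forall>\<^sub>F x in F. \<bar>v m x - v n x\<bar> \<le> inverse (real (Suc m)) + inverse (real (Suc n))"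
      using vl(2)[of m] vl(2)[of n] by eventually_elim linarith
  qed
  have small: "\<exists>k. \<forall>n\<ge>k. inverse (real (Suc n)) < e" if "0 < e" for e :: real
    using reals_Archimedean[OF that]
    by (meson Suc_le_mono inverse_le_imp_le le_less_trans le_imp_inverse_le of_nat_0_less_iff of_nat_le_iff zero_less_Suc)
  have "Cauchy l"
  proof (rule CauchyI')
    fix e :: real assume "0 < e"
    then obtain k where k: "\<And>n. k \<le> n \<Longrightarrow> inverse (real (Suc n)) < e / 2" using small[of "e/2"] by auto
    show "\<exists>M. \<forall>m\<ge>M. \<forall>n>m. dist (l m) (l n) < e"
    proof (intro exI[of _ k] allI impI)
      fix m n assume "k \<le> m" "m < n"
      then show "dist (l m) (l n) < e" using near[of m n] k[of m] k[of n] by (simp add: dist_real_def)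
    qed
  qed
  then obtain L where L: "l \<longlonglongrightarrow> L" using Cauchy_convergent_iff convergent_def by blast
  have "(u \<longlongrightarrow> L) F"
  proof (rule tendstoI)
    fix e :: real assume e: "0 < e"
    obtain k where k: "\<And>n. k \<le> n \<Longrightarrow> inverse (real (Suc n)) < e / 3" using small[of "e/3"] e by auto
    have "\<forall>\<^sub>F n in sequentially. dist (l n) L < e / 3" using tendstoD[OF L, of "e/3"] e by simp
    then have "\<forall>\<^sub>F n in sequentially. k \<le> n \<and> dist (l n) L < e / 3"
      using eventually_ge_at_top[of k] by eventually_elim simp
    then obtain n where n: "k \<le> n" "dist (l n) L < e / 3" by (auto dest: eventually_happens)
    have "\<forall>\<^sub>F x in F. dist (v n x) (l n) < e / 3" using tendstoD[OF vl(1), of "e/3"] e by simp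
    with vl(2)[of n] show "\<forall>\<^sub>F x in F. dist (u x) L < e"
    proof eventually_elim
      case (elim x)
      then show ?case using n(2) k[OF n(1)] unfolding dist_real_def by linarith
    qed
  qed
  then show ?thesis ..
qed

subsection \<open>Divergence and pairing measures\<close>

lemma not_bot_at_right_0: "at_right (0::real) \<noteq> bot"
  by (simp add: trivial_limit_at_right_real)

lemma Cc_inf_Cc: "\<psi> \<in> Cc_inf \<Omega> \<Longrightarrow> \<psi> \<in> Cc \<Omega>"
  by (simp add: Cc_inf_def)

lemma Cc_inf_C1: "\<psi> \<in> Cc_inf \<Omega> \<Longrightarrow> C1 \<psi>"
  by (rule C_k_C1[of 0]) (simp add: Cc_inf_def del: C_k.simps)

locale dm_field = mollification \<rho> for \<rho> :: "'a::euclidean_space \<Rightarrow> real" +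
  fixes \<Omega> :: "'a set" and F :: "'a set \<Rightarrow> 'a"
  assumes open_\<Omega>: "open \<Omega>" and F: "F \<in> DM_ext \<Omega>"
begin

abbreviation "vint \<equiv> vector_integral \<Omega> F"
abbreviation "divF \<equiv> divergence \<Omega> F"
abbreviation "pair \<equiv> pairing \<rho> \<Omega> F"

lemma \<Omega>_borel: "\<Omega> \<in> sets borel"
  using open_\<Omega> by simp

lemma finite_vmeasure_component: "finite_vmeasure \<Omega> (\<lambda>A. F A \<bullet> i)"
  using F by (intro finite_vmeasure_inner) (simp add: DM_ext_def)

lemma finite_vmeasure_eqI_Cc_inf:
  assumes "finite_vmeasure \<Omega> \<mu>" "finite_vmeasure \<Omega> \<nu>"
    and "\<And>\<psi>. \<psi> \<in> Cc_inf \<Omega> \<Longrightarrow> signed_integral \<Omega> \<mu> \<Omega> \<psi> = signed_integral \<Omega> \<nu> \<Omega> \<psi>"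
  shows "\<mu> = \<nu>"
  by (rule finite_vmeasure_eqI_integral[OF \<Omega>_borel assms(1,2)])
    (rule signed_integral_eqI_Cc_inf[OF open_\<Omega> assms(1,2) order_refl assms(3)])

text \<open>Membership in \<open>DM_ext\<close> gives existence and smooth test functions give
  uniqueness, so the definite description denotes the divergence.\<close>

lemma is_divergence_divergence: "is_divergence \<Omega> F divF"
proof -
  obtain \<mu> where \<mu>: "is_divergence \<Omega> F \<mu>" using F by (auto simp: DM_ext_def)
  show ?thesis
    unfolding divergence_def
  proof (rule theI[where P="is_divergence \<Omega> F" and a=\<mu>])
    show "is_divergence \<Omega> F \<mu>" by fact
    fix \<nu> assume "is_divergence \<Omega> F \<nu>"
    with \<mu> show "\<nu> = \<mu>" by (intro finite_vmeasure_eqI_Cc_inf) (auto simp: is_divergence_def)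
  qed
qed

lemma finite_vmeasure_divergence: "finite_vmeasure \<Omega> divF"
  using is_divergence_divergence by (simp add: is_divergence_def)

section \<open>Integrals of bounded vector fields against F\<close>

definition bounded_field :: "('a \<Rightarrow> 'a) \<Rightarrow> bool" where
  "bounded_field G \<longleftrightarrow> (\<forall>i\<in>Basis. (\<lambda>x. G x \<bullet> i) \<in> bounded_borel \<Omega>)"

lemma bounded_fieldD: "bounded_field G \<Longrightarrow> i \<in> Basis \<Longrightarrow> (\<lambda>x. G x \<bullet> i) \<in> bounded_borel \<Omega>"
  by (simp add: bounded_field_def)

lemma vint_add:
  assumes "bounded_field G" "bounded_field H"
  shows "vint (\<lambda>x. G x + H x) = vint G + vint H"
  unfolding vector_integral_def inner_add_left
  by (simp add: signed_integral_add[OF finite_vmeasure_component] bounded_fieldD assms sum.distrib)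

lemma vint_diff:
  assumes "bounded_field G" "bounded_field H"
  shows "vint (\<lambda>x. G x - H x) = vint G - vint H"
  unfolding vector_integral_def inner_diff_left
  by (simp add: signed_integral_diff[OF finite_vmeasure_component] bounded_fieldD assms sum_subtractf)

lemma vint_cmult: "vint (\<lambda>x. c *\<^sub>R G x) = c * vint G"
  unfolding vector_integral_def inner_scaleR_left
  by (simp add: signed_integral_cmult[OF finite_vmeasure_component] sum_distrib_left)

lemma vint_uniform_limit:
  assumes "\<And>i. i \<in> Basis \<Longrightarrow> uniform_limit \<Omega> (\<lambda>d x. G d x \<bullet> i) (\<lambda>x. H x \<bullet> i) \<F>"
    and "\<forall>\<^sub>F d in \<F>. bounded_field (G d)" "bounded_field H"
  shows "((\<lambda>d. vint (G d)) \<longlongrightarrow> vint H) \<F>"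
  unfolding vector_integral_def
proof (rule tendsto_sum)
  fix i :: 'a assume i: "i \<in> Basis"
  show "((\<lambda>d. signed_integral \<Omega> (\<lambda>A. F A \<bullet> i) \<Omega> (\<lambda>x. G d x \<bullet> i)) \<longlongrightarrow>
      signed_integral \<Omega> (\<lambda>A. F A \<bullet> i) \<Omega> (\<lambda>x. H x \<bullet> i)) \<F>"
    using assms i
    by (intro signed_integral_uniform_limit[OF finite_vmeasure_component])
      (auto simp: bounded_field_def elim: eventually_mono)
qed

text \<open>Positive and negative variations of all components of \<open>F\<close>, indexed by basis
  vector and sign. Their sum stands in for the total variation of \<open>F\<close>; a finite family
  of dominating measures is the form that \<open>dominated_functional_measure\<close> takes.\<close>

definition component_var :: "'a \<times> bool \<Rightarrow> 'a measure" where
  "component_var p = (if snd p then pos_variation \<Omega> (\<lambda>A. F A \<bullet> fst p) else neg_variation \<Omega> (\<lambda>A. F A \<bullet> fst p))"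

definition total_var :: "('a \<Rightarrow> real) \<Rightarrow> real" where
  "total_var f = (\<Sum>p\<in>Basis \<times> UNIV. LINT x|component_var p. \<bar>f x\<bar>)"

lemma component_var:
  "finite_measure (component_var p)" "sets (component_var p) = sets (restrict_space borel \<Omega>)"
  using Jordan_decomposition(1,2)[OF finite_vmeasure_component] by (auto simp: component_var_def)

lemma total_var_eq:
  "total_var f = (\<Sum>i\<in>Basis. (LINT x|pos_variation \<Omega> (\<lambda>A. F A \<bullet> i). \<bar>f x\<bar>) + (LINT x|neg_variation \<Omega> (\<lambda>A. F A \<bullet> i). \<bar>f x\<bar>))"
  unfolding total_var_def sum.cartesian_product'
  by (simp add: UNIV_bool component_var_def add.commute)

lemma abs_vint_le:
  assumes g: "bounded_field G" and f: "f \<in> bounded_borel \<Omega>" and C: "0 \<le> C"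
    and le: "\<And>x. x \<in> \<Omega> \<Longrightarrow> norm (G x) \<le> C * \<bar>f x\<bar>"
  shows "\<bar>vint G\<bar> \<le> C * total_var f"
proof -
  have "\<bar>vint G\<bar> \<le> (\<Sum>i\<in>Basis. \<bar>signed_integral \<Omega> (\<lambda>A. F A \<bullet> i) \<Omega> (\<lambda>x. G x \<bullet> i)\<bar>)"
    unfolding vector_integral_def by (rule sum_abs)
  also have "\<dots> \<le> (\<Sum>i\<in>Basis. C * ((LINT x|pos_variation \<Omega> (\<lambda>A. F A \<bullet> i). \<bar>f x\<bar>) + (LINT x|neg_variation \<Omega> (\<lambda>A. F A \<bullet> i). \<bar>f x\<bar>)))"
  proof (rule sum_mono)
    fix i :: 'a assume i: "i \<in> Basis"
    note J = Jordan_decomposition(1,2)[OF finite_vmeasure_component[of i]]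
    have b: "(\<lambda>x. \<bar>G x \<bullet> i\<bar>) \<in> bounded_borel \<Omega>" "(\<lambda>x. C * \<bar>f x\<bar>) \<in> bounded_borel \<Omega>"
      using bounded_fieldD[OF g i] f by auto
    have le': "\<bar>G x \<bullet> i\<bar> \<le> C * \<bar>f x\<bar>" if "x \<in> \<Omega>" for x
      using Basis_le_norm[OF i, of "G x"] le[OF that] by linarith
    have "(LINT x|pos_variation \<Omega> (\<lambda>A. F A \<bullet> i). \<bar>G x \<bullet> i\<bar>) \<le> (LINT x|pos_variation \<Omega> (\<lambda>A. F A \<bullet> i). C * \<bar>f x\<bar>)"
      using b J le' by (intro integral_mono integrable_bounded_borel) auto
    moreover have "(LINT x|neg_variation \<Omega> (\<lambda>A. F A \<bullet> i). \<bar>G x \<bullet> i\<bar>) \<le> (LINT x|neg_variation \<Omega> (\<lambda>A. F A \<bullet> i). C * \<bar>f x\<bar>)"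
      using b J le' by (intro integral_mono integrable_bounded_borel) auto
    ultimately show "\<bar>signed_integral \<Omega> (\<lambda>A. F A \<bullet> i) \<Omega> (\<lambda>x. G x \<bullet> i)\<bar> \<le>
      C * ((LINT x|pos_variation \<Omega> (\<lambda>A. F A \<bullet> i). \<bar>f x\<bar>) + (LINT x|neg_variation \<Omega> (\<lambda>A. F A \<bullet> i). \<bar>f x\<bar>))"
      using abs_signed_integral_le[OF finite_vmeasure_component[of i], of "\<lambda>x. G x \<bullet> i"]
      by (simp add: distrib_left)
  qed
  also have "\<dots> = C * total_var f" unfolding total_var_eq by (simp add: sum_distrib_left)
  finally show ?thesis .
qed

lemma total_var_nonneg: "0 \<le> total_var f"
  unfolding total_var_def by (intro sum_nonneg integral_nonneg_AE) auto

lemma total_var_le: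
  assumes "f \<in> bounded_borel \<Omega>" "\<And>x. x \<in> \<Omega> \<Longrightarrow> \<bar>f x\<bar> \<le> e"
  shows "total_var f \<le> e * total_var (\<lambda>x. 1)"
  unfolding total_var_def sum_distrib_left
proof (rule sum_mono)
  fix p :: "'a \<times> bool"
  note cv = component_var[of p]
  have sp: "space (component_var p) = \<Omega>"
    using sets_eq_imp_space_eq[OF cv(2)] by (simp add: space_restrict_space)
  have "(LINT x|component_var p. \<bar>f x\<bar>) \<le> (LINT x|component_var p. e * \<bar>1\<bar>)"
    using assms cv sp by (intro integral_mono integrable_bounded_borel[OF _ cv]) auto
  then show "(LINT x|component_var p. \<bar>f x\<bar>) \<le> e * (LINT x|component_var p. \<bar>1\<bar>)" by (simp add: mult.commute)
qed

lemma Cc_scaleR_field: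
  assumes "\<psi> \<in> Cc \<Omega>" "continuous_on UNIV G"
  shows "bounded_field (\<lambda>x. \<psi> x *\<^sub>R G x)"
  unfolding bounded_field_def
proof
  fix i :: 'a assume "i \<in> Basis"
  have "(\<lambda>x. (G x \<bullet> i) * \<psi> x) \<in> Cc \<Omega>" using assms by (intro Cc_mult continuous_intros)
  then show "(\<lambda>x. \<psi> x *\<^sub>R G x \<bullet> i) \<in> bounded_borel \<Omega>"
    using Cc_bounded_borel by (simp add: mult.commute)
qed

lemma scaleR_Cc_field:
  assumes "\<And>i. i \<in> Basis \<Longrightarrow> (\<lambda>x. G x \<bullet> i) \<in> Cc \<Omega>" "continuous_on UNIV \<psi>"
  shows "bounded_field (\<lambda>x. \<psi> x *\<^sub>R G x)"
  unfolding bounded_field_def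
proof
  fix i :: 'a assume "i \<in> Basis"
  then have "(\<lambda>x. \<psi> x * (G x \<bullet> i)) \<in> Cc \<Omega>" using assms by (intro Cc_mult)
  then show "(\<lambda>x. \<psi> x *\<^sub>R G x \<bullet> i) \<in> bounded_borel \<Omega>"
    using Cc_bounded_borel by simp
qed

lemma Cc_field: "(\<And>i. i \<in> Basis \<Longrightarrow> (\<lambda>x. G x \<bullet> i) \<in> Cc \<Omega>) \<Longrightarrow> bounded_field G"
  unfolding bounded_field_def using Cc_bounded_borel by blast

text \<open>The cutoffs built from the mollified distance are only C1, as the weight whose primitive
  they use is merely continuous. Mollifying them leads back to \<open>Cc_inf\<close>, and function
  and gradient converge uniformly.\<close>

lemma divergence_C1:
  assumes \<psi>: "C1 \<psi>" "\<psi> \<in> Cc \<Omega>"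
  shows "signed_integral \<Omega> divF \<Omega> \<psi> = - vint (grad \<psi>)"
proof (rule tendsto_unique[OF not_bot_at_right_0])
  let ?\<psi> = "\<lambda>\<delta>. mollify \<rho> UNIV \<delta> \<psi>"
  have \<psi>U: "\<psi> \<in> Cc UNIV" using \<psi>(2) Cc_mono[of \<Omega> UNIV] by auto
  have ev: "\<forall>\<^sub>F \<delta> in at_right 0. ?\<psi> \<delta> \<in> Cc_inf \<Omega>"
  proof (rule mollify_Cc[OF open_\<Omega> \<psi>(2)])
    fix K assume "\<forall>\<^sub>F \<delta> in at_right 0. ?\<psi> \<delta> \<in> Cc_inf \<Omega> \<and> (\<forall>x. x \<notin> K \<longrightarrow> ?\<psi> \<delta> x = 0)"
    then show ?thesis by eventually_elim simp
  qed
  then have ev': "\<forall>\<^sub>F \<delta> in at_right 0. ?\<psi> \<delta> \<in> bounded_borel \<Omega>"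
    by eventually_elim (rule Cc_bounded_borel[of _ \<Omega>], simp add: Cc_inf_def)
  have "uniform_limit \<Omega> ?\<psi> \<psi> (at_right 0)"
    using mollify_Cc_uniform_limit[OF \<psi>U] by (rule uniform_limit_on_subset) simp
  then show "((\<lambda>\<delta>. signed_integral \<Omega> divF \<Omega> (?\<psi> \<delta>)) \<longlongrightarrow> signed_integral \<Omega> divF \<Omega> \<psi>) (at_right 0)"
    using ev' Cc_bounded_borel[OF \<psi>(2)]
    by (rule signed_integral_uniform_limit[OF finite_vmeasure_divergence])
  have "((\<lambda>\<delta>. vint (grad (?\<psi> \<delta>))) \<longlongrightarrow> vint (grad \<psi>)) (at_right 0)"
  proof (rule vint_uniform_limit)
    fix i :: 'a assume i: "i \<in> Basis"
    have g: "(\<lambda>x. grad \<psi> x \<bullet> i) \<in> Cc UNIV" by (rule Cc_grad_inner[OF \<psi>(1) \<psi>U])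
    have "uniform_limit \<Omega> (\<lambda>\<delta>. mollify \<rho> UNIV \<delta> (\<lambda>x. grad \<psi> x \<bullet> i)) (\<lambda>x. grad \<psi> x \<bullet> i) (at_right 0)"
      using mollify_Cc_uniform_limit[OF g] by (rule uniform_limit_on_subset) simp
    moreover have "\<forall>\<^sub>F \<delta> in at_right 0. \<forall>x\<in>\<Omega>. mollify \<rho> UNIV \<delta> (\<lambda>x. grad \<psi> x \<bullet> i) x = grad (?\<psi> \<delta>) x \<bullet> i"
      using eventually_at_right_less[OF zero_less_one]
      by (rule eventually_mono) (auto simp: grad_mollify_inner_C1[OF \<psi>(1) \<psi>U])
    ultimately show "uniform_limit \<Omega> (\<lambda>\<delta> x. grad (?\<psi> \<delta>) x \<bullet> i) (\<lambda>x. grad \<psi> x \<bullet> i) (at_right 0)"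
      by (subst (asm) uniform_limit_cong[where g="\<lambda>\<delta> x. grad (?\<psi> \<delta>) x \<bullet> i" and i="\<lambda>x. grad \<psi> x \<bullet> i"]) auto
  next
    show "\<forall>\<^sub>F \<delta> in at_right 0. bounded_field (grad (?\<psi> \<delta>))"
      using ev
    proof eventually_elim
      case (elim \<delta>)
      then show ?case by (intro Cc_field Cc_grad_inner Cc_inf_C1 Cc_inf_Cc)
    qed
    show "bounded_field (grad \<psi>)" by (intro Cc_field Cc_grad_inner \<psi>)
  qed
  then have "((\<lambda>\<delta>. - vint (grad (?\<psi> \<delta>))) \<longlongrightarrow> - vint (grad \<psi>)) (at_right 0)"
    by (rule tendsto_minus)
  moreover have "\<forall>\<^sub>F \<delta> in at_right 0. - vint (grad (?\<psi> \<delta>)) = signed_integral \<Omega> divF \<Omega> (?\<psi> \<delta>)"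
    using ev by eventually_elim (use is_divergence_divergence in \<open>simp add: is_divergence_def\<close>)
  ultimately show "((\<lambda>\<delta>. signed_integral \<Omega> divF \<Omega> (?\<psi> \<delta>)) \<longlongrightarrow> - vint (grad \<psi>)) (at_right 0)"
    by (rule Lim_transform_eventually)
qed

text \<open>The gradient is moved from \<open>f\<close> to \<open>\<psi>\<close>; afterwards uniform
  convergence of the values of \<open>f\<close> is enough to pass to limits.\<close>

lemma divergence_product:
  assumes f: "C1 f" and \<psi>: "C1 \<psi>" "\<psi> \<in> Cc \<Omega>"
  shows "vint (\<lambda>x. \<psi> x *\<^sub>R grad f x) = - signed_integral \<Omega> divF \<Omega> (\<lambda>x. f x * \<psi> x) - vint (\<lambda>x. f x *\<^sub>R grad \<psi> x)"
proof -
  have "(\<lambda>x. f x * \<psi> x) \<in> Cc \<Omega>" using \<psi>(2) C1_continuous[OF f] by (rule Cc_mult)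
  with C1_mult[OF f \<psi>(1)]
  have "signed_integral \<Omega> divF \<Omega> (\<lambda>x. f x * \<psi> x) = - vint (\<lambda>x. f x *\<^sub>R grad \<psi> x + \<psi> x *\<^sub>R grad f x)"
    using divergence_C1[of "\<lambda>x. f x * \<psi> x"] by simp
  also have "\<dots> = - (vint (\<lambda>x. f x *\<^sub>R grad \<psi> x) + vint (\<lambda>x. \<psi> x *\<^sub>R grad f x))"
    using vint_add[OF scaleR_Cc_field[OF Cc_grad_inner[OF \<psi>] C1_continuous[OF f]]
      Cc_scaleR_field[OF \<psi>(2) C1_continuous_grad[OF f]]] by simp
  finally show ?thesis by simp
qed

text \<open>The first factor converges only on \<open>K\<close>; off \<open>K\<close> the second
  factor vanishes, so nothing is asked of the first one there.\<close>

lemma uniform_limit_mult_vanishing: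
  fixes u v :: "real \<Rightarrow> 'b \<Rightarrow> real"
  assumes u: "uniform_limit K u f G" and v: "uniform_limit K v g G"
    and bdd: "bounded (f ` K)" "bounded (g ` K)"
    and z: "\<forall>\<^sub>F d in G. \<forall>x\<in>S. x \<notin> K \<longrightarrow> v d x = 0" "\<And>x. x \<in> S \<Longrightarrow> x \<notin> K \<Longrightarrow> g x = 0"
  shows "uniform_limit S (\<lambda>d x. u d x * v d x) (\<lambda>x. f x * g x) G"
proof (rule uniform_limitI)
  fix e :: real assume e: "0 < e"
  have "uniform_limit K (\<lambda>d x. u d x * v d x) (\<lambda>x. f x * g x) G"
    using u v bdd by (intro uniform_lim_mult)
  then have "\<forall>\<^sub>F d in G. \<forall>x\<in>K. dist (u d x * v d x) (f x * g x) < e" using e by (rule uniform_limitD)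
  with z(1) show "\<forall>\<^sub>F d in G. \<forall>x\<in>S. dist (u d x * v d x) (f x * g x) < e"
  proof eventually_elim
    case (elim d)
    show ?case
    proof
      fix x assume "x \<in> S"
      then show "dist (u d x * v d x) (f x * g x) < e"
        using elim z(2)[of x] e by (cases "x \<in> K") auto
    qed
  qed
qed

section \<open>The mollified pairing and its limit\<close>

definition pre_pair :: "('a \<Rightarrow> real) \<Rightarrow> ('a \<Rightarrow> real) \<Rightarrow> real \<Rightarrow> real" where
  "pre_pair \<phi> \<psi> \<delta> = vint (\<lambda>x. \<psi> x *\<^sub>R grad (mollify \<rho> \<Omega> \<delta> \<phi>) x)"

lemma pairableD:
  assumes "pairable \<Omega> \<phi>"
  shows "continuous_on \<Omega> \<phi>" "locally_bounded (zero_ext \<Omega> \<phi>)"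
    "\<exists>C\<ge>0. \<forall>K. compact K \<longrightarrow> K \<subseteq> \<Omega> \<longrightarrow>
      (\<forall>\<^sub>F \<delta> in at_right 0. \<forall>x\<in>K. norm (grad (mollify \<rho> \<Omega> \<delta> \<phi>) x) \<le> C)"
proof -
  show "continuous_on \<Omega> \<phi>" "locally_bounded (zero_ext \<Omega> \<phi>)" using assms by (auto simp: pairable_def)
  obtain C where C: "\<And>K. compact K \<Longrightarrow> K \<subseteq> \<Omega> \<Longrightarrow> \<forall>\<^sub>F \<delta> in at_right 0. \<forall>x\<in>K. norm (grad (mollify \<rho> \<Omega> \<delta> \<phi>) x) \<le> C"
    using assms unfolding pairable_def by blast
  show "\<exists>C\<ge>0. \<forall>K. compact K \<longrightarrow> K \<subseteq> \<Omega> \<longrightarrow>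
      (\<forall>\<^sub>F \<delta> in at_right 0. \<forall>x\<in>K. norm (grad (mollify \<rho> \<Omega> \<delta> \<phi>) x) \<le> C)"
  proof (intro exI[of _ "\<bar>C\<bar>"] conjI allI impI)
    fix K assume "compact K" "K \<subseteq> \<Omega>"
    from C[OF this] show "\<forall>\<^sub>F \<delta> in at_right 0. \<forall>x\<in>K. norm (grad (mollify \<rho> \<Omega> \<delta> \<phi>) x) \<le> \<bar>C\<bar>"
      by eventually_elim (meson abs_ge_self order_trans)
  qed simp
qed

lemma pairable_field:
  assumes "pairable \<Omega> \<phi>" "\<psi> \<in> Cc \<Omega>" "0 < \<delta>"
  shows "bounded_field (\<lambda>x. \<psi> x *\<^sub>R grad (mollify \<rho> \<Omega> \<delta> \<phi>) x)"
  using assms pairableD(2)[OF assms(1)] by (intro Cc_scaleR_field C1_continuous_grad C1_mollify)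

text \<open>Quantifying over the test functions inside one predicate of \<open>\<delta>\<close>
  makes the threshold for \<open>\<delta>\<close> depend on the support \<open>K\<close> alone, so
  that the test function may itself vary with \<open>\<delta>\<close>.\<close>

definition pre_pair_bounded :: "('a \<Rightarrow> real) \<Rightarrow> real \<Rightarrow> 'a set \<Rightarrow> real \<Rightarrow> bool" where
  "pre_pair_bounded \<phi> C K \<delta> \<longleftrightarrow>
    0 < \<delta> \<and> (\<forall>\<psi>. \<psi> \<in> Cc \<Omega> \<longrightarrow> (\<forall>x. x \<notin> K \<longrightarrow> \<psi> x = 0) \<longrightarrow> \<bar>pre_pair \<phi> \<psi> \<delta>\<bar> \<le> C * total_var \<psi>)"

lemma pre_pair_boundedD:
  assumes "pre_pair_bounded \<phi> C K \<delta>"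
  shows "0 < \<delta>" "\<psi> \<in> Cc \<Omega> \<Longrightarrow> (\<And>x. x \<notin> K \<Longrightarrow> \<psi> x = 0) \<Longrightarrow> \<bar>pre_pair \<phi> \<psi> \<delta>\<bar> \<le> C * total_var \<psi>"
  using assms by (auto simp: pre_pair_bounded_def)

text \<open>The constant is fixed before \<open>K\<close>, because the limit functional must be
  dominated by one multiple of \<open>total_var\<close> on all of \<open>Cc\<close>.\<close>

lemma pre_pair_bound:
  assumes \<phi>: "pairable \<Omega> \<phi>"
  obtains C where "0 \<le> C"
    "\<And>K. compact K \<Longrightarrow> K \<subseteq> \<Omega> \<Longrightarrow> \<forall>\<^sub>F \<delta> in at_right 0. pre_pair_bounded \<phi> C K \<delta>"
proof -
  obtain C where C: "0 \<le> C" "\<And>K. compact K \<Longrightarrow> K \<subseteq> \<Omega> \<Longrightarrow> \<forall>\<^sub>F \<delta> in at_right 0. \<forall>x\<in>K. norm (grad (mollify \<rho> \<Omega> \<delta> \<phi>) x) \<le> C"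
    using pairableD(3)[OF \<phi>] by blast
  show ?thesis
  proof (rule that[OF C(1)])
    fix K assume K: "compact K" "K \<subseteq> \<Omega>"
    have "\<forall>\<^sub>F \<delta> in at_right (0::real). 0 < \<delta> \<and> \<delta> < 1" by (rule eventually_at_right_less) simp
    with C(2)[OF K] show "\<forall>\<^sub>F \<delta> in at_right 0. pre_pair_bounded \<phi> C K \<delta>"
    proof eventually_elim
      case (elim \<delta>)
      show ?case
        unfolding pre_pair_bounded_def
      proof (intro conjI allI impI)
        show "0 < \<delta>" using elim by simp
        fix \<psi> assume \<psi>: "\<psi> \<in> Cc \<Omega>" and z: "\<forall>x. x \<notin> K \<longrightarrow> \<psi> x = 0"
        show "\<bar>pre_pair \<phi> \<psi> \<delta>\<bar> \<le> C * total_var \<psi>"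
          unfolding pre_pair_def
        proof (rule abs_vint_le[OF pairable_field[OF \<phi> \<psi>] Cc_bounded_borel[OF \<psi>] C(1)])
          show "0 < \<delta>" using elim by simp
          fix x
          show "norm (\<psi> x *\<^sub>R grad (mollify \<rho> \<Omega> \<delta> \<phi>) x) \<le> C * \<bar>\<psi> x\<bar>"
          proof (cases "x \<in> K")
            case True
            then have "\<bar>\<psi> x\<bar> * norm (grad (mollify \<rho> \<Omega> \<delta> \<phi>) x) \<le> \<bar>\<psi> x\<bar> * C"
              using elim by (intro mult_left_mono) auto
            then show ?thesis by (simp add: mult.commute)
          qed (use z in simp)
        qed
      qed
    qed
  qed
qed

lemma pre_pair_diff:
  assumes "pairable \<Omega> \<phi>" "\<psi> \<in> Cc \<Omega>" "\<theta> \<in> Cc \<Omega>" "0 < \<delta>"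
  shows "pre_pair \<phi> (\<lambda>x. \<psi> x - \<theta> x) \<delta> = pre_pair \<phi> \<psi> \<delta> - pre_pair \<phi> \<theta> \<delta>"
  unfolding pre_pair_def scaleR_diff_left by (intro vint_diff pairable_field assms)

text \<open>Integration by parts removes the gradient of the mollified \<open>\<phi>\<close>. What
  remains involves only its values, which converge uniformly on the support of
  \<open>\<psi>\<close>.\<close>

lemma pre_pair_tendsto_C1:
  assumes \<phi>: "pairable \<Omega> \<phi>" and \<psi>: "C1 \<psi>" "\<psi> \<in> Cc \<Omega>"
  shows "(pre_pair \<phi> \<psi> \<longlongrightarrow> - signed_integral \<Omega> divF \<Omega> (\<lambda>x. \<phi> x * \<psi> x) - vint (\<lambda>x. \<phi> x *\<^sub>R grad \<psi> x)) (at_right 0)"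
proof -
  note p = pairableD[OF \<phi>]
  obtain K where K: "compact K" "K \<subseteq> \<Omega>" "\<And>x. x \<notin> K \<Longrightarrow> \<psi> x = 0" using CcE[OF \<psi>(2)] by metis
  have gz: "grad \<psi> x = 0" if "x \<notin> K" for x
    using grad_zero_on_open[of "- K" x \<psi>] that K compact_imp_closed[OF K(1)] by (simp add: open_Compl)
  have ul: "uniform_limit K (\<lambda>\<delta>. mollify \<rho> \<Omega> \<delta> \<phi>) \<phi> (at_right 0)"
    by (rule mollify_uniform_limit[OF open_\<Omega> p(1,2) K(1,2)])
  have bK: "bounded (\<phi> ` K)"
    using p(1) K by (intro compact_imp_bounded compact_continuous_image) (auto intro: continuous_on_subset)
  have bC: "bounded (g ` K)" if "g \<in> Cc \<Omega>" for g
    using Cc_bounded[OF that] unfolding bounded_iff by (metis image_iff real_norm_def)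
  have lim: "uniform_limit \<Omega> (\<lambda>\<delta> x. mollify \<rho> \<Omega> \<delta> \<phi> x * g x) (\<lambda>x. \<phi> x * g x) (at_right 0)"
    if "g \<in> Cc \<Omega>" "\<And>x. x \<notin> K \<Longrightarrow> g x = 0" for g
    by (rule uniform_limit_mult_vanishing[OF ul uniform_limit_const bK bC[OF that(1)]]) (use that in auto)
  have bb: "(\<lambda>x. \<phi> x * g x) \<in> bounded_borel \<Omega>"
    if "g \<in> Cc \<Omega>" "\<And>x. x \<notin> K \<Longrightarrow> g x = 0" for g
  proof (rule bounded_borel_continuous)
    show "continuous_on \<Omega> (\<lambda>x. \<phi> x * g x)"
      using p(1) Cc_continuous[OF that(1)] by (intro continuous_intros) (auto intro: continuous_on_subset)
    have bg: "bounded (g ` K)" by (rule bC[OF that(1)])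
    have "bounded ((\<lambda>x. \<phi> x * g x) ` K)"
    proof -
      obtain a b where ab: "\<And>x. x \<in> K \<Longrightarrow> \<bar>\<phi> x\<bar> \<le> a" "\<And>x. x \<in> K \<Longrightarrow> \<bar>g x\<bar> \<le> b"
        using bK bg by (auto simp: bounded_iff)
      have "\<bar>\<phi> x * g x\<bar> \<le> \<bar>a\<bar> * \<bar>b\<bar>" if "x \<in> K" for x
        unfolding abs_mult using ab[OF that] by (intro mult_mono) auto
      then show ?thesis by (auto simp: bounded_iff)
    qed
    \<comment> \<open>Off \<open>K\<close> the product is 0, so its range on \<open>\<Omega>\<close>
      contains at most this further value.\<close>
    then have "bounded (insert 0 ((\<lambda>x. \<phi> x * g x) ` K))" by simp
    then show "bounded ((\<lambda>x. \<phi> x * g x) ` \<Omega>)" 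
    proof (rule bounded_subset, intro subsetI)
      fix y assume "y \<in> (\<lambda>x. \<phi> x * g x) ` \<Omega>"
      then obtain x where x: "y = \<phi> x * g x" by blast
      show "y \<in> insert 0 ((\<lambda>x. \<phi> x * g x) ` K)"
        using x that(2)[of x] by (cases "x \<in> K") auto
    qed
  qed
  have ev1: "\<forall>\<^sub>F \<delta> in at_right (0::real). 0 < \<delta> \<and> \<delta> < 1" by (rule eventually_at_right_less) simp
  have "((\<lambda>\<delta>. signed_integral \<Omega> divF \<Omega> (\<lambda>x. mollify \<rho> \<Omega> \<delta> \<phi> x * \<psi> x)) \<longlongrightarrow>
      signed_integral \<Omega> divF \<Omega> (\<lambda>x. \<phi> x * \<psi> x)) (at_right 0)"
  proof (rule signed_integral_uniform_limit[OF finite_vmeasure_divergence lim])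
    show "\<forall>\<^sub>F \<delta> in at_right 0. (\<lambda>x. mollify \<rho> \<Omega> \<delta> \<phi> x * \<psi> x) \<in> bounded_borel \<Omega>"
      using ev1 by eventually_elim
        (intro Cc_bounded_borel[of _ \<Omega>] Cc_mult \<psi> C1_continuous C1_mollify p(2), simp)
  qed (use \<psi> K bb in auto)
  moreover have "((\<lambda>\<delta>. vint (\<lambda>x. mollify \<rho> \<Omega> \<delta> \<phi> x *\<^sub>R grad \<psi> x)) \<longlongrightarrow> vint (\<lambda>x. \<phi> x *\<^sub>R grad \<psi> x)) (at_right 0)"
  proof (rule vint_uniform_limit)
    fix i :: 'a assume i: "i \<in> Basis"
    show "uniform_limit \<Omega> (\<lambda>\<delta> x. mollify \<rho> \<Omega> \<delta> \<phi> x *\<^sub>R grad \<psi> x \<bullet> i) (\<lambda>x. \<phi> x *\<^sub>R grad \<psi> x \<bullet> i) (at_right 0)"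
      unfolding inner_scaleR_left by (rule lim[OF Cc_grad_inner[OF \<psi>]]) (simp add: gz)
  next
    show "\<forall>\<^sub>F \<delta> in at_right 0. bounded_field (\<lambda>x. mollify \<rho> \<Omega> \<delta> \<phi> x *\<^sub>R grad \<psi> x)"
      using ev1 by eventually_elim
        (intro scaleR_Cc_field Cc_grad_inner \<psi> C1_continuous C1_mollify p(2), simp)
    show "bounded_field (\<lambda>x. \<phi> x *\<^sub>R grad \<psi> x)"
      unfolding bounded_field_def inner_scaleR_left
      by (intro ballI bb Cc_grad_inner \<psi>) (simp add: gz)
  qed
  ultimately have "((\<lambda>\<delta>. - signed_integral \<Omega> divF \<Omega> (\<lambda>x. mollify \<rho> \<Omega> \<delta> \<phi> x * \<psi> x) - vint (\<lambda>x. mollify \<rho> \<Omega> \<delta> \<phi> x *\<^sub>R grad \<psi> x))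
     \<longlongrightarrow> - signed_integral \<Omega> divF \<Omega> (\<lambda>x. \<phi> x * \<psi> x) - vint (\<lambda>x. \<phi> x *\<^sub>R grad \<psi> x)) (at_right 0)"
    by (intro tendsto_intros)
  moreover have "\<forall>\<^sub>F \<delta> in at_right 0. - signed_integral \<Omega> divF \<Omega> (\<lambda>x. mollify \<rho> \<Omega> \<delta> \<phi> x * \<psi> x) - vint (\<lambda>x. mollify \<rho> \<Omega> \<delta> \<phi> x *\<^sub>R grad \<psi> x) = pre_pair \<phi> \<psi> \<delta>"
    using ev1
  proof eventually_elim
    case (elim \<delta>)
    then have "C1 (mollify \<rho> \<Omega> \<delta> \<phi>)" using C1_mollify[OF p(2)] by simp
    from divergence_product[OF this \<psi>] show ?case by (simp add: pre_pair_def)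
  qed
  ultimately show ?thesis by (rule Lim_transform_eventually)
qed

text \<open>A mollification of \<open>\<psi>\<close> at one fixed scale is C1, and its error in the
  pairing is bounded, uniformly in small \<open>\<delta>\<close>, by the sup distance times a
  multiple of the mass of the component variations.\<close>

lemma pre_pair_convergent:
  assumes \<phi>: "pairable \<Omega> \<phi>" and \<psi>: "\<psi> \<in> Cc \<Omega>"
  shows "\<exists>l. (pre_pair \<phi> \<psi> \<longlongrightarrow> l) (at_right 0)"
proof (rule tendsto_of_approximations[OF not_bot_at_right_0])
  fix e :: real assume e: "0 < e"
  obtain C where C: "0 \<le> C"
    "\<And>K. compact K \<Longrightarrow> K \<subseteq> \<Omega> \<Longrightarrow> \<forall>\<^sub>F \<delta> in at_right 0. pre_pair_bounded \<phi> C K \<delta>"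
    using pre_pair_bound[OF \<phi>] by blast
  define M where "M = C * total_var (\<lambda>x. 1)"
  have M: "0 \<le> M" using C(1) total_var_nonneg by (simp add: M_def)
  define e' where "e' = e / (M + 1)"
  have e': "0 < e'" "M * e' \<le> e" using M e by (auto simp: e'_def field_simps)
  obtain K where K: "compact K" "K \<subseteq> \<Omega>" "\<And>x. x \<notin> K \<Longrightarrow> \<psi> x = 0"
    "\<forall>\<^sub>F \<delta> in at_right 0. mollify \<rho> UNIV \<delta> \<psi> \<in> Cc_inf \<Omega> \<and> (\<forall>x. x \<notin> K \<longrightarrow> mollify \<rho> UNIV \<delta> \<psi> x = 0)"
    by (rule mollify_Cc[OF open_\<Omega> \<psi>]) blast
  have "\<psi> \<in> Cc UNIV" using \<psi> Cc_mono[of \<Omega> UNIV] by auto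
  from uniform_limitD[OF mollify_Cc_uniform_limit[OF this] e'(1)] K(4)
  have "\<forall>\<^sub>F \<delta> in at_right 0. (\<forall>x. dist (mollify \<rho> UNIV \<delta> \<psi> x) (\<psi> x) < e') \<and>
     mollify \<rho> UNIV \<delta> \<psi> \<in> Cc_inf \<Omega> \<and> (\<forall>x. x \<notin> K \<longrightarrow> mollify \<rho> UNIV \<delta> \<psi> x = 0)"
    by eventually_elim simp
  then obtain \<delta>0 where d0: "\<And>x. dist (mollify \<rho> UNIV \<delta>0 \<psi> x) (\<psi> x) < e'"
     "mollify \<rho> UNIV \<delta>0 \<psi> \<in> Cc_inf \<Omega>" "\<And>x. x \<notin> K \<Longrightarrow> mollify \<rho> UNIV \<delta>0 \<psi> x = 0"
    using eventually_happens'[OF not_bot_at_right_0] by blast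
  define \<theta> where "\<theta> = mollify \<rho> UNIV \<delta>0 \<psi>"
  have \<theta>: "C1 \<theta>" "\<theta> \<in> Cc \<Omega>" using d0(2) Cc_inf_C1 Cc_inf_Cc by (auto simp: \<theta>_def)
  have d\<theta>: "\<bar>\<psi> x - \<theta> x\<bar> \<le> e'" for x using d0(1)[of x] by (simp add: \<theta>_def dist_real_def abs_minus_commute less_imp_le)
  have "\<forall>\<^sub>F \<delta> in at_right 0. \<bar>pre_pair \<phi> \<psi> \<delta> - pre_pair \<phi> \<theta> \<delta>\<bar> \<le> e"
    using C(2)[OF K(1,2)]
  proof eventually_elim
    case (elim \<delta>)
    have diff: "(\<lambda>x. \<psi> x - \<theta> x) \<in> Cc \<Omega>" using \<psi> \<theta>(2) by (rule Cc_diff)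
    have z: "\<psi> x - \<theta> x = 0" if "x \<notin> K" for x using that K(3) d0(3) by (simp add: \<theta>_def)
    have "\<bar>pre_pair \<phi> (\<lambda>x. \<psi> x - \<theta> x) \<delta>\<bar> \<le> C * total_var (\<lambda>x. \<psi> x - \<theta> x)"
      using pre_pair_boundedD(2)[OF elim diff z] .
    also have "\<dots> \<le> C * (e' * total_var (\<lambda>x. 1))"
      by (intro mult_left_mono C(1) total_var_le Cc_bounded_borel[OF diff] d\<theta>)
    also have "\<dots> \<le> e" using e'(2) by (simp add: M_def mult_ac)
    finally show ?case using pre_pair_diff[OF \<phi> \<psi> \<theta>(2) pre_pair_boundedD(1)[OF elim]] by simp
  qed
  with pre_pair_tendsto_C1[OF \<phi> \<theta>]
  show "\<exists>v l. (v \<longlongrightarrow> l) (at_right 0) \<and> (\<forall>\<^sub>F \<delta> in at_right 0. \<bar>pre_pair \<phi> \<psi> \<delta> - v \<delta>\<bar> \<le> e)" by blast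
qed

text \<open>The gradient bound survives the limit, so the limit functional is dominated by the
  component variations of \<open>F\<close> and hence given by a measure.\<close>

lemma pairing_exists:
  assumes \<phi>: "pairable \<Omega> \<phi>"
  shows "\<exists>\<mu>. is_pairing \<rho> \<Omega> F \<phi> \<mu>"
proof -
  obtain C where C: "0 \<le> C"
    "\<And>K. compact K \<Longrightarrow> K \<subseteq> \<Omega> \<Longrightarrow> \<forall>\<^sub>F \<delta> in at_right 0. pre_pair_bounded \<phi> C K \<delta>"
    using pre_pair_bound[OF \<phi>] by blast
  obtain L where L: "\<And>\<psi>. \<psi> \<in> Cc \<Omega> \<Longrightarrow> (pre_pair \<phi> \<psi> \<longlongrightarrow> L \<psi>) (at_right 0)"
    using pre_pair_convergent[OF \<phi>] by metis
  have ev1: "\<forall>\<^sub>F \<delta> in at_right (0::real). 0 < \<delta> \<and> \<delta> < 1" by (rule eventually_at_right_less) simp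
  have "\<exists>\<mu>. finite_vmeasure \<Omega> \<mu> \<and> (\<forall>\<psi>\<in>Cc \<Omega>. signed_integral \<Omega> \<mu> \<Omega> \<psi> = L \<psi>)"
  proof (rule dominated_functional_measure[OF open_\<Omega>, of "Basis \<times> UNIV" component_var])
    show "finite (Basis \<times> UNIV :: ('a \<times> bool) set)" by simp
    show "finite_measure (component_var p)" "sets (component_var p) = sets (restrict_space borel \<Omega>)" for p
      by (rule component_var)+
    show "0 \<le> C" by fact
    fix \<psi> :: "'a \<Rightarrow> real" assume \<psi>: "\<psi> \<in> Cc \<Omega>"
    show "\<bar>L \<psi>\<bar> \<le> C * (\<Sum>p\<in>Basis \<times> UNIV. LINT x|component_var p. \<bar>\<psi> x\<bar>)"
    proof (rule tendsto_upperbound[OF tendsto_rabs[OF L[OF \<psi>]] _ not_bot_at_right_0])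
      obtain K where K: "compact K" "K \<subseteq> \<Omega>" "\<And>x. x \<notin> K \<Longrightarrow> \<psi> x = 0" using CcE[OF \<psi>] by metis
      show "\<forall>\<^sub>F \<delta> in at_right 0. \<bar>pre_pair \<phi> \<psi> \<delta>\<bar> \<le> C * (\<Sum>p\<in>Basis \<times> UNIV. LINT x|component_var p. \<bar>\<psi> x\<bar>)"
        using C(2)[OF K(1,2)] by eventually_elim (use pre_pair_boundedD(2)[OF _ \<psi> K(3)] in \<open>simp add: total_var_def\<close>)
    qed
    show "L (\<lambda>x. c * \<psi> x) = c * L \<psi>" for c
    proof (rule tendsto_unique[OF not_bot_at_right_0 L[OF Cc_cmult[OF \<psi>]]])
      have "pre_pair \<phi> (\<lambda>x. c * \<psi> x) = (\<lambda>\<delta>. c * pre_pair \<phi> \<psi> \<delta>)"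
        unfolding pre_pair_def scaleR_scaleR[symmetric] vint_cmult ..
      then show "(pre_pair \<phi> (\<lambda>x. c * \<psi> x) \<longlongrightarrow> c * L \<psi>) (at_right 0)"
        by (simp add: tendsto_mult_left L[OF \<psi>])
    qed
    fix \<theta> :: "'a \<Rightarrow> real" assume \<theta>: "\<theta> \<in> Cc \<Omega>"
    show "L (\<lambda>x. \<psi> x + \<theta> x) = L \<psi> + L \<theta>"
    proof (rule tendsto_unique[OF not_bot_at_right_0 L[OF Cc_add[OF \<psi> \<theta>]]])
      have "((\<lambda>\<delta>. pre_pair \<phi> \<psi> \<delta> + pre_pair \<phi> \<theta> \<delta>) \<longlongrightarrow> L \<psi> + L \<theta>) (at_right 0)"
        by (intro tendsto_add L \<psi> \<theta>)
      moreover have "\<forall>\<^sub>F \<delta> in at_right 0. pre_pair \<phi> \<psi> \<delta> + pre_pair \<phi> \<theta> \<delta> = pre_pair \<phi> (\<lambda>x. \<psi> x + \<theta> x) \<delta>"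
        using ev1
      proof eventually_elim
        case (elim \<delta>)
        then show ?case
          unfolding pre_pair_def scaleR_add_left
          by (subst vint_add) (auto intro!: pairable_field \<phi> \<psi> \<theta>)
      qed
      ultimately show "(pre_pair \<phi> (\<lambda>x. \<psi> x + \<theta> x) \<longlongrightarrow> L \<psi> + L \<theta>) (at_right 0)"
        by (rule Lim_transform_eventually)
    qed
  qed
  then obtain \<mu> where \<mu>: "finite_vmeasure \<Omega> \<mu>" "\<And>\<psi>. \<psi> \<in> Cc \<Omega> \<Longrightarrow> signed_integral \<Omega> \<mu> \<Omega> \<psi> = L \<psi>" by blast
  have "is_pairing \<rho> \<Omega> F \<phi> \<mu>"
    unfolding is_pairing_def using \<mu>(1) \<mu>(2)[symmetric] L by (simp add: pre_pair_def[abs_def])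
  then show ?thesis by (intro exI[of _ \<mu>])
qed

lemma is_pairing_pairing:
  assumes "pairable \<Omega> \<phi>"
  shows "is_pairing \<rho> \<Omega> F \<phi> (pair \<phi>)"
proof -
  obtain \<mu> where \<mu>: "is_pairing \<rho> \<Omega> F \<phi> \<mu>" using pairing_exists[OF assms] by blast
  show ?thesis
    unfolding pairing_def
  proof (rule theI[where P="is_pairing \<rho> \<Omega> F \<phi>" and a=\<mu>])
    show "is_pairing \<rho> \<Omega> F \<phi> \<mu>" by fact
    fix \<nu> assume \<nu>: "is_pairing \<rho> \<Omega> F \<phi> \<nu>"
    show "\<nu> = \<mu>"
    proof (rule finite_vmeasure_eqI_Cc_inf)
      show "finite_vmeasure \<Omega> \<nu>" "finite_vmeasure \<Omega> \<mu>" using \<mu> \<nu> by (auto simp: is_pairing_def)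
      fix \<psi> assume "\<psi> \<in> Cc_inf \<Omega>"
      then have "\<psi> \<in> Cc \<Omega>" by (simp add: Cc_inf_def)
      then show "signed_integral \<Omega> \<nu> \<Omega> \<psi> = signed_integral \<Omega> \<mu> \<Omega> \<psi>"
        using \<mu> \<nu> tendsto_unique[OF not_bot_at_right_0] unfolding is_pairing_def by blast
    qed
  qed
qed

lemma finite_vmeasure_pairing: "pairable \<Omega> \<phi> \<Longrightarrow> finite_vmeasure \<Omega> (pair \<phi>)"
  using is_pairing_pairing by (auto simp: is_pairing_def)

lemma pre_pair_tendsto:
  "pairable \<Omega> \<phi> \<Longrightarrow> \<psi> \<in> Cc \<Omega> \<Longrightarrow> (pre_pair \<phi> \<psi> \<longlongrightarrow> signed_integral \<Omega> (pair \<phi>) \<Omega> \<psi>) (at_right 0)"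
  using is_pairing_pairing[of \<phi>] by (simp add: is_pairing_def pre_pair_def[abs_def])

text \<open>Here the test function moves together with the mollification of \<open>\<phi>\<close>.
  Its difference to the limiting test function is uniformly small with support in \<open>K\<close>,
  hence negligible by the gradient bound.\<close>

lemma pre_pair_tendsto_uniform:
  assumes \<phi>: "pairable \<Omega> \<phi>" and f: "f \<in> Cc \<Omega>" and K: "compact K" "K \<subseteq> \<Omega>"
    and lim: "uniform_limit \<Omega> f' f (at_right 0)"
    and ev: "\<forall>\<^sub>F \<delta> in at_right 0. f' \<delta> \<in> Cc \<Omega> \<and> (\<forall>x. x \<notin> K \<longrightarrow> f' \<delta> x = 0)"
    and z: "\<And>x. x \<notin> K \<Longrightarrow> f x = 0"
  shows "((\<lambda>\<delta>. pre_pair \<phi> (f' \<delta>) \<delta>) \<longlongrightarrow> signed_integral \<Omega> (pair \<phi>) \<Omega> f) (at_right 0)"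
proof -
  obtain C where C: "0 \<le> C"
    "\<And>K. compact K \<Longrightarrow> K \<subseteq> \<Omega> \<Longrightarrow> \<forall>\<^sub>F \<delta> in at_right 0. pre_pair_bounded \<phi> C K \<delta>"
    using pre_pair_bound[OF \<phi>] by blast
  have "((\<lambda>\<delta>. pre_pair \<phi> (f' \<delta>) \<delta> - pre_pair \<phi> f \<delta>) \<longlongrightarrow> 0) (at_right 0)"
  proof (rule tendstoI)
    fix e :: real assume e: "0 < e"
    define M where "M = C * total_var (\<lambda>x. 1)"
    have M: "0 \<le> M" using C(1) total_var_nonneg by (simp add: M_def)
    define e' where "e' = e / (M + 1)"
    have e': "0 < e'" "M * e' < e" using M e by (auto simp: e'_def field_simps)
    from C(2)[OF K] ev uniform_limitD[OF lim e'(1)]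
    show "\<forall>\<^sub>F \<delta> in at_right 0. dist (pre_pair \<phi> (f' \<delta>) \<delta> - pre_pair \<phi> f \<delta>) 0 < e"
    proof eventually_elim
      case (elim \<delta>)
      have f': "f' \<delta> \<in> Cc \<Omega>" using elim by simp
      have diff: "(\<lambda>x. f' \<delta> x - f x) \<in> Cc \<Omega>" using f' f by (rule Cc_diff)
      have z': "f' \<delta> x - f x = 0" if "x \<notin> K" for x using z elim that by simp
      have "\<bar>pre_pair \<phi> (\<lambda>x. f' \<delta> x - f x) \<delta>\<bar> \<le> C * total_var (\<lambda>x. f' \<delta> x - f x)"
        using pre_pair_boundedD(2)[OF elim(1) diff z'] .
      also have "\<dots> \<le> C * (e' * total_var (\<lambda>x. 1))"
        using elim by (intro mult_left_mono C(1) total_var_le Cc_bounded_borel[OF diff])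
          (auto simp: dist_real_def less_imp_le)
      also have "\<dots> < e" using e'(2) by (simp add: M_def mult_ac)
      finally show ?case using pre_pair_diff[OF \<phi> f' f pre_pair_boundedD(1)[OF elim(1)]] by simp
    qed
  qed
  from tendsto_add[OF this pre_pair_tendsto[OF \<phi> f]] show ?thesis by simp
qed

end

subsection \<open>The coarea identity for the distance function\<close>

text \<open>Integration starts at -1 instead of 0, so that \<open>H\<close> is differentiable on an
  open interval that contains 0 and tolerates errors in the distance. Since \<open>\<zeta>\<close>
  vanishes up to \<open>e\<close>, the values are those of the primitive from 0.\<close>

lemma Cc_positive_primitive:
  fixes \<zeta> :: "real \<Rightarrow> real"
  assumes \<zeta>: "\<zeta> \<in> Cc {0<..}"
  obtains H e where "0 < e" "e \<le> 1" "\<And>t. t \<le> e \<Longrightarrow> \<zeta> t = 0"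
    "\<And>s. -1 < s \<Longrightarrow> (H has_field_derivative \<zeta> s) (at s)"
    "\<And>s. -1 \<le> s \<Longrightarrow> s \<le> e \<Longrightarrow> H s = 0"
    "\<And>s. -1 \<le> s \<Longrightarrow> H s = (LINT t|lborel. indicator {0<..} t * \<zeta> t * indicator {..<s} t)"
proof -
  have c: "continuous_on S \<zeta>" for S using Cc_continuous[OF \<zeta>] by (rule continuous_on_subset) simp
  obtain K where K: "compact K" "K \<subseteq> {0<..}" "\<And>t. t \<notin> K \<Longrightarrow> \<zeta> t = 0" using CcE[OF \<zeta>] by metis
  obtain e K' where e: "0 < e" "compact K'" "K' \<subseteq> {0<..}" "\<And>x. x \<in> K \<Longrightarrow> cball x e \<subseteq> K'"
    using compact_neighbourhood[OF K(1) _ K(2)] by (metis open_greaterThan)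
  \<comment> \<open>With the bound by 1, an error of \<open>e' / 2\<close> in a nonnegative distance
    cannot leave the interval on which \<open>H\<close> is differentiable.\<close>
  define e' where "e' = min e 1"
  have z: "\<zeta> t = 0" if "t \<le> e'" for t
  proof (rule K(3), rule notI)
    assume "t \<in> K"
    have "t - e \<in> cball t e" using e(1) by (simp add: dist_real_def)
    with e(4)[OF \<open>t \<in> K\<close>] e(3) have "t - e \<in> {0<..}" by blast
    with that show False by (simp add: e'_def)
  qed
  define H where "H s = integral {-1..s} \<zeta>" for s
  show ?thesis
  proof
    show "0 < e'" "e' \<le> 1" using e(1) by (auto simp: e'_def)
    show "\<zeta> t = 0" if "t \<le> e'" for t using z[OF that] .
    show "(H has_field_derivative \<zeta> s) (at s)" if s: "-1 < s" for s
    proof -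
      have "(H has_vector_derivative \<zeta> s) (at s within {-1..s+1})"
        unfolding H_def using s by (intro integral_has_vector_derivative c) auto
      moreover have "at s within {-1..s+1} = at s"
        using s by (intro at_within_interior) auto
      ultimately show ?thesis by (simp add: has_real_derivative_iff_has_vector_derivative)
    qed
    show "H s = 0" if "-1 \<le> s" "s \<le> e'" for s
    proof -
      have "H s = integral {-1..s} (\<lambda>_. 0)" unfolding H_def
        by (intro integral_cong z) (use that in auto)
      then show ?thesis by simp
    qed
    show "H s = (LINT t|lborel. indicator {0<..} t * \<zeta> t * indicator {..<s} t)" if s: "-1 \<le> s" for s
    proof -
      have "H s = (LINT t:{-1..s}|lborel. \<zeta> t)"
        unfolding H_def by (intro set_borel_integral_eq_integral(2)[symmetric] borel_integrable_atLeastAtMost' c)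
      also have "\<dots> = (LINT t|lborel. indicator {0<..} t * \<zeta> t * indicator {..<s} t)"
        unfolding set_lebesgue_integral_def
      proof (rule integral_cong_AE)
        have m: "\<zeta> \<in> borel_measurable borel" using c[of UNIV] by (rule borel_measurable_continuous_onI)
        then show "(\<lambda>t. indicator {-1..s} t *\<^sub>R \<zeta> t) \<in> borel_measurable lborel"
          "(\<lambda>t. indicator {0<..} t * \<zeta> t * indicator {..<s} t) \<in> borel_measurable lborel" by measurable
        \<comment> \<open>The two intervals of integration differ in the endpoint \<open>s\<close>
          and in nonpositive arguments, where the weight vanishes.\<close>
        have "AE t in lborel. t \<noteq> s" by (rule AE_lborel_singleton)
        then show "AE t in lborel. indicator {-1..s} t *\<^sub>R \<zeta> t = indicator {0<..} t * \<zeta> t * indicator {..<s} t"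
        proof eventually_elim
          case (elim t)
          have "\<zeta> t = 0" if "t \<le> 0" using z that \<open>0 < e'\<close> by simp
          then show ?case using elim by (cases "t \<le> 0") (auto simp: indicator_def)
        qed
      qed
      finally show ?thesis .
    qed
  qed
qed

locale dm_field_on_open = dm_field +
  fixes U :: "'a set"
  assumes open_U: "open U" and compact_U: "compact (closure U)" and closure_U: "closure U \<subseteq> \<Omega>"
begin

definition "bdist x = infdist x (frontier U)"

abbreviation "\<nu> \<equiv> pair bdist"
abbreviation "NT \<phi> t \<equiv> normal_trace \<rho> \<Omega> F (inner_set U t) \<phi>"

lemma U_subset: "U \<subseteq> \<Omega>"
  using closure_subset closure_U by blast

lemma bdist_nonneg: "0 \<le> bdist x"
  by (simp add: bdist_def infdist_nonneg)

lemma bdist_Lipschitz: "\<bar>bdist x - bdist y\<bar> \<le> norm (x - y)"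
  using infdist_triangle_abs[of x "frontier U" y] by (simp add: bdist_def dist_norm)

lemma continuous_bdist: "continuous_on S bdist"
  unfolding bdist_def[abs_def] by (intro continuous_intros)

lemma bdist_measurable [measurable]: "bdist \<in> borel_measurable borel"
  by (rule borel_measurable_continuous_onI[OF continuous_bdist])

lemma pairable_bdist: "pairable \<Omega> bdist"
  by (rule Lipschitz_pairable[OF open_\<Omega> bdist_Lipschitz])

lemma finite_vmeasure_\<nu>: "finite_vmeasure \<Omega> \<nu>"
  by (rule finite_vmeasure_pairing[OF pairable_bdist])

lemma bdist_pos: "x \<in> U \<Longrightarrow> 0 < bdist x"
proof -
  assume x: "x \<in> U"
  \<comment> \<open>An empty boundary must be excluded first, because \<open>infdist\<close> to the
    empty set is 0 by convention; boundedness of \<open>U\<close> does this.\<close>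
  have "bounded U" using compact_U bounded_closure closure_subset bounded_subset compact_imp_bounded by metis
  then have "U \<noteq> UNIV" by (metis not_bounded_UNIV)
  then have ne: "frontier U \<noteq> {}" using x frontier_not_empty by auto
  have "x \<notin> frontier U" using x open_U by (simp add: frontier_def interior_open)
  then have "bdist x \<noteq> 0" unfolding bdist_def using in_closed_iff_infdist_zero[OF frontier_closed ne] by auto
  then show ?thesis using bdist_nonneg[of x] by linarith
qed

lemma closure_U_eq: "closure U = U \<union> frontier U"
  by (simp add: closure_Un_frontier)

text \<open>On the boundary the distance is 0, so for positive \<open>e\<close> the superlevel set
  in \<open>U\<close> equals the one in the compact closure.\<close>

lemma compact_superlevel:
  assumes "0 < e" shows "compact {x\<in>U. e \<le> bdist x}"
proof -
  have "{x\<in>U. e \<le> bdist x} = closure U \<inter> {x. e \<le> bdist x}"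
    using assms by (auto simp: closure_U_eq bdist_def)
  moreover have "closed {x. e \<le> bdist x}"
    by (intro closed_Collect_le continuous_intros continuous_bdist)
  ultimately show ?thesis using compact_U by (simp add: compact_Int_closed)
qed

lemma bdist_bound: obtains R where "0 < R" "\<And>x. x \<in> closure U \<Longrightarrow> bdist x \<le> R"
proof -
  have "bounded (bdist ` closure U)"
    by (intro compact_imp_bounded compact_continuous_image continuous_bdist compact_U)
  then obtain R where "0 < R" "\<And>x. x \<in> closure U \<Longrightarrow> \<bar>bdist x\<bar> \<le> R" by (auto simp: bounded_pos)
  then show ?thesis by (intro that[of R]) (auto simp: abs_le_iff)
qed

lemma inner_set_eq: "inner_set U t = {x\<in>U. t < bdist x}"
  by (auto simp: inner_set_def bdist_def)

text \<open>At fixed \<open>\<delta>\<close>, integration by parts is applied to the product of the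
  mollified \<open>\<phi>\<close> and \<open>H\<close> of the mollified distance. The chain rule
  turns the gradient of the cutoff into \<open>\<zeta>\<close> times the gradient of the mollified
  distance. The resulting three terms converge to the divergence term and to the pairings of
  \<open>\<phi>\<close> and of the distance, because the test functions converge uniformly with
  supports in one compact set.\<close>

lemma Leibniz_distance:
  assumes \<phi>: "pairable \<Omega> \<phi>" and e: "0 < e" "e \<le> 1" "\<And>t. t \<le> e \<Longrightarrow> \<zeta> t = 0"
    and \<zeta>: "\<zeta> \<in> Cc {0<..}"
    and H: "\<And>s. -1 < s \<Longrightarrow> (H has_field_derivative \<zeta> s) (at s)" "\<And>s. -1 \<le> s \<Longrightarrow> s \<le> e \<Longrightarrow> H s = 0"
  shows "signed_integral \<Omega> \<nu> \<Omega> (\<lambda>x. \<phi> x * (indicator U x * \<zeta> (bdist x))) =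
     - signed_integral \<Omega> divF \<Omega> (\<lambda>x. \<phi> x * (indicator U x * H (bdist x)))
     - signed_integral \<Omega> (pair \<phi>) \<Omega> (\<lambda>x. indicator U x * H (bdist x))"
proof -
  note p = pairableD[OF \<phi>] note pd = pairableD[OF pairable_bdist]
  \<comment> \<open>In \<open>U\<close> outside \<open>K\<close> the distance is below
    \<open>e / 2\<close>; a mollification error below \<open>e / 2\<close> keeps the mollified
    distance below \<open>e\<close>, where \<open>\<zeta>\<close> and \<open>H\<close>
    vanish.\<close>
  define K where "K = {x\<in>U. e/2 \<le> bdist x}"
  have K: "compact K" "K \<subseteq> U" "K \<subseteq> \<Omega>" using compact_superlevel[of "e/2"] e U_subset by (auto simp: K_def)
  have cK: "open (- K)" using compact_imp_closed[OF K(1)] by (simp add: open_Compl)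
  have cover: "U \<union> - K = UNIV" using K by auto
  have c\<zeta>: "continuous_on S \<zeta>" for S using Cc_continuous[OF \<zeta>] by (rule continuous_on_subset) simp
  have cH: "continuous_on {-1<..} H"
    using H(1) by (intro DERIV_continuous_on) (auto intro: has_field_derivative_at_within)
  obtain R where R: "0 < R" "\<And>x. x \<in> closure U \<Longrightarrow> bdist x \<le> R" using bdist_bound by blast
  let ?d = "\<lambda>\<delta>. mollify \<rho> \<Omega> \<delta> bdist" and ?\<phi> = "\<lambda>\<delta>. mollify \<rho> \<Omega> \<delta> \<phi>"
  define w where "w x = indicator U x * H (bdist x)" for x
  define z where "z x = indicator U x * \<zeta> (bdist x)" for x
  define w' where "w' \<delta> x = indicator U x * H (?d \<delta> x)" for \<delta> x
  define z' where "z' \<delta> x = indicator U x * \<zeta> (?d \<delta> x)" for \<delta> x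
  have ul_d: "uniform_limit (closure U) ?d bdist (at_right 0)"
    by (rule mollify_uniform_limit[OF open_\<Omega> pd(1,2) compact_U closure_U])
  have ul_\<phi>: "uniform_limit (closure U) ?\<phi> \<phi> (at_right 0)"
    by (rule mollify_uniform_limit[OF open_\<Omega> p(1,2) compact_U closure_U])
  have KU: "K \<subseteq> closure U" using K(2) closure_subset by blast
  have ev: "\<forall>\<^sub>F \<delta> in at_right 0. 0 < \<delta> \<and> (\<forall>x\<in>closure U. \<bar>?d \<delta> x - bdist x\<bar> < e/2)"
  proof -
    have "0 < e / 2" using e by simp
    from uniform_limitD[OF ul_d this] eventually_at_right_less[OF zero_less_one]
    show ?thesis by eventually_elim (simp add: dist_real_def)
  qed
  have base: "C1 (w' \<delta>)" "grad (w' \<delta>) = (\<lambda>x. z' \<delta> x *\<^sub>R grad (?d \<delta>) x)"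
    "\<And>x. x \<notin> K \<Longrightarrow> w' \<delta> x = 0" "\<And>x. x \<notin> K \<Longrightarrow> z' \<delta> x = 0" "continuous_on UNIV (z' \<delta>)"
    if \<delta>: "0 < \<delta>" "\<forall>x\<in>closure U. \<bar>?d \<delta> x - bdist x\<bar> < e/2" for \<delta>
  proof -
    have C1d: "C1 (?d \<delta>)" by (rule C1_mollify[OF pd(2) \<delta>(1)])
    have near: "\<bar>?d \<delta> x - bdist x\<bar> < e/2" if "x \<in> U" for x using \<delta>(2) that closure_subset by blast
    have gt: "-1 < ?d \<delta> x" if "x \<in> U" for x using near[OF that] bdist_nonneg[of x] e(1,2) by linarith
    have small: "?d \<delta> x \<le> e" if "x \<in> U" "x \<notin> K" for x
    proof -
      have "bdist x < e/2" using that by (simp add: K_def)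
      with near[OF that(1)] show ?thesis by linarith
    qed
    show w0: "w' \<delta> x = 0" if "x \<notin> K" for x
      using H(2)[of "?d \<delta> x"] gt[of x] small[of x] that by (cases "x \<in> U") (auto simp: w'_def)
    show z0: "z' \<delta> x = 0" if "x \<notin> K" for x
      using e(3)[of "?d \<delta> x"] small[of x] that by (cases "x \<in> U") (auto simp: z'_def)
    \<comment> \<open>\<open>U\<close> and the complement of \<open>K\<close> are open and cover the
      space, and on the latter the function is 0; so the jump of the indicator of \<open>U\<close>
      does no harm.\<close>
    have cont_z: "continuous_on (U \<union> - K) (z' \<delta>)"
    proof (rule continuous_on_open_Un[OF open_U cK])
      have "continuous_on U (\<lambda>x. \<zeta> (?d \<delta> x))"
        by (intro continuous_on_compose2[OF c\<zeta>[of UNIV]] continuous_on_subset[OF C1_continuous[OF C1d]]) auto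
      then show "continuous_on U (z' \<delta>)" by (rule continuous_on_eq) (simp add: z'_def)
      have "continuous_on (- K) (\<lambda>x. 0 :: real)" by simp
      then show "continuous_on (- K) (z' \<delta>)" by (rule continuous_on_eq) (simp add: z0)
    qed
    then show cz: "continuous_on UNIV (z' \<delta>)" by (simp add: cover)
    have der: "(w' \<delta> has_derivative (\<lambda>h. h \<bullet> (z' \<delta> x *\<^sub>R grad (?d \<delta>) x))) (at x)" for x
    proof (cases "x \<in> U")
      case True
      have "((\<lambda>x. H (?d \<delta> x)) has_derivative (\<lambda>h. \<zeta> (?d \<delta> x) * (h \<bullet> grad (?d \<delta>) x))) (at x)"
        using has_derivative_compose[OF C1_has_derivative[OF C1d] H(1)[OF gt[OF True], unfolded has_field_derivative_def]] .
      then have "((\<lambda>x. H (?d \<delta> x)) has_derivative (\<lambda>h. h \<bullet> (z' \<delta> x *\<^sub>R grad (?d \<delta>) x))) (at x)"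
        using True by (simp add: z'_def)
      then show ?thesis
        by (rule has_derivative_transform_within_open[OF _ open_U True]) (simp add: w'_def)
    next
      case False
      then have "x \<in> - K" using K by auto
      from has_derivative_zero_on_open[OF cK this, of "w' \<delta>"] w0 z0 this show ?thesis by simp
    qed
    show "C1 (w' \<delta>)" "grad (w' \<delta>) = (\<lambda>x. z' \<delta> x *\<^sub>R grad (?d \<delta>) x)"
      using C1I[OF der] cz C1_continuous_grad[OF C1d] by (auto intro!: continuous_intros)
  qed
  have w'Cc: "w' \<delta> \<in> Cc \<Omega>" if "0 < \<delta>" "\<forall>x\<in>closure U. \<bar>?d \<delta> x - bdist x\<bar> < e/2" for \<delta>
    using K base[OF that] by (intro CcI[of _ K] C1_continuous) auto
  have z'Cc: "(\<lambda>x. ?\<phi> \<delta> x * z' \<delta> x) \<in> Cc \<Omega>" if "0 < \<delta>" "\<forall>x\<in>closure U. \<bar>?d \<delta> x - bdist x\<bar> < e/2" for \<delta>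
    using K base[OF that] C1_continuous[OF C1_mollify[OF p(2) that(1)]]
    by (intro CcI[of _ K] continuous_intros) auto
  have w0: "w x = 0" if "x \<notin> K" for x
    using that e bdist_nonneg[of x] H(2)[of "bdist x"] by (auto simp: w_def K_def indicator_def)
  have z0: "z x = 0" if "x \<notin> K" for x
    using that e e(3)[of "bdist x"] by (auto simp: z_def K_def indicator_def)
  have ul_dK: "uniform_limit K ?d bdist (at_right 0)" using ul_d KU by (rule uniform_limit_on_subset)
  have ul_\<phi>K: "uniform_limit K ?\<phi> \<phi> (at_right 0)" using ul_\<phi> KU by (rule uniform_limit_on_subset)
  \<comment> \<open>A compact interval inside the domain of \<open>H\<close> that contains the
    values on \<open>K\<close> of the distance and of its mollifications; composition with
    \<open>H\<close> and with \<open>\<zeta>\<close> preserves uniform limits there.\<close>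
  have inT: "\<forall>\<^sub>F \<delta> in at_right 0. \<forall>x\<in>K. ?d \<delta> x \<in> {-1/2..R+1}"
    using ev
  proof eventually_elim
    case (elim \<delta>)
    show ?case
    proof
      fix x assume "x \<in> K"
      then have x: "x \<in> closure U" using KU by auto
      with elim have "\<bar>?d \<delta> x - bdist x\<bar> < e/2" by blast
      then have "-1/2 \<le> ?d \<delta> x" "?d \<delta> x \<le> R + 1"
        using R(2)[OF x] bdist_nonneg[of x] e(1,2) by linarith+
      then show "?d \<delta> x \<in> {-1/2..R+1}" by simp
    qed
  qed
  have inT': "bdist x \<in> {-1/2..R+1}" if "x \<in> K" for x
    using R(2)[of x] bdist_nonneg[of x] KU that by auto
  have ulw: "uniform_limit K w' w (at_right 0)"
  proof -
    have "uniformly_continuous_on {-1/2..R+1} H"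
      by (intro compact_uniformly_continuous continuous_on_subset[OF cH]) auto
    from uniform_limit_compose_uniformly_continuous_on[OF ul_dK this inT closed_atLeastAtMost]
    show ?thesis
      by (subst uniform_limit_cong'[where g="\<lambda>d x. H (?d d x)" and i="\<lambda>x. H (bdist x)"])
        (use K in \<open>auto simp: w'_def w_def\<close>)
  qed
  have ulz: "uniform_limit K z' z (at_right 0)"
  proof -
    have "uniformly_continuous_on {-1/2..R+1} \<zeta>"
      by (intro compact_uniformly_continuous c\<zeta>) auto
    from uniform_limit_compose_uniformly_continuous_on[OF ul_dK this inT closed_atLeastAtMost]
    show ?thesis
      by (subst uniform_limit_cong'[where g="\<lambda>d x. \<zeta> (?d d x)" and i="\<lambda>x. \<zeta> (bdist x)"])
        (use K in \<open>auto simp: z'_def z_def\<close>)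
  qed
  have cwK: "continuous_on K w"
  proof -
    have "continuous_on K (\<lambda>x. H (bdist x))"
      using inT' by (intro continuous_on_compose2[OF cH] continuous_bdist) force
    then show ?thesis by (rule continuous_on_eq) (use K in \<open>auto simp: w_def\<close>)
  qed
  have czK: "continuous_on K z"
  proof -
    have "continuous_on K (\<lambda>x. \<zeta> (bdist x))"
      by (intro continuous_on_compose2[OF c\<zeta>[of UNIV]] continuous_bdist) auto
    then show ?thesis by (rule continuous_on_eq) (use K in \<open>auto simp: z_def\<close>)
  qed
  have c\<phi>: "continuous_on K \<phi>" using p(1) K(3) by (rule continuous_on_subset)
  have bnd: "bounded (w ` K)" "bounded (z ` K)" "bounded (\<phi> ` K)"
    using cwK czK c\<phi> K(1) by (auto intro: compact_imp_bounded compact_continuous_image)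
  have lim_const: "uniform_limit \<Omega> g f (at_right 0)"
    if "uniform_limit K g f (at_right 0)" "\<forall>\<^sub>F \<delta> in at_right 0. \<forall>x. x \<notin> K \<longrightarrow> g \<delta> x = 0" "\<And>x. x \<notin> K \<Longrightarrow> f x = 0" for g f
  proof (rule uniform_limitI)
    fix e :: real assume e: "0 < e"
    from uniform_limitD[OF that(1) e] that(2)
    show "\<forall>\<^sub>F \<delta> in at_right 0. \<forall>x\<in>\<Omega>. dist (g \<delta> x) (f x) < e"
    proof eventually_elim
      case (elim \<delta>)
      show ?case
      proof
        fix x show "dist (g \<delta> x) (f x) < e" using elim that(3)[of x] e by (cases "x \<in> K") auto
      qed
    qed
  qed
  have ev_w0: "\<forall>\<^sub>F \<delta> in at_right 0. \<forall>x. x \<notin> K \<longrightarrow> w' \<delta> x = 0"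
    using ev by eventually_elim (use base(3) in blast)
  have ev_z0: "\<forall>\<^sub>F \<delta> in at_right 0. \<forall>x. x \<notin> K \<longrightarrow> z' \<delta> x = 0"
    using ev by eventually_elim (use base(4) in blast)
  have ev_Cw: "\<forall>\<^sub>F \<delta> in at_right 0. w' \<delta> \<in> Cc \<Omega>"
    using ev by eventually_elim (use w'Cc in blast)
  have ev_Cz: "\<forall>\<^sub>F \<delta> in at_right 0. (\<lambda>x. ?\<phi> \<delta> x * z' \<delta> x) \<in> Cc \<Omega>"
    using ev by eventually_elim (use z'Cc in blast)
  have ulw\<Omega>: "uniform_limit \<Omega> w' w (at_right 0)" by (rule lim_const[OF ulw ev_w0 w0])
  have ul\<phi>w: "uniform_limit \<Omega> (\<lambda>\<delta> x. ?\<phi> \<delta> x * w' \<delta> x) (\<lambda>x. \<phi> x * w x) (at_right 0)"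
    using ev_w0 by (intro uniform_limit_mult_vanishing[OF ul_\<phi>K ulw bnd(3,1)]) (auto simp: w0 elim: eventually_mono)
  have ul\<phi>z: "uniform_limit \<Omega> (\<lambda>\<delta> x. ?\<phi> \<delta> x * z' \<delta> x) (\<lambda>x. \<phi> x * z x) (at_right 0)"
    using ev_z0 by (intro uniform_limit_mult_vanishing[OF ul_\<phi>K ulz bnd(3,2)]) (auto simp: z0 elim: eventually_mono)
  have limit_Cc: "f \<in> Cc \<Omega>" if f: "continuous_on U f" "\<And>x. x \<notin> K \<Longrightarrow> f x = 0" for f :: "'a \<Rightarrow> real"
  proof -
    have "continuous_on (- K) (\<lambda>x. 0 :: real)" by simp
    then have "continuous_on (- K) f" by (rule continuous_on_eq) (simp add: f)
    with f(1) have "continuous_on (U \<union> - K) f" by (rule continuous_on_open_Un[OF open_U cK])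
    then show ?thesis using K f by (intro CcI[of _ K]) (auto simp: cover)
  qed
  have cwU: "continuous_on U w"
  proof -
    have "continuous_on U (\<lambda>x. H (bdist x))"
      by (intro continuous_on_compose2[OF cH] continuous_bdist) (auto intro: order_less_le_trans[OF _ bdist_nonneg])
    then show ?thesis by (rule continuous_on_eq) (auto simp: w_def)
  qed
  have czU: "continuous_on U z"
  proof -
    have "continuous_on U (\<lambda>x. \<zeta> (bdist x))"
      by (intro continuous_on_compose2[OF c\<zeta>[of UNIV]] continuous_bdist) auto
    then show ?thesis by (rule continuous_on_eq) (auto simp: z_def)
  qed
  have c\<phi>U: "continuous_on U \<phi>" using p(1) U_subset by (rule continuous_on_subset)
  have wCc: "w \<in> Cc \<Omega>" by (rule limit_Cc[OF cwU w0])
  have \<phi>wCc: "(\<lambda>x. \<phi> x * w x) \<in> Cc \<Omega>" using w0 by (intro limit_Cc continuous_intros c\<phi>U cwU) auto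
  have \<phi>zCc: "(\<lambda>x. \<phi> x * z x) \<in> Cc \<Omega>" using z0 by (intro limit_Cc continuous_intros c\<phi>U czU) auto
  \<comment> \<open>The test functions in \<open>L1\<close> and \<open>L2\<close> depend on
    \<open>\<delta>\<close> through the mollified functions, hence the limit lemma for moving test
    functions.\<close>
  have L1: "((\<lambda>\<delta>. pre_pair \<phi> (w' \<delta>) \<delta>) \<longlongrightarrow> signed_integral \<Omega> (pair \<phi>) \<Omega> w) (at_right 0)"
    using ev_Cw ev_w0 by (intro pre_pair_tendsto_uniform[OF \<phi> wCc K(1,3) ulw\<Omega> _ w0] eventually_conj)
  have L2: "((\<lambda>\<delta>. pre_pair bdist (\<lambda>x. ?\<phi> \<delta> x * z' \<delta> x) \<delta>) \<longlongrightarrow> signed_integral \<Omega> \<nu> \<Omega> (\<lambda>x. \<phi> x * z x)) (at_right 0)"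
    using ev_Cz ev_z0
    by (intro pre_pair_tendsto_uniform[OF pairable_bdist \<phi>zCc K(1,3) ul\<phi>z] eventually_conj)
      (auto simp: z0 elim: eventually_mono)
  have L3: "((\<lambda>\<delta>. signed_integral \<Omega> divF \<Omega> (\<lambda>x. ?\<phi> \<delta> x * w' \<delta> x)) \<longlongrightarrow> signed_integral \<Omega> divF \<Omega> (\<lambda>x. \<phi> x * w x)) (at_right 0)"
  proof (rule signed_integral_uniform_limit[OF finite_vmeasure_divergence ul\<phi>w _ Cc_bounded_borel[OF \<phi>wCc]])
    show "\<forall>\<^sub>F \<delta> in at_right 0. (\<lambda>x. ?\<phi> \<delta> x * w' \<delta> x) \<in> bounded_borel \<Omega>"
      using ev
    proof eventually_elim
      case (elim \<delta>)
      then show ?case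
        by (intro Cc_bounded_borel[of _ \<Omega>] Cc_mult w'Cc C1_continuous C1_mollify p(2)) auto
    qed
  qed
  have "((\<lambda>\<delta>. - signed_integral \<Omega> divF \<Omega> (\<lambda>x. ?\<phi> \<delta> x * w' \<delta> x) - pre_pair bdist (\<lambda>x. ?\<phi> \<delta> x * z' \<delta> x) \<delta>) \<longlongrightarrow>
     - signed_integral \<Omega> divF \<Omega> (\<lambda>x. \<phi> x * w x) - signed_integral \<Omega> \<nu> \<Omega> (\<lambda>x. \<phi> x * z x)) (at_right 0)"
    by (intro tendsto_intros L2 L3)
  \<comment> \<open>The product rule is exact at each fixed \<open>\<delta>\<close>; as both
    functions are mollified at the same scale, its gradient terms are values of
    \<open>pre_pair\<close> at \<open>\<delta>\<close>.\<close>
  moreover have "\<forall>\<^sub>F \<delta> in at_right 0. - signed_integral \<Omega> divF \<Omega> (\<lambda>x. ?\<phi> \<delta> x * w' \<delta> x) - pre_pair bdist (\<lambda>x. ?\<phi> \<delta> x * z' \<delta> x) \<delta> = pre_pair \<phi> (w' \<delta>) \<delta>"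
    using ev
  proof eventually_elim
    case (elim \<delta>)
    then have \<delta>: "0 < \<delta>" "\<forall>x\<in>closure U. \<bar>?d \<delta> x - bdist x\<bar> < e/2" by auto
    from divergence_product[OF C1_mollify[OF p(2) \<delta>(1)] base(1)[OF \<delta>] w'Cc[OF \<delta>]]
    show ?case by (simp add: pre_pair_def base(2)[OF \<delta>])
  qed
  ultimately have "((\<lambda>\<delta>. pre_pair \<phi> (w' \<delta>) \<delta>) \<longlongrightarrow>
     - signed_integral \<Omega> divF \<Omega> (\<lambda>x. \<phi> x * w x) - signed_integral \<Omega> \<nu> \<Omega> (\<lambda>x. \<phi> x * z x)) (at_right 0)"
    by (rule Lim_transform_eventually)
  from tendsto_unique[OF not_bot_at_right_0 L1 this] show ?thesis by (simp add: w_def[abs_def] z_def[abs_def])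
qed

section \<open>Integration over the superlevel sets of the distance\<close>

lemma sets_\<Omega>I: "A \<in> sets borel \<Longrightarrow> A \<subseteq> \<Omega> \<Longrightarrow> A \<in> sets (restrict_space borel \<Omega>)"
  using \<Omega>_borel by (simp add: sets_restrict_space_iff)

lemma U_sets: "U \<in> sets (restrict_space borel \<Omega>)"
  by (rule sets_\<Omega>I[OF _ U_subset]) (use open_U in simp)

lemma open_inner_set: "open (inner_set U t)"
proof -
  have "inner_set U t = U \<inter> {x. t < bdist x}" by (auto simp: inner_set_eq)
  moreover have "open {x. t < bdist x}" by (intro open_Collect_less continuous_intros continuous_bdist)
  ultimately show ?thesis using open_U by (simp add: open_Int)
qed

lemma inner_set_sets: "inner_set U t \<in> sets (restrict_space borel \<Omega>)"
  by (rule sets_\<Omega>I) (use open_inner_set U_subset in \<open>auto simp: inner_set_eq\<close>)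

text \<open>Layer cake: for fixed \<open>x\<close> in \<open>U\<close>, membership in
  \<open>inner_set U t\<close> means \<open>t < bdist x\<close>, so exchanging the integrals leaves
  the primitive of \<open>\<zeta>\<close> at \<open>bdist x\<close>.\<close>

lemma
  fixes f :: "'a \<Rightarrow> real"
  assumes m: "finite_measure m" "sets m = sets (restrict_space borel \<Omega>)" and f: "f \<in> bounded_borel \<Omega>"
  shows superlevel_measurable:
      "(\<lambda>t. LINT x|m. indicator (inner_set U t) x * f x) \<in> borel_measurable borel" (is ?meas)
    and superlevel_integrable:
      "integrable lborel \<zeta> \<Longrightarrow> integrable lborel (\<lambda>t. \<zeta> t * (LINT x|m. indicator (inner_set U t) x * f x))"
    and superlevel_Fubini:
      "integrable lborel \<zeta> \<Longrightarrow> (LINT t|lborel. \<zeta> t * (LINT x|m. indicator (inner_set U t) x * f x)) =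
       (LINT x|m. f x * (indicator U x * (LINT t|lborel. \<zeta> t * indicator {..<bdist x} t)))"
proof -
  interpret m: finite_measure m by fact
  interpret pair_sigma_finite lborel m ..
  have sp: "space m = \<Omega>" using sets_eq_imp_space_eq[OF m(2)] by (simp add: space_restrict_space)
  have meas_m: "g \<in> borel_measurable m \<longleftrightarrow> g \<in> borel_measurable (restrict_space borel \<Omega>)" for g :: "'a \<Rightarrow> real"
    using measurable_cong_sets[OF m(2) refl] by blast
  have [measurable]: "f \<in> borel_measurable m" using bounded_borel_measurable[OF f] meas_m by blast
  have [measurable]: "bdist \<in> borel_measurable m"
    unfolding meas_m by (rule measurable_restrict_space1[OF bdist_measurable])
  have [measurable]: "U \<in> sets m" using U_sets m(2) by simp
  obtain B where B: "0 \<le> B" "\<And>x. x \<in> \<Omega> \<Longrightarrow> \<bar>f x\<bar> \<le> B" using bounded_borel_bound[OF f] by blast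
  \<comment> \<open>This form makes joint measurability in \<open>t\<close> and \<open>x\<close>
    evident.\<close>
  have ind: "indicator (inner_set U t) x * f x = (indicator U x * (if t < bdist x then 1 else 0)) * f x" for t x
    by (auto simp: inner_set_eq indicator_def)
  show ?meas
  proof -
    have "(\<lambda>t. LINT x|m. (indicator U x * (if t < bdist x then 1 else 0)) * f x) \<in> borel_measurable lborel"
      by (rule m.borel_measurable_lebesgue_integral) measurable
    then show ?thesis by (simp add: ind)
  qed
  assume \<zeta>: "integrable lborel \<zeta>"
  then have [measurable]: "\<zeta> \<in> borel_measurable lborel" by auto
  define g where "g t x = \<zeta> t * ((indicator U x * (if t < bdist x then 1 else 0)) * f x)" for t x
  have bb: "(\<lambda>x. indicator (inner_set U t) x * f x) \<in> bounded_borel \<Omega>" for t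
    by (rule bounded_borel_mult_indicator[OF f inner_set_sets])
  have gi: "integrable m (g t)" for t
    unfolding g_def ind[symmetric]
    using integrable_bounded_borel[OF bb m] by auto
  have g_le: "\<bar>g t x\<bar> \<le> \<bar>\<zeta> t\<bar> * B" if "x \<in> \<Omega>" for t x
    using B(1) B(2)[OF that] unfolding g_def abs_mult
    by (intro mult_left_mono) (auto simp: indicator_def)
  have "integrable (lborel \<Otimes>\<^sub>M m) (case_prod g)"
  proof (rule Fubini_integrable)
    show [measurable]: "case_prod g \<in> borel_measurable (lborel \<Otimes>\<^sub>M m)" unfolding g_def by measurable
    show "AE t in lborel. integrable m (\<lambda>x. case_prod g (t, x))" using gi by simp
    show "integrable lborel (\<lambda>t. LINT x|m. norm (case_prod g (t, x)))"
    proof (rule Bochner_Integration.integrable_bound)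
      show "integrable lborel (\<lambda>t. \<bar>\<zeta> t\<bar> * (B * measure m \<Omega>))" using \<zeta> by auto
      show "(\<lambda>t. LINT x|m. norm (case_prod g (t, x))) \<in> borel_measurable lborel"
        by (rule m.borel_measurable_lebesgue_integral) measurable
      show "AE t in lborel. norm (LINT x|m. norm (case_prod g (t, x))) \<le> norm (\<bar>\<zeta> t\<bar> * (B * measure m \<Omega>))"
      proof (rule AE_I2)
        fix t :: real
        have "(LINT x|m. norm (g t x)) \<le> (LINT x|m. \<bar>\<zeta> t\<bar> * B)"
          using gi g_le sp by (intro integral_mono integrable_norm) auto
        also have "\<dots> = \<bar>\<zeta> t\<bar> * (B * measure m \<Omega>)" by (simp add: sp)
        finally show "norm (LINT x|m. norm (case_prod g (t, x))) \<le> norm (\<bar>\<zeta> t\<bar> * (B * measure m \<Omega>))"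
          by (simp add: integral_nonneg_AE)
      qed
    qed
  qed
  note G = this
  have inner: "(LINT x|m. g t x) = \<zeta> t * (LINT x|m. indicator (inner_set U t) x * f x)" for t
    unfolding g_def ind by simp
  show "integrable lborel (\<lambda>t. \<zeta> t * (LINT x|m. indicator (inner_set U t) x * f x))"
    using integrable_fst[OF G] unfolding inner .
  have "(LINT t|lborel. \<zeta> t * (LINT x|m. indicator (inner_set U t) x * f x)) = (LINT x|m. LINT t|lborel. g t x)"
    unfolding inner[symmetric] using Fubini_integral[OF G] by simp
  also have "\<dots> = (LINT x|m. f x * (indicator U x * (LINT t|lborel. \<zeta> t * indicator {..<bdist x} t)))"
  proof (rule Bochner_Integration.integral_cong[OF refl])
    fix x
    have "(LINT t|lborel. g t x) = (LINT t|lborel. (f x * indicator U x) * (\<zeta> t * indicator {..<bdist x} t))"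
      by (intro Bochner_Integration.integral_cong) (auto simp: g_def indicator_def)
    then show "(LINT t|lborel. g t x) = f x * (indicator U x * (LINT t|lborel. \<zeta> t * indicator {..<bdist x} t))"
      by (simp add: mult.assoc)
  qed
  finally show "(LINT t|lborel. \<zeta> t * (LINT x|m. indicator (inner_set U t) x * f x)) =
       (LINT x|m. f x * (indicator U x * (LINT t|lborel. \<zeta> t * indicator {..<bdist x} t)))" .
qed

lemma
  assumes \<mu>: "finite_vmeasure \<Omega> \<mu>" and f: "f \<in> bounded_borel \<Omega>"
  shows signed_superlevel_measurable:
      "(\<lambda>t. signed_integral \<Omega> \<mu> (inner_set U t) f) \<in> borel_measurable borel"
    and signed_superlevel_integrable:
      "integrable lborel \<zeta> \<Longrightarrow> integrable lborel (\<lambda>t. \<zeta> t * signed_integral \<Omega> \<mu> (inner_set U t) f)"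
    and signed_superlevel_Fubini:
      "integrable lborel \<zeta> \<Longrightarrow> (LINT t|lborel. \<zeta> t * signed_integral \<Omega> \<mu> (inner_set U t) f) =
       signed_integral \<Omega> \<mu> \<Omega> (\<lambda>x. f x * (indicator U x * (LINT t|lborel. \<zeta> t * indicator {..<bdist x} t)))"
proof -
  note J = Jordan_decomposition(1,2)[OF \<mu>]
  show "(\<lambda>t. signed_integral \<Omega> \<mu> (inner_set U t) f) \<in> borel_measurable borel"
    unfolding signed_integral_eq
    using superlevel_measurable[OF J(1) _ f] superlevel_measurable[OF J(2) _ f]
    by (intro borel_measurable_diff) auto
  assume \<zeta>: "integrable lborel \<zeta>"
  note i = superlevel_integrable[OF J(1) sets_pos_variation f \<zeta>] superlevel_integrable[OF J(2) sets_neg_variation f \<zeta>]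
  show "integrable lborel (\<lambda>t. \<zeta> t * signed_integral \<Omega> \<mu> (inner_set U t) f)"
    unfolding signed_integral_eq right_diff_distrib by (rule Bochner_Integration.integrable_diff[OF i])
  show "(LINT t|lborel. \<zeta> t * signed_integral \<Omega> \<mu> (inner_set U t) f) =
       signed_integral \<Omega> \<mu> \<Omega> (\<lambda>x. f x * (indicator U x * (LINT t|lborel. \<zeta> t * indicator {..<bdist x} t)))"
    unfolding signed_integral_eq[of _ _ "inner_set U _"] right_diff_distrib signed_integral_top
      Bochner_Integration.integral_diff[OF i]
    by (intro arg_cong2[of _ _ _ _ "(-)"] superlevel_Fubini J f \<zeta>) auto
qed

lemma pairing_inner_set:
  assumes "pairable \<Omega> \<phi>"
  shows "pair \<phi> (inner_set U t) = signed_integral \<Omega> (pair \<phi>) (inner_set U t) (\<lambda>x. 1)"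
proof -
  have "(\<lambda>x. indicator (inner_set U t) x * 1 :: real) = indicator (inner_set U t)" by simp
  then show ?thesis
    using signed_integral_indicator[OF finite_vmeasure_pairing[OF assms] inner_set_sets[of t]]
      signed_integral_restrict[of \<Omega> "pair \<phi>" "inner_set U t" "\<lambda>x. 1"] by simp
qed

lemma NT_eq:
  "pairable \<Omega> \<phi> \<Longrightarrow> NT \<phi> t =
    - signed_integral \<Omega> divF (inner_set U t) \<phi> - signed_integral \<Omega> (pair \<phi>) (inner_set U t) (\<lambda>x. 1)"
  by (simp add: normal_trace_def pairing_inner_set)

lemma W1inf_bounded_borel: "\<phi> \<in> W1inf \<Omega> \<Longrightarrow> \<phi> \<in> bounded_borel \<Omega>"
  by (intro bounded_borel_continuous) (auto simp: W1inf_def)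

lemmas W1inf_pairable' = W1inf_pairable[OF open_\<Omega>]

lemma inner_set_empty:
  assumes "\<And>x. x \<in> closure U \<Longrightarrow> bdist x \<le> R" "R \<le> t" shows "inner_set U t = {}"
  using assms closure_subset[of U] by (force simp: inner_set_eq)

text \<open>The weight is controlled on positive arguments, and the distance takes only such values
  on \<open>U\<close>.\<close>

lemma distance_comp_bounded_borel:
  assumes "\<zeta> \<in> bounded_borel {0<..}"
  shows "(\<lambda>x. indicator U x * \<zeta> (bdist x)) \<in> bounded_borel \<Omega>"
proof -
  obtain B where B: "0 \<le> B" "\<And>x. x \<in> {0<..} \<Longrightarrow> \<bar>\<zeta> x\<bar> \<le> B" using bounded_borel_bound[OF assms] by blast
  have "(\<lambda>t. indicator {0<..} t *\<^sub>R \<zeta> t) \<in> borel_measurable borel"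
    using bounded_borel_measurable[OF assms] by (subst borel_measurable_restrict_space_iff[symmetric]) auto
  then have "(\<lambda>x. indicator U x * (indicator {0<..} (bdist x) *\<^sub>R \<zeta> (bdist x))) \<in> borel_measurable borel"
    using measurable_compose[OF bdist_measurable] open_U
    by (intro borel_measurable_times borel_measurable_indicator) auto
  also have "(\<lambda>x. indicator U x * (indicator {0<..} (bdist x) *\<^sub>R \<zeta> (bdist x))) = (\<lambda>x. indicator U x * \<zeta> (bdist x))"
    using bdist_pos by (auto simp: indicator_def)
  finally have m: "(\<lambda>x. indicator U x * \<zeta> (bdist x)) \<in> borel_measurable (restrict_space borel \<Omega>)"
    by (rule measurable_restrict_space1)
  show ?thesis
    by (rule bounded_borelI[OF m, of B]) (use B bdist_pos in \<open>auto simp: indicator_def\<close>)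
qed

section \<open>Normal traces of one function as a function of the level\<close>

context
  fixes \<phi> :: "'a \<Rightarrow> real"
  assumes \<phi>: "pairable \<Omega> \<phi>" and \<phi>b: "\<phi> \<in> bounded_borel \<Omega>"
begin

lemma NT_measurable [measurable]: "NT \<phi> \<in> borel_measurable borel"
  unfolding NT_eq[OF \<phi>]
  by (intro borel_measurable_diff borel_measurable_uminus signed_superlevel_measurable
      finite_vmeasure_divergence finite_vmeasure_pairing \<phi> \<phi>b bounded_borel_const)

lemma NT_bounded: obtains M where "0 \<le> M" "\<And>t. \<bar>NT \<phi> t\<bar> \<le> M"
proof -
  obtain B where B: "0 \<le> B" "\<And>x. x \<in> \<Omega> \<Longrightarrow> \<bar>\<phi> x\<bar> \<le> B" using bounded_borel_bound[OF \<phi>b] by blast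
  have *: "\<exists>M\<ge>0. \<forall>t. \<bar>signed_integral \<Omega> \<mu> (inner_set U t) f\<bar> \<le> M"
    if \<mu>: "finite_vmeasure \<Omega> \<mu>" and f: "f \<in> bounded_borel \<Omega>" for \<mu> f
  proof -
    obtain B where B: "0 \<le> B" "\<And>x. x \<in> \<Omega> \<Longrightarrow> \<bar>f x\<bar> \<le> B" using bounded_borel_bound[OF f] by blast
    have "\<bar>signed_integral \<Omega> \<mu> (inner_set U t) f\<bar> \<le> B * (measure (pos_variation \<Omega> \<mu>) \<Omega> + measure (neg_variation \<Omega> \<mu>) \<Omega>)" for t
      unfolding signed_integral_restrict[of _ _ "inner_set U t"]
      by (rule abs_signed_integral_le_sup[OF \<mu> _ bounded_borel_mult_indicator[OF f inner_set_sets]])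
        (use B in \<open>auto simp: indicator_def\<close>)
    then show ?thesis using B(1) by (intro exI[of _ "B * (measure (pos_variation \<Omega> \<mu>) \<Omega> + measure (neg_variation \<Omega> \<mu>) \<Omega>)"]) simp
  qed
  obtain M1 where M1: "0 \<le> M1" "\<And>t. \<bar>signed_integral \<Omega> divF (inner_set U t) \<phi>\<bar> \<le> M1"
    using *[OF finite_vmeasure_divergence \<phi>b] by blast
  obtain M2 where M2: "0 \<le> M2" "\<And>t. \<bar>signed_integral \<Omega> (pair \<phi>) (inner_set U t) (\<lambda>x. 1)\<bar> \<le> M2"
    using *[OF finite_vmeasure_pairing[OF \<phi>] bounded_borel_const] by blast
  show ?thesis
  proof (rule that[of "M1 + M2"])
    show "\<bar>NT \<phi> t\<bar> \<le> M1 + M2" for t using M1(2)[of t] M2(2)[of t] unfolding NT_eq[OF \<phi>] by linarith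
  qed (use M1 M2 in simp)
qed

lemma NT_zero: "inner_set U t = {} \<Longrightarrow> NT \<phi> t = 0"
  unfolding NT_eq[OF \<phi>] signed_integral_eq by simp

text \<open>Fubini replaces the weight by its primitive \<open>H\<close> at the distance, and the
  Leibniz rule turns \<open>H\<close> back into the weight, now against the pairing measure of the
  distance.\<close>

lemma coarea_Cc:
  assumes \<zeta>: "\<zeta> \<in> Cc {0<..}"
  shows "(LINT t|lborel. indicator {0<..} t * (\<zeta> t * NT \<phi> t)) =
    signed_integral \<Omega> \<nu> \<Omega> (\<lambda>x. \<phi> x * (indicator U x * \<zeta> (bdist x)))"
proof (rule Cc_positive_primitive[OF \<zeta>])
  fix H :: "real \<Rightarrow> real" and e :: real
  assume H: "0 < e" "e \<le> 1" "\<And>t. t \<le> e \<Longrightarrow> \<zeta> t = 0"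
    "\<And>s. -1 < s \<Longrightarrow> (H has_field_derivative \<zeta> s) (at s)"
    "\<And>s. -1 \<le> s \<Longrightarrow> s \<le> e \<Longrightarrow> H s = 0"
    "\<And>s. -1 \<le> s \<Longrightarrow> H s = (LINT t|lborel. indicator {0<..} t * \<zeta> t * indicator {..<s} t)"
  define \<xi> where "\<xi> t = indicator {0<..} t * \<zeta> t" for t
  have \<xi>: "\<xi> t = \<zeta> t" for t using H(1) H(3)[of t] by (auto simp: \<xi>_def indicator_def)
  obtain r where r: "vanishes_outside r \<zeta>" using Cc_vanishes[OF \<zeta>] .
  have i\<zeta>: "integrable lborel \<zeta>"
  proof -
    \<comment> \<open>The reflected weight serves as kernel: its convolution with 1 at the point 0
      has \<open>\<zeta>\<close> as integrand.\<close>
    have "continuous_on UNIV (\<lambda>z. \<zeta> (- z))"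
      by (rule continuous_on_compose2[OF Cc_continuous[OF \<zeta>]]) (auto intro: continuous_intros)
    moreover have "vanishes_outside r (\<lambda>z. \<zeta> (- z))" using r by (simp add: vanishes_outside_def)
    ultimately show ?thesis
      using integrable_convol[OF locally_bounded_continuous[of "\<lambda>_. 1"], of "\<lambda>z. \<zeta> (- z)" r 0] by simp
  qed
  have HL: "(LINT t|lborel. \<zeta> t * indicator {..<bdist x} t) = H (bdist x)" for x
  proof -
    have "-1 \<le> bdist x" using bdist_nonneg[of x] by linarith
    from H(6)[OF this] show ?thesis unfolding \<xi>[unfolded \<xi>_def] by (rule sym)
  qed
  have "indicator {0<..} t * (\<zeta> t * NT \<phi> t) = \<zeta> t * NT \<phi> t" for t
    using \<xi>[of t] unfolding \<xi>_def mult.assoc[symmetric] by simp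
  then have "(LINT t|lborel. indicator {0<..} t * (\<zeta> t * NT \<phi> t)) = (LINT t|lborel. \<zeta> t * NT \<phi> t)"
    by (simp only:)
  also have "\<dots> = (LINT t|lborel. - (\<zeta> t * signed_integral \<Omega> divF (inner_set U t) \<phi>)
      - \<zeta> t * signed_integral \<Omega> (pair \<phi>) (inner_set U t) (\<lambda>x. 1))"
    unfolding NT_eq[OF \<phi>] by (simp add: algebra_simps)
  also have "\<dots> = - (LINT t|lborel. \<zeta> t * signed_integral \<Omega> divF (inner_set U t) \<phi>)
      - (LINT t|lborel. \<zeta> t * signed_integral \<Omega> (pair \<phi>) (inner_set U t) (\<lambda>x. 1))"
    using signed_superlevel_integrable[OF finite_vmeasure_divergence \<phi>b i\<zeta>]
      signed_superlevel_integrable[OF finite_vmeasure_pairing[OF \<phi>] bounded_borel_const[of 1] i\<zeta>]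
    by simp
  also have "\<dots> = - signed_integral \<Omega> divF \<Omega> (\<lambda>x. \<phi> x * (indicator U x * H (bdist x)))
      - signed_integral \<Omega> (pair \<phi>) \<Omega> (\<lambda>x. indicator U x * H (bdist x))"
    by (simp add: signed_superlevel_Fubini[OF finite_vmeasure_divergence \<phi>b i\<zeta>]
        signed_superlevel_Fubini[OF finite_vmeasure_pairing[OF \<phi>] bounded_borel_const[of 1] i\<zeta>] HL)
  also have "\<dots> = signed_integral \<Omega> \<nu> \<Omega> (\<lambda>x. \<phi> x * (indicator U x * \<zeta> (bdist x)))"
    by (rule Leibniz_distance[OF \<phi> H(1-3) \<zeta> H(4,5), symmetric])
  finally show "(LINT t|lborel. indicator {0<..} t * (\<zeta> t * NT \<phi> t)) =
    signed_integral \<Omega> \<nu> \<Omega> (\<lambda>x. \<phi> x * (indicator U x * \<zeta> (bdist x)))" .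
qed

lemma bounded_borel_times_NT:
  assumes "\<zeta> \<in> bounded_borel {0<..}"
  shows "integrable lborel (\<lambda>t. indicator {0<..} t * (\<zeta> t * NT \<phi> t))"
    and "(\<lambda>t. indicator {0<..} t * (\<zeta> t * NT \<phi> t)) \<in> borel_measurable borel"
proof -
  obtain B where B: "0 \<le> B" "\<And>x. x \<in> {0<..} \<Longrightarrow> \<bar>\<zeta> x\<bar> \<le> B" using bounded_borel_bound[OF assms] by blast
  obtain M where M: "0 \<le> M" "\<And>t. \<bar>NT \<phi> t\<bar> \<le> M" using NT_bounded by blast
  obtain R where R: "0 < R" "\<And>x. x \<in> closure U \<Longrightarrow> bdist x \<le> R" using bdist_bound by blast
  have m\<zeta>: "(\<lambda>t. indicator {0<..} t *\<^sub>R \<zeta> t) \<in> borel_measurable borel"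
    using bounded_borel_measurable[OF assms] by (subst borel_measurable_restrict_space_iff[symmetric]) auto
  then have "(\<lambda>t. (indicator {0<..} t *\<^sub>R \<zeta> t) * NT \<phi> t) \<in> borel_measurable borel" by measurable
  then show m: "(\<lambda>t. indicator {0<..} t * (\<zeta> t * NT \<phi> t)) \<in> borel_measurable borel" by (simp add: mult.assoc)
  show "integrable lborel (\<lambda>t. indicator {0<..} t * (\<zeta> t * NT \<phi> t))"
  proof (rule Bochner_Integration.integrable_bound)
    show "integrable lborel (\<lambda>t. (B * M) * indicator {0..R} t)"
      using R(1) by (intro integrable_mult_right integrable_real_indicator) (auto simp: emeasure_lborel_Icc_eq)
    show "(\<lambda>t. indicator {0<..} t * (\<zeta> t * NT \<phi> t)) \<in> borel_measurable lborel" using m by simp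
    show "AE t in lborel. norm (indicator {0<..} t * (\<zeta> t * NT \<phi> t)) \<le> norm ((B * M) * indicator {0..R} t)"
    proof (rule AE_I2)
      fix t
      show "norm (indicator {0<..} t * (\<zeta> t * NT \<phi> t)) \<le> norm ((B * M) * indicator {0..R} t)"
      proof (cases "0 < t \<and> t \<le> R")
        case True
        then have "\<bar>\<zeta> t\<bar> * \<bar>NT \<phi> t\<bar> \<le> B * M" using B M by (intro mult_mono) auto
        with True show ?thesis using B M by (simp add: abs_mult)
      next
        case False
        then have "t \<le> 0 \<or> NT \<phi> t = 0" using NT_zero[OF inner_set_empty[OF R(2), of t]] by auto
        then show ?thesis by auto
      qed
    qed
  qed
qed

text \<open>Both sides are linear in the weight and respect bounded limits, on the left because the
  traces are bounded in \<open>t\<close> and vanish beyond the largest distance. The constant weight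
  yields the integral over all levels, and narrow weights localise at one level.\<close>

lemma coarea:
  assumes \<zeta>: "\<zeta> \<in> bounded_borel {0<..}"
  shows "(LINT t|lborel. indicator {0<..} t * (\<zeta> t * NT \<phi> t)) =
    signed_integral \<Omega> \<nu> \<Omega> (\<lambda>x. \<phi> x * (indicator U x * \<zeta> (bdist x)))"
  using open_greaterThan \<zeta>
proof (induction \<zeta> rule: bounded_borel_induct_Cc)
  case (Cc \<zeta>) then show ?case by (rule coarea_Cc)
next
  case (add f g)
  have "(LINT t|lborel. indicator {0<..} t * ((f t + g t) * NT \<phi> t)) =
    (LINT t|lborel. indicator {0<..} t * (f t * NT \<phi> t) + indicator {0<..} t * (g t * NT \<phi> t))"
    by (simp add: algebra_simps)
  also have "\<dots> = (LINT t|lborel. indicator {0<..} t * (f t * NT \<phi> t)) + (LINT t|lborel. indicator {0<..} t * (g t * NT \<phi> t))"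
    by (intro Bochner_Integration.integral_add bounded_borel_times_NT add.hyps)
  also have "\<dots> = signed_integral \<Omega> \<nu> \<Omega> (\<lambda>x. \<phi> x * (indicator U x * f (bdist x)) + \<phi> x * (indicator U x * g (bdist x)))"
    unfolding add.IH
    by (intro signed_integral_add[OF finite_vmeasure_\<nu>, symmetric] bounded_borel_mult \<phi>b distance_comp_bounded_borel add.hyps)
  finally show ?case by (simp add: algebra_simps)
next
  case (scale f c)
  have "(LINT t|lborel. indicator {0<..} t * (c * f t * NT \<phi> t)) = (LINT t|lborel. c * (indicator {0<..} t * (f t * NT \<phi> t)))"
    by (simp add: mult_ac)
  also have "\<dots> = c * signed_integral \<Omega> \<nu> \<Omega> (\<lambda>x. \<phi> x * (indicator U x * f (bdist x)))"
    using scale.IH by simp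
  also have "\<dots> = signed_integral \<Omega> \<nu> \<Omega> (\<lambda>x. c * (\<phi> x * (indicator U x * f (bdist x))))"
    by (rule signed_integral_cmult[OF finite_vmeasure_\<nu>, symmetric])
  finally show ?case by (simp add: mult_ac)
next
  case (lim F f B)
  have f: "f \<in> bounded_borel {0<..}" by (rule bounded_borel_LIMSEQ[OF lim.hyps])
  obtain M where M: "0 \<le> M" "\<And>t. \<bar>NT \<phi> t\<bar> \<le> M" using NT_bounded by blast
  obtain R where R: "0 < R" "\<And>x. x \<in> closure U \<Longrightarrow> bdist x \<le> R" using bdist_bound by blast
  obtain B\<phi> where B\<phi>: "0 \<le> B\<phi>" "\<And>x. x \<in> \<Omega> \<Longrightarrow> \<bar>\<phi> x\<bar> \<le> B\<phi>" using bounded_borel_bound[OF \<phi>b] by blast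
  have "(\<lambda>k. LINT t|lborel. indicator {0<..} t * (F k t * NT \<phi> t)) \<longlonglongrightarrow> (LINT t|lborel. indicator {0<..} t * (f t * NT \<phi> t))"
  proof (rule integral_dominated_convergence)
    show "integrable lborel (\<lambda>t. (\<bar>B\<bar> * M) * indicator {0..R} t)"
      using R(1) by (intro integrable_mult_right integrable_real_indicator) (auto simp: emeasure_lborel_Icc_eq)
    show "(\<lambda>t. indicator {0<..} t * (f t * NT \<phi> t)) \<in> borel_measurable lborel"
      "(\<lambda>t. indicator {0<..} t * (F k t * NT \<phi> t)) \<in> borel_measurable lborel" for k
      using bounded_borel_times_NT(2)[OF f] bounded_borel_times_NT(2)[OF lim.hyps(1)] by auto
    show "AE t in lborel. (\<lambda>k. indicator {0<..} t * (F k t * NT \<phi> t)) \<longlonglongrightarrow> indicator {0<..} t * (f t * NT \<phi> t)"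
    proof (rule AE_I2)
      fix t :: real
      show "(\<lambda>k. indicator {0<..} t * (F k t * NT \<phi> t)) \<longlonglongrightarrow> indicator {0<..} t * (f t * NT \<phi> t)"
        using lim.hyps(3)[of t] by (cases "0 < t") (auto intro!: tendsto_intros)
    qed
    show "AE t in lborel. norm (indicator {0<..} t * (F k t * NT \<phi> t)) \<le> (\<bar>B\<bar> * M) * indicator {0..R} t" for k
    proof (rule AE_I2)
      fix t :: real
      show "norm (indicator {0<..} t * (F k t * NT \<phi> t)) \<le> (\<bar>B\<bar> * M) * indicator {0..R} t"
      proof (cases "0 < t \<and> t \<le> R")
        case True
        then have "\<bar>F k t\<bar> \<le> \<bar>B\<bar>" using lim.hyps(2)[of t k] by auto
        then have "\<bar>F k t\<bar> * \<bar>NT \<phi> t\<bar> \<le> \<bar>B\<bar> * M" using M by (intro mult_mono) auto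
        with True show ?thesis using M by (simp add: abs_mult)
      next
        case False
        then have "t \<le> 0 \<or> NT \<phi> t = 0" using NT_zero[OF inner_set_empty[OF R(2), of t]] by auto
        then show ?thesis using M by auto
      qed
    qed
  qed
  moreover have "(\<lambda>k. signed_integral \<Omega> \<nu> \<Omega> (\<lambda>x. \<phi> x * (indicator U x * F k (bdist x)))) \<longlonglongrightarrow>
      signed_integral \<Omega> \<nu> \<Omega> (\<lambda>x. \<phi> x * (indicator U x * f (bdist x)))"
  proof (rule signed_integral_LIMSEQ[OF finite_vmeasure_\<nu>, where B="B\<phi> * \<bar>B\<bar>"])
    show "(\<lambda>x. \<phi> x * (indicator U x * F k (bdist x))) \<in> bounded_borel \<Omega>" for k
      by (intro bounded_borel_mult \<phi>b distance_comp_bounded_borel lim.hyps)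
    show "\<bar>\<phi> x * (indicator U x * F k (bdist x))\<bar> \<le> B\<phi> * \<bar>B\<bar>" if "x \<in> \<Omega>" for k x
    proof -
      have "\<bar>indicator U x * F k (bdist x)\<bar> \<le> \<bar>B\<bar>"
        using lim.hyps(2)[of "bdist x" k] bdist_pos[of x] by (auto simp: indicator_def)
      then show ?thesis unfolding abs_mult[of "\<phi> x"] using B\<phi>(1) B\<phi>(2)[OF that] by (intro mult_mono) auto
    qed
    show "(\<lambda>k. \<phi> x * (indicator U x * F k (bdist x))) \<longlonglongrightarrow> \<phi> x * (indicator U x * f (bdist x))" if "x \<in> \<Omega>" for x
      using lim.hyps(3)[of "bdist x"] bdist_pos[of x] by (cases "x \<in> U") (auto intro!: tendsto_intros)
  qed
  ultimately show ?case using lim.IH by (simp add: LIMSEQ_unique)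
qed

text \<open>The inner sets are given by a strict inequality, so they increase to
  \<open>inner_set U t\<close> as the level decreases to \<open>t\<close>. From the left the
  limiting set would be the one with \<open>t \<le> bdist x\<close>.\<close>

lemma NT_right_continuous: "(NT \<phi> \<longlongrightarrow> NT \<phi> t) (at_right t)"
proof (rule tendsto_at_right_sequentially[of t "t + 1"])
  fix S assume S: "\<And>n. t < S n" "S \<longlonglongrightarrow> t"
  have ind: "(\<lambda>n. indicator (inner_set U (S n)) x :: real) \<longlonglongrightarrow> indicator (inner_set U t) x" for x
  proof (cases "x \<in> inner_set U t")
    case True
    then have "\<forall>\<^sub>F n in sequentially. S n < bdist x"
      using order_tendstoD(2)[OF S(2), of "bdist x"] by (simp add: inner_set_eq)
    then have "\<forall>\<^sub>F n in sequentially. indicator (inner_set U (S n)) x = (1 :: real)"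
      by eventually_elim (use True in \<open>simp add: inner_set_eq\<close>)
    with True show ?thesis by (simp add: tendsto_eventually)
  next
    case False
    then have "x \<notin> inner_set U (S n)" for n using S(1)[of n] by (auto simp: inner_set_eq)
    with False show ?thesis by simp
  qed
  have *: "(\<lambda>n. signed_integral \<Omega> \<mu> (inner_set U (S n)) f) \<longlonglongrightarrow> signed_integral \<Omega> \<mu> (inner_set U t) f"
    if \<mu>: "finite_vmeasure \<Omega> \<mu>" and f: "f \<in> bounded_borel \<Omega>" for \<mu> f
  proof -
    obtain B where B: "0 \<le> B" "\<And>x. x \<in> \<Omega> \<Longrightarrow> \<bar>f x\<bar> \<le> B" using bounded_borel_bound[OF f] by blast
    show ?thesis
      unfolding signed_integral_restrict[of _ _ "inner_set U _"]
    proof (rule signed_integral_LIMSEQ[OF \<mu>, where B=B])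
      show "(\<lambda>x. indicator (inner_set U (S n)) x * f x) \<in> bounded_borel \<Omega>" for n
        by (rule bounded_borel_mult_indicator[OF f inner_set_sets])
      show "\<bar>indicator (inner_set U (S n)) x * f x\<bar> \<le> B" if "x \<in> \<Omega>" for n x
        using B that by (auto simp: indicator_def)
      show "(\<lambda>n. indicator (inner_set U (S n)) x * f x) \<longlonglongrightarrow> indicator (inner_set U t) x * f x" for x
        by (intro tendsto_mult ind tendsto_const)
    qed
  qed
  show "(\<lambda>n. NT \<phi> (S n)) \<longlonglongrightarrow> NT \<phi> t"
    unfolding NT_eq[OF \<phi>]
    by (intro tendsto_intros * finite_vmeasure_divergence finite_vmeasure_pairing \<phi> \<phi>b bounded_borel_const)
qed simp

text \<open>By \<open>coarea\<close> the terms are averages of the trace over short intervals to the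
  right of \<open>t\<close>, so right continuity gives the limit. It holds at every positive
  \<open>t\<close>; no exceptional null set depends on \<open>\<phi>\<close>.\<close>

lemma NT_limit:
  assumes t: "0 < t"
  shows "(\<lambda>k. signed_integral \<Omega> \<nu> \<Omega> (\<lambda>x. \<phi> x * (indicator U x *
      (real (Suc k) * indicator {t<..<t + 1 / real (Suc k)} (bdist x))))) \<longlonglongrightarrow> NT \<phi> t"
proof (rule LIMSEQ_I)
  fix e :: real assume e: "0 < e"
  obtain b where b: "t < b" "\<And>s. t < s \<Longrightarrow> s < b \<Longrightarrow> \<bar>NT \<phi> s - NT \<phi> t\<bar> < e/2"
    using tendstoD[OF NT_right_continuous[of t], of "e/2"] e
    unfolding eventually_at_right_field dist_real_def by auto
  obtain k0 where k0: "1 / real (Suc k0) < b - t" using nat_approx_posE[of "b - t"] b(1) by auto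
  show "\<exists>k0. \<forall>k\<ge>k0. norm (signed_integral \<Omega> \<nu> \<Omega> (\<lambda>x. \<phi> x * (indicator U x *
      (real (Suc k) * indicator {t<..<t + 1 / real (Suc k)} (bdist x)))) - NT \<phi> t) < e"
  proof (intro exI[of _ k0] allI impI)
    fix k assume "k0 \<le> k"
    then have "1 / real (Suc k) \<le> 1 / real (Suc k0)" by (intro divide_left_mono) auto
    with k0 have k: "t + 1 / real (Suc k) < b" by simp
    define I where "I = {t<..<t + 1 / real (Suc k)}"
    define K where "K = real (Suc k)"
    have K: "0 < K" by (simp add: K_def)
    have I: "measure lborel I = 1 / K" "I \<in> sets borel" "emeasure lborel I < \<infinity>" by (auto simp: I_def K_def)
    have bbI: "(\<lambda>s. K * indicator I s) \<in> bounded_borel {0<..}"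
      using t by (intro bounded_borel_cmult bounded_borel_indicator) (auto simp: I_def sets_restrict_space_iff)
    have iI: "integrable lborel (\<lambda>s. K * indicator I s * c)" for c :: real
      using I by (intro integrable_mult_left integrable_mult_right integrable_real_indicator) auto
    have int: "integrable lborel (\<lambda>s. K * indicator I s * NT \<phi> s)"
    proof -
      have "integrable lborel (\<lambda>s. indicator {0<..} s * (K * indicator I s * NT \<phi> s))"
        by (rule bounded_borel_times_NT(1)[OF bbI])
      moreover have "indicator {0<..} s * (K * indicator I s * NT \<phi> s) = K * indicator I s * NT \<phi> s" for s
        using t by (auto simp: indicator_def I_def)
      ultimately show ?thesis by simp
    qed
    have "signed_integral \<Omega> \<nu> \<Omega> (\<lambda>x. \<phi> x * (indicator U x * (K * indicator I (bdist x)))) =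
        (LINT s|lborel. indicator {0<..} s * (K * indicator I s * NT \<phi> s))"
      by (rule coarea[OF bbI, symmetric])
    also have "\<dots> = (LINT s|lborel. K * indicator I s * NT \<phi> s)"
      using t by (intro Bochner_Integration.integral_cong) (auto simp: indicator_def I_def)
    finally have 1: "signed_integral \<Omega> \<nu> \<Omega> (\<lambda>x. \<phi> x * (indicator U x * (K * indicator I (bdist x)))) - NT \<phi> t =
        (LINT s|lborel. K * indicator I s * NT \<phi> s) - (LINT s|lborel. K * indicator I s * NT \<phi> t)"
      using I K by simp
    also have "\<dots> = (LINT s|lborel. K * indicator I s * (NT \<phi> s - NT \<phi> t))"
      using int iI by (simp add: right_diff_distrib)
    finally have "\<bar>signed_integral \<Omega> \<nu> \<Omega> (\<lambda>x. \<phi> x * (indicator U x * (K * indicator I (bdist x)))) - NT \<phi> t\<bar> =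
        \<bar>LINT s|lborel. K * indicator I s * (NT \<phi> s - NT \<phi> t)\<bar>"
      by simp
    also have "\<dots> \<le> (LINT s|lborel. \<bar>K * indicator I s * (NT \<phi> s - NT \<phi> t)\<bar>)"
      by (rule integral_abs_bound)
    also have "\<dots> \<le> (LINT s|lborel. K * indicator I s * (e/2))"
    proof (rule integral_mono)
      show "integrable lborel (\<lambda>s. \<bar>K * indicator I s * (NT \<phi> s - NT \<phi> t)\<bar>)"
        using int iI by (auto simp: right_diff_distrib intro!: integrable_abs)
      show "integrable lborel (\<lambda>s. K * indicator I s * (e/2))" by (rule iI)
      fix s
      show "\<bar>K * indicator I s * (NT \<phi> s - NT \<phi> t)\<bar> \<le> K * indicator I s * (e/2)"
      proof (cases "s \<in> I")
        case True
        then have "\<bar>NT \<phi> s - NT \<phi> t\<bar> \<le> e/2" using b(2)[of s] k by (auto simp: I_def)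
        then have "K * \<bar>NT \<phi> s - NT \<phi> t\<bar> \<le> K * (e/2)" using K by (intro mult_left_mono) auto
        then show ?thesis using True K by (simp add: abs_mult)
      qed simp
    qed
    also have "\<dots> = e/2" using I K by simp
    finally show "norm (signed_integral \<Omega> \<nu> \<Omega> (\<lambda>x. \<phi> x * (indicator U x *
      (real (Suc k) * indicator {t<..<t + 1 / real (Suc k)} (bdist x)))) - NT \<phi> t) < e"
      using e by (simp add: I_def K_def del: of_nat_Suc)
  qed
qed

end

end

subsection \<open>Weak compactness of measures on a compact set\<close>

text \<open>
  Helly's selection theorem is available on the real line only. A space-filling curve \<open>c\<close> with a Borel right
  inverse \<open>s\<close> transports measures on a compact set to \<open>[0, 1]\<close>, and the weak limit there back by \<open>c\<close>:
  test functions are not affected, because \<open>f \<circ> c\<close> is continuous and \<open>f \<circ> c \<circ> s = f\<close>.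
\<close>

definition bump :: "real \<Rightarrow> real" where
  "bump x = max 0 (min 1 (1/2 - cos (pi * x)))"

lemma continuous_bump: "continuous_on S bump"
  unfolding bump_def[abs_def] by (intro continuous_intros)

lemma bump_bounds: "0 \<le> bump x" "bump x \<le> 1"
  by (auto simp: bump_def)

lemma bump_periodic: "bump (2 * of_int n + y) = bump y"
proof -
  have "cos (pi * (2 * of_int n + y)) = cos (pi * y + 2 * pi * of_int n)" by (simp add: algebra_simps)
  also have "\<dots> = cos (pi * y)" unfolding cos_add by (simp only: cos_int_2pin sin_int_2pin mult_1_right mult_zero_right diff_zero)
  finally show ?thesis by (simp add: bump_def)
qed

text \<open>The clamping constants are chosen for the outer thirds of the unit interval:
  \<open>cos (pi / 3) = 1/2\<close> gives 0 on the first third, and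
  \<open>cos (2 * pi / 3) = -1/2\<close> gives 1 on the last one. Ternary digits 0 and 2 select
  these thirds.\<close>

lemma bump_0:
  assumes "0 \<le> y" "y \<le> 1/3" shows "bump y = 0"
proof -
  have "cos (pi / 3) \<le> cos (pi * y)" using assms by (intro cos_monotone_0_pi_le) auto
  then show ?thesis by (simp add: bump_def cos_60)
qed

lemma bump_1:
  assumes "2/3 \<le> y" "y \<le> 1" shows "bump y = 1"
proof -
  have "cos (pi * y) \<le> cos (2 * pi / 3)" using assms by (intro cos_monotone_0_pi_le) auto
  then show ?thesis by (simp add: bump_def cos_120)
qed

definition binary_digit :: "real \<Rightarrow> nat \<Rightarrow> real" where
  "binary_digit x m = of_int (\<lfloor>2 ^ Suc m * x\<rfloor> mod 2)"

lemma binary_digit_cases: "binary_digit x m = 0 \<or> binary_digit x m = 1"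
proof -
  have "\<lfloor>2 ^ Suc m * x\<rfloor> mod 2 = 0 \<or> \<lfloor>2 ^ Suc m * x\<rfloor> mod 2 = 1" by presburger
  then show ?thesis unfolding binary_digit_def by (metis of_int_0 of_int_1)
qed

text \<open>Doubling before taking the floor appends one digit, so the partial sums are the dyadic
  truncations of \<open>x\<close> without its integer part.\<close>

lemma sum_binary_digits: "(\<Sum>m<M. binary_digit x m / 2 ^ Suc m) = of_int \<lfloor>2 ^ M * x\<rfloor> / 2 ^ M - of_int \<lfloor>x\<rfloor>"
proof (induction M)
  case (Suc M)
  have "\<lfloor>2 ^ Suc M * x\<rfloor> div 2 = \<lfloor>2 ^ M * x\<rfloor>"
    using floor_divide_real_eq_div[of 2 "2 ^ Suc M * x"] by simp
  then have "\<lfloor>2 ^ Suc M * x\<rfloor> = 2 * \<lfloor>2 ^ M * x\<rfloor> + \<lfloor>2 ^ Suc M * x\<rfloor> mod 2"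
    by (metis div_mult_mod_eq mult.commute)
  then have "of_int \<lfloor>2 ^ Suc M * x\<rfloor> = 2 * of_int \<lfloor>2 ^ M * x\<rfloor> + binary_digit x M"
    unfolding binary_digit_def by (metis of_int_add of_int_mult of_int_numeral)
  then show ?case using Suc by (simp add: field_simps)
qed simp

lemma sums_binary_digits:
  assumes "0 \<le> x" "x < 1"
  shows "(\<lambda>m. binary_digit x m / 2 ^ Suc m) sums x"
  unfolding sums_def
proof -
  have fl: "\<lfloor>x\<rfloor> = 0" using assms by (simp add: floor_eq_iff)
  have "(\<lambda>M. of_int \<lfloor>2 ^ M * x\<rfloor> / 2 ^ M - x) \<longlonglongrightarrow> 0"
  proof (rule Lim_null_comparison[OF always_eventually])
    show "\<forall>M. norm (of_int \<lfloor>2 ^ M * x\<rfloor> / 2 ^ M - x) \<le> (1/2) ^ M"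
    proof
      fix M :: nat
      have "\<bar>of_int \<lfloor>2 ^ M * x\<rfloor> - 2 ^ M * x\<bar> \<le> 1" by linarith
      moreover have "of_int \<lfloor>2 ^ M * x\<rfloor> / 2 ^ M - x = (of_int \<lfloor>2 ^ M * x\<rfloor> - 2 ^ M * x) / 2 ^ M"
        by (simp add: field_simps)
      ultimately show "norm (of_int \<lfloor>2 ^ M * x\<rfloor> / 2 ^ M - x) \<le> (1/2) ^ M"
        by (simp add: abs_divide power_divide divide_right_mono)
    qed
    show "(\<lambda>M. (1/2 :: real) ^ M) \<longlonglongrightarrow> 0" by (rule LIMSEQ_realpow_zero) auto
  qed
  then have "(\<lambda>M. of_int \<lfloor>2 ^ M * x\<rfloor> / 2 ^ M) \<longlonglongrightarrow> x" by (rule LIM_zero_cancel)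
  then show "(\<lambda>M. \<Sum>m<M. binary_digit x m / 2 ^ Suc m) \<longlonglongrightarrow> x" by (simp only: sum_binary_digits fl of_int_0 diff_zero)
qed

lemma summable_third:
  assumes "\<And>i. b i = 0 \<or> b i = (1::real)"
  shows "summable (\<lambda>i. 2 * b i / 3 ^ Suc i)"
proof (rule summable_comparison_test')
  show "summable (\<lambda>i. 2 * (1/3 :: real) ^ Suc i)" by (intro summable_mult summable_mult2 summable_Suc_iff[THEN iffD2] summable_geometric) auto
  show "norm (2 * b i / 3 ^ Suc i) \<le> 2 * (1/3) ^ Suc i" for i
    using assms[of i] by (auto simp: power_divide)
qed

text \<open>For a 0-1 sequence \<open>b\<close> this is the point of the Cantor set with ternary
  digits \<open>2 * b i\<close>.\<close>

definition ternary :: "(nat \<Rightarrow> real) \<Rightarrow> real" where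
  "ternary b = (\<Sum>i. 2 * b i / 3 ^ Suc i)"

lemma ternary_bounds:
  assumes b: "\<And>i. b i = 0 \<or> b i = (1::real)"
  shows "0 \<le> ternary b" "ternary b \<le> 1"
proof -
  have "0 \<le> b i" for i using b[of i] by auto
  then show "0 \<le> ternary b" unfolding ternary_def by (intro suminf_nonneg summable_third b) simp
  have g: "(\<lambda>i. (2/3) * (1/3 :: real) ^ i) sums ((2/3) * (1 / (1 - 1/3)))"
    by (intro sums_mult geometric_sums) auto
  have "ternary b \<le> (\<Sum>i. (2/3) * (1/3 :: real) ^ i)"
    unfolding ternary_def
  proof (intro suminf_le summable_third b)
    show "2 * b i / 3 ^ Suc i \<le> (2/3) * (1/3) ^ i" for i
      using b[of i] by (auto simp: power_divide)
    show "summable (\<lambda>i. (2/3) * (1/3 :: real) ^ i)" using g by (rule sums_summable)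
  qed
  also have "\<dots> = 1" using g by (simp add: sums_iff)
  finally show "ternary b \<le> 1" .
qed

lemma ternary_Suc:
  assumes b: "\<And>i. b i = 0 \<or> b i = (1::real)"
  shows "3 * ternary b = 2 * b 0 + ternary (\<lambda>i. b (Suc i))"
proof -
  have "ternary b = (\<Sum>i. 2 * b (Suc i) / 3 ^ Suc (Suc i)) + 2 * b 0 / 3"
    unfolding ternary_def using suminf_split_head[OF summable_third[of b, OF b]] by simp
  also have "(\<Sum>i. 2 * b (Suc i) / 3 ^ Suc (Suc i)) = (\<Sum>i. (1/3) * (2 * b (Suc i) / 3 ^ Suc i))" by simp
  also have "\<dots> = (1/3) * ternary (\<lambda>i. b (Suc i))"
    unfolding ternary_def using b by (intro suminf_mult summable_third) 
  finally show ?thesis by simp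
qed

text \<open>Multiplication by \<open>3 ^ k\<close> moves the first \<open>k\<close> digits in front
  of the point, where they form an even integer because every digit is 0 or 2; periodicity removes
  it. The next digit decides between the outer thirds of the unit interval, on which
  \<open>bump\<close> is constant.\<close>

lemma bump_ternary:
  assumes b: "\<And>i. b i = 0 \<or> b i = (1::real)"
  shows "bump (3 ^ k * ternary b) = b k"
proof -
  have "\<exists>n::int. 3 ^ k * ternary b = 2 * of_int n + ternary (\<lambda>i. b (k + i))"
  proof (induction k)
    case 0 show ?case by (intro exI[of _ 0]) simp
  next
    case (Suc k)
    then obtain n :: int where n: "3 ^ k * ternary b = 2 * of_int n + ternary (\<lambda>i. b (k + i))" by blast
    obtain m :: int where m: "b k = of_int m" using b[of k] by (metis of_int_0 of_int_1)
    have "3 ^ Suc k * ternary b = 6 * of_int n + 3 * ternary (\<lambda>i. b (k + i))" using n by simp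
    also have "\<dots> = 2 * of_int (3 * n + m) + ternary (\<lambda>i. b (Suc k + i))"
      using ternary_Suc[of "\<lambda>i. b (k + i)"] b m by simp
    finally show ?case by blast
  qed
  then obtain n :: int where n: "3 ^ k * ternary b = 2 * of_int n + ternary (\<lambda>i. b (k + i))" by blast
  have t: "3 * ternary (\<lambda>i. b (k + i)) = 2 * b k + ternary (\<lambda>i. b (k + Suc i))"
    using ternary_Suc[of "\<lambda>i. b (k + i)"] b by simp
  have t1: "0 \<le> ternary (\<lambda>i. b (k + Suc i))" "ternary (\<lambda>i. b (k + Suc i)) \<le> 1"
    using ternary_bounds[of "\<lambda>i. b (k + Suc i)"] b by auto
  have "bump (3 ^ k * ternary b) = bump (ternary (\<lambda>i. b (k + i)))" unfolding n by (rule bump_periodic)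
  also have "\<dots> = b k"
    using b[of k]
  proof
    assume "b k = 0"
    then show ?thesis using t t1 by (simp add: bump_0)
  next
    assume "b k = 1"
    then show ?thesis using t t1 by (simp add: bump_1)
  qed
  finally show ?thesis .
qed

text \<open>Schoenberg's form of the Lebesgue space-filling curve.\<close>

lemma space_filling_curve:
  fixes K :: "'a::euclidean_space set"
  assumes "bounded K"
  obtains c :: "real \<Rightarrow> 'a" where "continuous_on UNIV c" "bounded (range c)" "K \<subseteq> c ` {0..1}"
proof -
  define N where "N = DIM('a)"
  have N: "0 < N" by (simp add: N_def)
  obtain \<iota> where \<iota>: "bij_betw \<iota> (Basis :: 'a set) {0..<N}"
    using ex_bij_betw_finite_nat[OF finite_Basis] by (auto simp: N_def)
  obtain L where L: "0 < L" "\<And>x. x \<in> K \<Longrightarrow> norm x < L"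
    using assms unfolding bounded_pos_less by auto
  \<comment> \<open>Coordinate \<open>j\<close> takes the digits whose index is congruent to
    \<open>j\<close> modulo the dimension as its binary digits.\<close>
  define g where "g j t = (\<Sum>m. bump (3 ^ (N * m + j) * t) / 2 ^ Suc m)" for j t
  have M: "norm (bump (3 ^ (N * m + j) * t) / 2 ^ Suc m) \<le> (1/2) ^ Suc m" for m j t
    using bump_bounds[of "3 ^ (N * m + j) * t"] by (simp add: abs_divide power_divide divide_right_mono)
  have sm: "summable (\<lambda>m. (1/2 :: real) ^ Suc m)" by (intro summable_Suc_iff[THEN iffD2] summable_geometric) auto
  have cg: "continuous_on UNIV (g j)" for j
  proof -
    have ul: "uniform_limit UNIV (\<lambda>n t. \<Sum>m<n. bump (3 ^ (N * m + j) * t) / 2 ^ Suc m) (g j) sequentially"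
      unfolding g_def[abs_def] by (rule Weierstrass_m_test[OF _ sm]) (use M in auto)
    show ?thesis
      by (rule uniform_limit_theorem[OF _ ul])
        (auto intro!: always_eventually continuous_intros continuous_on_compose2[OF continuous_bump[of UNIV]])
  qed
  have gb: "\<bar>g j t\<bar> \<le> 1" for j t
  proof -
    have "norm (g j t) \<le> (\<Sum>m. (1/2 :: real) ^ Suc m)"
      unfolding g_def by (rule norm_suminf_le[OF M sm])
    also have "\<dots> = 1" using power_half_series by (simp add: sums_iff)
    finally show ?thesis by simp
  qed
  \<comment> \<open>Coordinates between 0 and 1 are rescaled to the cube of half-width
    \<open>L\<close>, which contains \<open>K\<close>.\<close>
  define c where "c t = (\<Sum>i\<in>Basis. (L * (2 * g (\<iota> i) t - 1)) *\<^sub>R i)" for t :: real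
  have "continuous_on UNIV c" unfolding c_def by (intro continuous_intros cg)
  moreover have "bounded (range c)"
    unfolding bounded_iff
  proof (intro exI ballI)
    fix y assume "y \<in> range c"
    then obtain t where y: "y = c t" by auto
    have "norm (c t) \<le> (\<Sum>i\<in>(Basis :: 'a set). 3 * L)"
      unfolding c_def
    proof (rule order_trans[OF norm_sum sum_mono])
      fix i :: 'a assume i: "i \<in> Basis"
      have "\<bar>2 * g (\<iota> i) t - 1\<bar> \<le> 3" using gb[of "\<iota> i" t] by linarith
      then have "L * \<bar>2 * g (\<iota> i) t - 1\<bar> \<le> L * 3" using L(1) by (intro mult_left_mono) auto
      then show "norm ((L * (2 * g (\<iota> i) t - 1)) *\<^sub>R i) \<le> 3 * L" using i L(1) by (simp add: abs_mult mult.commute)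
    qed
    then show "norm y \<le> (\<Sum>i\<in>(Basis :: 'a set). 3 * L)" using y by simp
  qed
  moreover have "K \<subseteq> c ` {0..1}"
  proof
    fix x assume x: "x \<in> K"
    \<comment> \<open>The strict bound on \<open>norm x\<close> keeps these coordinates below 1, as
      the binary expansion carries no integer part.\<close>
    define u where "u i = (x \<bullet> i / L + 1) / 2" for i
    have u: "0 \<le> u i" "u i < 1" if "i \<in> Basis" for i
    proof -
      have "\<bar>x \<bullet> i\<bar> < L" using Basis_le_norm[OF that, of x] L(2)[OF x] by linarith
      then have "-1 < x \<bullet> i / L" "x \<bullet> i / L < 1" using L(1) by (auto simp: field_simps abs_less_iff)
      then show "0 \<le> u i" "u i < 1" by (auto simp: u_def)
    qed
    \<comment> \<open>The binary expansions of the coordinates are interleaved into one digit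
      sequence; the parameter is the corresponding point of the Cantor set.\<close>
    define b where "b k = binary_digit (u (inv_into Basis \<iota> (k mod N))) (k div N)" for k
    have b: "b k = 0 \<or> b k = 1" for k unfolding b_def by (rule binary_digit_cases)
    have "g (\<iota> i) (ternary b) = u i" if i: "i \<in> Basis" for i
    proof -
      have \<iota>i: "\<iota> i < N" "inv_into Basis \<iota> (\<iota> i) = i"
        using \<iota> i by (auto simp: bij_betw_def inv_into_f_f)
      have "bump (3 ^ (N * m + \<iota> i) * ternary b) = binary_digit (u i) m" for m
        using bump_ternary[of b "N * m + \<iota> i"] b \<iota>i N by (simp add: b_def)
      then show ?thesis using sums_binary_digits[OF u[OF i]] by (simp add: g_def sums_iff)
    qed
    then have "c (ternary b) = (\<Sum>i\<in>Basis. (x \<bullet> i) *\<^sub>R i)"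
      unfolding c_def using L(1) by (intro sum.cong) (auto simp: u_def field_simps)
    then have "c (ternary b) = x" by (simp add: euclidean_representation)
    then show "x \<in> c ` {0..1}" using ternary_bounds[of b] b by (metis atLeastAtMost_iff image_eqI)
  qed
  ultimately show ?thesis by (rule that)
qed

text \<open>The smallest parameter is chosen. Within \<open>K\<close> its sublevel set at
  \<open>a\<close> is the image of the compact set of parameters up to \<open>a\<close>, hence
  closed, which makes the choice Borel.\<close>

lemma Borel_right_inverse:
  fixes c :: "real \<Rightarrow> 'a::euclidean_space"
  assumes c: "continuous_on UNIV c" and K: "compact K" "K \<subseteq> c ` {0..1}"
  obtains s where "s \<in> borel_measurable borel" "\<And>x. 0 \<le> s x \<and> s x \<le> 1" "\<And>x. x \<in> K \<Longrightarrow> c (s x) = x"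
proof -
  define s where "s x = (if x \<in> K then Inf {u \<in> {0..1}. c u = x} else 0)" for x
  have s: "s x \<in> {0..1}" "c (s x) = x" "\<And>u. u \<in> {0..1} \<Longrightarrow> c u = x \<Longrightarrow> s x \<le> u" if x: "x \<in> K" for x
  proof -
    let ?X = "{u \<in> {0..1}. c u = x}"
    have "closed ({0..1} \<inter> c -` {x})"
      using c by (intro closed_Int closed_vimage continuous_on_closed_vimage[THEN iffD1, rule_format]) auto
    moreover have "{0..1} \<inter> c -` {x} = ?X" by auto
    ultimately have cl: "closed ?X" by simp
    have ne: "?X \<noteq> {}"
    proof -
      have "x \<in> c ` {0..1}" using K(2) x by blast
      then show ?thesis by auto
    qed
    have bdd: "bdd_below ?X" by (rule bdd_belowI[of _ 0]) auto
    have "Inf ?X \<in> ?X" by (rule closed_contains_Inf[OF ne bdd cl])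
    then show "s x \<in> {0..1}" "c (s x) = x" using x by (auto simp: s_def)
    show "s x \<le> u" if "u \<in> {0..1}" "c u = x" for u
      using x that bdd by (auto simp: s_def intro: cInf_lower)
  qed
  have "{x. s x \<le> a} \<in> sets borel" for a
  proof -
    have "{x. s x \<le> a} = (K \<inter> c ` ({0..1} \<inter> {..a})) \<union> (if 0 \<le> a then - K else {})" (is "?L = ?R")
    proof (rule set_eqI)
      fix x show "x \<in> ?L \<longleftrightarrow> x \<in> ?R"
      proof (cases "x \<in> K")
        case True
        have "s x \<le> a \<longleftrightarrow> x \<in> c ` ({0..1} \<inter> {..a})"
        proof
          assume "s x \<le> a"
          with s(1,2)[OF True] show "x \<in> c ` ({0..1} \<inter> {..a})" by (intro image_eqI[of _ _ "s x"]) auto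
        next
          assume "x \<in> c ` ({0..1} \<inter> {..a})"
          then obtain u where "x = c u" "u \<in> {0..1}" "u \<le> a" by auto
          with s(3)[OF True, of u] show "s x \<le> a" by simp
        qed
        with True show ?thesis by simp
      next
        case False
        then show ?thesis by (simp add: s_def)
      qed
    qed
    moreover have "compact (c ` ({0..1} \<inter> {..a}))"
      using c by (intro compact_continuous_image compact_Int_closed) (auto intro: continuous_on_subset)
    ultimately show ?thesis using K(1)
      by (auto intro!: sets.Un sets.Int borel_closed borel_open simp: compact_imp_closed open_Compl)
  qed
  then have "s \<in> borel_measurable borel" by (simp add: borel_measurable_iff_le)
  moreover have "0 \<le> s x \<and> s x \<le> 1" for x using s(1)[of x] by (cases "x \<in> K") (auto simp: s_def)
  ultimately show ?thesis using s(2) by (rule that)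
qed

lemma prob_weak_compactness:
  fixes m :: "nat \<Rightarrow> 'a::euclidean_space measure"
  assumes K: "compact K" and m: "\<And>k. prob_space (m k)" "\<And>k. sets (m k) = sets borel" "\<And>k. AE x in m k. x \<in> K"
  shows "\<exists>r M. strict_mono r \<and> prob_space M \<and> sets M = sets borel \<and>
    (\<forall>f :: 'a \<Rightarrow> real. continuous_on UNIV f \<longrightarrow> (\<lambda>k. integral\<^sup>L (m (r k)) f) \<longlonglongrightarrow> integral\<^sup>L M f)"
proof -
  obtain c :: "real \<Rightarrow> 'a" where c: "continuous_on UNIV c" "bounded (range c)" "K \<subseteq> c ` {0..1}"
    using space_filling_curve[OF compact_imp_bounded[OF K]] by blast
  obtain s where s: "s \<in> borel_measurable borel" "\<And>x. 0 \<le> s x \<and> s x \<le> 1" "\<And>x. x \<in> K \<Longrightarrow> c (s x) = x"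
    using Borel_right_inverse[OF c(1) K c(3)] by blast
  have cm: "c \<in> borel_measurable borel" using c(1) by (rule borel_measurable_continuous_onI)
  have sm: "s \<in> borel_measurable (m k)" for k using s(1) measurable_cong_sets[OF m(2) refl] by blast
  define p where "p k = distr (m k) borel s" for k
  have rd: "real_distribution (p k)" for k
    unfolding p_def using prob_space.real_distribution_distr[OF m(1) sm] .
  have "tight p"
    unfolding tight_def
  proof (intro conjI allI impI)
    show "real_distribution (p n)" for n by (rule rd)
    fix e :: real assume e: "0 < e"
    \<comment> \<open>All mass lies in the unit interval, so tightness is immediate; the endpoint -1
      leaves room on the left for the half-open interval.\<close>
    have "measure (p n) {-1<..1} = 1" for n
    proof -
      have "measure (p n) {-1<..1} = measure (m n) (s -` {-1<..1} \<inter> space (m n))"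
        unfolding p_def using sm by (intro measure_distr) auto
      also have "s -` {-1<..1} \<inter> space (m n) = space (m n)"
      proof -
        have "-1 < s x" for x using s(2)[of x] by linarith
        then show ?thesis using s(2) by auto
      qed
      finally show ?thesis by (simp add: prob_space.prob_space m(1))
    qed
    then show "\<exists>a b. a < b \<and> (\<forall>n. 1 - e < measure (p n) {a<..b})"
      using e by (intro exI[of _ "-1"] exI[of _ 1]) auto
  qed
  then obtain r M where r: "strict_mono r" "real_distribution M" "weak_conv_m (p \<circ> id \<circ> r) M"
    using tight_imp_convergent_subsubsequence[of p id] by (auto simp: strict_mono_id)
  interpret M: real_distribution M by fact
  have cM: "c \<in> borel_measurable M" using cm measurable_cong_sets[of M borel] by simp
  define Q where "Q = distr M borel c"
  have "prob_space Q" unfolding Q_def by (rule M.prob_space_distr[OF cM])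
  moreover have "sets Q = sets borel" by (simp add: Q_def)
  moreover have "(\<lambda>k. integral\<^sup>L (m (r k)) f) \<longlonglongrightarrow> integral\<^sup>L Q f" if f: "continuous_on UNIV f" for f :: "'a \<Rightarrow> real"
  proof -
    have fm: "f \<in> borel_measurable borel" using f by (rule borel_measurable_continuous_onI)
    have fc: "continuous_on UNIV (\<lambda>t. f (c t))"
      by (rule continuous_on_compose2[OF f c(1)]) auto
    have "compact (closure (range c))" using c(2) by simp
    then have "bounded (f ` closure (range c))"
      by (intro compact_imp_bounded compact_continuous_image continuous_on_subset[OF f]) auto
    then obtain B where B: "\<And>y. y \<in> closure (range c) \<Longrightarrow> \<bar>f y\<bar> \<le> B" by (auto simp: bounded_iff)
    \<comment> \<open>The curve has bounded range on the whole line, so \<open>f \<circ> c\<close>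
      is a bounded test function for weak convergence.\<close>
    have fB: "norm (f (c t)) \<le> B" for t using B closure_subset[of "range c"] by auto
    have ic: "isCont (\<lambda>t. f (c t)) t" for t using fc by (simp add: continuous_on_eq_continuous_at)
    have 1: "integral\<^sup>L Q f = integral\<^sup>L M (\<lambda>t. f (c t))"
      unfolding Q_def by (rule integral_distr[OF cM fm])
    have fcm: "(\<lambda>t. f (c t)) \<in> borel_measurable borel" using fc by (rule borel_measurable_continuous_onI)
    have 2: "integral\<^sup>L (p k) (\<lambda>t. f (c t)) = integral\<^sup>L (m k) f" for k
    proof -
      have "integral\<^sup>L (p k) (\<lambda>t. f (c t)) = (LINT x|m k. f (c (s x)))"
        unfolding p_def by (rule integral_distr[OF sm fcm])
      also have "\<dots> = integral\<^sup>L (m k) f"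
      proof (rule integral_cong_AE)
        show "f \<in> borel_measurable (m k)" using fm measurable_cong_sets[OF m(2) refl] by blast
        show "(\<lambda>x. f (c (s x))) \<in> borel_measurable (m k)" using measurable_compose[OF sm fcm] .
        show "AE x in m k. f (c (s x)) = f x" using m(3)[of k] by eventually_elim (simp add: s(3))
      qed
      finally show ?thesis .
    qed
    have "(\<lambda>n. integral\<^sup>L ((p \<circ> id \<circ> r) n) (\<lambda>t. f (c t))) \<longlonglongrightarrow> integral\<^sup>L M (\<lambda>t. f (c t))"
      by (rule weak_conv_imp_integral_bdd_continuous_conv[OF _ r(2,3) ic fB]) (simp add: rd)
    then show ?thesis by (simp add: 1 2)
  qed
  ultimately show ?thesis using r(1) by blast
qed

text \<open>The masses converge along a subsequence. If their limit is 0, the integrals tend to 0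
  and the null measure serves; otherwise the measures are normalised to probabilities and the weak
  limit is scaled back by the limiting mass.\<close>

lemma weak_compactness:
  fixes m :: "nat \<Rightarrow> 'a::euclidean_space measure"
  assumes K: "compact K" and m: "\<And>k. finite_measure (m k)" "\<And>k. sets (m k) = sets borel" "\<And>k. AE x in m k. x \<in> K"
    and C: "\<And>k. measure (m k) UNIV \<le> C"
  shows "\<exists>r M. strict_mono r \<and> finite_measure M \<and> sets M = sets borel \<and> measure M UNIV \<le> C \<and>
    (\<forall>f :: 'a \<Rightarrow> real. continuous_on UNIV f \<longrightarrow> (\<lambda>k. integral\<^sup>L (m (r k)) f) \<longlonglongrightarrow> integral\<^sup>L M f)"
proof -
  have sp: "space (m k) = UNIV" for k using sets_eq_imp_space_eq[OF m(2)] by simp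
  define a where "a k = measure (m k) UNIV" for k
  have "bounded (range a)" unfolding bounded_iff using C by (intro exI[of _ C]) (auto simp: a_def)
  then obtain l r1 where r1: "strict_mono r1" "(a \<circ> r1) \<longlonglongrightarrow> l"
    using bounded_imp_convergent_subsequence by blast
  have l0: "0 \<le> l" using r1(2) by (rule LIMSEQ_le_const) (auto simp: a_def)
  have lC: "l \<le> C" using r1(2) by (rule LIMSEQ_le_const2) (auto simp: a_def C)
  have fm: "f \<in> borel_measurable (m k)" if "continuous_on UNIV f" for f :: "'a \<Rightarrow> real" and k
    using borel_measurable_continuous_onI[OF that] measurable_cong_sets[OF m(2) refl] by blast
  show ?thesis
  proof (cases "l = 0")
    case True
    have "(\<lambda>k. integral\<^sup>L (m (r1 k)) f) \<longlonglongrightarrow> integral\<^sup>L (null_measure borel) f" if f: "continuous_on UNIV f" for f :: "'a \<Rightarrow> real"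
    proof -
      have "bounded (f ` K)" by (intro compact_imp_bounded compact_continuous_image continuous_on_subset[OF f] K) auto
      then obtain B where B: "0 < B" "\<And>y. y \<in> K \<Longrightarrow> \<bar>f y\<bar> \<le> B" by (auto simp: bounded_pos)
      have le: "norm (integral\<^sup>L (m k) f) \<le> B * a k" for k
      proof -
        interpret finite_measure "m k" by (rule m)
        have ae: "AE x in m k. norm (f x) \<le> B" using m(3)[of k] by eventually_elim (simp add: B)
        have i: "integrable (m k) f" by (rule integrable_const_bound[OF ae fm[OF f]])
        have "norm (integral\<^sup>L (m k) f) \<le> (LINT x|m k. norm (f x))" by (rule integral_norm_bound)
        also have "\<dots> \<le> (LINT x|m k. B)" using i ae by (intro integral_mono_AE) auto
        also have "\<dots> = B * a k" by (simp add: a_def sp)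
        finally show ?thesis .
      qed
      have "(\<lambda>k. integral\<^sup>L (m (r1 k)) f) \<longlonglongrightarrow> 0"
      proof (rule Lim_null_comparison[OF always_eventually])
        show "\<forall>k. norm (integral\<^sup>L (m (r1 k)) f) \<le> B * (a \<circ> r1) k" using le by simp
        show "(\<lambda>k. B * (a \<circ> r1) k) \<longlonglongrightarrow> 0" using tendsto_mult_right_zero[OF r1(2)[unfolded True]] .
      qed
      then show ?thesis by simp
    qed
    moreover have "finite_measure (null_measure borel :: 'a measure)" by (rule finite_measureI) simp
    ultimately show ?thesis
      using r1(1) lC True by (intro exI[of _ r1] exI[of _ "null_measure borel"]) (auto simp: measure_def)
  next
    case False
    with l0 have l: "0 < l" by simp
    then have "\<forall>\<^sub>F k in sequentially. 0 < (a \<circ> r1) k" by (rule order_tendstoD(1)[OF r1(2)])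
    then obtain n0 where n0: "\<And>k. n0 \<le> k \<Longrightarrow> 0 < a (r1 k)" by (auto simp: eventually_sequentially)
    \<comment> \<open>Initial terms are dropped so that every remaining mass is positive and can be
      divided by.\<close>
    define r2 where "r2 k = r1 (k + n0)" for k
    have r2: "strict_mono r2" using r1(1) by (auto simp: r2_def strict_mono_def)
    have a0: "0 < a (r2 k)" for k by (simp add: r2_def n0)
    have al: "(\<lambda>k. a (r2 k)) \<longlonglongrightarrow> l" using LIMSEQ_ignore_initial_segment[OF r1(2), of n0] by (simp add: r2_def)
    define q where "q k = density (m (r2 k)) (\<lambda>_. ennreal (1 / a (r2 k)))" for k
    have q: "prob_space (q k)" "sets (q k) = sets borel" "AE x in q k. x \<in> K" for k
    proof -
      interpret finite_measure "m (r2 k)" by (rule m)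
      have "emeasure (q k) (space (q k)) = ennreal (1 / a (r2 k)) * emeasure (m (r2 k)) UNIV"
        unfolding q_def by (subst emeasure_density_const) (auto simp: sp m)
      also have "\<dots> = 1" using a0[of k] by (simp add: a_def emeasure_eq_measure ennreal_mult'[symmetric])
      finally show "prob_space (q k)" by (rule prob_spaceI)
      show "sets (q k) = sets borel" by (simp add: q_def m)
      show "AE x in q k. x \<in> K" unfolding q_def
        using m(3)[of "r2 k"] by (subst AE_density) (auto elim: eventually_mono)
    qed
    obtain r3 Q where Q: "strict_mono r3" "prob_space Q" "sets Q = sets borel"
      "\<And>f :: 'a \<Rightarrow> real. continuous_on UNIV f \<Longrightarrow> (\<lambda>k. integral\<^sup>L (q (r3 k)) f) \<longlonglongrightarrow> integral\<^sup>L Q f"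
      using prob_weak_compactness[of K q, OF K q] by blast
    interpret Q: prob_space Q by fact
    have spQ: "space Q = UNIV" using sets_eq_imp_space_eq[OF Q(3)] by simp
    define M where "M = density Q (\<lambda>_. ennreal l)"
    have em: "emeasure M UNIV = ennreal l"
      unfolding M_def using Q.emeasure_space_1 by (subst emeasure_density_const) (auto simp: spQ Q)
    have "finite_measure M" by (rule finite_measureI) (simp add: M_def spQ em[unfolded M_def])
    moreover have "sets M = sets borel" by (simp add: M_def Q)
    moreover have "measure M UNIV \<le> C" using em l lC by (simp add: measure_def)
    moreover have "strict_mono (\<lambda>k. r2 (r3 k))" using r2 Q(1) by (auto simp: strict_mono_def)
    moreover have "(\<lambda>k. integral\<^sup>L (m (r2 (r3 k))) f) \<longlonglongrightarrow> integral\<^sup>L M f" if f: "continuous_on UNIV f" for f :: "'a \<Rightarrow> real"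
    proof -
      have "integral\<^sup>L (q k) f = integral\<^sup>L (m (r2 k)) f / a (r2 k)" for k
        unfolding q_def using a0[of k] fm[OF f, of "r2 k"] by (subst integral_density) auto
      then have e1: "integral\<^sup>L (m (r2 k)) f = a (r2 k) * integral\<^sup>L (q k) f" for k using a0[of k] by simp
      have "f \<in> borel_measurable Q" using borel_measurable_continuous_onI[OF f] measurable_cong_sets[OF Q(3) refl] by blast
      then have e2: "integral\<^sup>L M f = l * integral\<^sup>L Q f"
        unfolding M_def using l by (subst integral_density) auto
      have "(\<lambda>k. a (r2 (r3 k)) * integral\<^sup>L (q (r3 k)) f) \<longlonglongrightarrow> l * integral\<^sup>L Q f"
        using LIMSEQ_subseq_LIMSEQ[OF al Q(1)] Q(4)[OF f] by (intro tendsto_mult) (auto simp: o_def)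
      then show ?thesis by (simp add: e1 e2)
    qed
    ultimately show ?thesis by blast
  qed
qed

subsection \<open>Trace measures\<close>

text \<open>The convolution of 1 with a compactly supported function is constant, so its gradient is
  0; but that gradient is also the integral of the gradient of the kernel.\<close>

lemma integral_grad_eq_0:
  fixes f :: "'a::euclidean_space \<Rightarrow> real"
  assumes f: "C1 f" "f \<in> Cc UNIV"
  shows "(LINT y|lborel. grad f y) = 0"
proof -
  \<comment> \<open>The convolution at 0 evaluates the kernel at \<open>0 - y\<close>, which this
    reflection undoes.\<close>
  define g where "g z = f (- z)" for z
  have der: "(g has_derivative (\<lambda>h. h \<bullet> - grad f (- z))) (at z)" for z
  proof -
    have "((\<lambda>y. - y) has_derivative (\<lambda>h. - h)) (at z)" by (auto intro!: derivative_eq_intros)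
    from has_derivative_compose[OF this C1_has_derivative[OF f(1)]] show ?thesis by (simp add: g_def[abs_def])
  qed
  have "continuous_on UNIV (\<lambda>z. - grad f (- z))"
    by (intro continuous_intros continuous_on_compose2[OF C1_continuous_grad[OF f(1)]]) auto
  note g = C1I[OF der this]
  obtain r where "vanishes_outside r f" using Cc_vanishes[OF f(2)] .
  then have r: "vanishes_outside r g" by (simp add: vanishes_outside_def g_def)
  have one: "locally_bounded (\<lambda>_ :: 'a. 1)" by (rule locally_bounded_continuous) simp
  have "convol (\<lambda>_. 1) g = (\<lambda>x. LINT y|lborel. g y)"
    using lborel_integral_affine[of g "-1"] C1_continuous[OF g(1)]
    by (auto simp: convol_def borel_measurable_continuous_onI fun_eq_iff)
  then have "grad (convol (\<lambda>_. 1) g) 0 = 0"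
    by (intro grad_eqI) simp
  then have "(LINT y|lborel. grad g (0 - y)) = 0"
    using grad_convol[OF one g(1) r, of 0] by simp
  then show ?thesis by (simp add: g(2))
qed

text \<open>The classical gradient is the weak one, since the gradient of a product of two test
  functions integrates to 0. Smooth test functions thereby become available in
  \<open>is_trace_measure\<close>, for uniqueness and as the base of the extension to Borel
  functions.\<close>

lemma Cc_inf_W1inf:
  assumes \<Omega>: "open \<Omega>" and \<phi>: "\<phi> \<in> Cc_inf \<Omega>"
  shows "\<phi> \<in> W1inf \<Omega>"
proof -
  note C1\<phi> = Cc_inf_C1[OF \<phi>] note Cc\<phi> = Cc_inf_Cc[OF \<phi>]
  obtain K where K: "compact K" "K \<subseteq> \<Omega>" "\<And>x. x \<notin> K \<Longrightarrow> \<phi> x = 0" using CcE[OF Cc\<phi>] by metis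
  have gz: "grad \<phi> x = 0" if "x \<notin> K" for x
    using grad_zero_on_open[of "- K" x \<phi>] that K(3) compact_imp_closed[OF K(1)] by (simp add: open_Compl)
  obtain B where B: "\<And>x. \<bar>\<phi> x\<bar> \<le> B" using Cc_bounded[OF Cc\<phi>] by blast
  have "bounded (grad \<phi> ` K)"
    using C1_continuous_grad[OF C1\<phi>] K(1)
    by (intro compact_imp_bounded compact_continuous_image) (auto intro: continuous_on_subset)
  then obtain C where C: "0 < C" "\<And>x. x \<in> K \<Longrightarrow> norm (grad \<phi> x) \<le> C" by (auto simp: bounded_pos)
  have normC: "norm (grad \<phi> x) \<le> C" for x using C gz[of x] by (cases "x \<in> K") auto
  have "(LINT x:\<Omega>|lborel. \<phi> x *\<^sub>R grad \<eta> x) = - (LINT x:\<Omega>|lborel. \<eta> x *\<^sub>R grad \<phi> x)"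
    if \<eta>: "\<eta> \<in> Cc_inf \<Omega>" for \<eta>
  proof -
    note C1\<eta> = Cc_inf_C1[OF \<eta>]
    have prod: "(\<lambda>x. \<phi> x * \<eta> x) \<in> Cc UNIV"
      using Cc_mult[OF Cc_inf_Cc[OF \<eta>] C1_continuous[OF C1\<phi>]] Cc_mono[of \<Omega> UNIV] by auto
    have c: "continuous_on K (\<lambda>x. \<phi> x *\<^sub>R grad \<eta> x)" "continuous_on K (\<lambda>x. \<eta> x *\<^sub>R grad \<phi> x)"
      by (auto intro!: continuous_intros continuous_on_subset[OF C1_continuous] C1\<phi> C1\<eta>
          continuous_on_subset[OF C1_continuous_grad])
    have e: "indicator K x *\<^sub>R \<phi> x *\<^sub>R grad \<eta> x = \<phi> x *\<^sub>R grad \<eta> x"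
      "indicator K x *\<^sub>R \<eta> x *\<^sub>R grad \<phi> x = \<eta> x *\<^sub>R grad \<phi> x"
      "indicator \<Omega> x *\<^sub>R \<phi> x *\<^sub>R grad \<eta> x = \<phi> x *\<^sub>R grad \<eta> x"
      "indicator \<Omega> x *\<^sub>R \<eta> x *\<^sub>R grad \<phi> x = \<eta> x *\<^sub>R grad \<phi> x" for x
      using K(2) K(3)[of x] gz[of x] by (auto simp: indicator_def)
    have i: "integrable lborel (\<lambda>x. \<phi> x *\<^sub>R grad \<eta> x)" "integrable lborel (\<lambda>x. \<eta> x *\<^sub>R grad \<phi> x)"
      using borel_integrable_compact[OF K(1) c(1)] borel_integrable_compact[OF K(1) c(2)] by (simp_all only: e)
    have "(LINT x|lborel. \<phi> x *\<^sub>R grad \<eta> x + \<eta> x *\<^sub>R grad \<phi> x) = 0"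
      using integral_grad_eq_0[OF C1_mult(1)[OF C1\<phi> C1\<eta>] prod] C1_mult(2)[OF C1\<phi> C1\<eta>] by simp
    then have "(LINT x|lborel. \<phi> x *\<^sub>R grad \<eta> x) = - (LINT x|lborel. \<eta> x *\<^sub>R grad \<phi> x)"
      using i by (simp add: eq_neg_iff_add_eq_0)
    then show ?thesis unfolding set_lebesgue_integral_def e .
  qed
  moreover have "set_borel_measurable lborel \<Omega> (grad \<phi>)"
    unfolding set_borel_measurable_def
    using borel_measurable_continuous_onI[OF C1_continuous_grad[OF C1\<phi>]] \<Omega>
    by (intro borel_measurable_scaleR borel_measurable_indicator) auto
  moreover have "continuous_on \<Omega> \<phi>" using C1_continuous[OF C1\<phi>] by (rule continuous_on_subset) simp
  moreover have "bounded (\<phi> ` \<Omega>)" using B by (auto simp: bounded_iff)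
  moreover have "AE x in lborel. x \<in> \<Omega> \<longrightarrow> norm (grad \<phi> x) \<le> C" using normC by simp
  ultimately show ?thesis unfolding W1inf_def by blast
qed

context dm_field_on_open
begin

lemma frontier_inner_set: "frontier (inner_set U t) \<subseteq> closure U" "frontier (inner_set U t) \<subseteq> \<Omega>"
proof -
  have "inner_set U t \<subseteq> U" by (auto simp: inner_set_eq)
  then have "closure (inner_set U t) \<subseteq> closure U" by (rule closure_mono)
  then show *: "frontier (inner_set U t) \<subseteq> closure U" by (auto simp: frontier_def)
  with closure_U show "frontier (inner_set U t) \<subseteq> \<Omega>" by auto
qed

lemma trace_measure_unique:
  assumes \<mu>: "is_trace_measure \<rho> \<Omega> F (inner_set U t) \<mu>" and \<mu>': "is_trace_measure \<rho> \<Omega> F (inner_set U t) \<mu>'"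
  shows "\<mu> = \<mu>'"
proof -
  let ?S = "frontier (inner_set U t)"
  have fv: "finite_vmeasure ?S \<mu>" "finite_vmeasure ?S \<mu>'" using \<mu> \<mu>' by (auto simp: is_trace_measure_def)
  have Sb: "?S \<in> sets borel" by (simp add: borel_closed)
  show ?thesis
  proof (rule finite_vmeasure_eqI[OF fv])
    fix A assume A: "A \<in> sets (restrict_space borel ?S)"
    then have AS: "A \<in> sets borel" "A \<subseteq> ?S" using Sb by (auto simp: sets_restrict_space_iff)
    then have "indicator A \<in> bounded_borel \<Omega>"
      using frontier_inner_set(2) by (intro bounded_borel_indicator sets_\<Omega>I) auto
    from signed_integral_eqI_Cc_inf[OF open_\<Omega> fv frontier_inner_set(2) _ this]
    have "signed_integral ?S \<mu> ?S (indicator A) = signed_integral ?S \<mu>' ?S (indicator A)"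
      using \<mu> \<mu>' Cc_inf_W1inf[OF open_\<Omega>] unfolding is_trace_measure_def by metis
    then show "\<mu> A = \<mu>' A"
      using A by (simp add: signed_integral_indicator[OF fv(1)] signed_integral_indicator[OF fv(2)])
  qed
qed

section \<open>Rescaled measures on thin bands\<close>

definition "band t k = {x\<in>U. t < bdist x \<and> bdist x < t + 1 / real (Suc k)}"

lemma open_band: "open (band t k)"
proof -
  have "band t k = U \<inter> {x. t < bdist x} \<inter> {x. bdist x < t + 1 / real (Suc k)}" by (auto simp: band_def)
  moreover have "open {x. t < bdist x}" "open {x. bdist x < t + 1 / real (Suc k)}"
    by (intro open_Collect_less continuous_intros continuous_bdist)+
  ultimately show ?thesis using open_U by (simp add: open_Int)
qed

lemma band_sets: "band t k \<in> sets (restrict_space borel \<Omega>)" "band t k \<in> sets borel"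
proof -
  show "band t k \<in> sets borel" using open_band by simp
  then show "band t k \<in> sets (restrict_space borel \<Omega>)"
    by (rule sets_\<Omega>I) (use U_subset in \<open>auto simp: band_def\<close>)
qed

lemma band_mono: "j \<le> k \<Longrightarrow> band t k \<subseteq> band t j"
proof -
  assume "j \<le> k"
  then have "1 / real (Suc k) \<le> 1 / real (Suc j)" by (intro divide_left_mono) auto
  then show ?thesis by (auto simp: band_def)
qed

text \<open>A point in all the closures has distance at most \<open>t\<close>, so it lies outside
  the open inner set, yet it is a limit of points of that set. This locates the support of the weak
  limits.\<close>

lemma Inter_closure_band: "(\<Inter>j. closure (band t j)) \<subseteq> frontier (inner_set U t)"
proof
  fix x assume x: "x \<in> (\<Inter>j. closure (band t j))"
  have "band t 0 \<subseteq> inner_set U t" by (auto simp: band_def inner_set_eq)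
  then have "x \<in> closure (inner_set U t)" using x closure_mono by blast
  moreover have "bdist x \<le> t"
  proof (rule field_le_epsilon)
    fix e :: real assume "0 < e"
    then obtain j where j: "1 / real (Suc j) < e" using nat_approx_posE by blast
    have "closure (band t j) \<subseteq> {x. bdist x \<le> t + 1 / real (Suc j)}"
      by (intro closure_minimal closed_Collect_le continuous_intros continuous_bdist) (auto simp: band_def)
    then have "bdist x \<le> t + 1 / real (Suc j)" using x by auto
    then show "bdist x \<le> t + e" using j by linarith
  qed
  then have "x \<notin> inner_set U t" by (simp add: inner_set_eq)
  ultimately show "x \<in> frontier (inner_set U t)"
    using open_inner_set[of t] by (simp add: frontier_def interior_open)
qed

text \<open>The factor is the reciprocal width of the band. The image under the identity moves the
  measure from the Borel sets of \<open>\<Omega>\<close> to those of the whole space, where weak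
  limits are taken.\<close>

definition scaled_band :: "'a measure \<Rightarrow> real \<Rightarrow> nat \<Rightarrow> 'a measure" where
  "scaled_band m t k = distr (density m (\<lambda>x. ennreal (real (Suc k)) * indicator (band t k) x)) borel (\<lambda>x. x)"

context
  fixes m :: "'a measure"
  assumes m: "finite_measure m" and sets_m: "sets m = sets (restrict_space borel \<Omega>)"
begin

lemma space_m: "space m = \<Omega>"
  using sets_eq_imp_space_eq[OF sets_m] by (simp add: space_restrict_space)

lemma measurable_m: "g \<in> borel_measurable m" if g: "g \<in> borel_measurable borel" for g :: "'a \<Rightarrow> 'c::topological_space"
  unfolding measurable_cong_sets[OF sets_m refl] by (rule measurable_restrict_space1[OF g])

lemma band_m: "band t k \<in> sets m"
  using band_sets sets_m by simp

lemma ident_measurable: "(\<lambda>x. x) \<in> measurable (density m h) borel"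
  using measurable_m[of "\<lambda>x::'a. x"] by simp

lemma sets_scaled_band: "sets (scaled_band m t k) = sets borel"
  by (simp add: scaled_band_def)

lemma emeasure_scaled_band: "emeasure (scaled_band m t k) A = ennreal (real (Suc k)) * emeasure m (band t k \<inter> A)"
  if A: "A \<in> sets borel"
proof -
  have A': "A \<inter> space m \<in> sets m"
    unfolding space_m sets_m using sets.Int[OF A \<Omega>_borel] by (rule sets_\<Omega>I) simp
  have bA: "band t k \<inter> A \<in> sets m"
  proof -
    have "band t k \<inter> A = band t k \<inter> (A \<inter> space m)" using sets.sets_into_space[OF band_m] by auto
    then show ?thesis using A' band_m by simp
  qed
  have "emeasure (scaled_band m t k) A = (\<integral>\<^sup>+x. ennreal (real (Suc k)) * indicator (band t k) x * indicator (A \<inter> space m) x \<partial>m)"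
    unfolding scaled_band_def using A A' band_m[of t k]
    by (subst emeasure_distr[OF ident_measurable]) (auto simp: emeasure_density)
  also have "\<dots> = (\<integral>\<^sup>+x. ennreal (real (Suc k)) * indicator (band t k \<inter> A) x \<partial>m)"
    by (intro nn_integral_cong) (auto simp: indicator_def)
  also have "\<dots> = ennreal (real (Suc k)) * emeasure m (band t k \<inter> A)"
    by (rule nn_integral_cmult_indicator[OF bA])
  finally show ?thesis .
qed

lemma finite_scaled_band: "finite_measure (scaled_band m t k)"
proof (rule finite_measureI)
  interpret finite_measure m by (rule m)
  have "space (scaled_band m t k) = UNIV" by (simp add: scaled_band_def)
  then show "emeasure (scaled_band m t k) (space (scaled_band m t k)) \<noteq> \<infinity>"
    by (simp add: emeasure_scaled_band ennreal_mult_eq_top_iff)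
qed

lemma AE_scaled_band: "AE x in scaled_band m t k. x \<in> closure (band t k)"
proof (rule AE_I'[where N="- closure (band t k)"])
  have "band t k \<inter> - closure (band t k) = {}" using closure_subset by auto
  then have "emeasure (scaled_band m t k) (- closure (band t k)) = 0"
    by (subst emeasure_scaled_band) auto
  then show "- closure (band t k) \<in> null_sets (scaled_band m t k)"
    by (auto simp: null_sets_def sets_scaled_band)
qed auto

lemma integral_scaled_band:
  fixes f :: "'a \<Rightarrow> real"
  assumes f: "f \<in> borel_measurable borel"
  shows "integral\<^sup>L (scaled_band m t k) f = (LINT x|m. f x * (real (Suc k) * indicator (band t k) x))"
proof -
  have fm: "f \<in> borel_measurable m" by (rule measurable_m[OF f])
  have "integral\<^sup>L (scaled_band m t k) f = integral\<^sup>L (density m (\<lambda>x. ennreal (real (Suc k) * indicator (band t k) x))) f"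
    unfolding scaled_band_def
    by (subst integral_distr[OF ident_measurable f])
      (auto intro!: arg_cong2[of _ _ _ _ "integral\<^sup>L"] arg_cong[of _ _ "density m"] simp: indicator_def)
  also have "\<dots> = (LINT x|m. (real (Suc k) * indicator (band t k) x) *\<^sub>R f x)"
    using fm band_m[of t k] by (intro integral_density) auto
  finally show ?thesis by (simp add: mult_ac)
qed

text \<open>A point \<open>x\<close> lies in the band only for levels \<open>t\<close> in an
  interval of length \<open>1 / real (Suc k)\<close>. Tonelli's theorem exchanges the integrals, and
  this length cancels the normalising factor.\<close>

lemma
  shows emeasure_band_measurable: "(\<lambda>t. emeasure m (band t k)) \<in> borel_measurable borel"
    and nn_integral_band: "(\<integral>\<^sup>+t. ennreal (real (Suc k)) * emeasure m (band t k) \<partial>lborel) \<le> emeasure m \<Omega>"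
proof -
  interpret m: finite_measure m by (rule m)
  interpret pair_sigma_finite lborel m ..
  have [measurable]: "bdist \<in> borel_measurable m" by (rule measurable_m[OF bdist_measurable])
  have [measurable]: "U \<in> sets m" using U_sets sets_m by simp
  define h where "h p = (if fst p < bdist (snd p) \<and> bdist (snd p) < fst p + 1 / real (Suc k) then indicator U (snd p) else 0 :: ennreal)"
    for p :: "real \<times> 'a"
  have [measurable]: "h \<in> borel_measurable (lborel \<Otimes>\<^sub>M m)" unfolding h_def by measurable
  have h: "h (t, x) = indicator (band t k) x" for t x by (auto simp: h_def band_def indicator_def)
  have em: "(\<integral>\<^sup>+x. h (t, x) \<partial>m) = emeasure m (band t k)" for t
    unfolding h by (rule nn_integral_indicator[OF band_m])
  have "(\<lambda>t. \<integral>\<^sup>+x. h (t, x) \<partial>m) \<in> borel_measurable lborel" by measurable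
  then show "(\<lambda>t. emeasure m (band t k)) \<in> borel_measurable borel" by (simp add: em)
  then have "(\<integral>\<^sup>+t. ennreal (real (Suc k)) * emeasure m (band t k) \<partial>lborel) = ennreal (real (Suc k)) * (\<integral>\<^sup>+t. (\<integral>\<^sup>+x. h (t, x) \<partial>m) \<partial>lborel)"
    unfolding em by (intro nn_integral_cmult) simp
  also have "(\<integral>\<^sup>+t. (\<integral>\<^sup>+x. h (t, x) \<partial>m) \<partial>lborel) = (\<integral>\<^sup>+x. (\<integral>\<^sup>+t. h (t, x) \<partial>lborel) \<partial>m)"
    by (rule Fubini[symmetric]) measurable
  also have "\<dots> \<le> (\<integral>\<^sup>+x. ennreal (1 / real (Suc k)) \<partial>m)"
  proof (rule nn_integral_mono)
    fix x
    have "(\<integral>\<^sup>+t. h (t, x) \<partial>lborel) \<le> (\<integral>\<^sup>+t. indicator {bdist x - 1 / real (Suc k)<..<bdist x} t \<partial>lborel)"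
      unfolding h by (intro nn_integral_mono) (auto simp: indicator_def band_def)
    also have "\<dots> = ennreal (1 / real (Suc k))" by simp
    finally show "(\<integral>\<^sup>+t. h (t, x) \<partial>lborel) \<le> ennreal (1 / real (Suc k))" .
  qed
  also have "(\<integral>\<^sup>+x. ennreal (1 / real (Suc k)) \<partial>m) = ennreal (1 / real (Suc k)) * emeasure m \<Omega>"
    by (simp add: space_m)
  finally have "(\<integral>\<^sup>+t. ennreal (real (Suc k)) * emeasure m (band t k) \<partial>lborel) \<le>
     ennreal (real (Suc k)) * (ennreal (1 / real (Suc k)) * emeasure m \<Omega>)"
    by (simp add: mult_left_mono)
  also have "\<dots> = emeasure m \<Omega>"
    unfolding mult.assoc[symmetric] by (subst ennreal_mult[symmetric]) auto
  finally show "(\<integral>\<^sup>+t. ennreal (real (Suc k)) * emeasure m (band t k) \<partial>lborel) \<le> emeasure m \<Omega>" .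
qed

end

definition "band_density t k =
  ennreal (real (Suc k)) * emeasure (pos_variation \<Omega> \<nu>) (band t k) +
  ennreal (real (Suc k)) * emeasure (neg_variation \<Omega> \<nu>) (band t k)"

text \<open>
  Fatou's lemma applied to \<open>band_density\<close> replaces the almost everywhere differentiability of the monotone
  function \<open>t \<mapsto> |\<nu>|({x \<in> U. d x \<le> t})\<close>.
\<close>

definition "lower_density t = liminf (band_density t)"

lemmas \<nu>_pos = Jordan_decomposition(1)[OF finite_vmeasure_\<nu>]
lemmas \<nu>_neg = Jordan_decomposition(2)[OF finite_vmeasure_\<nu>]

lemma band_density_measurable: "(\<lambda>t. band_density t k) \<in> borel_measurable borel"
  unfolding band_density_def
  by (intro borel_measurable_add borel_measurable_times_ennreal borel_measurable_const
      emeasure_band_measurable \<nu>_pos \<nu>_neg sets_pos_variation sets_neg_variation)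

lemma lower_density_measurable: "lower_density \<in> borel_measurable borel"
  unfolding lower_density_def[abs_def] by (rule borel_measurable_liminf) (rule band_density_measurable)

lemma nn_integral_lower_density: "(\<integral>\<^sup>+t. lower_density t \<partial>lborel) < \<infinity>"
proof -
  interpret p: finite_measure "pos_variation \<Omega> \<nu>" by (rule \<nu>_pos)
  interpret n: finite_measure "neg_variation \<Omega> \<nu>" by (rule \<nu>_neg)
  let ?C = "emeasure (pos_variation \<Omega> \<nu>) \<Omega> + emeasure (neg_variation \<Omega> \<nu>) \<Omega>"
  have "(\<integral>\<^sup>+t. lower_density t \<partial>lborel) \<le> liminf (\<lambda>k. \<integral>\<^sup>+t. band_density t k \<partial>lborel)"
    unfolding lower_density_def using band_density_measurable by (intro nn_integral_liminf) auto
  also have "\<dots> \<le> liminf (\<lambda>k. ?C)"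
  proof (rule Liminf_mono, rule always_eventually, rule allI)
    fix k
    have "(\<integral>\<^sup>+t. band_density t k \<partial>lborel) =
      (\<integral>\<^sup>+t. ennreal (real (Suc k)) * emeasure (pos_variation \<Omega> \<nu>) (band t k) \<partial>lborel) +
      (\<integral>\<^sup>+t. ennreal (real (Suc k)) * emeasure (neg_variation \<Omega> \<nu>) (band t k) \<partial>lborel)"
      unfolding band_density_def
      using emeasure_band_measurable[OF \<nu>_pos sets_pos_variation, of k]
        emeasure_band_measurable[OF \<nu>_neg sets_neg_variation, of k]
      by (intro nn_integral_add) auto
    also have "\<dots> \<le> ?C"
      by (intro add_mono nn_integral_band \<nu>_pos \<nu>_neg sets_pos_variation sets_neg_variation)
    finally show "(\<integral>\<^sup>+t. band_density t k \<partial>lborel) \<le> ?C" .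
  qed
  also have "\<dots> = ?C" by (simp add: Liminf_const)
  also have "\<dots> < \<infinity>" by (simp add: less_top[symmetric])
  finally show ?thesis .
qed

lemma AE_lower_density: "AE t in lborel. lower_density t < \<infinity>"
proof -
  have "AE t in lborel. lower_density t \<noteq> \<infinity>"
    using nn_integral_lower_density lower_density_measurable by (intro nn_integral_noteq_infinite) auto
  then show ?thesis by eventually_elim (simp add: less_top)
qed

text \<open>Infinitely many bands have density at most \<open>C\<close>, so the scaled positive and
  negative variations have weakly convergent subsequences, whose limits live on the boundary of the
  inner set; \<open>NT_limit\<close> identifies their difference. The bound on integrals is stated
  alongside because it becomes the dominating function in \<open>t\<close>.\<close>

lemma trace_measure_exists:
  assumes t: "0 < t" and fin: "lower_density t < \<infinity>"
  shows "\<exists>\<mu>. is_trace_measure \<rho> \<Omega> F (inner_set U t) \<mu> \<and>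
    (\<forall>f\<in>bounded_borel \<Omega>. \<forall>B\<ge>0. (\<forall>x\<in>\<Omega>. \<bar>f x\<bar> \<le> B) \<longrightarrow>
      \<bar>signed_integral (frontier (inner_set U t)) \<mu> (frontier (inner_set U t)) f\<bar> \<le>
        2 * (enn2real (lower_density t) + 1) * B)"
proof -
  let ?S = "frontier (inner_set U t)"
  \<comment> \<open>Strictly above the lower limit, so that infinitely many terms of the sequence
    lie below it.\<close>
  define C where "C = enn2real (lower_density t) + 1"
  have C0: "0 \<le> C" by (simp add: C_def)
  have "lower_density t < ennreal C"
  proof -
    have "lower_density t = ennreal (enn2real (lower_density t))" using fin by (simp add: less_top)
    also have "\<dots> < ennreal C" by (intro ennreal_lessI) (simp_all add: C_def add_nonneg_pos)
    finally show ?thesis .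
  qed
  then have "\<not> (\<forall>\<^sub>F k in sequentially. ennreal C \<le> band_density t k)"
    using Liminf_bounded[of "ennreal C" "band_density t" sequentially] unfolding lower_density_def by auto
  then have "\<exists>\<^sub>F k in sequentially. band_density t k \<le> ennreal C"
    unfolding frequently_def by (rule contrapos_nn) (auto elim!: eventually_mono)
  then have inf: "infinite {k. band_density t k \<le> ennreal C}"
    by (simp add: frequently_cofinite[symmetric] cofinite_eq_sequentially)
  obtain r0 :: "nat \<Rightarrow> nat" where "strict_mono r0 \<and> (\<forall>n. r0 n \<in> {k. band_density t k \<le> ennreal C})"
    using infinite_enumerate[OF inf] ..
  then have r0: "strict_mono r0" "\<And>k. band_density t (r0 k) \<le> ennreal C" by simp_all
  let ?mp = "\<lambda>k. scaled_band (pos_variation \<Omega> \<nu>) t k" and ?mn = "\<lambda>k. scaled_band (neg_variation \<Omega> \<nu>) t k"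
  have mass: "measure (scaled_band m t (r0 k)) UNIV \<le> C"
    if m: "finite_measure m" "sets m = sets (restrict_space borel \<Omega>)"
      and le: "ennreal (real (Suc (r0 k))) * emeasure m (band t (r0 k)) \<le> band_density t (r0 k)" for m k
  proof -
    have "emeasure (scaled_band m t (r0 k)) UNIV \<le> ennreal C"
      using le r0(2)[of k] by (simp add: emeasure_scaled_band[OF m])
    then show ?thesis using C0 by (simp add: measure_def enn2real_leI)
  qed
  have supp: "AE x in scaled_band m t k. x \<in> closure U"
    if m: "finite_measure m" "sets m = sets (restrict_space borel \<Omega>)" for m k
  proof -
    have "closure (band t k) \<subseteq> closure U" by (rule closure_mono) (auto simp: band_def)
    with AE_scaled_band[OF m, of t k] show ?thesis by (auto elim: eventually_mono)
  qed
  note P = \<nu>_pos sets_pos_variation[of \<Omega> \<nu>] note N = \<nu>_neg sets_neg_variation[of \<Omega> \<nu>]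
  have "\<exists>r M. strict_mono r \<and> finite_measure M \<and> sets M = sets borel \<and> measure M UNIV \<le> C \<and>
    (\<forall>f :: 'a \<Rightarrow> real. continuous_on UNIV f \<longrightarrow> (\<lambda>k. integral\<^sup>L (?mp (r0 (r k))) f) \<longlonglongrightarrow> integral\<^sup>L M f)"
  proof (rule weak_compactness[OF compact_U, of "\<lambda>k. ?mp (r0 k)"])
    show "measure (?mp (r0 k)) UNIV \<le> C" for k by (rule mass[OF P]) (simp add: band_density_def)
  qed (rule finite_scaled_band[OF P] sets_scaled_band[OF P] supp[OF P])+
  then obtain r1 M1 where r1: "strict_mono r1" and M1: "finite_measure M1" "sets M1 = sets borel" "measure M1 UNIV \<le> C"
    and lim1: "\<And>f :: 'a \<Rightarrow> real. continuous_on UNIV f \<Longrightarrow> (\<lambda>k. integral\<^sup>L (?mp (r0 (r1 k))) f) \<longlonglongrightarrow> integral\<^sup>L M1 f"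
    by blast
  \<comment> \<open>A further subsequence of the first one, so that both variations converge along
    the same indices.\<close>
  have "\<exists>r M. strict_mono r \<and> finite_measure M \<and> sets M = sets borel \<and> measure M UNIV \<le> C \<and>
    (\<forall>f :: 'a \<Rightarrow> real. continuous_on UNIV f \<longrightarrow> (\<lambda>k. integral\<^sup>L (?mn (r0 (r1 (r k)))) f) \<longlonglongrightarrow> integral\<^sup>L M f)"
  proof (rule weak_compactness[OF compact_U, of "\<lambda>k. ?mn (r0 (r1 k))"])
    show "measure (?mn (r0 (r1 k))) UNIV \<le> C" for k by (rule mass[OF N]) (simp add: band_density_def)
  qed (rule finite_scaled_band[OF N] sets_scaled_band[OF N] supp[OF N])+
  then obtain r2 M2 where r2: "strict_mono r2" and M2: "finite_measure M2" "sets M2 = sets borel" "measure M2 UNIV \<le> C"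
    and lim2: "\<And>f :: 'a \<Rightarrow> real. continuous_on UNIV f \<Longrightarrow> (\<lambda>k. integral\<^sup>L (?mn (r0 (r1 (r2 k)))) f) \<longlonglongrightarrow> integral\<^sup>L M2 f"
    by blast
  define r where "r k = r0 (r1 (r2 k))" for k
  have r: "strict_mono r" using r0(1) r1 r2 by (auto simp: r_def strict_mono_def)
  have lim1': "(\<lambda>k. integral\<^sup>L (?mp (r k)) f) \<longlonglongrightarrow> integral\<^sup>L M1 f" if "continuous_on UNIV f" for f :: "'a \<Rightarrow> real"
    using LIMSEQ_subseq_LIMSEQ[OF lim1[OF that] r2] by (simp add: o_def r_def)
  have lim2': "(\<lambda>k. integral\<^sup>L (?mn (r k)) f) \<longlonglongrightarrow> integral\<^sup>L M2 f" if "continuous_on UNIV f" for f :: "'a \<Rightarrow> real"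
    using lim2[OF that] by (simp add: r_def)
  have limit_support: "AE x in M. x \<in> ?S"
    if m: "finite_measure m" "sets m = sets (restrict_space borel \<Omega>)" and M: "finite_measure M" "sets M = sets borel"
      and lim: "\<And>f :: 'a \<Rightarrow> real. continuous_on UNIV f \<Longrightarrow> (\<lambda>k. integral\<^sup>L (scaled_band m t (r k)) f) \<longlonglongrightarrow> integral\<^sup>L M f"
    for m M
  proof -
    have "AE x in M. x \<in> closure (band t j)" for j
    proof -
      \<comment> \<open>A bounded continuous function that vanishes exactly on the closure of band
        \<open>j\<close>, hence on all later bands, so the limit measure gives it integral 0. An
        empty band is treated apart because \<open>infdist\<close> to the empty set is 0; the value
        1 then shows that the limit has no mass.\<close>
      define f where "f x = (if band t j = {} then 1 else min 1 (infdist x (closure (band t j))))" for x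
      have cf: "continuous_on UNIV f" unfolding f_def by (cases "band t j = {}") (auto intro!: continuous_intros)
      have f01: "0 \<le> f x" "f x \<le> 1" for x by (auto simp: f_def infdist_nonneg)
      have f0: "f x = 0 \<longleftrightarrow> x \<in> closure (band t j)" for x
      proof (cases "band t j = {}")
        case False
        then have "x \<in> closure (band t j) \<longleftrightarrow> infdist x (closure (band t j)) = 0"
          by (intro in_closed_iff_infdist_zero) auto
        with False show ?thesis by (auto simp: f_def min_def)
      qed (simp add: f_def)
      have "\<forall>\<^sub>F k in sequentially. integral\<^sup>L (scaled_band m t (r k)) f = 0"
        using eventually_ge_at_top[of j]
      proof eventually_elim
        case (elim k)
        have "j \<le> r k" using elim strict_mono_imp_increasing[OF r, of k] by linarith
        then have "band t (r k) \<subseteq> closure (band t j)" using band_mono[of j "r k" t] closure_subset by blast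
        then have z: "f x * (real (Suc (r k)) * indicator (band t (r k)) x) = 0" for x
          using f0[of x] by (auto simp: indicator_def)
        show ?case
          unfolding integral_scaled_band[OF m borel_measurable_continuous_onI[OF cf]] z by simp
      qed
      then have "(\<lambda>k. integral\<^sup>L (scaled_band m t (r k)) f) \<longlonglongrightarrow> 0" by (rule tendsto_eventually)
      then have "integral\<^sup>L M f = 0" using lim[OF cf] LIMSEQ_unique by blast
      moreover have "integrable M f"
      proof (rule finite_measure.integrable_const_bound[OF M(1), of _ 1])
        show "AE x in M. norm (f x) \<le> 1" using f01 by (intro AE_I2) (simp add: abs_le_iff order_trans[OF _ f01(1)])
        show "f \<in> borel_measurable M"
          unfolding measurable_cong_sets[OF M(2) refl] by (rule borel_measurable_continuous_onI[OF cf])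
      qed
      ultimately have "AE x in M. f x = 0" using integral_nonneg_eq_0_iff_AE[of M f] f01 by auto
      then show ?thesis by eventually_elim (simp add: f0)
    qed
    then have "AE x in M. \<forall>j. x \<in> closure (band t j)" by (simp add: AE_all_countable)
    then show ?thesis by eventually_elim (use Inter_closure_band in blast)
  qed
  have supp1: "AE x in M1. x \<in> ?S" by (rule limit_support[OF P M1(1,2) lim1'])
  have supp2: "AE x in M2. x \<in> ?S" by (rule limit_support[OF N M2(1,2) lim2'])
  have Sb: "?S \<in> sets borel" by (simp add: borel_closed)
  define R1 where "R1 = restrict_space M1 ?S"
  define R2 where "R2 = restrict_space M2 ?S"
  have sp12: "space M1 = UNIV" "space M2 = UNIV" using sets_eq_imp_space_eq[OF M1(2)] sets_eq_imp_space_eq[OF M2(2)] by auto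
  have R: "finite_measure R1" "finite_measure R2"
    "sets R1 = sets (restrict_space borel ?S)" "sets R2 = sets (restrict_space borel ?S)"
    unfolding R1_def R2_def
    using finite_measure_restrict_space[OF M1(1)] finite_measure_restrict_space[OF M2(1)] Sb M1(2) M2(2) sp12
    by (auto intro!: sets_restrict_space_cong)
  define \<mu> where "\<mu> A = (if A \<in> sets (restrict_space borel ?S) then measure R1 A - measure R2 A else 0)" for A
  have \<mu>: "finite_vmeasure ?S \<mu>" unfolding \<mu>_def[abs_def] by (rule finite_vmeasure_diff[OF R(1,3) R(2,4)])
  have SI: "signed_integral ?S \<mu> ?S f = (LINT x|M1. indicator ?S x * f x) - (LINT x|M2. indicator ?S x * f x)"
    if f: "f \<in> bounded_borel ?S" for f
  proof -
    have "signed_integral ?S \<mu> ?S f = (LINT x|R1. f x) - (LINT x|R2. f x)"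
      by (rule signed_integral_eq_diff[OF \<mu> f R(1,3) R(2,4)]) (simp add: \<mu>_def)
    then show ?thesis
      unfolding R1_def R2_def using Sb M1(2) M2(2) sp12 by (simp add: integral_restrict_space)
  qed
  have "normal_trace \<rho> \<Omega> F (inner_set U t) \<phi> = signed_integral ?S \<mu> ?S \<phi>" if \<phi>: "\<phi> \<in> W1inf \<Omega>" for \<phi>
  proof -
    have \<phi>b: "\<phi> \<in> bounded_borel \<Omega>" by (rule W1inf_bounded_borel[OF \<phi>])
    have pa: "pairable \<Omega> \<phi>" by (rule W1inf_pairable'[OF \<phi>])
    have c\<phi>: "continuous_on (closure U) \<phi>" using pairableD(1)[OF pa] closure_U by (rule continuous_on_subset)
    have cl: "closedin (top_of_set UNIV) (closure U)" by simp
    \<comment> \<open>\<open>\<phi>\<close> is continuous on \<open>\<Omega>\<close> only, whereas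
      weak convergence is tested with continuous functions on the whole space. The Tietze extension
      agrees with \<open>\<phi>\<close> wherever the scaled bands and their limits have
      mass.\<close>
    obtain g where g: "continuous_on UNIV g" "\<And>x. x \<in> closure U \<Longrightarrow> g x = \<phi> x"
      using Tietze_unbounded[OF c\<phi> cl] by metis
    have gm: "g \<in> borel_measurable borel" using g(1) by (rule borel_measurable_continuous_onI)
    have eq: "signed_integral \<Omega> \<nu> \<Omega> (\<lambda>x. \<phi> x * (indicator U x * (real (Suc k) * indicator {t<..<t + 1 / real (Suc k)} (bdist x)))) =
       integral\<^sup>L (?mp k) g - integral\<^sup>L (?mn k) g" for k
    proof -
      have e: "\<phi> x * (indicator U x * (real (Suc k) * indicator {t<..<t + 1 / real (Suc k)} (bdist x))) =
          g x * (real (Suc k) * indicator (band t k) x)" for x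
        using g(2)[of x] closure_subset[of U] by (auto simp: indicator_def band_def)
      show ?thesis
        unfolding e signed_integral_top integral_scaled_band[OF P gm] integral_scaled_band[OF N gm] ..
    qed
    have "(\<lambda>k. integral\<^sup>L (?mp (r k)) g - integral\<^sup>L (?mn (r k)) g) \<longlonglongrightarrow> NT \<phi> t"
      using LIMSEQ_subseq_LIMSEQ[OF NT_limit[OF pa \<phi>b t, unfolded eq] r] by (simp add: o_def)
    moreover have "(\<lambda>k. integral\<^sup>L (?mp (r k)) g - integral\<^sup>L (?mn (r k)) g) \<longlonglongrightarrow> integral\<^sup>L M1 g - integral\<^sup>L M2 g"
      by (intro tendsto_diff lim1' lim2' g(1))
    ultimately have "NT \<phi> t = integral\<^sup>L M1 g - integral\<^sup>L M2 g" by (rule LIMSEQ_unique)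
    also have "\<dots> = (LINT x|M1. indicator ?S x * \<phi> x) - (LINT x|M2. indicator ?S x * \<phi> x)"
    proof -
      have "integral\<^sup>L M g = (LINT x|M. indicator ?S x * \<phi> x)"
        if M: "sets M = sets borel" and supp: "AE x in M. x \<in> ?S" for M
      proof (rule integral_cong_AE)
        show "g \<in> borel_measurable M" unfolding measurable_cong_sets[OF M refl] by (rule gm)
        have "(\<lambda>x. indicator ?S x * \<phi> x) = (\<lambda>x. indicator ?S x * g x)"
          using g(2) frontier_inner_set(1)[of t] by (intro ext) (auto simp: indicator_def)
        moreover have "(\<lambda>x. indicator ?S x * g x) \<in> borel_measurable borel"
          using gm Sb by (intro borel_measurable_times borel_measurable_indicator)
        ultimately show "(\<lambda>x. indicator ?S x * \<phi> x) \<in> borel_measurable M"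
          unfolding measurable_cong_sets[OF M refl] by simp
        show "AE x in M. g x = indicator ?S x * \<phi> x"
          using supp by eventually_elim (use g(2) frontier_inner_set(1)[of t] in auto)
      qed
      then show ?thesis using M1(2) M2(2) supp1 supp2 by simp
    qed
    also have "\<dots> = signed_integral ?S \<mu> ?S \<phi>"
      by (rule SI[symmetric]) (rule bounded_borel_subset[OF \<phi>b frontier_inner_set(2)])
    finally show ?thesis .
  qed
  with \<mu> have tr: "is_trace_measure \<rho> \<Omega> F (inner_set U t) \<mu>" by (simp add: is_trace_measure_def)
  have "\<bar>signed_integral ?S \<mu> ?S f\<bar> \<le> 2 * C * B" if f: "f \<in> bounded_borel \<Omega>" and B0: "0 \<le> B" and B: "\<forall>x\<in>\<Omega>. \<bar>f x\<bar> \<le> B" for f B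
  proof -
    have fS: "f \<in> bounded_borel ?S" by (rule bounded_borel_subset[OF f frontier_inner_set(2)])
    have le: "\<bar>LINT x|M. indicator ?S x * f x\<bar> \<le> C * B"
      if M: "finite_measure M" "sets M = sets borel" "measure M UNIV \<le> C" for M
    proof -
      interpret finite_measure M by (rule M)
      have sp: "space M = UNIV" using sets_eq_imp_space_eq[OF M(2)] by simp
      have b: "\<bar>indicator ?S x * f x\<bar> \<le> B" for x
        using B B0 frontier_inner_set(2)[of t] by (auto simp: indicator_def)
      have "\<bar>LINT x|M. indicator ?S x * f x\<bar> \<le> (LINT x|M. \<bar>indicator ?S x * f x\<bar>)" by (rule integral_abs_bound)
      also have "\<dots> \<le> (LINT x|M. B)" by (rule integral_mono_AE') (use b B0 in auto)
      also have "\<dots> = measure M UNIV * B" by (simp add: sp)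
      also have "\<dots> \<le> C * B" using M(3) B0 by (rule mult_right_mono)
      finally show ?thesis .
    qed
    \<comment> \<open>The factor 2 accounts for the two limit measures.\<close>
    show ?thesis unfolding SI[OF fS] using le[OF M1] le[OF M2] by linarith
  qed
  with tr show ?thesis unfolding C_def by blast
qed

section \<open>Integrals of the traces over all levels\<close>

definition "trace_integral \<phi> t =
  signed_integral (frontier (inner_set U t)) (trace_measure \<rho> \<Omega> F (inner_set U t)) (frontier (inner_set U t)) \<phi>"

text \<open>Uniqueness identifies the constructed measure with \<open>trace_measure\<close>, which
  thus inherits the bound. The exceptional null set depends neither on \<open>f\<close> nor on
  \<open>B\<close>.\<close>

lemma AE_trace_measure:
  "AE t in lborel. 0 < t \<longrightarrow> is_trace_measure \<rho> \<Omega> F (inner_set U t) (trace_measure \<rho> \<Omega> F (inner_set U t)) \<and>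
    (\<forall>f\<in>bounded_borel \<Omega>. \<forall>B\<ge>0. (\<forall>x\<in>\<Omega>. \<bar>f x\<bar> \<le> B) \<longrightarrow>
      \<bar>trace_integral f t\<bar> \<le> 2 * (enn2real (lower_density t) + 1) * B)"
  using AE_lower_density
proof eventually_elim
  case (elim t)
  show ?case
  proof
    assume t: "0 < t"
    obtain \<mu> where \<mu>: "is_trace_measure \<rho> \<Omega> F (inner_set U t) \<mu>"
      "\<forall>f\<in>bounded_borel \<Omega>. \<forall>B\<ge>0. (\<forall>x\<in>\<Omega>. \<bar>f x\<bar> \<le> B) \<longrightarrow>
      \<bar>signed_integral (frontier (inner_set U t)) \<mu> (frontier (inner_set U t)) f\<bar> \<le>
        2 * (enn2real (lower_density t) + 1) * B"
      using trace_measure_exists[OF t elim] by blast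
    have "trace_measure \<rho> \<Omega> F (inner_set U t) = \<mu>"
      unfolding trace_measure_def
    proof (rule the_equality[where P="is_trace_measure \<rho> \<Omega> F (inner_set U t)" and a=\<mu>])
      show "is_trace_measure \<rho> \<Omega> F (inner_set U t) \<mu>" by (rule \<mu>(1))
      fix \<mu>' assume "is_trace_measure \<rho> \<Omega> F (inner_set U t) \<mu>'"
      then show "\<mu>' = \<mu>" using \<mu>(1) by (rule trace_measure_unique)
    qed
    with \<mu> show "is_trace_measure \<rho> \<Omega> F (inner_set U t) (trace_measure \<rho> \<Omega> F (inner_set U t)) \<and>
      (\<forall>f\<in>bounded_borel \<Omega>. \<forall>B\<ge>0. (\<forall>x\<in>\<Omega>. \<bar>f x\<bar> \<le> B) \<longrightarrow>
        \<bar>trace_integral f t\<bar> \<le> 2 * (enn2real (lower_density t) + 1) * B)"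
      by (simp add: trace_integral_def)
  qed
qed

lemma signed_integral_U: "signed_integral \<Omega> \<nu> U \<phi> = signed_integral \<Omega> \<nu> \<Omega> (\<lambda>x. \<phi> x * indicator U x)"
  unfolding signed_integral_restrict[of _ _ U] by (simp add: mult.commute)

text \<open>This is \<open>coarea\<close> with the constant weight 1; the integrand is Borel in
  \<open>t\<close>, so its integral for the completed measure is the one for
  \<open>lborel\<close>.\<close>

lemma normal_trace_integral:
  assumes \<phi>: "\<phi> \<in> W1inf \<Omega>"
  shows "set_integrable lebesgue {0<..} (NT \<phi>)"
    and "(LINT t:{0<..}|lebesgue. NT \<phi> t) = signed_integral \<Omega> \<nu> U \<phi>"
proof -
  note p = W1inf_pairable'[OF \<phi>] W1inf_bounded_borel[OF \<phi>]
  have m: "(\<lambda>t. indicator {0<..} t *\<^sub>R NT \<phi> t) \<in> borel_measurable lborel"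
    using bounded_borel_times_NT(2)[OF p bounded_borel_const[of 1]] by simp
  show "set_integrable lebesgue {0<..} (NT \<phi>)"
    unfolding set_integrable_def
    using bounded_borel_times_NT(1)[OF p bounded_borel_const[of 1]]
    by (subst integrable_completion[OF m]) simp
  show "(LINT t:{0<..}|lebesgue. NT \<phi> t) = signed_integral \<Omega> \<nu> U \<phi>"
    unfolding set_lebesgue_integral_def integral_completion[OF m] signed_integral_U
    using coarea[OF p bounded_borel_const[of 1]] by simp
qed

lemma trace_integral_zero:
  assumes "inner_set U t = {}" shows "trace_integral \<phi> t = 0"
  unfolding trace_integral_def assms frontier_empty signed_integral_eq by simp

text \<open>Monotone class induction in \<open>f\<close>, starting from smooth functions, where the
  trace integral is the normal trace for almost every level. Integrability belongs to the claim
  because the sum step must split the integral over the levels.\<close>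

lemma trace_integral_identity:
  assumes f: "f \<in> bounded_borel \<Omega>"
  shows "set_integrable lebesgue {0<..} (trace_integral f) \<and>
    (LINT t:{0<..}|lebesgue. trace_integral f t) = signed_integral \<Omega> \<nu> U f"
  using open_\<Omega> f
proof (induction f rule: bounded_borel_induct_Cc_inf)
  case (Cc_inf \<phi>)
  have \<phi>: "\<phi> \<in> W1inf \<Omega>" by (rule Cc_inf_W1inf[OF open_\<Omega> Cc_inf])
  note p = normal_trace_integral[OF \<phi>]
  have "AE t in lebesgue. 0 < t \<longrightarrow> trace_integral \<phi> t = NT \<phi> t"
    using AE_completion[OF AE_trace_measure]
    by eventually_elim (use \<phi> in \<open>auto simp: is_trace_measure_def trace_integral_def\<close>)
  then have ae: "AE t in lebesgue. indicator {0<..} t *\<^sub>R NT \<phi> t = indicator {0<..} t *\<^sub>R trace_integral \<phi> t"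
    by eventually_elim (auto simp: indicator_def)
  have m1: "(\<lambda>t. indicator {0<..} t *\<^sub>R NT \<phi> t) \<in> borel_measurable lebesgue"
    using p(1) unfolding set_integrable_def by (rule borel_measurable_integrable)
  \<comment> \<open>Measurability survives a change on a null set because the measure is
    complete.\<close>
  have m2: "(\<lambda>t. indicator {0<..} t *\<^sub>R trace_integral \<phi> t) \<in> borel_measurable lebesgue"
    by (rule borel_measurable_AE[OF m1 ae])
  show ?case
    using p integrable_cong_AE[OF m1 m2 ae] integral_cong_AE[OF m1 m2 ae]
    unfolding set_integrable_def set_lebesgue_integral_def by simp
next
  case (add f g)
  have tr: "AE t in lebesgue. 0 < t \<longrightarrow> trace_integral (\<lambda>x. f x + g x) t = trace_integral f t + trace_integral g t"
    using AE_completion[OF AE_trace_measure]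
  proof eventually_elim
    case (elim t)
    show ?case
    proof
      assume "0 < t"
      with elim have fv: "finite_vmeasure (frontier (inner_set U t)) (trace_measure \<rho> \<Omega> F (inner_set U t))"
        by (simp add: is_trace_measure_def)
      show "trace_integral (\<lambda>x. f x + g x) t = trace_integral f t + trace_integral g t"
        unfolding trace_integral_def
        by (intro signed_integral_add[OF fv] bounded_borel_subset[OF add.hyps(1)] bounded_borel_subset[OF add.hyps(2)] frontier_inner_set)
    qed
  qed
  note i = add.IH(1)[THEN conjunct1, unfolded set_integrable_def] add.IH(2)[THEN conjunct1, unfolded set_integrable_def]
  have ae: "AE t in lebesgue. indicator {0<..} t *\<^sub>R trace_integral f t + indicator {0<..} t *\<^sub>R trace_integral g t =
      indicator {0<..} t *\<^sub>R trace_integral (\<lambda>x. f x + g x) t"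
    using tr by eventually_elim (auto simp: indicator_def)
  have m1: "(\<lambda>t. indicator {0<..} t *\<^sub>R trace_integral f t + indicator {0<..} t *\<^sub>R trace_integral g t) \<in> borel_measurable lebesgue"
    by (rule borel_measurable_integrable[OF Bochner_Integration.integrable_add[OF i]])
  have m2: "(\<lambda>t. indicator {0<..} t *\<^sub>R trace_integral (\<lambda>x. f x + g x) t) \<in> borel_measurable lebesgue"
    by (rule borel_measurable_AE[OF m1 ae])
  have "(LINT t:{0<..}|lebesgue. trace_integral (\<lambda>x. f x + g x) t) = signed_integral \<Omega> \<nu> U f + signed_integral \<Omega> \<nu> U g"
    unfolding set_lebesgue_integral_def integral_cong_AE[OF m1 m2 ae, symmetric] Bochner_Integration.integral_add[OF i]
    using add.IH by (simp add: set_lebesgue_integral_def)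
  also have "\<dots> = signed_integral \<Omega> \<nu> U (\<lambda>x. f x + g x)"
    unfolding signed_integral_U distrib_right
    by (intro signed_integral_add[OF finite_vmeasure_\<nu>, symmetric] bounded_borel_mult bounded_borel_indicator U_sets add.hyps)
  finally show ?case
    using Bochner_Integration.integrable_add[OF i] integrable_cong_AE[OF m1 m2 ae] by (simp add: set_integrable_def)
next
  case (scale f c)
  \<comment> \<open>A constant factor passes through the integrals at every \<open>t\<close>,
    integrable or not, whereas additivity was obtained only where the trace measure is known to be a
    finite signed measure.\<close>
  have e: "trace_integral (\<lambda>x. c * f x) t = c * trace_integral f t" for t
    unfolding trace_integral_def signed_integral_top by (simp add: right_diff_distrib)
  have "signed_integral \<Omega> \<nu> U (\<lambda>x. c * f x) = c * signed_integral \<Omega> \<nu> U f"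
    unfolding signed_integral_U mult.assoc by (rule signed_integral_cmult[OF finite_vmeasure_\<nu>])
  then show ?case
    using scale.IH by (simp add: e)
next
  case (lim G f B)
  have f: "f \<in> bounded_borel \<Omega>" by (rule bounded_borel_LIMSEQ[OF lim.hyps])
  obtain R where R: "0 < R" "\<And>x. x \<in> closure U \<Longrightarrow> bdist x \<le> R" using bdist_bound by blast
  \<comment> \<open>The bound on the trace measures times the bound on the sequence, cut off beyond
    \<open>R\<close>, where the inner sets are empty; without the cutoff the summand 1 would spoil
    integrability.\<close>
  define D where "D t = 2 * (enn2real (lower_density t) + 1) * \<bar>B\<bar> * indicator {0..R} t" for t
  \<comment> \<open>\<open>enn2real\<close> sends infinity to 0, so passing to real values can only
    decrease the integral of \<open>lower_density\<close>.\<close>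
  have iL: "integrable lborel (\<lambda>t. enn2real (lower_density t))"
  proof (rule integrableI_bounded)
    show "(\<lambda>t. enn2real (lower_density t)) \<in> borel_measurable lborel" using lower_density_measurable by measurable
    have "(\<integral>\<^sup>+t. ennreal (norm (enn2real (lower_density t))) \<partial>lborel) \<le> (\<integral>\<^sup>+t. lower_density t \<partial>lborel)"
      by (intro nn_integral_mono) (simp add: ennreal_enn2real_if)
    then show "(\<integral>\<^sup>+t. ennreal (norm (enn2real (lower_density t))) \<partial>lborel) < \<infinity>"
      using nn_integral_lower_density by (rule le_less_trans)
  qed
  have iD: "integrable lborel D"
  proof -
    have 1: "integrable lborel (\<lambda>t. indicator {0..R} t *\<^sub>R enn2real (lower_density t))"
      by (rule integrable_mult_indicator[OF _ iL]) simp
    have 2: "integrable lborel (indicator {0..R} :: real \<Rightarrow> real)"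
      using R(1) by (intro integrable_real_indicator) (auto simp: emeasure_lborel_Icc_eq)
    have "integrable lborel (\<lambda>t. (2 * \<bar>B\<bar>) * (indicator {0..R} t *\<^sub>R enn2real (lower_density t) + indicator {0..R} t))"
      by (intro integrable_mult_right Bochner_Integration.integrable_add 1 2)
    moreover have "(\<lambda>t. (2 * \<bar>B\<bar>) * (indicator {0..R} t *\<^sub>R enn2real (lower_density t) + indicator {0..R} t)) = D"
      by (auto simp: D_def fun_eq_iff indicator_def)
    ultimately show ?thesis by (simp only:)
  qed
  then have iDL: "integrable lebesgue D" by (subst integrable_completion) auto
  let ?g = "\<lambda>k t. indicator {0<..} t *\<^sub>R trace_integral (G k) t" and ?h = "\<lambda>t. indicator {0<..} t *\<^sub>R trace_integral f t"
  have ig: "integrable lebesgue (?g k)" for k using lim.IH[of k] by (simp add: set_integrable_def)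
  have mg: "?g k \<in> borel_measurable lebesgue" for k using ig by (rule borel_measurable_integrable)
  have conv: "AE t in lebesgue. (\<lambda>k. ?g k t) \<longlonglongrightarrow> ?h t"
    using AE_completion[OF AE_trace_measure]
  proof eventually_elim
    case (elim t)
    show ?case
    proof (cases "0 < t")
      case True
      with elim have fv: "finite_vmeasure (frontier (inner_set U t)) (trace_measure \<rho> \<Omega> F (inner_set U t))"
        by (simp add: is_trace_measure_def)
      have "(\<lambda>k. trace_integral (G k) t) \<longlonglongrightarrow> trace_integral f t"
        unfolding trace_integral_def
      proof (rule signed_integral_LIMSEQ[OF fv, where B=B])
        show "G k \<in> bounded_borel (frontier (inner_set U t))" for k
          by (rule bounded_borel_subset[OF lim.hyps(1) frontier_inner_set(2)])
        fix x assume "x \<in> frontier (inner_set U t)"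
        then have x: "x \<in> \<Omega>" using frontier_inner_set(2)[of t] by auto
        show "\<bar>G k x\<bar> \<le> B" for k by (rule lim.hyps(2)[OF x])
        show "(\<lambda>k. G k x) \<longlonglongrightarrow> f x" by (rule lim.hyps(3)[OF x])
      qed
      with True show ?thesis by simp
    qed simp
  qed
  have bound: "AE t in lebesgue. norm (?g k t) \<le> D t" for k
    using AE_completion[OF AE_trace_measure]
  proof eventually_elim
    case (elim t)
    have D0: "0 \<le> D t" by (simp add: D_def)
    show ?case
    proof (cases "0 < t \<and> t \<le> R")
      case True
      have "\<bar>G k x\<bar> \<le> \<bar>B\<bar>" if "x \<in> \<Omega>" for x using lim.hyps(2)[OF that, of k] by linarith
      then have "\<bar>trace_integral (G k) t\<bar> \<le> 2 * (enn2real (lower_density t) + 1) * \<bar>B\<bar>"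
        using elim True lim.hyps(1)[of k] by auto
      with True show ?thesis by (simp add: D_def)
    next
      case False
      then have "t \<le> 0 \<or> trace_integral (G k) t = 0"
        using trace_integral_zero[OF inner_set_empty[OF R(2), of t]] by auto
      with D0 show ?thesis by auto
    qed
  qed
  have mh: "?h \<in> borel_measurable lebesgue"
  proof (rule borel_measurable_AE)
    \<comment> \<open>\<open>lim\<close> has a value even where the sequence diverges, so this
      function is measurable everywhere and agrees with the integrand almost everywhere.\<close>
    show "(\<lambda>t. lim (\<lambda>k. ?g k t)) \<in> borel_measurable lebesgue" by (rule borel_measurable_lim_metric[OF mg])
    show "AE t in lebesgue. lim (\<lambda>k. ?g k t) = ?h t" using conv by eventually_elim (rule limI)
  qed
  have "(\<lambda>k. integral\<^sup>L lebesgue (?g k)) \<longlonglongrightarrow> integral\<^sup>L lebesgue ?h" and ih: "integrable lebesgue ?h"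
    using integral_dominated_convergence[OF mh mg iDL conv bound]
      integrable_dominated_convergence[OF mh mg iDL conv bound] by auto
  moreover have "integral\<^sup>L lebesgue (?g k) = signed_integral \<Omega> \<nu> U (G k)" for k
    using lim.IH[of k] by (simp add: set_lebesgue_integral_def)
  ultimately have l1: "(\<lambda>k. signed_integral \<Omega> \<nu> U (G k)) \<longlonglongrightarrow> integral\<^sup>L lebesgue ?h" by simp
  have l2: "(\<lambda>k. signed_integral \<Omega> \<nu> U (G k)) \<longlonglongrightarrow> signed_integral \<Omega> \<nu> U f"
    unfolding signed_integral_U
  proof (rule signed_integral_LIMSEQ[OF finite_vmeasure_\<nu>, where B="\<bar>B\<bar>"])
    show "(\<lambda>x. G k x * indicator U x) \<in> bounded_borel \<Omega>" for k
      by (intro bounded_borel_mult bounded_borel_indicator U_sets lim.hyps)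
    show "\<bar>G k x * indicator U x\<bar> \<le> \<bar>B\<bar>" if "x \<in> \<Omega>" for k x
      using lim.hyps(2)[OF that, of k] by (auto simp: indicator_def)
    show "(\<lambda>k. G k x * indicator U x) \<longlonglongrightarrow> f x * indicator U x" if "x \<in> \<Omega>" for x
      by (intro tendsto_intros lim.hyps(3) that)
  qed
  show ?case
    using LIMSEQ_unique[OF l1 l2] ih by (simp add: set_integrable_def set_lebesgue_integral_def)
qed

end

theorem theorem4p1:
  fixes \<Omega> U :: "'a::euclidean_space set" and F :: "'a set \<Rightarrow> 'a"
    and \<rho> :: "'a \<Rightarrow> real" and d :: "'a \<Rightarrow> real"
  assumes "DIM('a) \<ge> 2"
    and "open \<Omega>"
    and "standard_mollifier \<rho>"
    and "F \<in> DM_ext \<Omega>"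
    and "open U" and "compact (closure U)" and "closure U \<subseteq> \<Omega>"
  defines "d \<equiv> \<lambda>x. infdist x (frontier U)"
  shows "(\<forall>\<phi>\<in>W1inf \<Omega>.
            set_integrable lebesgue {0<..} (\<lambda>t. normal_trace \<rho> \<Omega> F (inner_set U t) \<phi>) \<and>
            (LINT t:{0<..}|lebesgue. normal_trace \<rho> \<Omega> F (inner_set U t) \<phi>)
              = signed_integral \<Omega> (pairing \<rho> \<Omega> F d) U \<phi>) \<and>
         (AE t in lebesgue. 0 < t \<longrightarrow> (\<exists>\<mu>. is_trace_measure \<rho> \<Omega> F (inner_set U t) \<mu>)) \<and>
         (\<forall>\<phi>\<in>borel_measurable (restrict_space borel \<Omega>). bounded (\<phi> ` \<Omega>) \<longrightarrow>
            set_integrable lebesgue {0<..}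
              (\<lambda>t. signed_integral (frontier (inner_set U t)) (trace_measure \<rho> \<Omega> F (inner_set U t))
                     (frontier (inner_set U t)) \<phi>) \<and>
            (LINT t:{0<..}|lebesgue.
                signed_integral (frontier (inner_set U t)) (trace_measure \<rho> \<Omega> F (inner_set U t))
                  (frontier (inner_set U t)) \<phi>)
              = signed_integral \<Omega> (pairing \<rho> \<Omega> F d) U \<phi>)"
proof -
  interpret dm_field_on_open \<rho> \<Omega> F U
    by unfold_locales (use assms in auto)
  have d: "d = bdist" by (simp add: d_def bdist_def[abs_def])
  have "AE t in lebesgue. 0 < t \<longrightarrow> (\<exists>\<mu>. is_trace_measure \<rho> \<Omega> F (inner_set U t) \<mu>)"
    using AE_completion[OF AE_trace_measure] by eventually_elim blast
  moreover have "\<phi> \<in> bounded_borel \<Omega>"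
    if "\<phi> \<in> borel_measurable (restrict_space borel \<Omega>)" "bounded (\<phi> ` \<Omega>)" for \<phi>
    using that by (simp add: bounded_borel_def)
  ultimately show ?thesis
    using normal_trace_integral trace_integral_identity unfolding d trace_integral_def by blast
qed

end
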